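(* The operator $\mathcal{A}_2:\mathcal{D}(\mathcal{A}_2)\subset\mathcal{H}_2\to\mathcal{H}_2$ is the infinitesimal generator of a $C_0$-semigroup of contractions $\{e^{t\mathcal{A}_2}\}_{t\ge0}$ on $\mathcal{H}_2$. Consequently, for the abstract Cauchy problem $\frac{d}{dt}U=\mathcal{A}_2U$ for $t>0$, $U(0)=U_0$: if $U_0\in\mathcal{H}_2$, the problem admits a unique mild solution $U(t)=e^{t\mathcal{A}_2}U_0$, and $U\in C(\mathbb{R}^+,\mathcal{H}_2)$; if $U_0\in\mathcal{D}(\mathcal{A}_2)$, then $U(t)=e^{t\mathcal{A}_2}U_0$ is the unique classical solution, and $U\in C(\mathbb{R}^+,\mathcal{D}(\mathcal{A}_2))\cap C^1(\mathbb{R}^+,\mathcal{H}_2)$.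
   Context: Let $L>0$, let $\rho,\rho_1,\rho_2,\rho_3,\alpha,\kappa,b,\tau,\sigma,\beta,\gamma>0$ and $m\in\mathbb{R}\setminus\{0\}$ be constants, and let $\mathbb{R}^+=[0,\infty)$. The memory kernel $g\in L^1(\mathbb{R}^+)\cap C^1(\mathbb{R}^+)$ is a nonnegative function such that $\tilde b:=b-b_0>0$, where $b_0=\int_0^\infty g(s)\,ds$, and $g'(s)\le-\kappa_1g(s)$ for all $s\in\mathbb{R}^+$, with a constant $\kappa_1>0$. All functions of $x\in(0,L)$ are complex-valued; $L^2=L^2(0,L)$, $H^1=H^1(0,L)$, $H^2=H^2(0,L)$, $H_0^1=H_0^1(0,L)$; $(\cdot,\cdot)$ and $\|\cdot\|$ denote the inner product and norm of $L^2$. Let $L_*^2=\{\omega\in L^2:\int_0^L\omega\,dx=0\}$, $H_*^1=H^1\cap L_*^2$, and let $L_g^2(\mathbb{R}^+;H_0^1)=\{\omega:\sqrt g\,\omega\in L^2(\mathbb{R}^+;H_0^1)\}$, with norm $\|\omega\|_{L_g^2(\mathbb{R}^+;H_0^1)}^2=\int_0^\infty g(s)\|\omega_x(s)\|^2ds$. Put $$\mathcal{H}_2=H_*^1\times L_*^2\times H_*^1\times L_*^2\times H_0^1\times L^2\times L^2\times L^2\times L_g^2(\mathbb{R}^+;H_0^1),$$ with elements $U=(u,v,\varphi,\Phi,\psi,\Psi,\theta,q,\eta)$; it is a Hilbert space with the inner product inducing the norm $$\|U\|_{\mathcal{H}_2}^2=\rho\|v\|^2+\alpha\|u_x\|^2+\rho_1\|\Phi\|^2+\rho_2\|\Psi\|^2+\tilde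 b\|\psi_x\|^2+\beta\|\varphi-u\|^2+\kappa\|\varphi_x+\psi\|^2+\rho_3\|\theta\|^2+\tau\|q\|^2+\|\eta\|_{L_g^2(\mathbb{R}^+;H_0^1)}^2.$$ The linear operator $\mathcal{A}_2$ has domain $$\mathcal{D}(\mathcal{A}_2)=\Big\{U\in\mathcal{H}_2: v,\Phi\in H_*^1;\ u_x,\varphi_x,\theta,\Psi\in H_0^1;\ \tilde b\psi+\int_0^\infty g(s)\eta(s)\,ds\in H^2;\ q\in H^1;\ \eta_s\in L_g^2(\mathbb{R}^+;H_0^1);\ \eta(\cdot,0)=0\Big\}$$ and is given by $$\mathcal{A}_2U=\begin{pmatrix} v\\ \rho^{-1}[\alpha u_{xx}+\beta(\varphi-u)-\gamma v]\\ \Phi\\ \rho_1^{-1}[\kappa(\varphi_x+\psi)_x-\beta(\varphi-u)-m\theta_x]\\ \Psi\\ \rho_2^{-1}[\tilde b\psi_{xx}-\kappa(\varphi_x+\psi)+\int_0^\infty g(s)\eta_{xx}(s)\,ds+m\theta]\\ \rho_3^{-1}[-q_x-m(\Phi_x+\Psi)]\\ \tau^{-1}(-\sigma q-\theta_x)\\ \Psi-\eta_s\end{pmatrix},$$ where $\tilde b\psi_{xx}+\int_0^\infty g(s)\eta_{xx}(s)\,ds$ means $\big(\tilde b\psi+\int_0^\infty g(s)\eta(s)\,ds\big)_{xx}\in L^2$. $\mathcal{D}(\mathcal{A}_2)$ carries the graph norm. *)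

theory Defs
  imports "HOL-Analysis.Analysis" "HOL-Library.Function_Algebras"
begin

section \<open>Complex vector spaces of functions and of tuples of functions\<close>

class complex_vector = ab_group_add +
  fixes scaleC :: "complex \<Rightarrow> 'a \<Rightarrow> 'a"  (infixr "*\<^sub>C" 75)
  assumes scaleC_add_right: "c *\<^sub>C (x + y) = c *\<^sub>C x + c *\<^sub>C y"
    and scaleC_add_left: "(c + d) *\<^sub>C x = c *\<^sub>C x + d *\<^sub>C x"
    and scaleC_scaleC: "c *\<^sub>C d *\<^sub>C x = (c * d) *\<^sub>C x"
    and scaleC_one: "1 *\<^sub>C x = x"

instantiation complex :: complex_vector
begin
definition scaleC_complex_def: "c *\<^sub>C (z::complex) = c * z"
instance by standard (auto simp: scaleC_complex_def algebra_simps)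
end

instantiation "fun" :: (type, complex_vector) complex_vector
begin
definition scaleC_fun_def: "c *\<^sub>C f = (\<lambda>x. c *\<^sub>C f x)"
instance
  by standard (auto simp: scaleC_fun_def fun_eq_iff scaleC_add_right scaleC_add_left
      scaleC_scaleC scaleC_one)
end

instantiation prod :: (complex_vector, complex_vector) complex_vector
begin
definition scaleC_prod_def: "c *\<^sub>C p = (c *\<^sub>C fst p, c *\<^sub>C snd p)"
instance
  by standard (auto simp: scaleC_prod_def prod_eq_iff scaleC_add_right scaleC_add_left
      scaleC_scaleC scaleC_one)
end


section \<open>Semigroups and the abstract Cauchy problem\<close>

text \<open>
  As usual for \<open>L\<^sup>2\<close>-type spaces, a normed space is given by a set \<open>X\<close> of representatives
  together with a seminorm \<open>N\<close>, and \<open>x, y \<in> X\<close> stand for the same element of the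
  space iff \<open>N (x - y) = 0\<close>.  Every notion below depends on representatives only up to this
  identification, and equality in the space is always written \<open>N (x - y) = 0\<close>.
\<close>

definition tends_in :: "('a::complex_vector \<Rightarrow> real) \<Rightarrow> ('b \<Rightarrow> 'a) \<Rightarrow> 'a \<Rightarrow> 'b filter \<Rightarrow> bool" where
  "tends_in N f l F \<longleftrightarrow> ((\<lambda>t. N (f t - l)) \<longlongrightarrow> 0) F"

definition cont_on_in :: "('a::complex_vector \<Rightarrow> real) \<Rightarrow> real set \<Rightarrow> (real \<Rightarrow> 'a) \<Rightarrow> bool" where
  "cont_on_in N S U \<longleftrightarrow> (\<forall>t\<in>S. tends_in N U (U t) (at t within S))"

definition has_deriv_in ::
    "('a::complex_vector \<Rightarrow> real) \<Rightarrow> (real \<Rightarrow> 'a) \<Rightarrow> 'a \<Rightarrow> real \<Rightarrow> real set \<Rightarrow> bool" where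
  "has_deriv_in N U U' t S \<longleftrightarrow>
     tends_in N (\<lambda>r. complex_of_real (1 / (r - t)) *\<^sub>C (U r - U t)) U' (at t within S)"

definition C1_on_in ::
    "'a set \<Rightarrow> ('a::complex_vector \<Rightarrow> real) \<Rightarrow> real set \<Rightarrow> (real \<Rightarrow> 'a) \<Rightarrow> bool" where
  "C1_on_in X N S U \<longleftrightarrow>
     (\<exists>U'. (\<forall>t\<in>S. U' t \<in> X \<and> has_deriv_in N U (U' t) t S) \<and> cont_on_in N S U')"

text \<open>The definition of \<open>has_integral\<close> on an interval, with \<open>N\<close> replacing the norm of a type;
  it is only used for continuous integrands, where it is the Riemann integral.\<close>

definition has_integral_in ::
    "('a::complex_vector \<Rightarrow> real) \<Rightarrow> (real \<Rightarrow> 'a) \<Rightarrow> 'a \<Rightarrow> real \<Rightarrow> real \<Rightarrow> bool" where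
  "has_integral_in N f I a b \<longleftrightarrow>
     (\<forall>e>0. \<exists>\<gamma>. gauge \<gamma> \<and>
        (\<forall>p. p tagged_division_of {a..b} \<and> \<gamma> fine p \<longrightarrow>
             N ((\<Sum>(x, k)\<in>p. complex_of_real (measure lborel k) *\<^sub>C f x) - I) < e))"

definition C0_semigroup ::
    "'a set \<Rightarrow> ('a::complex_vector \<Rightarrow> real) \<Rightarrow> (real \<Rightarrow> 'a \<Rightarrow> 'a) \<Rightarrow> bool" where
  "C0_semigroup X N T \<longleftrightarrow>
     (\<forall>t\<ge>0. \<forall>x\<in>X. T t x \<in> X) \<and>
     (\<forall>t\<ge>0. \<forall>x\<in>X. \<forall>y\<in>X. \<forall>c d.
        N (T t (c *\<^sub>C x + d *\<^sub>C y) - (c *\<^sub>C T t x + d *\<^sub>C T t y)) = 0) \<and>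
     (\<forall>t\<ge>0. \<exists>M. \<forall>x\<in>X. N (T t x) \<le> M * N x) \<and>
     (\<forall>x\<in>X. N (T 0 x - x) = 0) \<and>
     (\<forall>s\<ge>0. \<forall>t\<ge>0. \<forall>x\<in>X. N (T (s + t) x - T s (T t x)) = 0) \<and>
     (\<forall>x\<in>X. tends_in N (\<lambda>t. T t x) x (at_right 0))"

definition contraction_semigroup ::
    "'a set \<Rightarrow> ('a::complex_vector \<Rightarrow> real) \<Rightarrow> (real \<Rightarrow> 'a \<Rightarrow> 'a) \<Rightarrow> bool" where
  "contraction_semigroup X N T \<longleftrightarrow> C0_semigroup X N T \<and> (\<forall>t\<ge>0. \<forall>x\<in>X. N (T t x) \<le> N x)"

text \<open>The operator \<open>A\<close> with domain \<open>D\<close> is the infinitesimal generator: \<open>D\<close> is exactly the set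
  where the difference quotient of the orbit converges, and \<open>A x\<close> is its limit.\<close>

definition is_generator ::
    "'a set \<Rightarrow> ('a::complex_vector \<Rightarrow> real) \<Rightarrow> (real \<Rightarrow> 'a \<Rightarrow> 'a) \<Rightarrow> 'a set \<Rightarrow> ('a \<Rightarrow> 'a) \<Rightarrow> bool" where
  "is_generator X N T D A \<longleftrightarrow>
     D \<subseteq> X \<and> A ` D \<subseteq> X \<and>
     (\<forall>x\<in>X. \<forall>y\<in>X.
        tends_in N (\<lambda>h. complex_of_real (1 / h) *\<^sub>C (T h x - x)) y (at_right 0) \<longleftrightarrow>
        x \<in> D \<and> N (A x - y) = 0)"

definition graph_norm :: "('a \<Rightarrow> real) \<Rightarrow> ('a \<Rightarrow> 'a) \<Rightarrow> 'a \<Rightarrow> real" where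
  "graph_norm N A x = N x + N (A x)"

text \<open>Mild solutions of \<open>U' = A U\<close>, \<open>U 0 = U0\<close>: continuous functions with
  \<open>\<integral>\<^sub>0\<^sup>t U \<in> D\<close> and \<open>U t = U0 + A (\<integral>\<^sub>0\<^sup>t U)\<close> for all \<open>t \<ge> 0\<close>.\<close>

definition mild_solution ::
    "'a set \<Rightarrow> ('a::complex_vector \<Rightarrow> real) \<Rightarrow> 'a set \<Rightarrow> ('a \<Rightarrow> 'a) \<Rightarrow> 'a \<Rightarrow> (real \<Rightarrow> 'a) \<Rightarrow> bool" where
  "mild_solution X N D A U0 U \<longleftrightarrow>
     (\<forall>t\<ge>0. U t \<in> X) \<and> cont_on_in N {0..} U \<and>
     (\<forall>t\<ge>0. \<exists>I\<in>D. has_integral_in N U I 0 t \<and> N (U t - (U0 + A I)) = 0)"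

text \<open>Classical solutions: continuous on \<open>[0,\<infinity>)\<close>, continuously differentiable on \<open>(0,\<infinity>)\<close>,
  with values in \<open>D\<close> and satisfying the equation for \<open>t > 0\<close>.\<close>

definition classical_solution ::
    "'a set \<Rightarrow> ('a::complex_vector \<Rightarrow> real) \<Rightarrow> 'a set \<Rightarrow> ('a \<Rightarrow> 'a) \<Rightarrow> 'a \<Rightarrow> (real \<Rightarrow> 'a) \<Rightarrow> bool" where
  "classical_solution X N D A U0 U \<longleftrightarrow>
     (\<forall>t\<ge>0. U t \<in> X) \<and> cont_on_in N {0..} U \<and> C1_on_in X N {0<..} U \<and>
     (\<forall>t>0. U t \<in> D \<and> has_deriv_in N U (A (U t)) t UNIV) \<and>
     N (U 0 - U0) = 0"


section \<open>Lebesgue and Sobolev spaces on the interval \<open>(0, L)\<close>\<close>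

text \<open>Representatives are Borel functions; every Lebesgue measurable function agrees almost
  everywhere with one.  Values outside \<open>(0, L)\<close> are irrelevant.\<close>

abbreviation intv :: "real \<Rightarrow> real measure" where
  "intv L \<equiv> restrict_space lborel {0<..<L}"

definition L2 :: "real \<Rightarrow> (real \<Rightarrow> complex) set" where
  "L2 L = {f. f \<in> borel_measurable (intv L) \<and> integrable (intv L) (\<lambda>x. (cmod (f x))\<^sup>2)}"

definition L2norm :: "real \<Rightarrow> (real \<Rightarrow> complex) \<Rightarrow> real" where
  "L2norm L f = sqrt (LINT x|intv L. (cmod (f x))\<^sup>2)"

definition L2star :: "real \<Rightarrow> (real \<Rightarrow> complex) set" where
  "L2star L = {f \<in> L2 L. (LINT x|intv L. f x) = 0}"

text \<open>Test functions \<open>C\<^sub>c\<^sup>1(0,L)\<close>, the class used by Brezis to define Sobolev spaces on an interval.\<close>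

definition test_functions :: "real \<Rightarrow> (real \<Rightarrow> complex) set" where
  "test_functions L = {h. h C1_differentiable_on UNIV \<and>
     (\<exists>a b. 0 < a \<and> b < L \<and> (\<forall>x. x \<notin> {a..b} \<longrightarrow> h x = 0))}"

definition has_weak_deriv :: "real \<Rightarrow> (real \<Rightarrow> complex) \<Rightarrow> (real \<Rightarrow> complex) \<Rightarrow> bool" where
  "has_weak_deriv L f f' \<longleftrightarrow>
     (\<forall>h\<in>test_functions L.
        (LINT x|intv L. f x * vector_derivative h (at x)) = - (LINT x|intv L. f' x * h x))"

definition H1 :: "real \<Rightarrow> (real \<Rightarrow> complex) set" where
  "H1 L = {f \<in> L2 L. \<exists>f'\<in>L2 L. has_weak_deriv L f f'}"

definition wderiv :: "real \<Rightarrow> (real \<Rightarrow> complex) \<Rightarrow> (real \<Rightarrow> complex)" where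
  "wderiv L f = (SOME f'. f' \<in> L2 L \<and> has_weak_deriv L f f')"

definition H2 :: "real \<Rightarrow> (real \<Rightarrow> complex) set" where
  "H2 L = {f \<in> H1 L. wderiv L f \<in> H1 L}"

definition H1norm :: "real \<Rightarrow> (real \<Rightarrow> complex) \<Rightarrow> real" where
  "H1norm L f = sqrt ((L2norm L f)\<^sup>2 + (L2norm L (wderiv L f))\<^sup>2)"

definition H10 :: "real \<Rightarrow> (real \<Rightarrow> complex) set" where
  "H10 L = {f \<in> H1 L. \<forall>e>0. \<exists>h\<in>test_functions L. H1norm L (f - h) < e}"

definition H1star :: "real \<Rightarrow> (real \<Rightarrow> complex) set" where
  "H1star L = H1 L \<inter> L2star L"


section \<open>The memory space \<open>L\<^sub>g\<^sup>2(\<real>\<^sup>+; H\<^sub>0\<^sup>1)\<close>\<close>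

text \<open>An element is represented by a jointly measurable function \<open>(s, x) \<mapsto> \<eta> s x\<close> whose
  slices \<open>\<eta> s\<close> lie in \<open>H\<^sub>0\<^sup>1(0,L)\<close>; as \<open>H\<^sub>0\<^sup>1(0,L)\<close> is separable, every Bochner measurable function
  has such a representative and conversely.  Since \<open>\<omega> \<in> L\<^sub>g\<^sup>2\<close> means that \<open>\<surd>g \<omega>\<close> is in \<open>L\<^sup>2\<close>,
  what happens where \<open>g s = 0\<close> is irrelevant.\<close>

definition Lg2 :: "real \<Rightarrow> (real \<Rightarrow> real) \<Rightarrow> (real \<Rightarrow> real \<Rightarrow> complex) set" where
  "Lg2 L g = {\<eta>.
     (\<lambda>(s, x). \<eta> s x) \<in> borel_measurable (restrict_space lborel {0..} \<Otimes>\<^sub>M intv L) \<and>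
     (AE s in lborel. 0 \<le> s \<and> 0 < g s \<longrightarrow> \<eta> s \<in> H10 L) \<and>
     set_integrable lebesgue {0..} (\<lambda>s. g s * (L2norm L (wderiv L (\<eta> s)))\<^sup>2)}"

definition Lg2norm :: "real \<Rightarrow> (real \<Rightarrow> real) \<Rightarrow> (real \<Rightarrow> real \<Rightarrow> complex) \<Rightarrow> real" where
  "Lg2norm L g \<eta> = sqrt (LINT s:{0..}|lebesgue. g s * (L2norm L (wderiv L (\<eta> s)))\<^sup>2)"

text \<open>\<open>\<zeta>\<close> is the derivative of \<open>\<eta>\<close> in \<open>s\<close> and \<open>\<eta>0\<close> the initial value \<open>\<eta>(\<cdot>,0)\<close> of \<open>\<eta>\<close>, in the sense of
  locally absolutely continuous functions of \<open>s\<close>: \<open>\<eta>(s) = \<eta>0 + \<integral>\<^sub>0\<^sup>s \<zeta>(r) dr\<close>.  Under the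
  assumptions on \<open>g\<close> the set where \<open>g > 0\<close> is an initial segment of \<open>[0,\<infinity>)\<close>.\<close>

definition has_s_deriv ::
    "real \<Rightarrow> (real \<Rightarrow> real) \<Rightarrow> (real \<Rightarrow> real \<Rightarrow> complex) \<Rightarrow> (real \<Rightarrow> real \<Rightarrow> complex) \<Rightarrow>
     (real \<Rightarrow> complex) \<Rightarrow> bool" where
  "has_s_deriv L g \<eta> \<zeta> \<eta>0 \<longleftrightarrow>
     (AE s in lborel. 0 \<le> s \<and> 0 < g s \<longrightarrow>
        (AE x in intv L. \<eta> s x = \<eta>0 x + (LINT r:{0..s}|lborel. \<zeta> r x)))"

definition s_deriv ::
    "real \<Rightarrow> (real \<Rightarrow> real) \<Rightarrow> (real \<Rightarrow> real \<Rightarrow> complex) \<Rightarrow> (real \<Rightarrow> real \<Rightarrow> complex)" where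
  "s_deriv L g \<eta> = (SOME \<zeta>. \<zeta> \<in> Lg2 L g \<and> (\<exists>\<eta>0\<in>H10 L. has_s_deriv L g \<eta> \<zeta> \<eta>0))"


section \<open>The phase space and the operator\<close>

type_synonym fld = "real \<Rightarrow> complex"

type_synonym state =
  "fld \<times> fld \<times> fld \<times> fld \<times> fld \<times> fld \<times> fld \<times> fld \<times> (real \<Rightarrow> fld)"

definition phase_space :: "real \<Rightarrow> (real \<Rightarrow> real) \<Rightarrow> state set" where
  "phase_space L g = H1star L \<times> L2star L \<times> H1star L \<times> L2star L \<times> H10 L \<times> L2 L \<times> L2 L \<times> L2 L \<times> Lg2 L g"

definition b_tilde :: "real \<Rightarrow> (real \<Rightarrow> real) \<Rightarrow> real" where
  "b_tilde b g = b - (LINT s:{0..}|lborel. g s)"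

definition phase_norm ::
    "real \<Rightarrow> real \<Rightarrow> real \<Rightarrow> real \<Rightarrow> real \<Rightarrow> real \<Rightarrow> real \<Rightarrow> real \<Rightarrow> real \<Rightarrow> real \<Rightarrow> (real \<Rightarrow> real) \<Rightarrow>
     state \<Rightarrow> real" where
  "phase_norm L \<rho> \<rho>1 \<rho>2 \<rho>3 \<alpha> \<kappa> b \<tau> \<beta> g = (\<lambda>(u, v, \<phi>, \<Phi>, \<psi>, \<Psi>, \<theta>, q, \<eta>).
     sqrt (\<rho> * (L2norm L v)\<^sup>2 + \<alpha> * (L2norm L (wderiv L u))\<^sup>2
         + \<rho>1 * (L2norm L \<Phi>)\<^sup>2 + \<rho>2 * (L2norm L \<Psi>)\<^sup>2
         + b_tilde b g * (L2norm L (wderiv L \<psi>))\<^sup>2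
         + \<beta> * (L2norm L (\<phi> - u))\<^sup>2
         + \<kappa> * (L2norm L (wderiv L \<phi> + \<psi>))\<^sup>2
         + \<rho>3 * (L2norm L \<theta>)\<^sup>2 + \<tau> * (L2norm L q)\<^sup>2
         + (Lg2norm L g \<eta>)\<^sup>2))"

definition memory_flux :: "real \<Rightarrow> (real \<Rightarrow> real) \<Rightarrow> fld \<Rightarrow> (real \<Rightarrow> fld) \<Rightarrow> fld" where
  "memory_flux b g \<psi> \<eta> =
     (\<lambda>x. complex_of_real (b_tilde b g) * \<psi> x
          + (LINT s:{0..}|lborel. complex_of_real (g s) * \<eta> s x))"

definition domA :: "real \<Rightarrow> real \<Rightarrow> (real \<Rightarrow> real) \<Rightarrow> state set" where
  "domA L b g = {U \<in> phase_space L g. case U of (u, v, \<phi>, \<Phi>, \<psi>, \<Psi>, \<theta>, q, \<eta>) \<Rightarrow>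
     v \<in> H1star L \<and> \<Phi> \<in> H1star L \<and>
     wderiv L u \<in> H10 L \<and> wderiv L \<phi> \<in> H10 L \<and> \<theta> \<in> H10 L \<and> \<Psi> \<in> H10 L \<and>
     memory_flux b g \<psi> \<eta> \<in> H2 L \<and>
     q \<in> H1 L \<and>
     (\<exists>\<zeta>\<in>Lg2 L g. has_s_deriv L g \<eta> \<zeta> 0)}"

definition opA ::
    "real \<Rightarrow> real \<Rightarrow> real \<Rightarrow> real \<Rightarrow> real \<Rightarrow> real \<Rightarrow> real \<Rightarrow> real \<Rightarrow> real \<Rightarrow> real \<Rightarrow> real \<Rightarrow> real \<Rightarrow> real \<Rightarrow>
     (real \<Rightarrow> real) \<Rightarrow> state \<Rightarrow> state" where
  "opA L \<rho> \<rho>1 \<rho>2 \<rho>3 \<alpha> \<kappa> b \<tau> \<sigma> \<beta> \<gamma> m g = (\<lambda>(u, v, \<phi>, \<Phi>, \<psi>, \<Psi>, \<theta>, q, \<eta>).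
     (v,
      (\<lambda>x. (\<alpha> * wderiv L (wderiv L u) x + \<beta> * (\<phi> x - u x) - \<gamma> * v x) / \<rho>),
      \<Phi>,
      (\<lambda>x. (\<kappa> * wderiv L (wderiv L \<phi> + \<psi>) x - \<beta> * (\<phi> x - u x) - m * wderiv L \<theta> x) / \<rho>1),
      \<Psi>,
      (\<lambda>x. (wderiv L (wderiv L (memory_flux b g \<psi> \<eta>)) x
             - \<kappa> * (wderiv L \<phi> x + \<psi> x) + m * \<theta> x) / \<rho>2),
      (\<lambda>x. (- wderiv L q x - m * (wderiv L \<Phi> x + \<Psi> x)) / \<rho>3),
      (\<lambda>x. (- \<sigma> * q x - wderiv L \<theta> x) / \<tau>),
      (\<lambda>s x. \<Psi> x - s_deriv L g \<eta> s x)))"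

end

theory Submission
  imports Defs "HOL-Probability.Discrete_Topology" "HOL-Real_Asymp.Real_Asymp"
begin

text \<open>
  The operator is dissipative and onto, so it has a bounded inverse; on a Hilbert space this already forces
  it to be m-dissipative with dense domain, and the semigroup is the limit of \<open>n = 2\<^sup>k\<close>
  implicit Euler steps \<open>(1 - t A / n)\<^sup>-\<^sup>n\<close>.  Spaces of representatives with a seminorm are mapped isometrically into the
  Banach space of bounded functions on the unit ball, \<open>x \<mapsto> r x (\<cdot>)\<close>, where the library's notions of limit,
  derivative and integral apply.  Dissipativity is integration by parts, the memory term being nonnegative
  by a layer-cake decomposition of the decreasing kernel \<open>g\<close>.  To solve \<open>A U = F\<close>, the components \<open>v\<close>, \<open>\<Phi>\<close>,
  \<open>\<Psi>\<close>, \<open>q\<close>, \<open>\<theta>\<close>, \<open>\<eta>\<close> are found by explicit integration (Hardy's inequality for the weight \<open>g\<close> puts \<open>\<eta>\<close> in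
  \<open>L\<^sub>g\<^sup>2\<close>), which leaves an elliptic problem for \<open>(u, \<phi>, \<psi>)\<close> solved by Riesz representation.  Elements of
  \<open>L\<^sub>g\<^sup>2(\<real>\<^sup>+; H\<^sub>0\<^sup>1)\<close> are handled through their joint \<open>x\<close>-derivative, a square integrable function of \<open>(s, x)\<close>.
\<close>


text \<open>Inverting \<open>A\<close> itself, rather than \<open>1 - A\<close>, makes the system
  triangular: three components of \<open>U\<close> are read off the right-hand side, flux,
  temperature and history are integrals of known functions, and what remains for
  \<open>(u, \<phi>, \<psi>)\<close> is symmetric, its form being part of the energy inner product.
  The price is that surjectivity is known only at the spectral value 0; a bound for the inverse and
  a continuation in the step size recover the range condition for every \<open>h > 0\<close>. The
  other obstacle is choice: \<open>wderiv\<close> and \<open>s_deriv\<close> pick representatives,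
  so the operator is linear only up to null elements. All its algebraic properties are therefore
  read from \<open>Rel\<close>, an integrated form of the equation built from maps that are linear
  modulo null functions. The kernel \<open>g\<close> may vanish from some point on. Statements in
  \<open>s\<close> are taken almost everywhere for the measure \<open>g(s) ds\<close>; to the left
  of a point where \<open>g > 0\<close> the kernel is bounded below, which gives local integrability
  there.\<close>

lemmas int_cong = Bochner_Integration.integral_cong and int_bound = Bochner_Integration.integrable_bound

section \<open>Operators on a Hilbert space\<close>

text \<open>The spaces depend on parameters such as \<open>L\<close> and \<open>g\<close> and so
  cannot be types. A closed subspace of a Banach type with an inner product of its own keeps the
  library's limits, integrals and derivatives available. Only the real inner product is recorded;
  dissipativity and projections are expressed with it.\<close>

locale hilbert_subspace =
 fixes Y :: "'b::banach set" and rr :: "'b => 'b => real"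
 assumes Y_sub: "subspace Y" and Y_closed: "closed Y"
  and rr_add: "[|x \<in> Y; y \<in> Y; z \<in> Y|] ==> rr (x + y) z = rr x z + rr y z"
  and rr_scale: "[|x \<in> Y; z \<in> Y|] ==> rr (c *\<^sub>R x) z = c * rr x z"
  and rr_sym: "[|x \<in> Y; z \<in> Y|] ==> rr x z = rr z x"
  and rr_self: "x \<in> Y ==> rr x x = (norm x)\<^sup>2"
begin

section \<open>Inner product calculus, Riesz representation and uniform boundedness\<close>

lemma Y_add: "x \<in> Y ==> y \<in> Y ==> x + y \<in> Y"
 and Y_scale: "x \<in> Y ==> c *\<^sub>R x \<in> Y"
 and Y_diff: "x \<in> Y ==> y \<in> Y ==> x - y \<in> Y"
 and Y_zero: "0 \<in> Y" using Y_sub by (auto simp: subspace_add subspace_scale subspace_diff subspace_0)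

lemma rr_add_right: "[|x \<in> Y; y \<in> Y; z \<in> Y|] ==> rr z (x + y) = rr z x + rr z y"
 using rr_add rr_sym Y_add by metis

lemma rr_scale_right: "[|x \<in> Y; z \<in> Y|] ==> rr z (c *\<^sub>R x) = c * rr z x"
 using rr_scale rr_sym Y_scale by metis

lemma rr_minus: "[|x \<in> Y; z \<in> Y|] ==> rr (- x) z = - rr x z" using rr_scale[of x z "-1"] by simp

lemma rr_minus_right: "[|x \<in> Y; z \<in> Y|] ==> rr z (- x) = - rr z x" using rr_scale_right[of x z "-1"] by simp

lemma Y_minus: "x \<in> Y ==> - x \<in> Y" using Y_scale[of x "-1"] by simp

lemma rr_diff: "[|x \<in> Y; y \<in> Y; z \<in> Y|] ==> rr (x - y) z = rr x z - rr y z"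
 using rr_add[of x "-y" z] by (simp add: Y_minus rr_minus)

lemma rr_diff_right: "[|x \<in> Y; y \<in> Y; z \<in> Y|] ==> rr z (x - y) = rr z x - rr z y"
 using rr_add_right[of x "-y" z] by (simp add: Y_minus rr_minus_right)

lemma norm_add_sq:
 assumes "x \<in> Y" "y \<in> Y"
 shows "(norm (x + y))\<^sup>2 = (norm x)\<^sup>2 + 2 * rr x y + (norm y)\<^sup>2"
proof -
 have "(norm (x + y))\<^sup>2 = rr (x + y) (x + y)" using assms rr_self Y_add by simp
 also have "\<dots> = rr x x + 2 * rr x y + rr y y"
  using assms by (simp add: rr_add rr_add_right Y_add rr_sym[of y x])
 finally show ?thesis using assms rr_self by simp
qed

lemma norm_diff_sq:
 assumes "x \<in> Y" "y \<in> Y"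
 shows "(norm (x - y))\<^sup>2 = (norm x)\<^sup>2 - 2 * rr x y + (norm y)\<^sup>2"
 using norm_add_sq[of x "-y"] assms by (simp add: Y_minus rr_minus_right)

lemma rr_bound:
 assumes "x \<in> Y" "y \<in> Y"
 shows "\<bar>rr x y\<bar> \<le> norm x * norm y"
proof -
 have "2 * rr x y \<le> 2 * (norm x * norm y)"
 proof -
  have "(norm (x + y))\<^sup>2 \<le> (norm x + norm y)\<^sup>2" by (intro power_mono norm_triangle_ineq) auto
  then show ?thesis using norm_add_sq[OF assms] by (simp add: power2_sum)
 qed
 moreover have "- (2 * rr x y) \<le> 2 * (norm x * norm y)"
 proof -
  have "(norm (x - y))\<^sup>2 \<le> (norm x + norm y)\<^sup>2" by (intro power_mono norm_triangle_ineq4) auto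
  then show ?thesis using norm_diff_sq[OF assms] by (simp add: power2_sum)
 qed
 ultimately show ?thesis by linarith
qed

text \<open>Near \<open>t = 0\<close> the linear term dominates, so a nonzero \<open>c\<close> would
  give a negative value at a small \<open>t\<close> of the opposite sign.\<close>

lemma quadratic_nonneg_imp_zero:
 fixes a c :: real
 assumes "!!t. 0 \<le> t\<^sup>2 * a + t * c"
 shows "c = 0"
proof (rule ccontr)
 assume c: "c \<noteq> 0"
 \<comment> \<open>Since \<open>a \<le> k - 1\<close>, the choice \<open>t = - c / k\<close> gives
   at most \<open>- c^2 / k^2\<close>.\<close>
 define k where "k = \<bar>a\<bar> + 1"
 have k: "k > 0" "a \<le> k - 1" by (auto simp: k_def)
 have "0 \<le> (- c / k)\<^sup>2 * a + (- c / k) * c" by (rule assms)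
 also have "\<dots> = c\<^sup>2 / k\<^sup>2 * a - c\<^sup>2 / k" using k by (simp add: power2_eq_square)
 also have "\<dots> \<le> c\<^sup>2 / k\<^sup>2 * (k - 1) - c\<^sup>2 / k"
  using k by (intro diff_right_mono mult_left_mono) auto
 also have "\<dots> = - (c\<^sup>2 / k\<^sup>2)" using k by (simp add: field_simps power2_eq_square)
 also have "\<dots> < 0" using c k by simp
 finally show False by simp
qed

text \<open>The representer minimizes \<open>(norm z)^2 - 2 * l z\<close> over \<open>Z\<close>: a
  minimizing sequence is Cauchy by the parallelogram law, and the first variation at its limit is
  the asserted identity. \<open>Z\<close> is not assumed closed, so the limit lies in
  \<open>closure Z\<close>; in this form the theorem also delivers orthogonal projections.\<close>

theorem riesz_representation:
 assumes Z: "Z \<subseteq> Y" "subspace Z"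
  and l_add: "!!x y. x \<in> Z ==> y \<in> Z ==> l (x + y) = l x + l y"
  and l_scale: "!!x c. x \<in> Z ==> l (c *\<^sub>R x) = c * l x"
  and l_bound: "!!x. x \<in> Z ==> \<bar>l x\<bar> \<le> C * norm x"
 obtains w where "w \<in> closure Z" "!!z. z \<in> Z ==> rr z w = (l z :: real)"
proof -
 have Zc: "x + y \<in> Z" "x - y \<in> Z" if "x \<in> Z" "y \<in> Z" for x y
  using that Z by (auto simp: subspace_add subspace_diff)
 have Zs: "c *\<^sub>R x \<in> Z" if "x \<in> Z" for x c using that Z by (auto simp: subspace_scale)
 define J where "J = (\<lambda>z. (norm z)\<^sup>2 - 2 * l z)"
 have J_lower: "- C\<^sup>2 \<le> J z" if "z \<in> Z" for z
 proof -
  have "0 \<le> (norm z - C)\<^sup>2" by simp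
  then show ?thesis using l_bound[OF that] by (simp add: J_def power2_diff algebra_simps)
 qed
 have ne: "Z \<noteq> {}" using Z(2) subspace_0 by blast
 have bdd: "bdd_below (J ` Z)" using J_lower by (auto intro!: bdd_belowI2)
 define m where "m = Inf (J ` Z)"
 have m_le: "m \<le> J z" if "z \<in> Z" for z unfolding m_def using bdd that by (intro cInf_lower) auto
 have "\<exists>z\<in>Z. J z < m + inverse (real (Suc n))" for n
 proof -
  have "Inf (J ` Z) < m + inverse (real (Suc n))" by (simp add: m_def)
  then show ?thesis using ne bdd by (subst (asm) cInf_less_iff) auto
 qed
 then obtain s where s: "!!n. s n \<in> Z" "!!n. J (s n) < m + inverse (real (Suc n))" by metis
 \<comment> \<open>Parallelogram law: the functional at the midpoint is at least the infimum, so the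
   distance is controlled by the two excesses over it.\<close>
 have key: "(norm (s i - s j))\<^sup>2 \<le> 2 * inverse (real (Suc i)) + 2 * inverse (real (Suc j))" for i j
 proof -
  let ?p = "(1/2) *\<^sub>R (s i + s j)"
  have sY: "s i \<in> Y" "s j \<in> Y" using s Z by auto
  have "(norm ?p)\<^sup>2 = (norm (s i + s j))\<^sup>2 / 4" by (simp add: power2_eq_square)
  moreover have "l ?p = (l (s i) + l (s j)) / 2" using l_scale l_add s Zc by simp
  moreover have "m \<le> J ?p" by (rule m_le[OF Zs[OF Zc(1)[OF s(1) s(1)]]])
  ultimately have "4 * m \<le> (norm (s i + s j))\<^sup>2 - 4 * (l (s i) + l (s j))" by (simp add: J_def)
  moreover define a b where "a = inverse (real (Suc i))" and "b = inverse (real (Suc j))"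
  moreover have "(norm (s i))\<^sup>2 - 2 * l (s i) < m + a" "(norm (s j))\<^sup>2 - 2 * l (s j) < m + b"
   using s(2)[of i] s(2)[of j] by (auto simp: J_def a_def b_def)
  ultimately show ?thesis
   using norm_add_sq[OF sY] norm_diff_sq[OF sY] unfolding a_def[symmetric] b_def[symmetric] by argo
 qed
 have "Cauchy s"
 proof (rule CauchyI)
  fix e :: real assume e: "e > 0"
  obtain N where N: "inverse (real (Suc N)) < e\<^sup>2 / 4" using reals_Archimedean[of "e\<^sup>2 / 4"] e by auto
  show "\<exists>N. \<forall>i\<ge>N. \<forall>j\<ge>N. norm (s i - s j) < e"
  proof (intro exI allI impI)
   fix i j assume "i \<ge> N" "j \<ge> N"
   then have "inverse (real (Suc i)) \<le> inverse (real (Suc N))"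
    "inverse (real (Suc j)) \<le> inverse (real (Suc N))" by (auto intro!: le_imp_inverse_le)
   then have "(norm (s i - s j))\<^sup>2 < e\<^sup>2" using key[of i j] N by linarith
   then show "norm (s i - s j) < e" using e by (simp add: power2_less_imp_less)
  qed
 qed
 then obtain w where w: "s \<longlonglongrightarrow> w" using Cauchy_convergent convergent_def by blast
 have wZ: "w \<in> closure Z" using s(1) w unfolding closure_sequential by blast
 have wY: "w \<in> Y" using closed_sequentially[OF Y_closed _ w] s(1) Z(1) by blast
 have Js: "(\<lambda>n. J (s n)) \<longlonglongrightarrow> m"
 proof (rule real_tendsto_sandwich[of "\<lambda>_. m" _ _ "\<lambda>n. m + inverse (real (Suc n))"])
  have "(\<lambda>n. m + inverse (real (Suc n))) \<longlonglongrightarrow> m + 0"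
   by (intro tendsto_intros LIMSEQ_inverse_real_of_nat)
  then show "(\<lambda>n. m + inverse (real (Suc n))) \<longlonglongrightarrow> m" by simp
 qed (use s m_le in \<open>auto intro!: always_eventually less_imp_le\<close>)
 have "rr z w = l z" if z: "z \<in> Z" for z
 proof -
  have zY: "z \<in> Y" using z Z by auto
  have lim: "(\<lambda>n. rr z (s n)) \<longlonglongrightarrow> rr z w"
  proof (rule LIM_zero_cancel, rule Lim_null_comparison)
   have "rr z (s n) - rr z w = rr z (s n - w)" for n
    using rr_diff_right[of "s n" w z] s(1)[of n] Z(1) wY zY by auto
   moreover have "s n - w \<in> Y" for n using s(1)[of n] Z(1) wY Y_diff by blast
   ultimately show "eventually (\<lambda>n. norm (rr z (s n) - rr z w) \<le> norm z * norm (s n - w)) sequentially"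
    using rr_bound[OF zY] by (intro always_eventually) simp
   show "(\<lambda>n. norm z * norm (s n - w)) \<longlonglongrightarrow> 0"
    using tendsto_mult_right_zero[OF tendsto_norm_zero[OF LIM_zero[OF w]]] by simp
  qed
  \<comment> \<open>Minimality is used along the sequence, at \<open>s n + t *\<^sub>R z\<close>,
    and passed to the limit, where the excess \<open>J (s n) - m\<close> disappears.\<close>
  have "0 \<le> t\<^sup>2 * (norm z)\<^sup>2 + t * (2 * (rr z w - l z))" for t
  proof (rule tendsto_lowerbound)
   show "(\<lambda>n. (J (s n) - m) + (t\<^sup>2 * (norm z)\<^sup>2 + t * (2 * (rr z (s n) - l z)))) \<longlonglongrightarrow>
     t\<^sup>2 * (norm z)\<^sup>2 + t * (2 * (rr z w - l z))"
   proof -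
    have "(\<lambda>n. (J (s n) - m) + (t\<^sup>2 * (norm z)\<^sup>2 + t * (2 * (rr z (s n) - l z)))) \<longlonglongrightarrow>
     0 + (t\<^sup>2 * (norm z)\<^sup>2 + t * (2 * (rr z w - l z)))"
     by (intro tendsto_add tendsto_mult tendsto_diff tendsto_const lim LIM_zero[OF Js])
    then show ?thesis by (simp only: add_0_left)
   qed
   have "0 \<le> (J (s n) - m) + (t\<^sup>2 * (norm z)\<^sup>2 + t * (2 * (rr z (s n) - l z)))" for n
   proof -
    have sY: "s n \<in> Y" using s Z by auto
    have "m \<le> J (s n + t *\<^sub>R z)" by (rule m_le[OF Zc(1)[OF s(1) Zs[OF z]]])
    moreover have "(norm (s n + t *\<^sub>R z))\<^sup>2 = (norm (s n))\<^sup>2 + 2 * t * rr z (s n) + t\<^sup>2 * (norm z)\<^sup>2"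
     using norm_add_sq[OF sY Y_scale[OF zY, of t]] sY zY
     by (simp add: rr_scale_right rr_sym[of "s n" z] power_mult_distrib)
    moreover have "l (s n + t *\<^sub>R z) = l (s n) + t * l z" using l_add l_scale z s Zs by simp
    ultimately show ?thesis by (simp add: J_def algebra_simps)
   qed
   then show "\<forall>\<^sub>F n in sequentially. 0 \<le> (J (s n) - m) + (t\<^sup>2 * (norm z)\<^sup>2 + t * (2 * (rr z (s n) - l z)))"
    by (intro always_eventually allI)
  qed simp
  then have "2 * (rr z w - l z) = 0" by (rule quadratic_nonneg_imp_zero)
  then show ?thesis by simp
 qed
 then show ?thesis using that wZ by blast
qed

text \<open>Sokal's gliding hump: of \<open>w + 3\<^sup>-\<^sup>k\<^sup>-\<^sup>1 e\<close> and \<open>w - 3\<^sup>-\<^sup>k\<^sup>-\<^sup>1 e\<close> (with \<open>e\<close> the unit vector in the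
 direction of \<open>f n\<close>) one has a large inner product with \<open>f n\<close>.\<close>

theorem uniform_boundedness:
 assumes f: "!!n::nat. f n \<in> Y" and pw: "!!w. w \<in> Y ==> \<exists>C. \<forall>n. \<bar>rr (f n) w\<bar> \<le> C"
 shows "\<exists>C. \<forall>n. norm (f n) \<le> C"
proof (rule ccontr)
 assume "\<not> ?thesis"
 then have unb: "\<exists>n. norm (f n) > C" for C by (meson not_le)
 define P where "P = (\<lambda>k (p :: 'b \<times> nat). fst p \<in> Y \<and>
  (1/3)^k * norm (f (snd p)) \<le> \<bar>rr (f (snd p)) (fst p)\<bar> \<and> 2 * real k \<le> (1/3)^k * norm (f (snd p)))"
 define Q where "Q = (\<lambda>k (p :: 'b \<times> nat) (p' :: 'b \<times> nat). norm (fst p' - fst p) \<le> (1/3)^(Suc k))"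
 have step: "\<exists>p'. P (Suc k) p' \<and> Q k p p'" if "P k p" for k p
 proof -
  have wY: "fst p \<in> Y" using that by (simp add: P_def)
  obtain n where n: "norm (f n) > 2 * real (Suc k) * 3^(Suc k)" using unb by blast
  then have nz: "norm (f n) > 0" by (smt (verit) mult_nonneg_nonneg of_nat_0_le_iff zero_le_power)
  define d where "d = ((1/3)^(Suc k) / norm (f n)) *\<^sub>R f n"
  have d: "d \<in> Y" "norm d = (1/3)^(Suc k)" using f nz by (auto simp: d_def Y_scale)
  have rd: "rr (f n) d = (1/3)^(Suc k) * norm (f n)"
   using nz f by (simp add: d_def rr_scale_right rr_self power2_eq_square)
  have big: "2 * real (Suc k) \<le> (1/3)^(Suc k) * norm (f n)" using n by (simp add: field_simps)
  have "(1/3)^(Suc k) * norm (f n) \<le> \<bar>rr (f n) (fst p + d)\<bar> \<or>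
     (1/3)^(Suc k) * norm (f n) \<le> \<bar>rr (f n) (fst p - d)\<bar>"
  proof -
   have "rr (f n) (fst p + d) - rr (f n) (fst p - d) = 2 * rr (f n) d"
    using f d wY by (simp add: rr_add_right rr_diff_right)
   then show ?thesis using rd by linarith
  qed
  then show ?thesis
  proof
   assume "(1/3)^(Suc k) * norm (f n) \<le> \<bar>rr (f n) (fst p + d)\<bar>"
   then have "P (Suc k) (fst p + d, n) \<and> Q k p (fst p + d, n)"
    using wY d big by (simp add: P_def Q_def Y_add)
   then show ?thesis by blast
  next
   assume "(1/3)^(Suc k) * norm (f n) \<le> \<bar>rr (f n) (fst p - d)\<bar>"
   then have "P (Suc k) (fst p - d, n) \<and> Q k p (fst p - d, n)"
    using wY d big by (simp add: P_def Q_def Y_diff)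
   then show ?thesis by blast
  qed
 qed
 have P0: "\<exists>p. P 0 p"
 proof -
  obtain n where n: "norm (f n) > 1" using unb by blast
  then have "norm (f n) * 1 \<le> norm (f n) * norm (f n)" by (intro mult_left_mono) auto
  then have "P 0 (f n, n)" using f rr_self by (simp add: P_def power2_eq_square)
  then show ?thesis by blast
 qed
 obtain p where p: "!!k. P k (p k)" "!!k. Q k (p k) (p (Suc k))"
  using dependent_nat_choice[of P Q] P0 step by metis
 define w where "w = (\<lambda>k. fst (p k))"
 have wY: "w k \<in> Y" for k using p(1) by (simp add: P_def w_def)
 have dw: "norm (w (Suc k) - w k) \<le> (1/3)^(Suc k)" for k using p(2) by (simp add: Q_def w_def)
 have tail: "norm (w (k + j) - w k) \<le> (1/2) * ((1/3)^k - (1/3)^(k+j))" for k j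
 proof (induction j)
  case (Suc j)
  have "norm (w (k + Suc j) - w k) \<le> norm (w (Suc (k + j)) - w (k + j)) + norm (w (k + j) - w k)"
   using norm_triangle_ineq[of "w (Suc (k + j)) - w (k + j)" "w (k + j) - w k"] by simp
  also have "\<dots> \<le> (1/3)^(Suc (k + j)) + (1/2) * ((1/3)^k - (1/3)^(k+j))" using Suc dw by (intro add_mono)
  finally show ?case by (simp add: algebra_simps)
 qed simp
 have tail': "norm (w i - w k) \<le> (1/2) * (1/3)^k" if "k \<le> i" for i k
 proof -
  have "(0::real) \<le> (1/3)^(k + (i - k))" by simp
  moreover have "norm (w i - w k) \<le> (1/2) * ((1/3)^k - (1/3)^(k + (i - k)))"
   using tail[of k "i - k"] that by simp
  ultimately show ?thesis by argo
 qed
 have "Cauchy w"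
 proof (rule CauchyI)
  fix e :: real assume e: "e > 0"
  obtain N where N: "(1/3::real)^N < e" using real_arch_pow_inv[OF e, of "1/3"] by auto
  show "\<exists>N. \<forall>i\<ge>N. \<forall>j\<ge>N. norm (w i - w j) < e"
  proof (intro exI allI impI)
   fix i j assume "i \<ge> N" "j \<ge> N"
   then have "norm (w i - w N) \<le> (1/2) * (1/3)^N" "norm (w j - w N) \<le> (1/2) * (1/3)^N"
    using tail' by auto
   then have "norm (w i - w j) \<le> (1/3)^N" using norm_triangle_ineq4[of "w i - w N" "w j - w N"] by simp
   then show "norm (w i - w j) < e" using N by simp
  qed
 qed
 then obtain z where z: "w \<longlonglongrightarrow> z" using Cauchy_convergent convergent_def by blast
 have zY: "z \<in> Y" using closed_sequentially[OF Y_closed wY z] .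
 \<comment> \<open>Later corrections move \<open>w k\<close> by at most the sum of
   \<open>3^-j\<close> over \<open>j > k\<close>, which is half of \<open>3^-k\<close>. So half of
   the pairing won at stage \<open>k\<close> survives, and that half is at least \<open>k\<close>.
   With ratio 1/2 the tail could cancel the gain.\<close>
 have zk: "norm (z - w k) \<le> (1/2) * (1/3)^k" for k
 proof (rule tendsto_upperbound)
  show "(\<lambda>i. norm (w i - w k)) \<longlonglongrightarrow> norm (z - w k)" using z by (intro tendsto_intros)
  show "\<forall>\<^sub>F i in sequentially. norm (w i - w k) \<le> (1/2) * (1/3)^k"
   using tail' eventually_sequentially by blast
 qed simp
 obtain C where C: "!!n. \<bar>rr (f n) z\<bar> \<le> C" using pw[OF zY] by blast
 obtain k :: nat where k: "real k > C" using reals_Archimedean2 by blast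
 let ?n = "snd (p k)"
 have "rr (f ?n) (w k) = rr (f ?n) z - rr (f ?n) (z - w k)" using f zY wY by (simp add: rr_diff_right)
 moreover have "\<bar>rr (f ?n) (z - w k)\<bar> \<le> (1/2) * ((1/3)^k * norm (f ?n))"
 proof -
  have "\<bar>rr (f ?n) (z - w k)\<bar> \<le> norm (f ?n) * norm (z - w k)" using rr_bound f zY wY Y_diff by simp
  also have "\<dots> \<le> norm (f ?n) * ((1/2) * (1/3)^k)" using zk by (intro mult_left_mono) auto
  finally show ?thesis by (simp add: mult.commute)
 qed
 moreover have "(1/3)^k * norm (f ?n) \<le> \<bar>rr (f ?n) (w k)\<bar>" "2 * real k \<le> (1/3)^k * norm (f ?n)"
  using p(1)[of k] by (auto simp: P_def w_def)
 ultimately show False using C[of ?n] k by linarith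
qed

end

section \<open>Range condition and density of the domain for a surjective dissipative
  operator\<close>

locale surjective_dissipative = hilbert_subspace Y rr
 for Y :: "'b::banach set" and rr :: "'b => 'b => real" +
 fixes D :: "'b set" and A :: "'b => 'b"
 assumes D_sub: "subspace D" and D_Y: "D \<subseteq> Y" and A_Y: "!!x. x \<in> D ==> A x \<in> Y"
  and A_add: "!!x y. x \<in> D ==> y \<in> D ==> A (x + y) = A x + A y"
  and A_scale: "!!x c. x \<in> D ==> A (c *\<^sub>R x) = c *\<^sub>R A x"
  and A_diss: "!!x. x \<in> D ==> rr (A x) x \<le> 0"
  and A_onto: "!!y. y \<in> Y ==> \<exists>x\<in>D. A x = y"
begin

lemma D_add: "x \<in> D ==> y \<in> D ==> x + y \<in> D"
 and D_scale: "x \<in> D ==> c *\<^sub>R x \<in> D"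
 and D_diff: "x \<in> D ==> y \<in> D ==> x - y \<in> D"
 and D_zero: "0 \<in> D" using D_sub by (auto simp: subspace_add subspace_scale subspace_diff subspace_0)

lemma A_diff: "x \<in> D ==> y \<in> D ==> A (x - y) = A x - A y"
 using A_add[of x "(-1) *\<^sub>R y"] A_scale[of y "-1"] D_scale[of y "-1"] by simp

lemma DY: "x \<in> D ==> x \<in> Y" using D_Y by blast

lemma norm_le_resolvent:
 assumes "x \<in> D" "h \<ge> 0"
 shows "norm x \<le> norm (x - h *\<^sub>R A x)"
proof (rule power2_le_imp_le)
 have "(norm (x - h *\<^sub>R A x))\<^sup>2 = (norm x)\<^sup>2 - 2 * h * rr (A x) x + (norm (h *\<^sub>R A x))\<^sup>2"
  using norm_diff_sq[of x "h *\<^sub>R A x"] assms DY A_Y rr_sym[of x "A x"] by (simp add: Y_scale rr_scale_right)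
 moreover have "2 * h * rr (A x) x \<le> 0" using A_diss[OF assms(1)] assms(2) by (simp add: mult_nonneg_nonpos)
 ultimately show "(norm x)\<^sup>2 \<le> (norm (x - h *\<^sub>R A x))\<^sup>2"
  using zero_le_power2[of "norm (h *\<^sub>R A x)"] by linarith
qed simp

text \<open>If no bound held, there would be vectors of growing norm whose images tend to 0.
  Dissipativity of differences, together with surjectivity, bounds their pairing with every fixed
  vector, which contradicts uniform boundedness.\<close>

lemma A_inverse_bounded: "\<exists>C>0. \<forall>x\<in>D. norm x \<le> C * norm (A x)"
proof (rule ccontr)
 assume neg: "\<not> ?thesis"
 \<comment> \<open>Normalization: the norms grow while \<open>norm (A x) * norm x\<close> stays at
   most 1, so that \<open>rr (A x) x\<close> is bounded along the sequence.\<close>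
 have "\<exists>x\<in>D. norm x = real (Suc k) \<and> norm (A x) \<le> 1 / real (Suc k)" for k
 proof -
  let ?C = "(real (Suc k))\<^sup>2"
  have "?C > 0" by simp
  then obtain x where x: "x \<in> D" "norm x > ?C * norm (A x)" using neg by (meson not_le)
  have nx: "norm x > 0" using x(2) by (smt (verit) mult_nonneg_nonneg norm_ge_zero zero_le_power2)
  let ?z = "(real (Suc k) / norm x) *\<^sub>R x"
  have "norm (A ?z) = real (Suc k) / norm x * norm (A x)" using x nx by (simp add: A_scale)
  also have "\<dots> \<le> 1 / real (Suc k)" using x(2) nx by (simp add: field_simps power2_eq_square)
  finally show ?thesis using x nx D_scale by (intro bexI[of _ ?z]) auto
 qed
 then obtain f where f: "!!k. f k \<in> D" "!!k. norm (f k) = real (Suc k)"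
  "!!k. norm (A (f k)) \<le> 1 / real (Suc k)" by metis
 have "\<exists>C. \<forall>n. norm (f n) \<le> C"
 proof (rule uniform_boundedness)
  show "f n \<in> Y" for n using f DY by blast
  fix w assume w: "w \<in> Y"
  \<comment> \<open>Monotonicity between \<open>f n\<close> and a \<open>z\<close> with
    \<open>A z = w\<close> bounds the pairing with \<open>w\<close> from one side only; the other
    side is the same bound for \<open>- w\<close>.\<close>
  have one: "\<exists>C. \<forall>n. - rr (f n) w \<le> C" if w: "w \<in> Y" for w
  proof -
   obtain z where z: "z \<in> D" "A z = w" using A_onto[OF w] by blast
   have "- rr (f n) w \<le> 1 + norm z + \<bar>rr w z\<bar>" for n
   proof -
    have Y: "f n \<in> Y" "A (f n) \<in> Y" "z \<in> Y" "w \<in> Y" using f z DY A_Y w by auto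
    have "rr (A (f n - z)) (f n - z) \<le> 0" using A_diss f z D_diff by simp
    then have "rr (A (f n)) (f n) - rr (A (f n)) z - rr w (f n) + rr w z \<le> 0"
     using Y z f by (simp add: A_diff rr_diff rr_diff_right Y_diff)
    moreover have "\<bar>rr (A (f n)) (f n)\<bar> \<le> 1"
    proof -
     have "\<bar>rr (A (f n)) (f n)\<bar> \<le> norm (A (f n)) * norm (f n)" using rr_bound Y by blast
     also have "\<dots> \<le> 1 / real (Suc n) * real (Suc n)" using f by (intro mult_mono) auto
     finally show ?thesis by simp
    qed
    moreover have "\<bar>rr (A (f n)) z\<bar> \<le> norm z"
    proof -
     have "\<bar>rr (A (f n)) z\<bar> \<le> norm (A (f n)) * norm z" using rr_bound Y by blast
     also have "\<dots> \<le> 1 * norm z" using f(3)[of n] by (intro mult_right_mono order_trans[OF f(3)]) auto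
     finally show ?thesis by simp
    qed
    ultimately show ?thesis using rr_sym[of "f n" w] Y by linarith
   qed
   then show ?thesis by blast
  qed
  obtain C1 where "\<forall>n. - rr (f n) w \<le> C1" using one[OF w] by blast
  moreover obtain C2 where "\<forall>n. - rr (f n) (-w) \<le> C2" using one[OF Y_minus[OF w]] by blast
  moreover have "rr (f n) (-w) = - rr (f n) w" for n using w f DY by (simp add: rr_minus_right)
  ultimately have "\<bar>rr (f n) w\<bar> \<le> max C1 C2" for n by (smt (verit))
  then show "\<exists>C. \<forall>n. \<bar>rr (f n) w\<bar> \<le> C" by blast
 qed
 then obtain C where "!!n. real (Suc n) \<le> C" using f by auto
 then show False by (meson Suc_leD not_less of_nat_le_iff order_trans reals_Archimedean2 less_le_not_le of_nat_less_iff lessI)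
qed

definition range_at :: "real => bool" where
 "range_at h \<longleftrightarrow> (\<forall>y\<in>Y. \<exists>x\<in>D. x - h *\<^sub>R A x = y)"

text \<open>For large \<open>h\<close> the identity is a small perturbation of \<open>h A\<close>:
  with \<open>y = A x\<close> the equation reads \<open>y = (B y - F) / h\<close>, where
  \<open>B\<close> is the inverse with Lipschitz constant \<open>C\<close>. The choice
  \<open>h = 2 C\<close> makes the contraction factor 1/2.\<close>

lemma range_at_large: "\<exists>h>0. range_at h"
proof -
 obtain C where C: "C > 0" "!!x. x \<in> D ==> norm x \<le> C * norm (A x)" using A_inverse_bounded by blast
 obtain B where B: "!!y. y \<in> Y ==> B y \<in> D \<and> A (B y) = y" using A_onto by metis
 have B_dist: "norm (B y - B z) \<le> C * norm (y - z)" if "y \<in> Y" "z \<in> Y" for y z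
  using C(2)[of "B y - B z"] B that by (simp add: D_diff A_diff)
 let ?h = "2 * C"
 have "\<exists>x\<in>D. x - ?h *\<^sub>R A x = F" if F: "F \<in> Y" for F
 proof -
  let ?f = "\<lambda>y. (1 / ?h) *\<^sub>R (B y - F)"
  have "\<exists>!y\<in>Y. ?f y = y"
  proof (rule Banach_fix)
   show "complete Y" using Y_closed complete_eq_closed by blast
   show "Y \<noteq> {}" using Y_zero by blast
   show "0 \<le> (1/2::real)" "(1/2::real) < 1" by auto
   show "?f ` Y \<subseteq> Y" using B F DY by (auto intro!: Y_scale Y_diff)
   show "dist (?f y) (?f z) \<le> 1/2 * dist y z" if "y \<in> Y" "z \<in> Y" for y z
   proof -
    have "?f y - ?f z = (1 / ?h) *\<^sub>R (B y - B z)" by (simp add: algebra_simps)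
    then have "norm (?f y - ?f z) = (1 / ?h) * norm (B y - B z)" using C(1) by simp
    also have "\<dots> \<le> (1 / ?h) * (C * norm (y - z))" using B_dist[OF that] C(1) by (intro mult_left_mono) auto
    finally show ?thesis using C(1) by (simp add: dist_norm)
   qed
  qed
  then obtain y where y: "y \<in> Y" "?f y = y" by blast
  have "?h *\<^sub>R y = B y - F" using C(1) by (subst y(2)[symmetric]) simp
  then show ?thesis using B[OF y(1)] by (intro bexI[of _ "B y"]) auto
 qed
 then show ?thesis using C(1) by (intro exI[of _ ?h]) (auto simp: range_at_def)
qed

text \<open>With \<open>R\<close> the nonexpansive resolvent at \<open>h0\<close>, the equation at
  \<open>h\<close> is equivalent to \<open>x = R ((h0/h) F + (1 - h0/h) x)\<close>, a contraction as
  soon as \<open>h0 / h < 2\<close>.\<close>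

lemma range_at_step:
 assumes h0: "h0 > 0" "range_at h0" and h: "h > h0 / 2"
 shows "range_at h"
proof -
 have hp: "h > 0" using h0(1) h by simp
 obtain R where R: "!!y. y \<in> Y ==> R y \<in> D \<and> R y - h0 *\<^sub>R A (R y) = y"
  using h0(2) unfolding range_at_def by metis
 have R_dist: "norm (R y - R z) \<le> norm (y - z)" if "y \<in> Y" "z \<in> Y" for y z
 proof -
  have "norm (R y - R z) \<le> norm ((R y - R z) - h0 *\<^sub>R A (R y - R z))"
   using norm_le_resolvent[of "R y - R z" h0] R that D_diff h0 by simp
  also have "(R y - R z) - h0 *\<^sub>R A (R y - R z) = (R y - h0 *\<^sub>R A (R y)) - (R z - h0 *\<^sub>R A (R z))"
   using R that by (simp add: A_diff algebra_simps)
  finally show ?thesis using R that by simp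
 qed
 let ?c = "1 - h0 / h"
 have c: "\<bar>?c\<bar> < 1"
 proof -
  have "h0 / h < 2" using h hp by (simp add: field_simps)
  moreover have "h0 / h > 0" using h0 hp by simp
  ultimately show ?thesis by (simp add: abs_if)
 qed
 have "\<exists>x\<in>D. x - h *\<^sub>R A x = F" if F: "F \<in> Y" for F
 proof -
  let ?f = "\<lambda>x. R ((h0 / h) *\<^sub>R F + ?c *\<^sub>R x)"
  have inY: "(h0 / h) *\<^sub>R F + ?c *\<^sub>R x \<in> Y" if "x \<in> Y" for x using that F by (intro Y_add Y_scale)
  have "\<exists>!x\<in>Y. ?f x = x"
  proof (rule Banach_fix)
   show "complete Y" using Y_closed complete_eq_closed by blast
   show "Y \<noteq> {}" using Y_zero by blast
   show "0 \<le> \<bar>?c\<bar>" "\<bar>?c\<bar> < 1" using c by auto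
   show "?f ` Y \<subseteq> Y" using R inY DY by blast
   show "dist (?f y) (?f z) \<le> \<bar>?c\<bar> * dist y z" if "y \<in> Y" "z \<in> Y" for y z
    using R_dist[OF inY inY, OF that] by (simp add: dist_norm scaleR_diff_right[symmetric])
  qed
  then obtain x where x: "x \<in> Y" "?f x = x" by blast
  have xD: "x \<in> D" and "x - h0 *\<^sub>R A x = (h0 / h) *\<^sub>R F + ?c *\<^sub>R x"
   using R[OF inY[OF x(1)]] x(2) by auto
  then have "(h0 / h) *\<^sub>R x - h0 *\<^sub>R A x = (h0 / h) *\<^sub>R F" by (simp add: algebra_simps)
  then have "(h / h0) *\<^sub>R ((h0 / h) *\<^sub>R x - h0 *\<^sub>R A x) = (h / h0) *\<^sub>R ((h0 / h) *\<^sub>R F)" by simp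
  then have "x - h *\<^sub>R A x = F" using h0 hp by (simp add: scaleR_diff_right)
  then show ?thesis using xD by blast
 qed
 then show ?thesis by (auto simp: range_at_def)
qed

text \<open>The step size is lowered by the factor 2/3, which exceeds the admissible 1/2, until it
  is below the target; from there any larger value is reached in a single step.\<close>

lemma range_at_all:
 assumes "h > 0"
 shows "range_at h"
proof -
 obtain h0 where h0: "h0 > 0" "range_at h0" using range_at_large by blast
 have "range_at (h0 * (2/3)^n)" for n
 proof (induction n)
  case (Suc n)
  show ?case by (rule range_at_step[of "h0 * (2/3)^n"]) (use Suc h0 in auto)
 qed (use h0 in simp)
 moreover obtain n where "(2/3::real)^n < h / h0" using real_arch_pow_inv[of "h / h0" "2/3"] assms h0 by auto
 ultimately show ?thesis
 proof -
  have "h0 * (2/3)^n < h" "h0 * (2/3)^n > 0" using \<open>(2/3)^n < h / h0\<close> h0 by (auto simp: field_simps)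
  then show ?thesis using range_at_step[of "h0 * (2/3)^n" h] \<open>!!n. range_at (h0 * (2/3)^n)\<close> assms by simp
 qed
qed

text \<open>A vector orthogonal to \<open>D\<close> is \<open>x - A x\<close> for some \<open>x \<in> D\<close>, and pairing with \<open>x\<close> gives \<open>x = 0\<close>.\<close>

lemma D_dense: "Y \<subseteq> closure D"
proof
 fix y assume y: "y \<in> Y"
 have clY: "closure D \<subseteq> Y" using D_Y Y_closed by (simp add: closure_minimal)
 \<comment> \<open>\<open>p\<close> is the orthogonal projection of \<open>y\<close> on the closure
   of \<open>D\<close>, so \<open>y - p\<close> is orthogonal to \<open>D\<close>.\<close>
 obtain p where p: "p \<in> closure D" "!!z. z \<in> D ==> rr z p = rr z y"
 proof (rule riesz_representation[of D "\<lambda>z. rr z y" "norm y"])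
  show "\<bar>rr x y\<bar> \<le> norm y * norm x" if "x \<in> D" for x
   using rr_bound[of x y] that DY y by (auto simp: mult.commute)
 qed (use D_sub DY y in \<open>auto simp: rr_add rr_scale\<close>)
 have pY: "p \<in> Y" using p clY by blast
 have "range_at 1" using range_at_all by simp
 then obtain x where x: "x \<in> D" "x - 1 *\<^sub>R A x = y - p"
  unfolding range_at_def using Y_diff[OF y pY] by blast
 have "rr x (y - p) = 0" using p(2)[OF x(1)] x DY y pY by (simp add: rr_diff_right)
 then have "rr x (x - A x) = 0" using x by simp
 then have "(norm x)\<^sup>2 = rr (A x) x" using x DY A_Y rr_self rr_sym by (simp add: rr_diff_right)
 then have "x = 0" using A_diss[OF x(1)] by (smt (verit) zero_le_power2 power2_eq_iff_nonneg norm_ge_zero norm_eq_zero zero_power2)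
 moreover have "A 0 = 0" using A_scale[OF D_zero, of 0] by simp
 ultimately show "y \<in> closure D" using x p by simp
qed

end

section \<open>Semigroups of m-dissipative operators\<close>

text \<open>Dissipativity is stated as a norm inequality, without an inner product: the construction
  of the semigroup rests on nonexpansive resolvents alone.\<close>

locale m_dissipative =
 fixes Y D :: "'b::banach set" and A :: "'b => 'b"
 assumes Y_sub: "subspace Y" and Y_closed: "closed Y"
  and D_sub: "subspace D" and D_Y: "D \<subseteq> Y" and A_Y: "!!x. x \<in> D ==> A x \<in> Y"
  and A_add: "!!x y. x \<in> D ==> y \<in> D ==> A (x + y) = A x + A y"
  and A_scale: "!!x c. x \<in> D ==> A (c *\<^sub>R x) = c *\<^sub>R A x"
  and A_diss: "!!x h. x \<in> D ==> h \<ge> 0 ==> norm x \<le> norm (x - h *\<^sub>R A x)"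
  and A_range: "!!y h. y \<in> Y ==> h > 0 ==> \<exists>x\<in>D. x - h *\<^sub>R A x = y"
  and D_dense: "Y \<subseteq> closure D"
begin

lemma Y_add: "x \<in> Y ==> y \<in> Y ==> x + y \<in> Y"
 and Y_scale: "x \<in> Y ==> c *\<^sub>R x \<in> Y"
 and Y_diff: "x \<in> Y ==> y \<in> Y ==> x - y \<in> Y"
 and Y_zero: "0 \<in> Y"
 and D_add: "x \<in> D ==> y \<in> D ==> x + y \<in> D"
 and D_scale: "x \<in> D ==> c *\<^sub>R x \<in> D"
 and D_diff: "x \<in> D ==> y \<in> D ==> x - y \<in> D"
 and D_zero: "0 \<in> D" using D_sub Y_sub by (auto simp: subspace_add subspace_scale subspace_diff subspace_0)

lemma A_diff: "x \<in> D ==> y \<in> D ==> A (x - y) = A x - A y"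
 using A_add[of x "(-1) *\<^sub>R y"] A_scale[of y "-1"] D_scale[of y "-1"] by simp

lemma DY: "x \<in> D ==> x \<in> Y" using D_Y by blast

section \<open>Resolvents and the contractions commuting with them\<close>

lemma resolvent_unique:
 assumes "x \<in> D" "x' \<in> D" "h \<ge> 0" "x - h *\<^sub>R A x = x' - h *\<^sub>R A x'"
 shows "x = x'"
proof -
 have "(x - x') - h *\<^sub>R A (x - x') = 0" using assms by (simp add: A_diff algebra_simps)
 then show ?thesis using A_diss[of "x - x'" h] assms D_diff by simp
qed

text \<open>The resolvent \<open>(1 - h A)^-1\<close>; the value at \<open>h = 0\<close> is the
  identity, so that the Euler products make sense at time 0.\<close>

definition J :: "real => 'b => 'b" where
 "J h y = (if h = 0 then y else THE x. x \<in> D \<and> x - h *\<^sub>R A x = y)"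

lemma J_eqI:
 assumes "x \<in> D" "h \<ge> 0" "x - h *\<^sub>R A x = y"
 shows "J h y = x"
proof (cases "h = 0")
 case False
 have "(THE x. x \<in> D \<and> x - h *\<^sub>R A x = y) = x"
 proof (rule the_equality)
  show "x' = x" if "x' \<in> D \<and> x' - h *\<^sub>R A x' = y" for x'
   using that by (intro resolvent_unique[OF _ assms(1,2)]) (auto simp: assms(3))
 qed (use assms in simp)
 then show ?thesis using False by (simp add: J_def)
qed (use assms in \<open>simp add: J_def\<close>)

lemma J_resolvent:
 assumes "y \<in> Y" "h > 0"
 shows "J h y \<in> D" "J h y - h *\<^sub>R A (J h y) = y"
proof -
 obtain x where x: "x \<in> D" "x - h *\<^sub>R A x = y" using A_range[OF assms] by blast
 then have "J h y = x" using J_eqI assms by simp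
 then show "J h y \<in> D" "J h y - h *\<^sub>R A (J h y) = y" using x by auto
qed

lemma J_0: "J 0 y = y" by (simp add: J_def)

lemma J_Y: "y \<in> Y ==> h \<ge> 0 ==> J h y \<in> Y" using J_resolvent(1)[of y h] DY J_0 by (cases "h = 0") auto

lemma J_norm: "y \<in> Y ==> h \<ge> 0 ==> norm (J h y) \<le> norm y"
 using A_diss[of "J h y" h] J_resolvent[of y h] J_0 by (cases "h = 0") auto

lemma J_add:
 assumes "x \<in> Y" "y \<in> Y" "h \<ge> 0"
 shows "J h (x + y) = J h x + J h y"
proof (cases "h = 0")
 case False
 then have h: "h > 0" using assms by simp
 have "(J h x - h *\<^sub>R A (J h x)) + (J h y - h *\<^sub>R A (J h y)) = x + y"
  using J_resolvent(2)[OF _ h] assms by simp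
 moreover have D: "J h x \<in> D" "J h y \<in> D" using J_resolvent(1)[OF _ h] assms by auto
 moreover have "(J h x + J h y) - h *\<^sub>R A (J h x + J h y) =
   (J h x - h *\<^sub>R A (J h x)) + (J h y - h *\<^sub>R A (J h y))"
  using D by (simp add: A_add scaleR_add_right)
 ultimately show ?thesis using assms by (intro J_eqI D_add) auto
qed (simp add: J_0)

lemma J_scale:
 assumes "x \<in> Y" "h \<ge> 0"
 shows "J h (c *\<^sub>R x) = c *\<^sub>R J h x"
proof (cases "h = 0")
 case False
 then have h: "h > 0" using assms by simp
 have "c *\<^sub>R (J h x - h *\<^sub>R A (J h x)) = c *\<^sub>R x" using J_resolvent(2)[OF _ h] assms by simp
 then have "c *\<^sub>R J h x - h *\<^sub>R A (c *\<^sub>R J h x) = c *\<^sub>R x"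
  using J_resolvent(1)[OF assms(1) h] by (simp add: A_scale scaleR_diff_right mult.commute)
 then show ?thesis using J_resolvent(1)[OF assms(1) h] assms by (intro J_eqI D_scale)
qed (simp add: J_0)

text \<open>For \<open>z = J h x\<close> one has \<open>A z = (z - x) / h\<close>, which lies in
  \<open>D\<close> again; hence \<open>A\<close> may be applied to the resolvent equation.\<close>

lemma J_D:
 assumes "x \<in> D" "h \<ge> 0"
 shows "J h x \<in> D" "A (J h x) = J h (A x)"
proof -
 have "J h x \<in> D \<and> A (J h x) = J h (A x)"
 proof (cases "h = 0")
  case False
  then have h: "h > 0" using assms by simp
  let ?z = "J h x"
  have z: "?z \<in> D" "?z - h *\<^sub>R A ?z = x" using J_resolvent[OF DY[OF assms(1)] h] by auto
  have "A ?z = (1 / h) *\<^sub>R (?z - x)" using arg_cong[OF z(2), of "\<lambda>w. (1/h) *\<^sub>R (?z - w)"] h by simp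
  then have AzD: "A ?z \<in> D" using z assms D_diff D_scale by metis
  have "A ?z - h *\<^sub>R A (A ?z) = A (?z - h *\<^sub>R A ?z)" using z(1) AzD by (simp add: A_diff A_scale D_scale)
  then have "A ?z - h *\<^sub>R A (A ?z) = A x" by (simp only: z(2))
  then have "J h (A x) = A ?z" using z AzD h by (intro J_eqI) auto
  then show ?thesis using z by simp
 qed (use assms in \<open>simp add: J_0\<close>)
 then show "J h x \<in> D" "A (J h x) = J h (A x)" by auto
qed

lemma J_commute:
 assumes "y \<in> Y" "h \<ge> 0" "k \<ge> 0"
 shows "J h (J k y) = J k (J h y)"
proof (cases "k = 0")
 case False
 then have k: "k > 0" using assms by simp
 have r: "J k y \<in> D" "J k y - k *\<^sub>R A (J k y) = y" using J_resolvent[OF assms(1) k] by auto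
 have w: "J h (J k y) \<in> D" "A (J h (J k y)) = J h (A (J k y))" using J_D[OF r(1) assms(2)] by auto
 have "J h y = J h (J k y + (- k) *\<^sub>R A (J k y))" using r(2) by simp
 also have "\<dots> = J h (J k y) + (- k) *\<^sub>R A (J h (J k y))"
  using r A_Y DY assms by (simp add: J_add J_scale Y_scale w del: scaleR_minus_left)
 finally show ?thesis by (intro J_eqI[OF w(1) assms(3), symmetric]) simp
qed (simp add: J_0)

text \<open>Contractions of \<open>Y\<close> commuting with all resolvents. Euler products, their
  limits and, later, multiplication by \<open>\<i>\<close> all belong to this class, so a single
  commutation argument covers the semigroup law, invariance of the domain and complex
  linearity.\<close>

definition cop :: "('b => 'b) => bool" where
 "cop K \<longleftrightarrow> (\<forall>y\<in>Y. K y \<in> Y \<and> norm (K y) \<le> norm y) \<and> (\<forall>x\<in>Y. \<forall>y\<in>Y. K (x + y) = K x + K y) \<and>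
   (\<forall>x\<in>Y. \<forall>c. K (c *\<^sub>R x) = c *\<^sub>R K x) \<and> (\<forall>y\<in>Y. \<forall>h\<ge>0. K (J h y) = J h (K y))"

lemma copD:
 assumes "cop K"
 shows "y \<in> Y ==> K y \<in> Y" "y \<in> Y ==> norm (K y) \<le> norm y"
  "x \<in> Y ==> y \<in> Y ==> K (x + y) = K x + K y" "x \<in> Y ==> K (c *\<^sub>R x) = c *\<^sub>R K x"
  "y \<in> Y ==> h \<ge> 0 ==> K (J h y) = J h (K y)" using assms by (auto simp: cop_def)

lemma cop_diff: "cop K ==> x \<in> Y ==> y \<in> Y ==> K (x - y) = K x - K y"
 using copD(3)[of K x "(-1) *\<^sub>R y"] copD(4)[of K y "-1"] Y_scale[of y "-1"] by simp

lemma cop_J: "h \<ge> 0 ==> cop (J h)" by (simp add: cop_def J_Y J_norm J_add J_scale J_commute)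

lemma cop_comp:
 assumes "cop K" "cop K'"
 shows "cop (K \<circ> K')"
proof -
 have "norm (K (K' y)) \<le> norm y" if "y \<in> Y" for y
  using copD(2)[OF assms(1) copD(1)[OF assms(2) that]] copD(2)[OF assms(2) that] by simp
 then show ?thesis using assms by (simp add: cop_def)
qed

lemma cop_id: "cop id" by (simp add: cop_def)

lemma cop_pow: "cop K ==> cop (K ^^ n)" by (induction n) (simp_all add: cop_id cop_comp)

text \<open>Elements of \<open>D\<close> are the values of \<open>J 1\<close>, as
  \<open>x = J 1 (x - A x)\<close>; an operator commuting with \<open>J 1\<close> therefore
  preserves \<open>D\<close> and commutes with \<open>A\<close>.\<close>

lemma cop_D:
 assumes K: "cop K" and x: "x \<in> D"
 shows "K x \<in> D" "A (K x) = K (A x)"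
proof -
 have xY: "x \<in> Y" "A x \<in> Y" using x DY A_Y by auto
 have "x = J 1 (x - A x)" using x J_eqI[of x 1] by simp
 then have Kx: "K x = J 1 (K x - K (A x))" using copD(5)[OF K, of "x - A x" 1] xY cop_diff[OF K] Y_diff by simp
 have r: "K x - K (A x) \<in> Y" using copD(1)[OF K] xY Y_diff by simp
 show D: "K x \<in> D" using J_resolvent(1)[OF r, of 1] Kx by simp
 have "K x - 1 *\<^sub>R A (K x) = K x - K (A x)" using J_resolvent(2)[OF r, of 1] Kx by simp
 then show "A (K x) = K (A x)" by simp
qed

text \<open>Telescoping of \<open>K^n - K'^n\<close> into \<open>n\<close> terms, each containing
  the one-step difference applied to \<open>y\<close>, surrounded by contractions.\<close>

lemma pow_diff_bound:
 assumes K: "cop K" "cop K'" and comm: "!!y. y \<in> Y ==> K (K' y) = K' (K y)" and y: "y \<in> Y"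
 shows "norm ((K ^^ n) y - (K' ^^ n) y) \<le> real n * norm (K y - K' y)"
proof (induction n)
 case (Suc n)
 have KnY: "(K ^^ n) y \<in> Y" "(K' ^^ n) y \<in> Y" using cop_pow[OF K(1)] cop_pow[OF K(2)] copD(1) y by auto
 have comm': "K ((K' ^^ n) y) = (K' ^^ n) (K y)" for n
 proof (induction n)
  case (Suc n)
  then show ?case using comm[of "(K' ^^ n) y"] cop_pow[OF K(2)] copD(1) y by auto
 qed simp
 have "(K ^^ Suc n) y - (K' ^^ Suc n) y = K ((K ^^ n) y - (K' ^^ n) y) + (K' ^^ n) (K y - K' y)"
 proof -
  have "(K' ^^ Suc n) y = (K' ^^ n) (K' y)" by (simp add: funpow_swap1)
  then show ?thesis
   using comm'[of n] cop_diff[OF K(1) KnY] cop_diff[OF cop_pow[OF K(2)]] copD(1)[OF K(1) y] copD(1)[OF K(2) y]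
   by simp
 qed
 then have "norm ((K ^^ Suc n) y - (K' ^^ Suc n) y) \<le>
   norm (K ((K ^^ n) y - (K' ^^ n) y)) + norm ((K' ^^ n) (K y - K' y))" by (metis norm_triangle_ineq)
 also have "\<dots> \<le> norm ((K ^^ n) y - (K' ^^ n) y) + norm (K y - K' y)"
  using copD(2)[OF K(1)] copD(2)[OF cop_pow[OF K(2)]] KnY Y_diff copD(1)[OF K(1) y] copD(1)[OF K(2) y]
  by (intro add_mono) auto
 also have "\<dots> \<le> real (Suc n) * norm (K y - K' y)" using Suc by (simp add: algebra_simps)
 finally show ?case .
qed simp

lemma cop_commute_pow:
 assumes "cop K" "y \<in> Y" "h \<ge> 0"
 shows "K ((J h ^^ n) y) = (J h ^^ n) (K y)"
proof (induction n)
 case (Suc n)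
 then show ?case using assms copD(5)[OF assms(1), of "(J h ^^ n) y" h] copD(1)[OF cop_pow[OF cop_J]] by simp
qed simp

text \<open>Doubling the number of steps at each stage allows a local comparison of successive
  approximations: one step of length \<open>h\<close> against two of length
  \<open>h/2\<close>.\<close>

definition S :: "nat => real => 'b => 'b" where
 "S k t = J (t / 2^k) ^^ (2^k)"

lemma cop_S: "t \<ge> 0 ==> cop (S k t)" by (simp add: S_def cop_pow cop_J)

section \<open>Convergence of the Euler products and the semigroup law\<close>

definition D2 :: "'b set" where "D2 = {x \<in> D. A x \<in> D}"

lemma J_diff_bound:
 assumes "x \<in> D" "h \<ge> 0"
 shows "norm (J h x - x) \<le> h * norm (A x)"
proof (cases "h = 0")
 case False
 then have "J h x - x = h *\<^sub>R J h (A x)"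
  using J_resolvent(2)[of x h] J_D[OF assms] assms DY by (auto simp: algebra_simps)
 then show ?thesis using J_norm[of "A x" h] A_Y assms by (simp add: mult_left_mono)
qed (simp add: J_0)

lemma J_tendsto:
 assumes "x \<in> Y"
 shows "((\<lambda>h. J h x) \<longlongrightarrow> x) (at_right 0)"
proof (rule tendstoI)
 fix e :: real assume e: "e > 0"
 obtain z where z: "z \<in> D" "norm (x - z) < e / 3" using D_dense assms e closure_approachable[of x D]
  by (metis dist_norm dist_commute subsetD zero_less_divide_iff zero_less_numeral)
 have zY: "z \<in> Y" using z DY by blast
 let ?d = "e / (3 * (norm (A z) + 1))"
 have d: "?d > 0" using e by (simp add: add_nonneg_pos)
 have "dist (J h x) x < e" if h: "0 < h" "h < ?d" for h
 proof -
  have "h * norm (A z) \<le> ?d * norm (A z)" using h by (intro mult_right_mono) auto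
  also have "\<dots> = e / 3 * (norm (A z) / (norm (A z) + 1))" by simp
  also have "\<dots> \<le> e / 3 * 1" using e by (intro mult_left_mono) (auto simp: divide_le_eq_1 add_nonneg_pos)
  finally have "h * norm (A z) \<le> e / 3" by simp
  then have 1: "norm (J h z - z) \<le> e / 3" using J_diff_bound[OF z(1), of h] h by simp
  have 2: "norm (J h (x - z)) \<le> norm (x - z)" using J_norm h Y_diff assms zY by simp
  have "J h x - x = J h (x - z) + (J h z - z) - (x - z)" using cop_diff[OF cop_J assms zY, of h] h by simp
  then have "norm (J h x - x) \<le> norm (J h (x - z)) + norm (J h z - z) + norm (x - z)"
   by (metis norm_triangle_le norm_triangle_le_diff order_refl add_right_mono)
  then show ?thesis using 1 2 z by (simp add: dist_norm)
 qed
 then show "\<forall>\<^sub>F h in at_right 0. dist (J h x) x < e"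
  unfolding eventually_at_right_field using d by blast
qed

text \<open>\<open>J h x\<close> is in \<open>D2\<close> when \<open>x\<close> is in
  \<open>D\<close>, and \<open>J h x\<close>, \<open>A (J h x) = J h (A x)\<close> converge to
  \<open>x\<close>, \<open>A x\<close> as \<open>h\<close> tends to 0.\<close>

lemma D2_dense_graph:
 assumes x: "x \<in> D" and e: "e > 0"
 shows "\<exists>z\<in>D2. norm (x - z) < e \<and> norm (A x - A z) < e"
proof -
 have "\<forall>\<^sub>F h in at_right 0. dist (J h x) x < e" "\<forall>\<^sub>F h in at_right 0. dist (J h (A x)) (A x) < e"
  using J_tendsto[OF DY[OF x]] J_tendsto[OF A_Y[OF x]] e tendstoD by blast+
 then have "\<forall>\<^sub>F h in at_right 0. h > 0 \<and> dist (J h x) x < e \<and> dist (J h (A x)) (A x) < e"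
  using eventually_at_right_less[of "0::real"] by eventually_elim auto
 then obtain h where h: "h > 0" "dist (J h x) x < e" "dist (J h (A x)) (A x) < e"
  using eventually_happens'[OF trivial_limit_at_right_real] by blast
 have "J h x \<in> D2" using J_D[OF x, of h] J_resolvent(1)[OF A_Y[OF x] h(1)] h by (simp add: D2_def)
 then show ?thesis using h J_D(2)[OF x, of h]
  by (intro bexI[of _ "J h x"]) (auto simp: dist_norm norm_minus_commute)
qed

lemma D2_dense:
 assumes x: "x \<in> Y" and e: "e > 0"
 shows "\<exists>z\<in>D2. norm (x - z) < e"
proof -
 obtain w where w: "w \<in> D" "norm (x - w) < e / 2" using D_dense x e closure_approachable[of x D]
  by (metis dist_norm dist_commute subsetD half_gt_zero)
 obtain z where "z \<in> D2" "norm (w - z) < e / 2" using D2_dense_graph[OF w(1), of "e/2"] e by auto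
 then show ?thesis using w norm_triangle_ineq[of "x - w" "w - z"] by (intro bexI[of _ z]) auto
qed

text \<open>With \<open>Q\<close> two half steps,
  \<open>x = Q x - h A (Q x) + (h^2/4) A (A (Q x))\<close>. Applying \<open>J h\<close> leaves
  \<open>Q x\<close> and a remainder of size \<open>h^2/4\<close>.\<close>

lemma J_half:
 assumes x: "x \<in> D2" and h: "h \<ge> 0"
 shows "norm (J h x - J (h/2) (J (h/2) x)) \<le> h\<^sup>2 / 4 * norm (A (A x))"
proof (cases "h = 0")
 case False
 then have h': "h > 0" "h / 2 > 0" "h / 2 \<ge> 0" using h by auto
 have xD: "x \<in> D" "A x \<in> D" "x \<in> Y" "A (A x) \<in> Y" using x DY A_Y by (auto simp: D2_def)
 define Q where "Q = J (h/2) \<circ> J (h/2)"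
 have cQ: "cop Q" using h' by (simp add: Q_def cop_comp cop_J)
 have QD: "Q x \<in> D" "A (Q x) = Q (A x)" "A (Q x) \<in> D" "A (A (Q x)) = Q (A (A x))"
  using cop_D[OF cQ] xD by auto
 define w where "w = J (h/2) x"
 have w: "w - (h/2) *\<^sub>R A w = x" "w \<in> D" using J_resolvent[OF xD(3) h'(2)] by (auto simp: w_def)
 have Qw: "Q x - (h/2) *\<^sub>R A (Q x) = w" using J_resolvent(2)[OF DY[OF w(2)] h'(2)] by (simp add: Q_def w_def)
 have "A w = A (Q x) - (h/2) *\<^sub>R A (A (Q x))" using Qw QD by (simp add: A_diff A_scale D_scale flip: Qw)
 then have x_eq: "x = (Q x - h *\<^sub>R A (Q x)) + (h\<^sup>2 / 4) *\<^sub>R A (A (Q x))"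
 proof -
  have "x = (Q x - (h/2) *\<^sub>R A (Q x)) - (h/2) *\<^sub>R (A (Q x) - (h/2) *\<^sub>R A (A (Q x)))"
   using w(1) Qw \<open>A w = _\<close> by simp
  also have "\<dots> = (Q x - h *\<^sub>R A (Q x)) + (h\<^sup>2 / 4) *\<^sub>R A (A (Q x))"
   by (simp add: algebra_simps power2_eq_square) (simp flip: scaleR_left.add)
  finally show ?thesis .
 qed
 have "J h x = Q x + (h\<^sup>2 / 4) *\<^sub>R J h (A (A (Q x)))"
 proof -
  have "J h (Q x - h *\<^sub>R A (Q x)) = Q x" using QD h by (intro J_eqI) auto
  moreover have "Q x - h *\<^sub>R A (Q x) \<in> Y" "A (A (Q x)) \<in> Y"
   using DY[OF QD(1)] DY[OF QD(3)] A_Y[OF QD(3)] by (auto intro!: Y_diff Y_scale)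
  ultimately show ?thesis using h by (subst x_eq) (simp add: J_add J_scale Y_scale)
 qed
 then have "norm (J h x - Q x) = h\<^sup>2 / 4 * norm (J h (Q (A (A x))))" using QD by simp
 also have "\<dots> \<le> h\<^sup>2 / 4 * norm (A (A x))"
  using J_norm[of "Q (A (A x))" h] copD(1,2)[OF cQ xD(4)] h by (intro mult_left_mono) auto
 finally show ?thesis by (simp add: Q_def)
qed (simp add: J_0)

text \<open>There are \<open>2^k\<close> local errors, each of size
  \<open>(t / 2^k)^2 / 4\<close>.\<close>

lemma S_step:
 assumes x: "x \<in> D2" and t: "t \<ge> 0"
 shows "norm (S k t x - S (Suc k) t x) \<le> t\<^sup>2 / 4 * norm (A (A x)) * (1/2)^k"
proof -
 let ?h = "t / 2^k"
 have h: "?h \<ge> 0" "?h / 2 \<ge> 0" using t by auto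
 have xY: "x \<in> Y" using x DY by (simp add: D2_def)
 let ?Q = "J (?h/2) \<circ> J (?h/2)"
 have e1: "S (Suc k) t = ?Q ^^ (2^k)"
 proof -
  have "?Q = J (t / 2^Suc k) ^^ 2" by (simp add: numeral_2_eq_2 fun_eq_iff mult.commute)
  then show ?thesis by (simp add: S_def funpow_mult)
 qed
 have i1: "norm ((J ?h ^^ (2^k)) x - (?Q ^^ (2^k)) x) \<le> real (2^k) * norm (J ?h x - ?Q x)"
  using h xY by (intro pow_diff_bound cop_comp cop_J) (auto simp: J_commute J_Y)
 have i2: "real (2^k) * norm (J ?h x - ?Q x) \<le> real (2^k) * (?h\<^sup>2 / 4 * norm (A (A x)))"
  using J_half[OF x h(1)] by (intro mult_left_mono) simp_all
 have i3: "real (2^k) * (?h\<^sup>2 / 4 * norm (A (A x))) = t\<^sup>2 / 4 * norm (A (A x)) * (1/2)^k"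
  by (simp add: power2_eq_square power_divide)
 have e2: "S k t = J ?h ^^ (2^k)" by (simp add: S_def)
 show ?thesis unfolding e1 e2 using order_trans[OF i1 i2] unfolding i3 .
qed

text \<open>The errors of \<open>S_step\<close> form a geometric series of ratio 1/2, whose sum
  doubles the constant.\<close>

lemma S_tail:
 assumes x: "x \<in> D2" and t: "t \<ge> 0" and kl: "k \<le> l"
 shows "norm (S k t x - S l t x) \<le> t\<^sup>2 / 2 * norm (A (A x)) * (1/2)^k"
proof -
 let ?c = "t\<^sup>2 / 2 * norm (A (A x))"
 have "norm (S k t x - S (k + j) t x) \<le> ?c * ((1/2)^k - (1/2)^(k+j))" for j
 proof (induction j)
  case (Suc j)
  have "norm (S k t x - S (k + Suc j) t x) \<le>
    norm (S k t x - S (k + j) t x) + norm (S (k + j) t x - S (Suc (k + j)) t x)"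
   using norm_triangle_ineq[of "S k t x - S (k + j) t x" "S (k + j) t x - S (Suc (k + j)) t x"] by simp
  also have "\<dots> \<le> ?c * ((1/2)^k - (1/2)^(k+j)) + t\<^sup>2 / 4 * norm (A (A x)) * (1/2)^(k+j)"
   using Suc S_step[OF x t] by (intro add_mono)
  finally show ?case by (simp add: algebra_simps)
 qed simp
 from this[of "l - k"] have "norm (S k t x - S l t x) \<le> ?c * ((1/2)^k - (1/2)^l)" using kl by simp
 also have "\<dots> \<le> ?c * (1/2)^k" by (intro mult_left_mono) auto
 finally show ?thesis .
qed

lemma S_Cauchy:
 assumes y: "y \<in> Y" and t: "t \<ge> 0"
 shows "Cauchy (\<lambda>k. S k t y)"
proof (rule CauchyI)
 fix e :: real assume e: "e > 0"
 obtain x where x: "x \<in> D2" "norm (y - x) < e / 4" using D2_dense[OF y, of "e/4"] e by auto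
 have xY: "x \<in> Y" using x DY by (simp add: D2_def)
 let ?c = "t\<^sup>2 / 2 * norm (A (A x))"
 obtain N where N: "(1/2::real)^N < e / (4 * (?c + 1))"
  using real_arch_pow_inv[of "e / (4 * (?c + 1))" "1/2"] e by (auto simp: add_nonneg_pos)
 have cN: "?c * (1/2)^N \<le> e / 4"
 proof -
  have "?c * (1/2)^N \<le> ?c * (e / (4 * (?c + 1)))" using N by (intro mult_left_mono) auto
  also have "\<dots> = e / 4 * (?c / (?c + 1))" by (simp add: algebra_simps)
  also have "\<dots> \<le> e / 4 * 1" using e by (intro mult_left_mono) (auto simp: divide_le_eq_1 add_nonneg_pos)
  finally show ?thesis by simp
 qed
 have close: "norm (S k t y - S k t x) < e / 4" for k
 proof -
  have "norm (S k t y - S k t x) \<le> norm (y - x)"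
   using cop_diff[OF cop_S[OF t] y xY] copD(2)[OF cop_S[OF t], of "y - x"] y xY Y_diff by simp
  then show ?thesis using x by simp
 qed
 show "\<exists>N. \<forall>k\<ge>N. \<forall>l\<ge>N. norm (S k t y - S l t y) < e"
 proof (intro exI allI impI)
  fix k l assume kl: "k \<ge> N" "l \<ge> N"
  have "norm (S N t x - S k t x) \<le> e/4" "norm (S N t x - S l t x) \<le> e/4"
   using S_tail[OF x(1) t kl(1)] S_tail[OF x(1) t kl(2)] cN by linarith+
  then show "norm (S k t y - S l t y) < e" using close[of k] close[of l] by norm
 qed
qed

definition T :: "real => 'b => 'b" where
 "T t y = lim (\<lambda>k. S k t y)"

lemma T_lim: "y \<in> Y ==> t \<ge> 0 ==> (\<lambda>k. S k t y) \<longlonglongrightarrow> T t y"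
 using S_Cauchy Cauchy_convergent_iff convergent_LIMSEQ_iff by (auto simp: T_def)

text \<open>Proved before \<open>T t\<close> is known to be a \<open>cop\<close>; it is applied with
  \<open>K\<close> a resolvent, a semigroup operator at another time, and multiplication by
  \<open>\<i>\<close>.\<close>

lemma T_commute:
 assumes K: "cop K" and y: "y \<in> Y" and t: "t \<ge> 0"
 shows "K (T t y) = T t (K y)"
proof -
 have TY: "T t y \<in> Y" using closed_sequentially[OF Y_closed _ T_lim[OF y t]] copD(1)[OF cop_S[OF t] y] by blast
 have "(\<lambda>k. K (S k t y)) \<longlonglongrightarrow> K (T t y)"
 proof (rule LIM_zero_cancel, rule Lim_null_comparison)
  show "\<forall>\<^sub>F k in sequentially. norm (K (S k t y) - K (T t y)) \<le> norm (S k t y - T t y)"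
  proof (intro always_eventually allI)
   fix k
   have SY: "S k t y \<in> Y" using copD(1)[OF cop_S[OF t] y] .
   show "norm (K (S k t y) - K (T t y)) \<le> norm (S k t y - T t y)"
    using cop_diff[OF K SY TY] copD(2)[OF K Y_diff[OF SY TY]] by simp
  qed
  show "(\<lambda>k. norm (S k t y - T t y)) \<longlonglongrightarrow> 0"
   using tendsto_norm_zero[OF LIM_zero[OF T_lim[OF y t]]] .
 qed
 moreover have "K (S k t y) = S k t (K y)" for k unfolding S_def using t by (intro cop_commute_pow[OF K y]) auto
 ultimately have "(\<lambda>k. S k t (K y)) \<longlonglongrightarrow> K (T t y)" by simp
 moreover have "(\<lambda>k. S k t (K y)) \<longlonglongrightarrow> T t (K y)" using T_lim[OF copD(1)[OF K y] t] .
 ultimately show ?thesis using LIMSEQ_unique by blast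
qed

lemma cop_T:
 assumes t: "t \<ge> 0"
 shows "cop (T t)" unfolding cop_def
proof (intro conjI ballI allI impI)
 fix y assume y: "y \<in> Y"
 show "T t y \<in> Y" using closed_sequentially[OF Y_closed _ T_lim[OF y t]] copD(1)[OF cop_S[OF t] y] by blast
 show "norm (T t y) \<le> norm y"
  using copD(2)[OF cop_S[OF t] y] by (intro tendsto_upperbound[OF tendsto_norm[OF T_lim[OF y t]]]) auto
 show "T t (x + y) = T t x + T t y" if x: "x \<in> Y" for x
 proof -
  have "(\<lambda>k. S k t x + S k t y) \<longlonglongrightarrow> T t x + T t y" using T_lim x y t by (intro tendsto_add)
  moreover have "(\<lambda>k. S k t x + S k t y) \<longlonglongrightarrow> T t (x + y)"
   using T_lim[OF Y_add[OF x y] t] copD(3)[OF cop_S[OF t] x y] by simp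
  ultimately show ?thesis using LIMSEQ_unique by blast
 qed
 show "T t (c *\<^sub>R y) = c *\<^sub>R T t y" for c
 proof -
  have "(\<lambda>k. c *\<^sub>R S k t y) \<longlonglongrightarrow> c *\<^sub>R T t y" using T_lim y t by (intro tendsto_intros)
  moreover have "(\<lambda>k. c *\<^sub>R S k t y) \<longlonglongrightarrow> T t (c *\<^sub>R y)"
   using T_lim[OF Y_scale[OF y] t] copD(4)[OF cop_S[OF t] y] by simp
  ultimately show ?thesis using LIMSEQ_unique by blast
 qed
 show "T t (J h y) = J h (T t y)" if "h \<ge> 0" for h using T_commute[OF cop_J[OF that] y t] by simp
qed

lemmas T_Y = copD(1)[OF cop_T] and T_norm = copD(2)[OF cop_T] and T_add = copD(3)[OF cop_T]
 and T_scale = copD(4)[OF cop_T] and T_diff = cop_diff[OF cop_T]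
 and T_D = cop_D(1)[OF cop_T] and A_T = cop_D(2)[OF cop_T]

lemma T_0: "y \<in> Y ==> T 0 y = y"
proof -
 assume y: "y \<in> Y"
 have "J 0 = id" by (auto simp: J_0)
 then have "S k 0 y = y" for k by (simp add: S_def)
 then have "(\<lambda>k. y) \<longlonglongrightarrow> T 0 y" using T_lim[OF y, of 0] by simp
 then show "T 0 y = y" using LIMSEQ_unique[OF _ tendsto_const] by metis
qed

lemma T_bound_D:
 assumes x: "x \<in> D" and t: "t \<ge> 0"
 shows "norm (T t x - x) \<le> t * norm (A x)"
proof -
 have xY: "x \<in> Y" using x DY by blast
 have "norm (S k t x - x) \<le> t * norm (A x)" for k
 proof -
  have "norm ((J (t/2^k) ^^ (2^k)) x - (id ^^ (2^k)) x) \<le> real (2^k) * norm (J (t/2^k) x - id x)"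
   using t xY by (intro pow_diff_bound cop_id cop_J) auto
  also have "\<dots> \<le> real (2^k) * (t/2^k * norm (A x))"
   using J_diff_bound[OF x, of "t/2^k"] t by (intro mult_left_mono) auto
  finally show ?thesis by (simp add: S_def id_funpow)
 qed
 moreover have "(\<lambda>k. norm (S k t x - x)) \<longlonglongrightarrow> norm (T t x - x)"
  using T_lim[OF xY t] by (intro tendsto_intros)
 ultimately show ?thesis by (intro tendsto_upperbound) auto
qed

text \<open>The constant 3/2 is 1/2, the distance of \<open>T h x\<close> from a single Euler step,
  plus 1, the error of that step against the linear part.\<close>

lemma T_expansion_D2:
 assumes x: "x \<in> D2" and h: "h \<ge> 0"
 shows "norm (T h x - x - h *\<^sub>R A x) \<le> 3/2 * h\<^sup>2 * norm (A (A x))"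
proof -
 have xD: "x \<in> D" "A x \<in> D" "x \<in> Y" using x DY by (auto simp: D2_def)
 have 1: "norm (S 0 h x - T h x) \<le> h\<^sup>2 / 2 * norm (A (A x))"
 proof (rule tendsto_upperbound)
  show "(\<lambda>l. norm (S 0 h x - S l h x)) \<longlonglongrightarrow> norm (S 0 h x - T h x)"
   using T_lim[OF xD(3) h] by (intro tendsto_intros)
  show "\<forall>\<^sub>F l in sequentially. norm (S 0 h x - S l h x) \<le> h\<^sup>2 / 2 * norm (A (A x))"
   using S_tail[OF x h, of 0] by (intro always_eventually) auto
 qed simp
 have "S 0 h x = J h x" by (simp add: S_def)
 moreover have 2: "norm (J h x - x - h *\<^sub>R A x) \<le> h\<^sup>2 * norm (A (A x))"
 proof (cases "h = 0")
  case False
  have "J h x - x = h *\<^sub>R J h (A x)"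
   using J_resolvent(2)[OF xD(3), of h] J_D[OF xD(1) h] h False by (auto simp: algebra_simps)
  then have "norm (J h x - x - h *\<^sub>R A x) = h * norm (J h (A x) - A x)"
   using h by (simp flip: scaleR_diff_right)
  also have "\<dots> \<le> h * (h * norm (A (A x)))" using J_diff_bound[OF xD(2) h] h by (intro mult_left_mono)
  finally show ?thesis by (simp add: power2_eq_square)
 qed (simp add: J_0)
 moreover define w where "w = h *\<^sub>R A x"
 moreover have "norm (T h x - x - w) \<le> norm (J h x - T h x) + norm (J h x - x - w)" by norm
 ultimately have "norm (T h x - x - h *\<^sub>R A x) \<le> norm (J h x - T h x) + norm (J h x - x - h *\<^sub>R A x)"
  by simp
 then show ?thesis using 1 2 \<open>S 0 h x = J h x\<close> by (simp add: algebra_simps)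
qed

text \<open>The local error of \<open>T s \<circ> T t\<close> against \<open>T (s + t)\<close> is quadratic, and \<open>T\<close> is exactly
 multiplicative under halving of the step.\<close>

lemma T_double:
 assumes y: "y \<in> Y" and h: "h \<ge> 0"
 shows "T (2 * h) y = T h (T h y)"
proof -
 have TY: "T h y \<in> Y" using T_Y[OF h y] .
 have "(\<lambda>k. S k h (S k h y)) \<longlonglongrightarrow> T h (T h y)"
 proof (rule LIM_zero_cancel, rule Lim_null_comparison)
  show "\<forall>\<^sub>F k in sequentially. norm (S k h (S k h y) - T h (T h y)) \<le>
    norm (S k h y - T h y) + norm (S k h (T h y) - T h (T h y))"
  proof (intro always_eventually allI)
   fix k
   have SY: "S k h y \<in> Y" using copD(1)[OF cop_S[OF h] y] .
   have "norm (S k h (S k h y) - S k h (T h y)) \<le> norm (S k h y - T h y)"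
    using cop_diff[OF cop_S[OF h] SY TY] copD(2)[OF cop_S[OF h] Y_diff[OF SY TY]] by metis
   then show "norm (S k h (S k h y) - T h (T h y)) \<le>
    norm (S k h y - T h y) + norm (S k h (T h y) - T h (T h y))" by norm
  qed
  have "(\<lambda>k. norm (S k h y - T h y) + norm (S k h (T h y) - T h (T h y))) \<longlonglongrightarrow> 0 + 0"
   using T_lim[OF y h] T_lim[OF TY h] by (intro tendsto_add tendsto_norm_zero LIM_zero)
  then show "(\<lambda>k. norm (S k h y - T h y) + norm (S k h (T h y) - T h (T h y))) \<longlonglongrightarrow> 0" by simp
 qed
 moreover have "S (Suc k) (2 * h) y = S k h (S k h y)" for k
 proof -
  have "J ((2 * h) / 2^Suc k) = J (h / 2^k)" by simp
  then have "S (Suc k) (2 * h) = J (h / 2^k) ^^ (2^k + 2^k)" unfolding S_def by (simp only: power_Suc mult_2)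
  then show ?thesis by (simp only: funpow_add S_def o_apply)
 qed
 moreover have "(\<lambda>k. S (Suc k) (2 * h) y) \<longlonglongrightarrow> T (2 * h) y"
  by (rule LIMSEQ_Suc[OF T_lim[OF y]]) (use h in simp)
 ultimately have "(\<lambda>k. S k h (S k h y)) \<longlonglongrightarrow> T (2 * h) y" by simp
 then show ?thesis using \<open>(\<lambda>k. S k h (S k h y)) \<longlonglongrightarrow> T h (T h y)\<close> LIMSEQ_unique by blast
qed

lemma T_dyadic:
 assumes y: "y \<in> Y" and t: "t \<ge> 0"
 shows "T t y = (T (t / 2^k) ^^ (2^k)) y"
proof (induction k)
 case (Suc k)
 let ?h = "t / 2^Suc k"
 have h: "?h \<ge> 0" using t by simp
 have eq: "(T (t / 2^k) ^^ n) y = ((T ?h ^^ 2) ^^ n) y" for n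
 proof (induction n)
  case (Suc n)
  have "((T ?h ^^ 2) ^^ n) y \<in> Y" using copD(1)[OF cop_pow[OF cop_pow[OF cop_T[OF h]]] y] .
  then have "T (2 * ?h) (((T ?h ^^ 2) ^^ n) y) = (T ?h ^^ 2) (((T ?h ^^ 2) ^^ n) y)"
   using T_double[OF _ h] by (simp add: numeral_2_eq_2)
  then show ?case using Suc by simp
 qed simp
 have "(T ?h ^^ (2 * 2^k)) y = ((T ?h ^^ 2) ^^ (2^k)) y" by (simp add: funpow_mult)
 then show ?case using Suc eq by simp
qed simp

text \<open>On \<open>D2\<close>, both times are divided by \<open>2^k\<close>. By
  \<open>T_dyadic\<close> each side is an exact \<open>2^k\<close>-th power, so \<open>2^k\<close>
  local errors of order \<open>4^-k\<close> add up to something that tends to 0; density of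
  \<open>D2\<close> gives the rest.\<close>

lemma T_semigroup:
 assumes y: "y \<in> Y" and s: "s \<ge> 0" and t: "t \<ge> 0"
 shows "T (s + t) y = T s (T t y)"
proof -
 have comm: "T s (T t z) = T t (T s z)" if "z \<in> Y" "s \<ge> 0" "t \<ge> 0" for s t z
  using T_commute[OF cop_T[OF that(2)] that(1) that(3)] .
 have main: "T (s + t) x = T s (T t x)" if x: "x \<in> D2" for x
 proof -
  have xD: "x \<in> D" "A x \<in> D" "x \<in> Y" "A x \<in> Y" using x DY by (auto simp: D2_def)
  let ?a = "norm (A (A x))"
  \<comment> \<open>The four remainders collected below sum to at most \<open>3 * (s + t)^2\<close>
    times the norm of \<open>A (A x)\<close>; the factor 5 is generous.\<close>
  have local: "norm (T s (T t x) - T (s + t) x) \<le> 5 * (s + t)\<^sup>2 * ?a" if st: "s \<ge> 0" "t \<ge> 0" for s t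
  proof -
   have tx: "T t x - x - t *\<^sub>R A x \<in> Y" using T_Y xD st by (intro Y_diff Y_scale) auto
   have "T s (T t x) = T s ((T t x - x - t *\<^sub>R A x) + x + t *\<^sub>R A x)" by simp
   also have "\<dots> = T s (T t x - x - t *\<^sub>R A x) + T s x + t *\<^sub>R T s (A x)"
    by (simp only: T_add[OF st(1) Y_add[OF tx xD(3)] Y_scale[OF xD(4)]] T_add[OF st(1) tx xD(3)]
      T_scale[OF st(1) xD(4)])
   finally have "T s (T t x) - T (s + t) x = T s (T t x - x - t *\<^sub>R A x) + (T s x - x - s *\<^sub>R A x)
     + t *\<^sub>R (T s (A x) - A x) - (T (s + t) x - x - (s + t) *\<^sub>R A x)" by (simp add: algebra_simps)
   then have "norm (T s (T t x) - T (s + t) x) \<le> norm (T s (T t x - x - t *\<^sub>R A x)) + norm (T s x - x - s *\<^sub>R A x)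
     + norm (t *\<^sub>R (T s (A x) - A x)) + norm (T (s + t) x - x - (s + t) *\<^sub>R A x)"
    by (simp only:) (intro order_trans[OF norm_triangle_ineq4] add_right_mono order_trans[OF norm_triangle_ineq] order_refl)
   also have "\<dots> \<le> 3/2 * t\<^sup>2 * ?a + 3/2 * s\<^sup>2 * ?a + t * (s * ?a) + 3/2 * (s + t)\<^sup>2 * ?a"
   proof (intro add_mono)
    show "norm (T s (T t x - x - t *\<^sub>R A x)) \<le> 3/2 * t\<^sup>2 * ?a"
     using T_norm[OF st(1) tx] T_expansion_D2[OF x st(2)] by simp
    show "norm (t *\<^sub>R (T s (A x) - A x)) \<le> t * (s * ?a)"
     using T_bound_D[OF xD(2) st(1)] st by (simp add: mult_left_mono)
   qed (use T_expansion_D2[OF x] st in auto)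
   also have "\<dots> = (3/2 * t\<^sup>2 + 3/2 * s\<^sup>2 + t * s + 3/2 * (s + t)\<^sup>2) * ?a" by (simp add: algebra_simps)
   also have "\<dots> \<le> (5 * (s + t)\<^sup>2) * ?a"
   proof (rule mult_right_mono)
    have "0 \<le> s * t" "0 \<le> s\<^sup>2" "0 \<le> t\<^sup>2" using st by auto
    then show "3/2 * t\<^sup>2 + 3/2 * s\<^sup>2 + t * s + 3/2 * (s + t)\<^sup>2 \<le> 5 * (s + t)\<^sup>2"
     unfolding power2_sum by argo
   qed simp
   finally show ?thesis .
  qed
  have "norm (T s (T t x) - T (s + t) x) \<le> 5 * (s + t)\<^sup>2 * ?a * (1/2)^k" for k
  proof -
   let ?s = "s / 2^k" and ?t = "t / 2^k"
   have st': "?s \<ge> 0" "?t \<ge> 0" "?s + ?t \<ge> 0" using s t by auto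
   have "T s (T t x) = (T ?s ^^ (2^k)) ((T ?t ^^ (2^k)) x)"
    using T_dyadic[OF xD(3) t, of k] T_dyadic[OF T_Y[OF t xD(3)] s, of k] by simp
   also have "\<dots> = ((T ?s \<circ> T ?t) ^^ (2^k)) x"
   proof -
    have "(T ?s ^^ n) ((T ?t ^^ n) x) = ((T ?s \<circ> T ?t) ^^ n) x" for n
    proof (induction n)
     case (Suc n)
     have c: "(T ?s ^^ n) (T ?t z) = T ?t ((T ?s ^^ n) z)" if "z \<in> Y" for z
     proof (induction n)
      case (Suc n)
      have "(T ?s ^^ n) z \<in> Y" using copD(1)[OF cop_pow[OF cop_T[OF st'(1)]] that] .
      then show ?case using Suc comm st' by simp
     qed simp
     have "(T ?t ^^ n) x \<in> Y" using copD(1)[OF cop_pow[OF cop_T[OF st'(2)]] xD(3)] .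
     then show ?case using Suc c by simp
    qed simp
    then show ?thesis by blast
   qed
   finally have 1: "T s (T t x) = ((T ?s \<circ> T ?t) ^^ (2^k)) x" .
   have 2: "T (s + t) x = (T (?s + ?t) ^^ (2^k)) x"
    using T_dyadic[OF xD(3), of "s + t" k] s t by (simp add: add_divide_distrib)
   have "norm (T s (T t x) - T (s + t) x) \<le> real (2^k) * norm ((T ?s \<circ> T ?t) x - T (?s + ?t) x)"
    unfolding 1 2 using st' xD T_Y comm by (intro pow_diff_bound cop_comp cop_T) auto
   also have "\<dots> \<le> real (2^k) * (5 * (?s + ?t)\<^sup>2 * ?a)" using local[OF st'(1,2)] by (intro mult_left_mono) auto
   also have "\<dots> = 5 * (s + t)\<^sup>2 * ?a * (1/2)^k" by (simp add: power2_eq_square field_simps)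
   finally show ?thesis .
  qed
  moreover have "(\<lambda>k. 5 * (s + t)\<^sup>2 * ?a * (1/2)^k) \<longlonglongrightarrow> 0"
   by (intro tendsto_mult_right_zero LIMSEQ_realpow_zero) auto
  ultimately have "norm (T s (T t x) - T (s + t) x) \<le> 0" by (intro tendsto_lowerbound) auto
  then show ?thesis by simp
 qed
 have "norm (T s (T t y) - T (s + t) y) \<le> 0 + e" if e: "e > 0" for e
 proof -
  obtain x where x: "x \<in> D2" "norm (y - x) < e / 2" using D2_dense[OF y, of "e/2"] e by auto
  have xY: "x \<in> Y" using x DY by (simp add: D2_def)
  have "norm (T s (T t y) - T s (T t x)) \<le> norm (y - x)"
  proof -
   have "T s (T t y) - T s (T t x) = T s (T t (y - x))"
    using T_diff[OF t y xY] T_diff[OF s T_Y[OF t y] T_Y[OF t xY]] by simp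
   moreover have "norm (T s (T t (y - x))) \<le> norm (T t (y - x))"
    by (rule T_norm[OF s T_Y[OF t Y_diff[OF y xY]]])
   moreover have "norm (T t (y - x)) \<le> norm (y - x)" by (rule T_norm[OF t Y_diff[OF y xY]])
   ultimately show ?thesis by simp
  qed
  moreover have "norm (T (s + t) y - T (s + t) x) \<le> norm (y - x)"
   using T_diff[of "s + t", OF _ y xY] T_norm[of "s + t" "y - x"] s t y xY Y_diff by simp
  moreover define a b c d where "a = T s (T t y)" and "b = T (s + t) y" and "c = T (s + t) x" and "d = norm (y - x)"
  ultimately have "norm (a - c) \<le> d" "norm (b - c) \<le> d" using main[OF x(1)] by simp_all
  moreover have "d < e / 2" using x(2) by (simp add: d_def)
  ultimately have "norm (a - b) \<le> 0 + e" by norm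
  then show ?thesis by (simp add: a_def b_def)
 qed
 then have "norm (T s (T t y) - T (s + t) y) \<le> 0" by (rule field_le_epsilon)
 then show ?thesis by simp
qed

end

text \<open>Connects the library's derivative with the difference quotients in which
  \<open>has_deriv_in\<close> and \<open>is_generator\<close> are phrased; it holds for every set
  \<open>S\<close>, so one-sided limits are included.\<close>

lemma has_vector_derivative_iff_quotient:
 fixes f :: "real => 'b::real_normed_vector"
 shows "(f has_vector_derivative D) (at t within S) \<longleftrightarrow>
  ((\<lambda>r. (1 / (r - t)) *\<^sub>R (f r - f t)) \<longlongrightarrow> D) (at t within S)"
proof -
 have eq: "norm ((1 / norm (r - t)) *\<^sub>R (f r - (f t + (r - t) *\<^sub>R D))) =
   norm ((1 / (r - t)) *\<^sub>R (f r - f t) - D)" if "r \<noteq> t" for r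
 proof -
  have "(1 / (r - t)) *\<^sub>R (f r - f t) - D = (1 / (r - t)) *\<^sub>R (f r - (f t + (r - t) *\<^sub>R D))"
   using that by (simp add: scaleR_diff_right scaleR_add_right)
  then show ?thesis by simp
 qed
 have "(f has_vector_derivative D) (at t within S) \<longleftrightarrow>
  ((\<lambda>r. norm ((1 / norm (r - t)) *\<^sub>R (f r - (f t + (r - t) *\<^sub>R D)))) \<longlongrightarrow> 0) (at t within S)"
  unfolding has_vector_derivative_def has_derivative_within
  by (subst tendsto_norm_zero_iff) (simp add: bounded_linear_scaleR_left)
 also have "\<dots> \<longleftrightarrow> ((\<lambda>r. norm ((1 / (r - t)) *\<^sub>R (f r - f t) - D)) \<longlongrightarrow> 0) (at t within S)"
  by (intro filterlim_cong refl) (unfold eventually_at_filter, intro always_eventually allI impI, rule eq)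
 also have "\<dots> \<longleftrightarrow> ((\<lambda>r. (1 / (r - t)) *\<^sub>R (f r - f t)) \<longlongrightarrow> D) (at t within S)"
  by (simp only: tendsto_norm_zero_iff LIM_zero_iff)
 finally show ?thesis .
qed

section \<open>Orbits, the generator and uniqueness of solutions\<close>

context m_dissipative
begin

lemma T_lipschitz:
 assumes x: "x \<in> D" and s: "s \<ge> 0" and t: "t \<ge> 0"
 shows "norm (T t x - T s x) \<le> \<bar>t - s\<bar> * norm (A x)"
proof -
 have *: "norm (T t x - T s x) \<le> (t - s) * norm (A x)" if "0 \<le> s" "s \<le> t" for s t
 proof -
  have xY: "x \<in> Y" "T (t - s) x \<in> Y" using x DY T_Y that by auto
  have "T t x = T s (T (t - s) x)" using T_semigroup[OF xY(1) that(1), of "t - s"] that by simp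
  then have "T t x - T s x = T s (T (t - s) x - x)" using T_diff[OF that(1) xY(2) xY(1)] by simp
  then have "norm (T t x - T s x) \<le> norm (T (t - s) x - x)"
   using T_norm[OF that(1) Y_diff[OF xY(2) xY(1)]] by simp
  then show ?thesis using T_bound_D[OF x, of "t - s"] that by simp
 qed
 show ?thesis using *[of s t] *[of t s] s t by (cases "s \<le> t") (auto simp: norm_minus_commute abs_if)
qed

lemma D_approx: "y \<in> Y ==> e > 0 ==> \<exists>x\<in>D. norm (y - x) < e"
 using D2_dense[of y e] by (auto simp: D2_def)

lemma T_cont:
 assumes y: "y \<in> Y"
 shows "continuous_on {0..} (\<lambda>t. T t y)" unfolding continuous_on_iff
proof (intro ballI allI impI)
 fix s e :: real assume s: "s \<in> {0..}" and e: "0 < e"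
 obtain x where x: "x \<in> D" "norm (y - x) < e / 3" using D_approx[OF y, of "e/3"] e by auto
 have xY: "x \<in> Y" using x DY by blast
 have close: "norm (T t y - T t x) < e / 3" if "t \<ge> 0" for t
  using T_diff[OF that y xY] T_norm[OF that Y_diff[OF y xY]] x by simp
 let ?d = "e / (3 * (norm (A x) + 1))"
 have d: "?d > 0" using e by (simp add: add_nonneg_pos)
 have "dist (T t y) (T s y) < e" if t: "t \<in> {0..}" "dist t s < ?d" for t
 proof -
  have "norm (T t x - T s x) \<le> \<bar>t - s\<bar> * norm (A x)" using T_lipschitz x s t by simp
  also have "\<dots> \<le> ?d * norm (A x)" using t by (intro mult_right_mono) (auto simp: dist_real_def)
  also have "\<dots> = e / 3 * (norm (A x) / (norm (A x) + 1))" by simp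
  also have "\<dots> \<le> e / 3 * 1" using e by (intro mult_left_mono) (auto simp: divide_le_eq_1 add_nonneg_pos)
  finally have "norm (T t x - T s x) \<le> e / 3" by simp
  then show ?thesis using close[of t] close[of s] s t unfolding dist_norm by simp norm
 qed
 then show "\<exists>d>0. \<forall>t\<in>{0..}. dist t s < d --> dist (T t y) (T s y) < e" using d by blast
qed

text \<open>To the right of \<open>t\<close> this is the expansion at 0 moved by \<open>T t\<close>.
  To the left one expands at \<open>r\<close> and replaces \<open>T r (A x)\<close> by
  \<open>T t (A x)\<close>; that costs one more unit, whence 3/2 + 1 = 5/2.\<close>

lemma T_expansion_D2_at:
 assumes x: "x \<in> D2" and t: "t \<ge> 0" and r: "r \<ge> 0"
 shows "norm (T r x - T t x - (r - t) *\<^sub>R T t (A x)) \<le> 5/2 * (r - t)\<^sup>2 * norm (A (A x))"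
proof -
 have xD: "x \<in> D" "A x \<in> D" "x \<in> Y" "A x \<in> Y" using x DY by (auto simp: D2_def)
 have 1: "norm (T r x - T t x - (r - t) *\<^sub>R T t (A x)) \<le> 3/2 * (r - t)\<^sup>2 * norm (A (A x))"
  if t: "0 \<le> t" and tr: "t \<le> r" for t r
 proof -
  let ?h = "r - t"
  have "T r x = T t (T ?h x)" using T_semigroup[OF xD(3) t, of ?h] tr by simp
  then have "T r x - T t x - ?h *\<^sub>R T t (A x) = T t (T ?h x - x - ?h *\<^sub>R A x)"
   using tr by (simp add: T_diff[OF t] T_scale[OF t] T_Y Y_diff Y_scale xD)
  then have "norm (T r x - T t x - ?h *\<^sub>R T t (A x)) \<le> norm (T ?h x - x - ?h *\<^sub>R A x)"
   using T_norm[OF t, of "T ?h x - x - ?h *\<^sub>R A x"] tr by (simp add: T_Y Y_diff Y_scale xD)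
  also have "\<dots> \<le> 3/2 * ?h\<^sup>2 * norm (A (A x))" using T_expansion_D2[OF x] tr by simp
  finally show ?thesis .
 qed
 show ?thesis
 proof (cases "t \<le> r")
  case True
  show ?thesis by (rule order_trans[OF 1[OF t True]]) (intro mult_right_mono, auto)
 next
  case False
  let ?h = "t - r"
  have "norm (?h *\<^sub>R (T t (A x) - T r (A x))) \<le> ?h * (?h * norm (A (A x)))"
   using T_lipschitz[OF xD(2) r t] False by (simp add: mult_left_mono)
  moreover have "T r x - T t x - (r - t) *\<^sub>R T t (A x) =
    ?h *\<^sub>R (T t (A x) - T r (A x)) - (T t x - T r x - ?h *\<^sub>R T r (A x))"
   by (simp add: algebra_simps)
  moreover have "norm (T t x - T r x - ?h *\<^sub>R T r (A x)) \<le> 3/2 * (r - t)\<^sup>2 * norm (A (A x))"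
   using 1[OF r, of t] False by (simp add: power2_commute)
  ultimately show ?thesis
   using norm_triangle_ineq4[of "?h *\<^sub>R (T t (A x) - T r (A x))" "T t x - T r x - ?h *\<^sub>R T r (A x)"]
   by (simp add: power2_eq_square algebra_simps)
 qed
qed

text \<open>A graph-norm approximation \<open>z\<close> in \<open>D2\<close> carries the quadratic
  expansion over to \<open>D\<close>: orbit and derivative of \<open>x - z\<close> cost
  \<open>e/4\<close> each, and the remainder for \<open>z\<close> costs \<open>e/2\<close> near
  \<open>t\<close>.\<close>

lemma T_deriv:
 assumes x: "x \<in> D" and t: "t \<ge> 0"
 shows "((\<lambda>t. T t x) has_vector_derivative T t (A x)) (at t within {0..})"
 unfolding has_vector_derivative_def has_derivative_within_alt
proof (intro conjI allI impI)
 show "bounded_linear (\<lambda>h. h *\<^sub>R T t (A x))" by (rule bounded_linear_scaleR_left)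
 fix e :: real assume e: "e > 0"
 obtain z where z: "z \<in> D2" "norm (A x - A z) < e / 4" using D2_dense_graph[OF x, of "e/4"] e by auto
 have zD: "z \<in> D" "z \<in> Y" "x \<in> Y" "A x \<in> Y" "A z \<in> Y" using z x DY A_Y by (auto simp: D2_def)
 let ?a = "5/2 * norm (A (A z))"
 let ?d = "e / (2 * (?a + 1))"
 have d: "?d > 0" using e by (simp add: add_nonneg_pos)
 have "norm (T r x - T t x - (r - t) *\<^sub>R T t (A x)) \<le> e * norm (r - t)" if r: "r \<in> {0..}" "norm (r - t) < ?d" for r
 proof -
  have r0: "r \<ge> 0" using r by simp
  have 1: "norm (T r (x - z) - T t (x - z)) \<le> \<bar>r - t\<bar> * (e / 4)"
  proof -
   have "norm (T r (x - z) - T t (x - z)) \<le> \<bar>r - t\<bar> * norm (A (x - z))"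
    using T_lipschitz[OF D_diff[OF x zD(1)] t r0] .
   also have "\<dots> \<le> \<bar>r - t\<bar> * (e / 4)" using z x zD by (intro mult_left_mono) (auto simp: A_diff)
   finally show ?thesis .
  qed
  have 2: "norm ((r - t) *\<^sub>R T t (A x - A z)) \<le> \<bar>r - t\<bar> * (e / 4)"
  proof -
   have "norm (T t (A x - A z)) \<le> e / 4" using T_norm[OF t Y_diff[OF zD(4,5)]] z by simp
   then have "\<bar>r - t\<bar> * norm (T t (A x - A z)) \<le> \<bar>r - t\<bar> * (e / 4)" by (intro mult_left_mono) auto
   then show ?thesis by (simp only: norm_scaleR)
  qed
  have 3: "norm (T r z - T t z - (r - t) *\<^sub>R T t (A z)) \<le> \<bar>r - t\<bar> * (e / 2)"
  proof -
   have "norm (T r z - T t z - (r - t) *\<^sub>R T t (A z)) \<le> 5/2 * (r - t)\<^sup>2 * norm (A (A z))"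
    using T_expansion_D2_at[OF z(1) t r0] .
   also have "\<dots> = \<bar>r - t\<bar> * (\<bar>r - t\<bar> * ?a)"
    by (simp add: power2_eq_square abs_mult_self_eq flip: mult.assoc)
   also have "\<dots> \<le> \<bar>r - t\<bar> * (?d * ?a)" using r by (intro mult_left_mono mult_right_mono) auto
   also have "?d * ?a = e / 2 * (?a / (?a + 1))" by simp
   also have "\<bar>r - t\<bar> * \<dots> \<le> \<bar>r - t\<bar> * (e / 2 * 1)"
    using e by (intro mult_left_mono) (auto simp: divide_le_eq_1 add_nonneg_pos)
   finally show ?thesis by simp
  qed
  have "T r x - T t x - (r - t) *\<^sub>R T t (A x) = (T r (x - z) - T t (x - z)) - (r - t) *\<^sub>R T t (A x - A z)
    + (T r z - T t z - (r - t) *\<^sub>R T t (A z))" by (simp add: T_diff[OF r0] T_diff[OF t] zD algebra_simps)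
  then have "norm (T r x - T t x - (r - t) *\<^sub>R T t (A x)) \<le> norm (T r (x - z) - T t (x - z))
    + norm ((r - t) *\<^sub>R T t (A x - A z)) + norm (T r z - T t z - (r - t) *\<^sub>R T t (A z))"
   by (metis norm_triangle_le norm_triangle_ineq4 add_right_mono)
  also have "\<dots> \<le> \<bar>r - t\<bar> * (e / 4) + \<bar>r - t\<bar> * (e / 4) + \<bar>r - t\<bar> * (e / 2)" using 1 2 3 by linarith
  also have "\<dots> = e * norm (r - t)" by (simp add: algebra_simps)
  finally show ?thesis .
 qed
 then show "\<exists>d>0. \<forall>r\<in>{0..}. norm (r - t) < d -->
   norm (T r x - T t x - (r - t) *\<^sub>R T t (A x)) \<le> e * norm (r - t)" using d by blast
qed

lemma T_deriv_at:
 assumes x: "x \<in> D" and t: "t > 0"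
 shows "((\<lambda>t. T t x) has_vector_derivative T t (A x)) (at t)"
proof -
 have "((\<lambda>t. T t x) has_vector_derivative T t (A x)) (at t within {0<..})"
  by (rule has_vector_derivative_within_subset[OF T_deriv[OF x]]) (use t in auto)
 moreover have "at t within {0<..} = at t" by (rule at_within_open) (use t in auto)
 ultimately show ?thesis by simp
qed

lemma generator_limit:
 assumes x: "x \<in> D"
 shows "((\<lambda>h. (1 / h) *\<^sub>R (T h x - x)) \<longlongrightarrow> A x) (at_right 0)"
proof -
 have "((\<lambda>r. (1 / (r - 0)) *\<^sub>R (T r x - T 0 x)) \<longlongrightarrow> T 0 (A x)) (at 0 within {0..})"
  using T_deriv[OF x, of 0] by (simp add: has_vector_derivative_iff_quotient)
 then have "((\<lambda>r. (1 / (r - 0)) *\<^sub>R (T r x - T 0 x)) \<longlongrightarrow> T 0 (A x)) (at 0 within {0<..})"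
  by (rule tendsto_within_subset) auto
 then show ?thesis using T_0 x DY A_Y by simp
qed

text \<open>Applying \<open>J 1\<close> moves the orbit into the domain: \<open>w = J 1 y\<close> is
  in \<open>D\<close> and its difference quotients give \<open>A w = J 1 z\<close>. Then
  \<open>y = w - A w = w - J 1 z\<close> is a difference of two elements of
  \<open>D\<close>.\<close>

lemma generator_converse:
 assumes y: "y \<in> Y" and z: "z \<in> Y"
  and lim: "((\<lambda>h. (1 / h) *\<^sub>R (T h y - y)) \<longlongrightarrow> z) (at_right 0)"
 shows "y \<in> D \<and> A y = z"
proof -
 let ?w = "J 1 y"
 have wD: "?w \<in> D" and w: "?w - A ?w = y" using J_resolvent[OF y, of 1] by auto
 have "((\<lambda>h. J 1 ((1 / h) *\<^sub>R (T h y - y))) \<longlongrightarrow> J 1 z) (at_right 0)"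
 proof (rule LIM_zero_cancel, rule Lim_null_comparison)
  show "\<forall>\<^sub>F h in at_right 0. norm (J 1 ((1 / h) *\<^sub>R (T h y - y)) - J 1 z) \<le> norm ((1 / h) *\<^sub>R (T h y - y) - z)"
   using eventually_at_right_less[of "0::real"]
  proof eventually_elim
   case (elim h)
   have q: "(1 / h) *\<^sub>R (T h y - y) \<in> Y" using T_Y y elim by (auto intro!: Y_scale Y_diff)
   show ?case using cop_diff[OF cop_J q z, of 1] J_norm[OF Y_diff[OF q z], of 1] by simp
  qed
  show "((\<lambda>h. norm ((1 / h) *\<^sub>R (T h y - y) - z)) \<longlongrightarrow> 0) (at_right 0)"
   using tendsto_norm_zero[OF LIM_zero[OF lim]] .
 qed
 moreover have "\<forall>\<^sub>F h in at_right 0. J 1 ((1 / h) *\<^sub>R (T h y - y)) = (1 / h) *\<^sub>R (T h ?w - ?w)"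
  using eventually_at_right_less[of "0::real"]
 proof eventually_elim
  case (elim h)
  then have T: "T h y \<in> Y" "h \<ge> 0" using T_Y y by auto
  show ?case
   using J_scale[OF Y_diff[OF T(1) y], of 1 "1/h"] cop_diff[OF cop_J T(1) y, of 1] T_commute[OF cop_J y T(2), of 1]
   by simp
 qed
 ultimately have l: "((\<lambda>h. (1 / h) *\<^sub>R (T h ?w - ?w)) \<longlongrightarrow> J 1 z) (at_right 0)"
  by (rule Lim_transform_eventually)
 have Aw: "A ?w = J 1 z" by (rule tendsto_unique[OF trivial_limit_at_right_real generator_limit[OF wD] l])
 have zD: "J 1 z \<in> D" "J 1 z - A (J 1 z) = z" using J_resolvent[OF z, of 1] by auto
 have yD: "?w - J 1 z = y" using w unfolding Aw .
 have "?w - J 1 z \<in> D" by (rule D_diff[OF wD zD(1)])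
 moreover have "A (?w - J 1 z) = z" using A_diff[OF wD zD(1)] zD(2) unfolding Aw by simp
 ultimately show ?thesis unfolding yD by blast
qed

text \<open>For fixed \<open>t\<close> the function \<open>s \<mapsto> T (t - s) (V s)\<close> has derivative zero.\<close>

lemma classical_unique:
 assumes V_cont: "continuous_on {0..} V" and V_Y: "!!t. t \<ge> 0 ==> V t \<in> Y"
  and V_D: "!!t. t > 0 ==> V t \<in> D" and V_deriv: "!!t. t > 0 ==> (V has_vector_derivative A (V t)) (at t)"
  and t: "t \<ge> 0"
 shows "V t = T t (V 0)"
proof (cases "t = 0")
 case True
 then show ?thesis using T_0 V_Y by simp
next
 case False
 then have t: "t > 0" using t by simp
 define f where "f = (\<lambda>s. T (t - s) (V s))"
 have "norm (f t - f 0) \<le> (\<lambda>_. 0) t - (\<lambda>_. 0) (0::real)"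
 proof (rule differentiable_bound_general[OF t])
  show "continuous_on {0..t} f" unfolding continuous_on_def
  proof
   fix s assume s: "s \<in> {0..t}"
   show "(f \<longlongrightarrow> f s) (at s within {0..t})"
   proof (rule LIM_zero_cancel, rule Lim_null_comparison)
    show "\<forall>\<^sub>F r in at s within {0..t}. norm (f r - f s) \<le>
      norm (V r - V s) + norm (T (t - r) (V s) - T (t - s) (V s))" unfolding eventually_at_filter
    proof (intro always_eventually allI impI)
     fix r assume r: "r \<in> {0..t}"
     have "norm (T (t - r) (V r) - T (t - r) (V s)) \<le> norm (V r - V s)"
      using T_diff[of "t - r" "V r" "V s"] T_norm[of "t - r" "V r - V s"] V_Y r s Y_diff by simp
     then show "norm (f r - f s) \<le> norm (V r - V s) + norm (T (t - r) (V s) - T (t - s) (V s))"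
      unfolding f_def by norm
    qed
    have "continuous_on {0..t} V" using continuous_on_subset[OF V_cont] by auto
    then have 1: "(V \<longlongrightarrow> V s) (at s within {0..t})" using s by (simp add: continuous_on_def)
    have "continuous_on {0..t} (\<lambda>r. T (t - r) (V s))"
     using s V_Y by (intro continuous_on_compose2[OF T_cont[of "V s"]] continuous_intros) auto
    then have 2: "((\<lambda>r. T (t - r) (V s)) \<longlongrightarrow> T (t - s) (V s)) (at s within {0..t})"
     using s by (simp add: continuous_on_def)
    have "((\<lambda>r. norm (V r - V s) + norm (T (t - r) (V s) - T (t - s) (V s))) \<longlongrightarrow> 0 + 0) (at s within {0..t})"
     using 1 2 by (intro tendsto_add tendsto_norm_zero LIM_zero)
    then show "((\<lambda>r. norm (V r - V s) + norm (T (t - r) (V s) - T (t - s) (V s))) \<longlongrightarrow> 0) (at s within {0..t})"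
     by simp
   qed
  qed
  fix s assume s: "0 < s" "s < t"
  let ?x = "V s"
  have xD: "?x \<in> D" "?x \<in> Y" "A ?x \<in> Y" using V_D s DY A_Y by auto
  have "((\<lambda>r. (1 / (r - s)) *\<^sub>R (f r - f s)) \<longlongrightarrow> 0) (at s)"
  proof (rule Lim_null_comparison)
   \<comment> \<open>The quotient of \<open>f\<close> splits into the error \<open>?q\<close> of the
     quotient of \<open>V\<close>, the quotient \<open>?p\<close> of the orbit through the fixed
     vector \<open>V s\<close>, and the time shift \<open>?u\<close> of \<open>A (V s)\<close>; all
     three tend to 0.\<close>
   let ?q = "\<lambda>r. (1 / (r - s)) *\<^sub>R (V r - V s) - A ?x"
   let ?p = "\<lambda>r. (1 / (r - s)) *\<^sub>R (T (t - r) ?x - T (t - s) ?x) + T (t - s) (A ?x)"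
   let ?u = "\<lambda>r. T (t - r) (A ?x) - T (t - s) (A ?x)"
   have near: "\<forall>\<^sub>F r in at s. r \<in> {0<..<t}" using s by (intro eventually_at_in_open') auto
   show "\<forall>\<^sub>F r in at s. norm ((1 / (r - s)) *\<^sub>R (f r - f s)) \<le> norm (?q r) + norm (?p r) + norm (?u r)"
    using near
   proof eventually_elim
    case (elim r)
    have r: "t - r \<ge> 0" "V r \<in> Y" using elim V_Y by auto
    have "T (t - r) (?q r) = (1 / (r - s)) *\<^sub>R (T (t - r) (V r) - T (t - r) ?x) - T (t - r) (A ?x)"
     using r xD by (simp add: T_diff[OF r(1)] T_scale[OF r(1)] Y_scale Y_diff)
    then have "(1 / (r - s)) *\<^sub>R (f r - f s) = T (t - r) (?q r) + ?p r + ?u r"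
     by (simp add: f_def algebra_simps)
    moreover have "norm (T (t - r) (?q r)) \<le> norm (?q r)" using r xD by (intro T_norm Y_diff Y_scale)
    ultimately show ?case
     using norm_triangle_ineq[of "T (t - r) (?q r) + ?p r" "?u r"] norm_triangle_ineq[of "T (t - r) (?q r)" "?p r"]
     by simp
   qed
   have "(?q \<longlongrightarrow> 0) (at s)"
    using V_deriv[OF s(1)] by (intro LIM_zero) (simp add: has_vector_derivative_iff_quotient)
   moreover have "(?p \<longlongrightarrow> 0) (at s)"
   proof -
    have "((\<lambda>r. t - r) has_vector_derivative -1) (at s)" by (auto intro!: derivative_eq_intros)
    moreover have "((\<lambda>t. T t ?x) has_vector_derivative T (t - s) (A ?x)) (at (t - s))"
     using T_deriv_at[OF xD(1)] s by simp
    ultimately have "((\<lambda>t. T t ?x) \<circ> (\<lambda>r. t - r) has_vector_derivative (-1) *\<^sub>R T (t - s) (A ?x)) (at s)"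
     by (rule vector_diff_chain_at)
    then have "((\<lambda>r. (1 / (r - s)) *\<^sub>R (T (t - r) ?x - T (t - s) ?x)) \<longlongrightarrow> - T (t - s) (A ?x)) (at s)"
     by (simp add: has_vector_derivative_iff_quotient o_def)
    then show ?thesis using LIM_zero by fastforce
   qed
   moreover have "(?u \<longlongrightarrow> 0) (at s)"
   proof -
    have "continuous_on {0<..<t} (\<lambda>r. T (t - r) (A ?x))"
     using xD by (intro continuous_on_compose2[OF T_cont[of "A ?x"]] continuous_intros) auto
    then have "isCont (\<lambda>r. T (t - r) (A ?x)) s" using s by (simp add: continuous_on_eq_continuous_at)
    then show ?thesis by (intro LIM_zero) (simp add: isCont_def)
   qed
   ultimately have "((\<lambda>r. norm (?q r) + norm (?p r) + norm (?u r)) \<longlongrightarrow> 0 + 0 + 0) (at s)"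
    by (intro tendsto_add tendsto_norm_zero)
   then show "((\<lambda>r. norm (?q r) + norm (?p r) + norm (?u r)) \<longlongrightarrow> 0) (at s)" by simp
  qed
  then show "(f has_vector_derivative 0) (at s)" by (simp add: has_vector_derivative_iff_quotient)
 qed (auto intro!: derivative_eq_intros)
 then have "f t = f 0" by simp
 then show ?thesis using T_0 V_Y t by (simp add: f_def)
qed

text \<open>Initial values are written as \<open>A z\<close>, every vector being of this form once
  \<open>A\<close> is onto. The orbit of \<open>A z\<close> is the derivative of the orbit of
  \<open>z\<close>, so its integral is explicit and lies in the domain.\<close>

lemma mild_exists:
 assumes z: "z \<in> D" and t: "t \<ge> 0"
 shows "((\<lambda>s. T s (A z)) has_integral (T t z - z)) {0..t}" "T t z - z \<in> D"
  "T t (A z) = A z + A (T t z - z)"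
proof -
 have "((\<lambda>s. T s (A z)) has_integral (T t z - T 0 z)) {0..t}"
 proof (rule fundamental_theorem_of_calculus[OF t])
  fix s assume "s \<in> {0..t}"
  then show "((\<lambda>s. T s z) has_vector_derivative T s (A z)) (at s within {0..t})"
   using has_vector_derivative_within_subset[OF T_deriv[OF z]] by auto
 qed
 then show "((\<lambda>s. T s (A z)) has_integral (T t z - z)) {0..t}" using T_0 z DY by simp
 show "T t z - z \<in> D" using T_D[OF t z] z D_diff by blast
 show "T t (A z) = A z + A (T t z - z)" using A_T[OF t z] A_diff[OF T_D[OF t z] z] by simp
qed

text \<open>The integral of \<open>V\<close> minus that of the orbit is a classical solution
  starting at 0. It vanishes by \<open>classical_unique\<close>, and applying \<open>A\<close> to it
  gives \<open>V t - T t (A z) = 0\<close>.\<close>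

lemma mild_unique:
 assumes z: "z \<in> D" and V_cont: "continuous_on {0..} V"
  and V_mild: "!!t. t \<ge> 0 ==> \<exists>I\<in>D. (V has_integral I) {0..t} \<and> V t = A z + A I"
  and t: "t \<ge> 0"
 shows "V t = T t (A z)"
proof -
 define I where "I = (\<lambda>t. integral {0..t} V)"
 have I: "I t \<in> D" "V t = A z + A (I t)" if "t \<ge> 0" for t
  using V_mild[OF that] integral_unique by (auto simp: I_def)
 define W where "W = (\<lambda>t. I t - (T t z - z))"
 have WD: "W t \<in> D" "A (W t) = V t - T t (A z)" if "t \<ge> 0" for t
 proof -
  note m = mild_exists(2,3)[OF z that]
  show "W t \<in> D" using I[OF that] m by (simp add: W_def D_diff)
  have "A (W t) = A (I t) - A (T t z - z)" using I(1)[OF that] m(1) by (simp add: W_def A_diff)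
  then show "A (W t) = V t - T t (A z)" using I(2)[OF that] m(2) by simp
 qed
 have I_deriv: "(I has_vector_derivative V t) (at t within {0..b})" if "t \<in> {0..b}" for t b
  unfolding I_def using that continuous_on_subset[OF V_cont] by (intro integral_has_vector_derivative) auto
 have W_deriv: "(W has_vector_derivative A (W t)) (at t)" if "t > 0" for t
 proof -
  have "(I has_vector_derivative V t) (at t within {0<..<t+1})"
   by (rule has_vector_derivative_within_subset[OF I_deriv[of t "t+1"]]) (use that in auto)
  moreover have "at t within {0<..<t+1} = at t" by (rule at_within_open) (use that in auto)
  ultimately have "(I has_vector_derivative V t) (at t)" by simp
  moreover have "((\<lambda>t. T t z - z) has_vector_derivative T t (A z) - 0) (at t)"
   using T_deriv_at[OF z that] by (intro has_vector_derivative_diff) auto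
  ultimately have "(W has_vector_derivative V t - (T t (A z) - 0)) (at t)"
   unfolding W_def by (rule has_vector_derivative_diff)
  then show ?thesis using WD[of t] that by simp
 qed
 have "continuous_on {0..} W"
 proof -
  have "continuous_on {0..b} I" for b unfolding continuous_on_eq_continuous_within
   using has_vector_derivative_continuous[OF I_deriv] by blast
  then have "continuous_on {0..} I"
  proof -
   assume c: "!!b. continuous_on {0..b} I"
   show ?thesis unfolding continuous_on_eq_continuous_within
   proof
    fix x :: real assume x: "x \<in> {0..}"
    have "continuous (at x within {0..x+1}) I" using c x by (auto simp: continuous_on_eq_continuous_within)
    moreover have "at x within {0..x+1} = at x within {0..}"
     using x by (intro at_within_nhd[of _ "{x-1<..<x+1}"]) auto
    ultimately show "continuous (at x within {0..}) I" by simp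
   qed
  qed
  then show ?thesis unfolding W_def using T_cont[OF DY[OF z]] by (intro continuous_intros)
 qed
 then have "W t = T t (W 0)" using WD W_deriv DY t by (intro classical_unique) auto
 moreover have "W 0 = 0" using T_0[OF DY[OF z]] by (simp add: W_def I_def)
 moreover have "T t 0 = 0" using T_scale[OF t Y_zero, of 0] by simp
 moreover have "A 0 = 0" using A_scale[OF D_zero, of 0] by simp
 ultimately show ?thesis using WD(2)[OF t] by simp
qed

end

section \<open>Hilbert spaces of representatives\<close>

lemma scaleC_zero_left [simp]: "0 *\<^sub>C (x::'a::complex_vector) = 0" using scaleC_add_left[of 0 0 x] by simp

lemma scaleC_minus1: "(-1) *\<^sub>C (x::'a::complex_vector) = - x"
 using scaleC_add_left[of "-1" 1 x] by (simp add: scaleC_one eq_neg_iff_add_eq_0)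

lemma scaleC_minus_right: "c *\<^sub>C (- x) = - (c *\<^sub>C (x::'a::complex_vector))"
 by (metis scaleC_minus1 scaleC_scaleC mult.commute)

lemma scaleC_diff_right: "c *\<^sub>C (x - y) = c *\<^sub>C x - c *\<^sub>C (y::'a::complex_vector)"
 using scaleC_add_right[of c x "-y"] by (simp add: scaleC_minus_right)

instance bcontfun :: (metric_space, banach) banach ..

text \<open>\<open>r\<close> stands for the real part of a complex semi-inner product. Homogeneity
  is required for real scalars only; the complex structure returns in \<open>generating\<close>
  through invariance under multiplication by \<open>\<i>\<close>.\<close>

locale semi_inner =
 fixes X :: "'a::complex_vector set" and r :: "'a => 'a => real"
 assumes X_zero: "0 \<in> X" and X_add: "[|x \<in> X; y \<in> X|] ==> x + y \<in> X"
  and X_scale: "!!x c. x \<in> X ==> c *\<^sub>C x \<in> X"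
  and r_add: "[|x \<in> X; y \<in> X; z \<in> X|] ==> r (x + y) z = r x z + r y z"
  and r_scale: "!!x z c. [|x \<in> X; z \<in> X|] ==> r (complex_of_real c *\<^sub>C x) z = c * r x z"
  and r_sym: "[|x \<in> X; z \<in> X|] ==> r x z = r z x"
  and r_ge0: "x \<in> X ==> r x x \<ge> 0"
begin

definition nrm :: "'a => real" where "nrm x = sqrt (r x x)"

lemma X_minus: "x \<in> X ==> - x \<in> X" using X_scale[of x "-1"] by (simp add: scaleC_minus1)

lemma X_diff: "[|x \<in> X; y \<in> X|] ==> x - y \<in> X" using X_add[of x "-y"] X_minus by simp

lemma r_minus: "[|x \<in> X; z \<in> X|] ==> r (- x) z = - r x z"
 using r_scale[of x z "-1"] by (simp add: scaleC_minus1)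

lemma r_diff: "[|x \<in> X; y \<in> X; z \<in> X|] ==> r (x - y) z = r x z - r y z"
 using r_add[of x "-y" z] by (simp add: X_minus r_minus)

lemma r_add_right: "[|x \<in> X; y \<in> X; z \<in> X|] ==> r z (x + y) = r z x + r z y"
 using r_add r_sym X_add by metis

lemma r_scale_right: "[|x \<in> X; z \<in> X|] ==> r z (complex_of_real c *\<^sub>C x) = c * r z x"
 using r_scale r_sym X_scale by metis

lemma nrm_sq: "x \<in> X ==> (nrm x)\<^sup>2 = r x x" using r_ge0 by (simp add: nrm_def)

lemma nrm_ge0: "x \<in> X ==> nrm x \<ge> 0" using r_ge0 by (simp add: nrm_def)

lemma r_bound:
 assumes "x \<in> X" "y \<in> X"
 shows "\<bar>r x y\<bar> \<le> nrm x * nrm y"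
proof -
 have q: "0 \<le> r x x + 2 * t * r x y + t\<^sup>2 * r y y" for t
 proof -
  have ty: "complex_of_real t *\<^sub>C y \<in> X" using X_scale assms by blast
  have "0 \<le> r (x + complex_of_real t *\<^sub>C y) (x + complex_of_real t *\<^sub>C y)"
   using r_ge0 X_add assms ty by blast
  also have "\<dots> = r x x + 2 * t * r x y + t\<^sup>2 * r y y"
   using assms ty by (simp add: r_add r_add_right X_add r_scale r_scale_right r_sym[of y x] power2_eq_square algebra_simps)
  finally show ?thesis .
 qed
 have "(r x y)\<^sup>2 \<le> r x x * r y y"
 proof (cases "r y y = 0")
  case True
  have "0 \<le> r x x + t * (2 * r x y)" for t using q[of t] True by (simp add: algebra_simps)
  have "r x y = 0"
  proof (rule ccontr)
   assume n: "r x y \<noteq> 0"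
   \<comment> \<open>For null \<open>y\<close> the quadratic is affine in \<open>t\<close>; at this
     \<open>t\<close> its value is -1.\<close>
   have "0 \<le> r x x + 2 * (- (r x x + 1) / (2 * r x y)) * r x y" using q[of "- (r x x + 1) / (2 * r x y)"] True by simp
   also have "\<dots> = -1" using n by (simp add: field_simps)
   finally show False by simp
  qed
  then show ?thesis using True by simp
 next
  case False
  then have p: "r y y > 0" using r_ge0[OF assms(2)] by simp
  have "0 \<le> r x x + 2 * (- r x y / r y y) * r x y + (- r x y / r y y)\<^sup>2 * r y y" by (rule q)
  also have "\<dots> = r x x - (r x y)\<^sup>2 / r y y" using p by (simp add: field_simps power2_eq_square)
  finally show ?thesis using p by (simp add: field_simps)
 qed
 also have "\<dots> = (nrm x * nrm y)\<^sup>2" using assms by (simp add: nrm_sq power_mult_distrib)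
 finally show ?thesis using nrm_ge0 assms by (simp add: abs_le_square_iff[symmetric] abs_mult)
qed

lemma nrm_triangle:
 assumes "x \<in> X" "y \<in> X"
 shows "nrm (x + y) \<le> nrm x + nrm y"
proof (rule power2_le_imp_le)
 have "(nrm (x + y))\<^sup>2 = (nrm x)\<^sup>2 + 2 * r x y + (nrm y)\<^sup>2"
  using assms by (simp add: nrm_sq X_add r_add r_add_right r_sym[of y x])
 also have "\<dots> \<le> (nrm x + nrm y)\<^sup>2" using r_bound[OF assms] by (simp add: power2_sum)
 finally show "(nrm (x + y))\<^sup>2 \<le> (nrm x + nrm y)\<^sup>2" .
qed (simp add: assms nrm_ge0)

end

locale semi_hilbert = semi_inner X r for X :: "'a::complex_vector set" and r :: "'a => 'a => real" +
 assumes complete: "!!f. [|!!n. f n \<in> X; !!e. e > 0 ==> \<exists>M. \<forall>m\<ge>M. \<forall>n\<ge>M. sqrt (r (f m - f n) (f m - f n)) < e|]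
    ==> \<exists>l\<in>X. (\<lambda>n. sqrt (r (f n - l) (f n - l))) \<longlonglongrightarrow> 0"
begin

text \<open>\<open>x\<close> is sent to its pairing with the unit ball, extended by 0. On the
  discrete copy of the type every bounded function is continuous, so the target is a Banach type
  without any topology on \<open>'a\<close>; representatives of one element have the same
  image.\<close>

definition E :: "'a => ('a discrete \<Rightarrow>\<^sub>C real)" where
 "E x = Bcontfun (\<lambda>d. if of_discrete d \<in> X \<and> nrm (of_discrete d) \<le> 1 then r x (of_discrete d) else 0)"

lemma E_apply:
 assumes x: "x \<in> X"
 shows "apply_bcontfun (E x) (discrete y) = (if y \<in> X \<and> nrm y \<le> 1 then r x y else 0)"
proof -
 have "(\<lambda>d. if of_discrete d \<in> X \<and> nrm (of_discrete d) \<le> 1 then r x (of_discrete d) else 0) \<in> bcontfun"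
 proof (rule bcontfun_normI)
  show "continuous_on UNIV (\<lambda>d. if of_discrete d \<in> X \<and> nrm (of_discrete d) \<le> 1 then r x (of_discrete d) else 0)"
   by (simp add: continuous_on_open_vimage open_discrete)
  show "norm (if of_discrete d \<in> X \<and> nrm (of_discrete d) \<le> 1 then r x (of_discrete d) else 0) \<le> nrm x" for d
  proof -
   have "\<bar>r x z\<bar> \<le> nrm x" if "z \<in> X" "nrm z \<le> 1" for z
    using r_bound[OF x that(1)] mult_left_mono[OF that(2) nrm_ge0[OF x]] by simp
   then show ?thesis using nrm_ge0[OF x] by auto
  qed
 qed
 then show ?thesis by (simp add: E_def Bcontfun_inverse discrete_inverse)
qed

lemma E_eqI:
 fixes f g :: "'a discrete \<Rightarrow>\<^sub>C real"
 assumes "!!y. apply_bcontfun f (discrete y) = apply_bcontfun g (discrete y)"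
 shows "f = g"
proof (rule bcontfun_eqI)
 fix d :: "'a discrete"
 have "d = discrete (of_discrete d)" by (simp add: of_discrete_inverse)
 then show "apply_bcontfun f d = apply_bcontfun g d" using assms by metis
qed

lemma E_add: "[|x \<in> X; y \<in> X|] ==> E (x + y) = E x + E y" by (rule E_eqI) (auto simp: E_apply X_add r_add)

lemma E_scale: "x \<in> X ==> E (complex_of_real c *\<^sub>C x) = c *\<^sub>R E x"
 by (rule E_eqI) (auto simp: E_apply X_scale r_scale)

lemma E_diff: "[|x \<in> X; y \<in> X|] ==> E (x - y) = E x - E y"
 by (rule E_eqI) (auto simp: E_apply X_diff r_diff)

lemma E_zero: "E 0 = 0" using E_scale[OF X_zero, of 0] by simp

text \<open>Cauchy-Schwarz gives one inequality, and the supremum is attained at \<open>x\<close>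
  divided by its norm.\<close>

lemma norm_E:
 assumes x: "x \<in> X"
 shows "norm (E x) = nrm x"
proof (rule antisym)
 show "norm (E x) \<le> nrm x"
 proof (rule norm_bound)
  fix d :: "'a discrete"
  have d: "d = discrete (of_discrete d)" by (simp add: of_discrete_inverse)
  have "\<bar>r x z\<bar> \<le> nrm x" if "z \<in> X" "nrm z \<le> 1" for z
   using r_bound[OF x that(1)] mult_left_mono[OF that(2) nrm_ge0[OF x]] by simp
  then show "norm (apply_bcontfun (E x) d) \<le> nrm x" by (subst d) (auto simp: E_apply[OF x] nrm_ge0[OF x])
 qed
 show "nrm x \<le> norm (E x)"
 proof (cases "nrm x = 0")
  case False
  then have p: "nrm x > 0" using nrm_ge0[OF x] by simp
  let ?y = "complex_of_real (1 / nrm x) *\<^sub>C x"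
  have y: "?y \<in> X" using X_scale x by blast
  have "r ?y ?y = (1 / nrm x) * ((1 / nrm x) * r x x)" using r_scale[OF x y] r_scale_right[OF x x] by metis
  also have "\<dots> = (1 / nrm x) * ((1 / nrm x) * (nrm x)\<^sup>2)" using nrm_sq[OF x] by simp
  also have "\<dots> = 1" using p by (simp add: power2_eq_square)
  finally have "r ?y ?y = 1" .
  then have ny: "nrm ?y = 1" by (simp add: nrm_def)
  have "r x ?y = (1 / nrm x) * (nrm x)\<^sup>2" using r_scale_right[OF x x, of "1 / nrm x"] nrm_sq[OF x] by simp
  then have "r x ?y = nrm x" using p by (simp add: power2_eq_square)
  then have "apply_bcontfun (E x) (discrete ?y) = nrm x" using E_apply[OF x, of ?y] y ny by simp
  then show ?thesis using norm_bounded[of "E x" "discrete ?y"] by simp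
 qed simp
qed

lemma E_eq_iff: "[|x \<in> X; y \<in> X|] ==> E x = E y \<longleftrightarrow> nrm (x - y) = 0"
 using E_diff norm_E X_diff by (metis eq_iff_diff_eq_0 norm_eq_zero)

abbreviation Y :: "('a discrete \<Rightarrow>\<^sub>C real) set" where "Y \<equiv> E ` X"

definition e :: "('a discrete \<Rightarrow>\<^sub>C real) => 'a" where "e = inv_into X E"

lemma e_X: "y \<in> Y ==> e y \<in> X" and E_e: "y \<in> Y ==> E (e y) = y"
 by (auto simp: e_def inv_into_into f_inv_into_f)

lemma r_cong:
 assumes "x \<in> X" "x' \<in> X" "z \<in> X" "E x = E x'"
 shows "r x z = r x' z"
proof -
 have "\<bar>r (x - x') z\<bar> \<le> 0" using r_bound[of "x - x'" z] E_eq_iff assms X_diff by simp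
 then show ?thesis using assms r_diff by simp
qed

definition rr where "rr y z = r (e y) (e z)"

lemma rr_E:
 assumes "x \<in> X" "z \<in> X"
 shows "rr (E x) (E z) = r x z"
proof -
 have *: "e (E x) \<in> X" "e (E z) \<in> X" "E (e (E x)) = E x" "E (e (E z)) = E z" using e_X E_e assms by auto
 have "rr (E x) (E z) = r x (e (E z))" unfolding rr_def by (rule r_cong) (use * assms in auto)
 also have "\<dots> = r (e (E z)) x" using r_sym * assms by blast
 also have "\<dots> = r z x" by (rule r_cong) (use * assms in auto)
 finally show ?thesis using r_sym assms by simp
qed

text \<open>Completeness of the space of representatives appears here as closedness of its
  image.\<close>

sublocale hilbert_subspace Y rr
proof
 show "subspace Y"
 proof (rule subspaceI)
  show "0 \<in> Y" using E_zero X_zero by (metis imageI)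
  show "x + y \<in> Y" if "x \<in> Y" "y \<in> Y" for x y
  proof -
   obtain a b where "a \<in> X" "b \<in> X" "x = E a" "y = E b" using \<open>x \<in> Y\<close> \<open>y \<in> Y\<close> by blast
   then show ?thesis using E_add[of a b] X_add[of a b] by (metis imageI)
  qed
  show "c *\<^sub>R x \<in> Y" if "x \<in> Y" for x c
  proof -
   obtain a where a: "a \<in> X" "x = E a" using \<open>x \<in> Y\<close> by blast
   then show ?thesis using E_scale[OF a(1), of c] X_scale[OF a(1), of "complex_of_real c"] by (metis imageI)
  qed
 qed
 show "closed Y" unfolding closed_sequential_limits
 proof (intro allI impI, elim conjE)
  fix f l assume fY: "\<forall>n. f n \<in> Y" and lim: "f \<longlonglongrightarrow> l"
  define x where "x = (\<lambda>n. e (f n))"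
  have x: "x n \<in> X" "f n = E (x n)" for n using e_X[of "f n"] E_e[of "f n"] fY by (simp_all add: x_def)
  have n: "sqrt (r (x m - x n) (x m - x n)) = norm (f m - f n)" for m n
   using x(1)[of m] x(1)[of n] x(2)[of m] x(2)[of n] E_diff[of "x m" "x n"] norm_E[OF X_diff, of "x m" "x n"]
   by (simp add: nrm_def)
  have "Cauchy f" using lim by (rule LIMSEQ_imp_Cauchy)
  then have "\<exists>M. \<forall>m\<ge>M. \<forall>n\<ge>M. sqrt (r (x m - x n) (x m - x n)) < ee" if "ee > 0" for ee
   unfolding n using that by (rule CauchyD)
  then obtain z where z: "z \<in> X" "(\<lambda>n. sqrt (r (x n - z) (x n - z))) \<longlonglongrightarrow> 0"
   using complete[of x, OF x(1)] by blast
  have n': "sqrt (r (x n - z) (x n - z)) = norm (f n - E z)" for n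
   using x(1)[of n] x(2)[of n] z(1) E_diff[of "x n" z] norm_E[OF X_diff, of "x n" z] by (simp add: nrm_def)
  have "f \<longlonglongrightarrow> E z" using z(2) unfolding n' tendsto_norm_zero_iff LIM_zero_iff .
  then have "l = E z" using lim by (rule LIMSEQ_unique[rotated])
  then show "l \<in> Y" using z(1) by simp
 qed
 fix x y z assume "x \<in> Y" "y \<in> Y" "z \<in> Y"
 then obtain a b c where *: "a \<in> X" "b \<in> X" "c \<in> X" and "x = E a" "y = E b" "z = E c" by blast
 moreover have "x + y = E (a + b)" using calculation E_add by simp
 ultimately show "rr (x + y) z = rr x z + rr y z"
  using rr_E[OF X_add[OF *(1,2)] *(3)] r_add[OF *] rr_E[OF *(1,3)] rr_E[OF *(2,3)] by simp
next
 fix x z :: "'a discrete \<Rightarrow>\<^sub>C real" and c :: real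
 assume "x \<in> Y" "z \<in> Y"
 then obtain a b where *: "a \<in> X" "b \<in> X" and "x = E a" "z = E b" by blast
 moreover have "c *\<^sub>R x = E (complex_of_real c *\<^sub>C a)" using calculation E_scale by simp
 ultimately show "rr (c *\<^sub>R x) z = c * rr x z" "rr x z = rr z x"
  using rr_E[OF X_scale[OF *(1)] *(2)] r_scale[OF *] r_sym[OF *] rr_E[OF *] rr_E[OF *(2,1)] by simp_all
next
 fix x assume "x \<in> Y"
 then show "rr x x = (norm x)\<^sup>2" by (auto simp: rr_E norm_E nrm_sq)
qed

theorem riesz:
 assumes V: "V \<subseteq> X" "0 \<in> V" "!!x y. [|x \<in> V; y \<in> V|] ==> x + y \<in> V"
  "!!x c. x \<in> V ==> complex_of_real c *\<^sub>C x \<in> V"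
  and l_add: "!!x y. [|x \<in> V; y \<in> V|] ==> l (x + y) = l x + l y"
  and l_scale: "!!x c. x \<in> V ==> l (complex_of_real c *\<^sub>C x) = c * l x"
  and l_bound: "!!x. x \<in> V ==> \<bar>l x\<bar> \<le> C * nrm x"
 obtains w where "w \<in> X" "!!x. x \<in> V ==> r x w = l x" "!!d. d > 0 ==> \<exists>v\<in>V. nrm (w - v) < d"
proof -
 have VX: "x \<in> X" if "x \<in> V" for x using V that by blast
 define e' where "e' = inv_into V E"
 have e': "e' (E x) \<in> V" "E (e' (E x)) = E x" if "x \<in> V" for x
  using that by (auto simp: e'_def inv_into_into f_inv_into_f)
 have l_diff: "l (x - y) = l x - l y" "x - y \<in> V" if "x \<in> V" "y \<in> V" for x y
  using l_add[of x "-y"] l_scale[of y "-1"] V(3)[of x "-y"] V(4)[of y "-1"] that by (auto simp: scaleC_minus1)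
 \<comment> \<open>The functional depends on the class only: its bound makes it vanish on null
   differences.\<close>
 have l_e: "l (e' (E x)) = l x" if "x \<in> V" for x
 proof -
  note * = e'[OF that]
  have "nrm (e' (E x) - x) = 0" using E_eq_iff[OF VX[OF *(1)] VX[OF that]] *(2) by simp
  then have "\<bar>l (e' (E x) - x)\<bar> \<le> C * 0" using l_bound[OF l_diff(2)[OF *(1) that]] by simp
  then show ?thesis using l_diff(1)[OF *(1) that] by simp
 qed
 obtain w where w: "w \<in> closure (E ` V)" "!!z. z \<in> E ` V ==> rr z w = l (e' z)"
 proof (rule riesz_representation[of "E ` V" "\<lambda>z. l (e' z)" C])
  show "E ` V \<subseteq> Y" using V by blast
  show "subspace (E ` V)"
  proof (rule subspaceI)
   show "0 \<in> E ` V" using E_zero V(2) by (metis imageI)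
   show "x + y \<in> E ` V" if "x \<in> E ` V" "y \<in> E ` V" for x y
   proof -
    obtain a b where "a \<in> V" "b \<in> V" "x = E a" "y = E b" using \<open>x \<in> E ` V\<close> \<open>y \<in> E ` V\<close> by blast
    then show ?thesis using E_add[OF VX VX, of a b] V(3)[of a b] by (metis imageI)
   qed
   show "c *\<^sub>R x \<in> E ` V" if "x \<in> E ` V" for x c
   proof -
    obtain a where a: "a \<in> V" "x = E a" using \<open>x \<in> E ` V\<close> by blast
    then show ?thesis using E_scale[OF VX[OF a(1)], of c] V(4)[OF a(1), of c] by (metis imageI)
   qed
  qed
 next
  fix x y assume "x \<in> E ` V" "y \<in> E ` V"
  then obtain a b where *: "a \<in> V" "b \<in> V" "x = E a" "y = E b" by blast
  then have "x + y = E (a + b)" using E_add VX by simp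
  then show "l (e' (x + y)) = l (e' x) + l (e' y)"
   using l_e[OF V(3)[OF *(1,2)]] l_e[OF *(1)] l_e[OF *(2)] l_add[OF *(1,2)] *(3,4) by simp
 next
  fix x c assume "x \<in> E ` V"
  then obtain a where *: "a \<in> V" "x = E a" by blast
  then have "c *\<^sub>R x = E (complex_of_real c *\<^sub>C a)" using E_scale VX by simp
  then show "l (e' (c *\<^sub>R x)) = c * l (e' x)"
   using l_e[OF V(4)[OF *(1), of c]] l_e[OF *(1)] l_scale[OF *(1), of c] *(2) by simp
 next
  fix x assume "x \<in> E ` V"
  then obtain a where *: "a \<in> V" "x = E a" by blast
  then show "\<bar>l (e' x)\<bar> \<le> C * norm x" using l_e[OF *(1)] norm_E[OF VX[OF *(1)]] l_bound[OF *(1)] by simp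
 qed blast
 have "closure (E ` V) \<subseteq> Y" using V(1) Y_closed by (intro closure_minimal) auto
 then obtain w' where w': "w' \<in> X" "w = E w'" using w(1) by blast
 show ?thesis
 proof (rule that[OF w'(1)])
  show "r x w' = l x" if "x \<in> V" for x
   using w(2)[of "E x"] that rr_E[OF VX[OF that] w'(1)] l_e[OF that] w'(2) by simp
  fix d :: real assume "d > 0"
  then obtain v where v: "v \<in> V" "dist (E v) w < d" using w(1) unfolding closure_approachable by blast
  then have "nrm (w' - v) < d" using E_diff[OF w'(1) VX[OF v(1)]] norm_E[OF X_diff[OF w'(1) VX[OF v(1)]]] w'(2)
   by (simp add: dist_norm norm_minus_commute)
  then show "\<exists>v\<in>V. nrm (w' - v) < d" using v(1) by blast
 qed
qed

end

text \<open>Linearity and surjectivity are required modulo \<open>N\<close> only.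
  \<open>D_closed_null\<close> states that the domain is a union of classes and that the operator
  respects them, so that both descend to the image of \<open>E\<close>.\<close>

locale generating = semi_hilbert X r
 for X :: "'a::complex_vector set" and r :: "'a => 'a => real" +
 fixes D :: "'a set" and A :: "'a => 'a" and N :: "'a => real"
 assumes N_eq: "x \<in> X ==> N x = sqrt (r x x)"
  and r_i: "[|x \<in> X; y \<in> X|] ==> r (\<i> *\<^sub>C x) (\<i> *\<^sub>C y) = r x y"
  and D_X: "D \<subseteq> X" and D_zero: "0 \<in> D" and D_add: "[|x \<in> D; y \<in> D|] ==> x + y \<in> D"
  and D_scale: "!!x c. x \<in> D ==> c *\<^sub>C x \<in> D"
  and A_X: "x \<in> D ==> A x \<in> X"
  and A_add: "[|x \<in> D; y \<in> D|] ==> N (A (x + y) - (A x + A y)) = 0"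
  and A_scale: "!!x c. x \<in> D ==> N (A (c *\<^sub>C x) - c *\<^sub>C A x) = 0"
  and A_diss: "x \<in> D ==> r (A x) x \<le> 0"
  and A_onto: "y \<in> X ==> \<exists>x\<in>D. N (A x - y) = 0"
  and D_closed_null: "[|x \<in> X; y \<in> D; N (x - y) = 0|] ==> x \<in> D \<and> N (A x - A y) = 0"
begin

section \<open>Transfer of the semigroup and of the solution concepts to representatives\<close>

lemma DX: "x \<in> D ==> x \<in> X" using D_X by blast

lemma N_E: "x \<in> X ==> N x = norm (E x)" using N_eq norm_E by (simp add: nrm_def)

lemma N_diff: "[|x \<in> X; y \<in> X|] ==> N (x - y) = norm (E x - E y)" using N_E[OF X_diff] E_diff by simp

lemma N_diff_0: "[|x \<in> X; y \<in> X|] ==> N (x - y) = 0 \<longleftrightarrow> E x = E y" by (simp add: N_diff)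

definition A' where "A' y = E (A (inv_into D E y))"

abbreviation D' where "D' \<equiv> E ` D"

lemma A'_E:
 assumes "x \<in> D"
 shows "A' (E x) = E (A x)"
proof -
 let ?x = "inv_into D E (E x)"
 have "?x \<in> D" "E ?x = E x" using assms by (auto simp: inv_into_into f_inv_into_f)
 then have "N (A ?x - A x) = 0" using D_closed_null[of ?x x] assms DX N_diff_0 by simp
 then show ?thesis using \<open>?x \<in> D\<close> assms A_X N_diff_0 by (simp add: A'_def)
qed

lemma E_D_iff: "x \<in> X ==> E x \<in> D' \<longleftrightarrow> x \<in> D"
proof
 assume x: "x \<in> X" and "E x \<in> D'"
 then obtain y where y: "y \<in> D" "E x = E y" by blast
 then have "N (x - y) = 0" using N_diff_0[OF x DX[OF y(1)]] by simp
 then show "x \<in> D" using D_closed_null[OF x y(1)] by blast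
qed simp

lemma A'_add: "[|x \<in> D; y \<in> D|] ==> E (A (x + y)) = E (A x) + E (A y)"
 using A_add[of x y] N_diff_0[of "A (x + y)" "A x + A y"] A_X D_add X_add E_add by simp

lemma A'_scale: "x \<in> D ==> E (A (c *\<^sub>C x)) = E (c *\<^sub>C A x)"
 using A_scale[of x c] N_diff_0[of "A (c *\<^sub>C x)" "c *\<^sub>C A x"] A_X D_scale X_scale by simp

sublocale sd: surjective_dissipative Y rr D' A'
proof
 show "subspace D'"
 proof (rule subspaceI)
  show "0 \<in> D'" using D_zero E_zero by (metis imageI)
  show "x + y \<in> D'" if "x \<in> D'" "y \<in> D'" for x y
  proof -
   obtain a b where "a \<in> D" "b \<in> D" "x = E a" "y = E b" using \<open>x \<in> D'\<close> \<open>y \<in> D'\<close> by blast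
   then show ?thesis using E_add[OF DX DX, of a b] D_add[of a b] by (metis imageI)
  qed
  show "c *\<^sub>R x \<in> D'" if "x \<in> D'" for x c
  proof -
   obtain a where a: "a \<in> D" "x = E a" using \<open>x \<in> D'\<close> by blast
   then show ?thesis
    using E_scale[OF DX[OF a(1)], of c] D_scale[OF a(1), of "complex_of_real c"] by (metis imageI)
  qed
 qed
 show "D' \<subseteq> Y" using D_X by blast
 show "A' x \<in> Y" if "x \<in> D'" for x using that A_X by (auto simp: A'_E)
 show "A' (x + y) = A' x + A' y" if "x \<in> D'" "y \<in> D'" for x y
 proof -
  obtain a b where *: "a \<in> D" "b \<in> D" "x = E a" "y = E b" using \<open>x \<in> D'\<close> \<open>y \<in> D'\<close> by blast
  then have "x + y = E (a + b)" using E_add DX by simp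
  then show ?thesis using A'_E[OF D_add[OF *(1,2)]] A'_E[OF *(1)] A'_E[OF *(2)] A'_add[OF *(1,2)] *(3,4) by simp
 qed
 show "A' (c *\<^sub>R x) = c *\<^sub>R A' x" if "x \<in> D'" for x c
 proof -
  obtain x' where x': "x' \<in> D" "x = E x'" using \<open>x \<in> D'\<close> by blast
  have "c *\<^sub>R x = E (complex_of_real c *\<^sub>C x')" using x' by (simp add: E_scale DX)
  then show ?thesis using x' by (simp add: A'_E D_scale A'_scale E_scale A_X)
 qed
 show "rr (A' x) x \<le> 0" if "x \<in> D'" for x using that by (auto simp: A'_E rr_E A_X DX A_diss)
 show "\<exists>x\<in>D'. A' x = y" if "y \<in> Y" for y
 proof -
  obtain y' where y': "y' \<in> X" "y = E y'" using \<open>y \<in> Y\<close> by blast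
  obtain x where "x \<in> D" "N (A x - y') = 0" using A_onto[OF y'(1)] by blast
  then show ?thesis using y' N_diff_0[of "A x" y'] A_X A'_E by auto
 qed
qed

sublocale md: m_dissipative Y D' A'
proof
 show "\<exists>x\<in>D'. x - h *\<^sub>R A' x = y" if "y \<in> Y" "h > 0" for y h
  using sd.range_at_all[OF that(2)] that(1) unfolding sd.range_at_def by blast
qed (use Y_sub Y_closed sd.D_sub sd.D_Y sd.A_Y sd.A_add sd.A_scale sd.norm_le_resolvent sd.D_dense in auto)

definition K where "K y = E (\<i> *\<^sub>C e y)"

lemma norm_E_i: "x \<in> X ==> norm (E (\<i> *\<^sub>C x)) = norm (E x)" by (simp add: norm_E X_scale nrm_def r_i)

lemma K_E:
 assumes "x \<in> X"
 shows "K (E x) = E (\<i> *\<^sub>C x)"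
proof -
 have *: "e (E x) \<in> X" "E (e (E x)) = E x" using e_X E_e assms by auto
 have "norm (E (\<i> *\<^sub>C (e (E x) - x))) = norm (E (e (E x) - x))" using * assms by (intro norm_E_i X_diff)
 also have "\<dots> = 0" using * assms by (simp add: E_diff)
 finally show ?thesis using * assms by (simp add: K_def scaleC_diff_right E_diff X_scale)
qed

text \<open>The semigroup is constructed over the reals. Multiplication by \<open>\<i>\<close>
  commutes with the resolvents because the operator is complex linear modulo null elements, hence it
  commutes with the limit of the Euler products.\<close>

lemma cop_K: "md.cop K" unfolding md.cop_def
proof (intro conjI ballI allI impI)
 fix y assume "y \<in> Y"
 then obtain y' where y: "y' \<in> X" "y = E y'" by blast
 show "K y \<in> Y" "norm (K y) \<le> norm y" using y by (auto simp: K_E X_scale norm_E_i)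
 show "K (y + z) = K y + K z" if "z \<in> Y" for z
 proof -
  obtain z' where "z' \<in> X" "z = E z'" using \<open>z \<in> Y\<close> by blast
  then show ?thesis using y K_E[OF X_add, of y' z'] by (simp add: K_E scaleC_add_right X_scale E_add)
 qed
 show "K (c *\<^sub>R y) = c *\<^sub>R K y" for c
 proof -
  have "\<i> *\<^sub>C complex_of_real c *\<^sub>C y' = complex_of_real c *\<^sub>C \<i> *\<^sub>C y'"
   by (simp add: scaleC_scaleC mult.commute)
  then have "E (\<i> *\<^sub>C complex_of_real c *\<^sub>C y') = c *\<^sub>R E (\<i> *\<^sub>C y')"
   using E_scale[OF X_scale[OF y(1)], of c "\<i>"] by simp
  then show ?thesis using K_E[OF X_scale[OF y(1)], of "complex_of_real c"] K_E[OF y(1)] E_scale[OF y(1), of c] y by simp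
 qed
 show "K (md.J h y) = md.J h (K y)" if h: "h \<ge> 0" for h
 proof (cases "h = 0")
  case False
  then have h: "h > 0" using h by simp
  have J: "md.J h y \<in> D'" "md.J h y - h *\<^sub>R A' (md.J h y) = y" using md.J_resolvent[of y h] y h by auto
  then obtain x where x: "x \<in> D" "md.J h y = E x" by blast
  have Kx: "K (E x) = E (\<i> *\<^sub>C x)" "\<i> *\<^sub>C x \<in> D" using x DX D_scale K_E by auto
  have "A' (K (E x)) = K (A' (E x))" using Kx x by (simp add: A'_E A'_scale K_E A_X)
  have "K (E x) - h *\<^sub>R A' (K (E x)) = K y"
  proof -
   have xh: "x - complex_of_real h *\<^sub>C A x \<in> X" using x by (intro X_diff X_scale DX A_X)
   have "y = E (x - complex_of_real h *\<^sub>C A x)"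
    using J(2) x by (simp add: A'_E E_diff E_scale DX A_X X_scale)
   then have "K y = E (\<i> *\<^sub>C (x - complex_of_real h *\<^sub>C A x))" using K_E[OF xh] by simp
   also have "\<dots> = E (\<i> *\<^sub>C x) - E (complex_of_real h *\<^sub>C \<i> *\<^sub>C A x)"
    using x by (simp add: scaleC_diff_right E_diff X_scale DX A_X scaleC_scaleC mult.commute)
   also have "\<dots> = K (E x) - h *\<^sub>R A' (K (E x))"
    using x Kx by (simp add: E_scale X_scale A_X A'_E A'_scale)
   finally show ?thesis by simp
  qed
  then show ?thesis using x Kx h by (intro md.J_eqI[symmetric]) auto
 qed (simp add: md.J_0)
qed

definition T :: "real => 'a => 'a" where "T t x = e (md.T t (E x))"

lemma T_X: "[|t \<ge> 0; x \<in> X|] ==> T t x \<in> X" by (simp add: T_def e_X md.T_Y)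

lemma E_T: "[|t \<ge> 0; x \<in> X|] ==> E (T t x) = md.T t (E x)" by (simp add: T_def E_e md.T_Y)

lemma E_scaleC: "x \<in> X ==> E (c *\<^sub>C x) = Re c *\<^sub>R E x + Im c *\<^sub>R K (E x)"
proof -
 assume x: "x \<in> X"
 have "c *\<^sub>C x = complex_of_real (Re c) *\<^sub>C x + complex_of_real (Im c) *\<^sub>C \<i> *\<^sub>C x"
  by (simp add: scaleC_scaleC mult.commute flip: scaleC_add_left complex_eq)
 then show ?thesis using x by (simp add: E_add E_scale X_scale K_E)
qed

lemma T_scaleC:
 assumes "t \<ge> 0" "x \<in> X"
 shows "E (T t (c *\<^sub>C x)) = E (c *\<^sub>C T t x)"
proof -
 have x: "E x \<in> Y" "K (E x) \<in> Y" using assms md.copD(1)[OF cop_K] by auto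
 have "E (T t (c *\<^sub>C x)) = md.T t (Re c *\<^sub>R E x + Im c *\<^sub>R K (E x))"
  using assms by (simp add: E_T X_scale E_scaleC)
 also have "\<dots> = Re c *\<^sub>R md.T t (E x) + Im c *\<^sub>R K (md.T t (E x))"
  using x assms by (simp add: md.T_add md.T_scale md.Y_scale md.T_commute[OF cop_K])
 also have "\<dots> = E (c *\<^sub>C T t x)" using assms by (simp add: E_scaleC T_X E_T)
 finally show ?thesis .
qed

lemma T_add: "[|t \<ge> 0; x \<in> X; y \<in> X|] ==> E (T t (x + y)) = E (T t x + T t y)"
 by (simp add: E_T X_add E_add T_X md.T_add)

lemma tends_in_iff:
 assumes "l \<in> X" "\<forall>\<^sub>F t in F. f t \<in> X"
 shows "tends_in N f l F \<longleftrightarrow> ((\<lambda>t. E (f t)) \<longlongrightarrow> E l) F"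
proof -
 have "\<forall>\<^sub>F t in F. N (f t - l) = norm (E (f t) - E l)"
  using assms(2) by eventually_elim (simp add: N_diff assms(1))
 then have "tends_in N f l F \<longleftrightarrow> ((\<lambda>t. norm (E (f t) - E l)) \<longlongrightarrow> 0) F"
  unfolding tends_in_def by (intro filterlim_cong) auto
 then show ?thesis by (simp add: tendsto_norm_zero_iff LIM_zero_iff)
qed

lemma cont_on_in_iff:
 assumes "!!t. t \<in> S ==> U t \<in> X"
 shows "cont_on_in N S U \<longleftrightarrow> continuous_on S (\<lambda>t. E (U t))"
 unfolding cont_on_in_def continuous_on_def using assms
 by (intro ball_cong refl tends_in_iff) (auto simp: eventually_at_filter)

lemma has_deriv_in_iff:
 assumes "U' \<in> X" "U t \<in> X" "\<forall>\<^sub>F s in at t within S. U s \<in> X"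
 shows "has_deriv_in N U U' t S \<longleftrightarrow> ((\<lambda>t. E (U t)) has_vector_derivative E U') (at t within S)"
proof -
 have "has_deriv_in N U U' t S \<longleftrightarrow>
   ((\<lambda>s. E (complex_of_real (1 / (s - t)) *\<^sub>C (U s - U t))) \<longlongrightarrow> E U') (at t within S)"
  unfolding has_deriv_in_def
  by (rule tends_in_iff[OF assms(1)], use assms(3) in eventually_elim) (intro X_scale X_diff assms(2))
 also have "\<dots> \<longleftrightarrow> ((\<lambda>s. (1 / (s - t)) *\<^sub>R (E (U s) - E (U t))) \<longlongrightarrow> E U') (at t within S)"
 proof (rule filterlim_cong)
  show "\<forall>\<^sub>F s in at t within S. E (complex_of_real (1 / (s - t)) *\<^sub>C (U s - U t)) = (1 / (s - t)) *\<^sub>R (E (U s) - E (U t))"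
   using assms(3) by eventually_elim (simp only: E_scale E_diff X_diff assms(2))
 qed auto
 finally show ?thesis by (simp only: has_vector_derivative_iff_quotient)
qed

lemma E_sum:
 assumes "finite p" "!!i. i \<in> p ==> f i \<in> X"
 shows "(\<Sum>i\<in>p. f i) \<in> X \<and> E (\<Sum>i\<in>p. f i) = (\<Sum>i\<in>p. E (f i))"
 using assms by (induction p rule: finite_induct) (auto simp: X_zero E_zero X_add E_add)

lemma has_integral_in_iff:
 assumes "I \<in> X" "!!t. t \<in> {a..b} ==> U t \<in> X"
 shows "has_integral_in N U I a b \<longleftrightarrow> ((\<lambda>t. E (U t)) has_integral E I) {a..b}"
proof -
 have "N ((\<Sum>(x, k)\<in>p. complex_of_real (measure lborel k) *\<^sub>C U x) - I) =
   norm ((\<Sum>(x, k)\<in>p. measure lborel k *\<^sub>R E (U x)) - E I)" if p: "p tagged_division_of {a..b}" for p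
 proof -
  have fin: "finite p" and tag: "!!x k. (x, k) \<in> p ==> U x \<in> X"
   using tagged_division_ofD(1,2,3)[OF p] assms(2) by blast+
  let ?f = "\<lambda>(x, k). complex_of_real (measure lborel k) *\<^sub>C U x"
  have s: "sum ?f p \<in> X \<and> E (sum ?f p) = (\<Sum>i\<in>p. E (?f i))"
   by (rule E_sum[OF fin]) (use tag X_scale in auto)
  have "(\<Sum>i\<in>p. E (?f i)) = (\<Sum>(x, k)\<in>p. measure lborel k *\<^sub>R E (U x))"
   by (rule sum.cong[OF refl]) (use tag E_scale in auto)
  then show ?thesis using s assms(1) by (simp add: N_diff)
 qed
 then show ?thesis unfolding has_integral_in_def has_integral_real by (metis (no_types, lifting))
qed

lemma orbit_cont:
 assumes "U0 \<in> X"
 shows "continuous_on {0..} (\<lambda>t. E (T t U0))"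
proof -
 have "continuous_on {0..} (\<lambda>t. md.T t (E U0))" using assms by (intro md.T_cont) auto
 then show ?thesis by (rule continuous_on_eq) (use assms E_T in auto)
qed

lemma orbit_mild:
 assumes "U0 \<in> X"
 shows "mild_solution X N D A U0 (\<lambda>t. T t U0)" unfolding mild_solution_def
proof (intro conjI allI impI)
 show "T t U0 \<in> X" if "t \<ge> 0" for t using T_X that assms by simp
 show "cont_on_in N {0..} (\<lambda>t. T t U0)"
  using orbit_cont[OF assms] by (subst cont_on_in_iff) (use assms T_X in auto)
 fix t :: real assume t: "t \<ge> 0"
 obtain z where z: "z \<in> D'" "A' z = E U0" using sd.A_onto assms by blast
 note m = md.mild_exists[OF z(1) t]
 obtain I where I: "I \<in> D" "E I = md.T t z - z" using m(2) by auto
 have "((\<lambda>s. E (T s U0)) has_integral E I) {0..t}"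
  using m(1) unfolding I(2) by (rule has_integral_eq[rotated]) (use assms E_T z in auto)
 then have "has_integral_in N (\<lambda>t. T t U0) I 0 t" using I DX T_X assms by (subst has_integral_in_iff) auto
 moreover have "E (T t U0) = E (U0 + A I)" using m(3) z I assms t by (simp add: E_T E_add A_X flip: A'_E)
 then have "N (T t U0 - (U0 + A I)) = 0" using I assms t by (subst N_diff_0) (auto simp: T_X X_add A_X)
 ultimately show "\<exists>I\<in>D. has_integral_in N (\<lambda>t. T t U0) I 0 t \<and> N (T t U0 - (U0 + A I)) = 0"
  using I(1) by blast
qed

lemma mild_solution_unique:
 assumes "U0 \<in> X" and V: "mild_solution X N D A U0 V" and t: "t \<ge> 0"
 shows "N (V t - T t U0) = 0"
proof -
 have VX: "V t \<in> X" if "t \<ge> 0" for t using V that by (auto simp: mild_solution_def)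
 obtain z where z: "z \<in> D'" "A' z = E U0" using sd.A_onto assms by blast
 have "E (V t) = md.T t (A' z)"
 proof (rule md.mild_unique[OF z(1) _ _ t])
  show "continuous_on {0..} (\<lambda>t. E (V t))"
   using V VX cont_on_in_iff[of "{0..}" V] by (simp add: mild_solution_def)
  fix t :: real assume t: "t \<ge> 0"
  obtain I where I: "I \<in> D" "has_integral_in N V I 0 t" "N (V t - (U0 + A I)) = 0"
   using V t unfolding mild_solution_def by blast
  have "((\<lambda>t. E (V t)) has_integral E I) {0..t}" using I DX VX by (subst (asm) has_integral_in_iff) auto
  moreover have "E (V t) = A' z + A' (E I)" using I(3) z(2) N_diff_0[of "V t" "U0 + A I"] VX[OF t] assms(1) I(1)
   by (simp add: X_add A_X E_add A'_E)
  ultimately show "\<exists>I\<in>D'. ((\<lambda>t. E (V t)) has_integral I) {0..t} \<and> E (V t) = A' z + A' I"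
   using I(1) by blast
 qed
 then show ?thesis using z t assms VX by (simp add: N_diff_0 T_X E_T)
qed

lemma T_D: "[|t \<ge> 0; x \<in> D|] ==> T t x \<in> D"
 using md.T_D[of t "E x"] E_D_iff[of "T t x"] T_X DX by (simp add: E_T)

lemma A_T: "[|t \<ge> 0; x \<in> D|] ==> E (A (T t x)) = E (T t (A x))"
 using md.A_T[of t "E x"] T_D[of t x] DX A_X by (simp add: E_T flip: A'_E)

text \<open>\<open>Z\<close> may be any representative of the derivative; it is taken as
  \<open>T t (A U0)\<close> for continuous differentiability and as \<open>A (T t U0)\<close> for
  the equation.\<close>

lemma orbit_deriv:
 assumes "U0 \<in> D" "t \<ge> 0" "S \<subseteq> {0..}" "E Z = E (T t (A U0))" "Z \<in> X"
 shows "has_deriv_in N (\<lambda>t. T t U0) Z t S"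
proof (subst has_deriv_in_iff)
 have "((\<lambda>t. md.T t (E U0)) has_vector_derivative md.T t (A' (E U0))) (at t within {0..})"
  using assms by (intro md.T_deriv) auto
 then have "((\<lambda>t. E (T t U0)) has_vector_derivative E Z) (at t within {0..})"
  using assms DX A_X by (intro has_vector_derivative_transform[of t "{0..}" "\<lambda>t. E (T t U0)" "\<lambda>t. md.T t (E U0)"])
   (auto simp: E_T A'_E)
 then show "((\<lambda>t. E (T t U0)) has_vector_derivative E Z) (at t within S)"
  by (rule has_vector_derivative_within_subset) (use assms in auto)
 show "\<forall>\<^sub>F s in at t within S. T s U0 \<in> X"
  unfolding eventually_at_filter using assms DX T_X by (intro always_eventually) auto
qed (use assms DX T_X in auto)

lemma orbit_C1:
 assumes "U0 \<in> D" "S \<subseteq> {0..}"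
 shows "C1_on_in X N S (\<lambda>t. T t U0)" unfolding C1_on_in_def
proof (intro exI conjI ballI)
 fix t assume "t \<in> S"
 then show "T t (A U0) \<in> X" "has_deriv_in N (\<lambda>t. T t U0) (T t (A U0)) t S"
  using assms T_X A_X by (auto intro!: orbit_deriv)
next
 have "continuous_on S (\<lambda>t. E (T t (A U0)))"
  using continuous_on_subset[OF orbit_cont[OF A_X[OF assms(1)]] assms(2)] .
 then show "cont_on_in N S (\<lambda>t. T t (A U0))" using T_X A_X assms by (subst cont_on_in_iff) auto
qed

lemma orbit_classical:
 assumes "U0 \<in> D"
 shows "classical_solution X N D A U0 (\<lambda>t. T t U0)" unfolding classical_solution_def
proof (intro conjI allI impI)
 show "T t U0 \<in> X" if "t \<ge> 0" for t using that assms DX T_X by simp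
 show "cont_on_in N {0..} (\<lambda>t. T t U0)" using orbit_mild[OF DX[OF assms]] by (simp add: mild_solution_def)
 show "C1_on_in X N {0<..} (\<lambda>t. T t U0)" using assms by (intro orbit_C1) auto
 show "N (T 0 U0 - U0) = 0" using assms DX T_X by (simp add: N_diff_0 E_T md.T_0)
 fix t :: real assume t: "t > 0"
 show "T t U0 \<in> D" using t assms T_D by simp
 have "has_deriv_in N (\<lambda>t. T t U0) (A (T t U0)) t {0<..}"
  using assms t A_T[of t U0] T_D A_X by (intro orbit_deriv) auto
 moreover have "at t within {0<..} = at t" by (rule at_within_open) (use t in auto)
 ultimately show "has_deriv_in N (\<lambda>t. T t U0) (A (T t U0)) t UNIV" unfolding has_deriv_in_def by simp
qed

lemma classical_solution_unique:
 assumes "U0 \<in> D" and V: "classical_solution X N D A U0 V" and t: "t \<ge> 0"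
 shows "N (V t - T t U0) = 0"
proof -
 have VX: "V t \<in> X" if "t \<ge> 0" for t using V that by (auto simp: classical_solution_def)
 have VD: "V t \<in> D" if "t > 0" for t using V that by (auto simp: classical_solution_def)
 have "E (V t) = md.T t (E (V 0))"
 proof (rule md.classical_unique[OF _ _ _ _ t])
  show "continuous_on {0..} (\<lambda>t. E (V t))"
   using V VX cont_on_in_iff[of "{0..}" V] by (simp add: classical_solution_def)
  show "E (V t) \<in> Y" if "t \<ge> 0" for t using VX that by simp
  fix t :: real assume t: "t > 0"
  show "E (V t) \<in> D'" using VD t by simp
  have "has_deriv_in N V (A (V t)) t UNIV" using V t by (simp add: classical_solution_def)
  moreover have "\<forall>\<^sub>F s in at t. V s \<in> X"
  proof -
   have "\<forall>\<^sub>F s in at t. s \<in> {0<..}" using t by (intro eventually_at_in_open') auto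
   then show ?thesis by eventually_elim (use VX in auto)
  qed
  ultimately show "((\<lambda>t. E (V t)) has_vector_derivative A' (E (V t))) (at t)"
   using has_deriv_in_iff[of "A (V t)" V t UNIV] A_X VD VX t by (simp add: A'_E)
 qed
 moreover have "E (V 0) = E U0" using V VX DX assms N_diff_0[of "V 0" U0] by (simp add: classical_solution_def)
 ultimately show ?thesis using t assms VX DX by (simp add: N_diff_0 T_X E_T)
qed

lemma orbit_graph_cont:
 assumes "U0 \<in> D"
 shows "cont_on_in (graph_norm N A) {0..} (\<lambda>t. T t U0)" unfolding cont_on_in_def tends_in_def
proof
 fix t :: real assume t: "t \<in> {0..}"
 have c: "((\<lambda>s. E (T s U)) \<longlongrightarrow> E (T t U)) (at t within {0..})" if "U \<in> X" for U
  using orbit_cont[OF that] t by (simp add: continuous_on_def)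
 have eq: "graph_norm N A (T s U0 - T t U0) = norm (E (T s U0) - E (T t U0)) + norm (E (T s (A U0)) - E (T t (A U0)))"
  if s: "s \<ge> 0" for s
 proof -
  have D: "T s U0 \<in> D" "T t U0 \<in> D" using T_D s t assms by auto
  have dD: "T s U0 - T t U0 \<in> D" using D D_add[of "T s U0" "(-1) *\<^sub>C T t U0"] D_scale[OF D(2), of "-1"] by (simp add: scaleC_minus1)
  have "E (A (T s U0 - T t U0)) = E (A (T s U0)) - E (A (T t U0))"
   using sd.A_diff[of "E (T s U0)" "E (T t U0)"] D dD by (simp add: DX A'_E flip: E_diff)
  then show ?thesis using D dD s t assms by (simp add: graph_norm_def N_diff DX N_E[OF A_X] A_T)
 qed
 have "((\<lambda>s. norm (E (T s U0) - E (T t U0)) + norm (E (T s (A U0)) - E (T t (A U0)))) \<longlongrightarrow> 0 + 0) (at t within {0..})"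
  using c[OF DX[OF assms]] c[OF A_X[OF assms]] by (intro tendsto_add tendsto_norm_zero LIM_zero)
 then show "((\<lambda>s. graph_norm N A (T s U0 - T t U0)) \<longlongrightarrow> 0) (at t within {0..})"
  by (subst filterlim_cong[OF refl refl]) (auto simp: eventually_at_filter eq)
qed

lemma contraction_semigroup_T: "contraction_semigroup X N T" unfolding contraction_semigroup_def C0_semigroup_def
proof (intro conjI allI impI ballI)
 fix t :: real and x assume t: "t \<ge> 0" and x: "x \<in> X"
 show "T t x \<in> X" using t x T_X by simp
 show "N (T t x) \<le> N x" using t x by (simp add: N_E T_X E_T md.T_norm)
 fix y c d assume y: "y \<in> X"
 have "E (T t (c *\<^sub>C x + d *\<^sub>C y)) = E (c *\<^sub>C T t x + d *\<^sub>C T t y)"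
  using t x y by (simp add: T_add X_scale E_add T_X T_scaleC)
 then show "N (T t (c *\<^sub>C x + d *\<^sub>C y) - (c *\<^sub>C T t x + d *\<^sub>C T t y)) = 0"
  using t x y by (subst N_diff_0) (auto simp: T_X X_add X_scale)
next
 fix t :: real assume t: "t \<ge> 0"
 show "\<exists>M. \<forall>x\<in>X. N (T t x) \<le> M * N x"
  using t by (intro exI[of _ 1]) (auto simp: N_E T_X E_T md.T_norm)
next
 fix x assume x: "x \<in> X"
 show "N (T 0 x - x) = 0" using x by (simp add: N_diff_0 T_X E_T md.T_0)
 have "continuous_on {0..} (\<lambda>t. E (T t x))" by (rule orbit_cont[OF x])
 then have "((\<lambda>t. E (T t x)) \<longlongrightarrow> E (T 0 x)) (at 0 within {0..})" by (simp add: continuous_on_def)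
 then have "((\<lambda>t. E (T t x)) \<longlongrightarrow> E (T 0 x)) (at 0 within {0<..})"
  by (rule tendsto_within_subset) auto
 moreover have "E (T 0 x) = E x" using x by (simp add: E_T md.T_0)
 moreover have "\<forall>\<^sub>F t in at_right 0. T t x \<in> X"
  unfolding eventually_at_filter using x T_X by (intro always_eventually) simp
 ultimately show "tends_in N (\<lambda>t. T t x) x (at_right 0)"
  using tends_in_iff[OF x, of "\<lambda>t. T t x"] by simp
next
 fix s t :: real and x assume "s \<ge> 0" "t \<ge> 0" "x \<in> X"
 then show "N (T (s + t) x - T s (T t x)) = 0" by (simp add: N_diff_0 T_X E_T md.T_semigroup)
qed

lemma is_generator_T: "is_generator X N T D A" unfolding is_generator_def
proof (intro conjI ballI)
 show "D \<subseteq> X" by (rule D_X)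
 show "A ` D \<subseteq> X" using A_X by blast
 fix x y assume x: "x \<in> X" and y: "y \<in> X"
 have ev: "\<forall>\<^sub>F h in at_right 0. E (complex_of_real (1 / h) *\<^sub>C (T h x - x)) = (1 / h) *\<^sub>R (md.T h (E x) - E x)"
  using eventually_at_right_less[of "0::real"]
 proof eventually_elim
  case (elim h)
  then show ?case using x T_X[of h x] E_scale[of "T h x - x" "1/h"] by (simp add: X_diff E_diff E_T)
 qed
 have "tends_in N (\<lambda>h. complex_of_real (1 / h) *\<^sub>C (T h x - x)) y (at_right 0) \<longleftrightarrow>
   ((\<lambda>h. E (complex_of_real (1 / h) *\<^sub>C (T h x - x))) \<longlongrightarrow> E y) (at_right 0)"
 proof (rule tends_in_iff[OF y])
  show "\<forall>\<^sub>F h in at_right 0. complex_of_real (1 / h) *\<^sub>C (T h x - x) \<in> X"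
   using x T_X X_scale X_diff by (auto simp: eventually_at_filter)
 qed
 also have "\<dots> \<longleftrightarrow> ((\<lambda>h. (1 / h) *\<^sub>R (md.T h (E x) - E x)) \<longlongrightarrow> E y) (at_right 0)"
  by (intro filterlim_cong refl ev)
 also have "\<dots> \<longleftrightarrow> E x \<in> D' \<and> A' (E x) = E y"
  using md.generator_converse[of "E x" "E y"] md.generator_limit[of "E x"] x y by auto
 also have "\<dots> \<longleftrightarrow> x \<in> D \<and> N (A x - y) = 0"
  using E_D_iff[OF x] A'_E[of x] y N_diff_0[OF A_X y, of x] by auto
 finally show "tends_in N (\<lambda>h. complex_of_real (1 / h) *\<^sub>C (T h x - x)) y (at_right 0) \<longleftrightarrow>
   x \<in> D \<and> N (A x - y) = 0" .
qed

theorem generation: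
 "\<exists>T. contraction_semigroup X N T \<and> is_generator X N T D A \<and> (\<forall>U0\<in>X.
     mild_solution X N D A U0 (\<lambda>t. T t U0) \<and>
     (\<forall>V. mild_solution X N D A U0 V --> (\<forall>t\<ge>0. N (V t - T t U0) = 0)) \<and>
     cont_on_in N {0..} (\<lambda>t. T t U0)) \<and> (\<forall>U0\<in>D.
     classical_solution X N D A U0 (\<lambda>t. T t U0) \<and>
     (\<forall>V. classical_solution X N D A U0 V --> (\<forall>t\<ge>0. N (V t - T t U0) = 0)) \<and>
     (\<forall>t\<ge>0. T t U0 \<in> D) \<and> cont_on_in (graph_norm N A) {0..} (\<lambda>t. T t U0) \<and>
     C1_on_in X N {0..} (\<lambda>t. T t U0))"
proof (intro exI[of _ T] conjI ballI allI impI contraction_semigroup_T is_generator_T)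
 show "cont_on_in N {0..} (\<lambda>t. T t U0)" if "U0 \<in> X" for U0
  using orbit_mild[OF that] by (simp add: mild_solution_def)
qed (use orbit_mild mild_solution_unique orbit_classical classical_solution_unique T_D orbit_graph_cont orbit_C1 in auto)

end

section \<open>Square integrable functions\<close>

text \<open>Kept generic in the measure: it serves the interval, the half line with weight
  \<open>g\<close>, and the product of the two.\<close>

definition sqi :: "'x measure => ('x => complex) set" where
 "sqi M = {f. f \<in> borel_measurable M \<and> integrable M (\<lambda>x. (cmod (f x))\<^sup>2)}"

definition rip :: "'x measure => ('x => complex) => ('x => complex) => real" where
 "rip M f h = (LINT x|M. inner (f x) (h x))"

definition l2n :: "'x measure => ('x => complex) => real" where
 "l2n M f = sqrt (LINT x|M. (cmod (f x))\<^sup>2)"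

lemma sqiD: "f \<in> sqi M ==> f \<in> borel_measurable M" "f \<in> sqi M ==> integrable M (\<lambda>x. (cmod (f x))\<^sup>2)"
 by (auto simp: sqi_def)

lemma sqi_bound:
 assumes "h \<in> borel_measurable M" "integrable M w" "AE x in M. (cmod (h x))\<^sup>2 \<le> w x"
 shows "h \<in> sqi M"
proof -
 have "integrable M (\<lambda>x. (cmod (h x))\<^sup>2)" by (rule int_bound[OF assms(2)]) (use assms in auto)
 then show ?thesis using assms(1) by (simp add: sqi_def)
qed

lemma sqi_cong: "f \<in> sqi M ==> h \<in> borel_measurable M ==> AE x in M. h x = f x ==> h \<in> sqi M"
 by (rule sqi_bound[OF _ sqiD(2)]) auto

lemma sqi_zero [simp]: "(\<lambda>_. 0) \<in> sqi M" "0 \<in> sqi M" by (auto simp: sqi_def zero_fun_def)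

lemma cmod_add_sq: "(cmod (a + b))\<^sup>2 \<le> 2 * (cmod a)\<^sup>2 + 2 * (cmod b)\<^sup>2"
proof -
 have "(cmod (a + b))\<^sup>2 \<le> (cmod a + cmod b)\<^sup>2" by (intro power_mono norm_triangle_ineq) auto
 also have "\<dots> \<le> 2 * (cmod a)\<^sup>2 + 2 * (cmod b)\<^sup>2"
  using sum_squares_bound[of "cmod a" "cmod b"] by (simp add: power2_sum)
 finally show ?thesis .
qed

lemma sqi_add':
 assumes "f \<in> sqi M" "h \<in> sqi M"
 shows "(\<lambda>x. f x + h x) \<in> sqi M"
proof (rule sqi_bound)
 show "integrable M (\<lambda>x. 2 * (cmod (f x))\<^sup>2 + 2 * (cmod (h x))\<^sup>2)"
  by (intro Bochner_Integration.integrable_add integrable_mult_right sqiD assms)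
 show "(\<lambda>x. f x + h x) \<in> borel_measurable M" by (intro borel_measurable_add sqiD assms)
qed (simp add: cmod_add_sq)

lemma sqi_mult': "f \<in> sqi M ==> (\<lambda>x. c * f x) \<in> sqi M"
 by (rule sqi_bound[of _ _ "\<lambda>x. (cmod c)\<^sup>2 * (cmod (f x))\<^sup>2"])
  (auto simp: norm_mult power_mult_distrib dest: sqiD intro!: borel_measurable_times)

lemma sqi_add: "f \<in> sqi M ==> h \<in> sqi M ==> f + h \<in> sqi M" using sqi_add' by (simp add: plus_fun_def)

lemma sqi_scaleC: "f \<in> sqi M ==> c *\<^sub>C f \<in> sqi M"
 using sqi_mult' by (simp add: scaleC_fun_def scaleC_complex_def)

lemma sqi_diff': "f \<in> sqi M ==> h \<in> sqi M ==> (\<lambda>x. f x - h x) \<in> sqi M"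
 using sqi_add'[OF _ sqi_mult'[of h M "-1"], of f] by simp

lemma sqi_diff: "f \<in> sqi M ==> h \<in> sqi M ==> f - h \<in> sqi M" using sqi_diff' by (simp add: fun_diff_def)

lemma sqi_uminus': "f \<in> sqi M ==> (\<lambda>x. - f x) \<in> sqi M" using sqi_mult'[of f M "-1"] by simp

lemma sqi_divide': "f \<in> sqi M ==> (\<lambda>x. f x / c) \<in> sqi M" using sqi_mult'[of f M "1/c"] by simp

lemma sqi_cnj: "f \<in> sqi M ==> (\<lambda>x. cnj (f x)) \<in> sqi M"
 by (rule sqi_bound[of _ _ "\<lambda>x. (cmod (f x))\<^sup>2"]) (auto dest: sqiD simp: borel_measurable_complex_iff)

lemmas sqi_ops = sqi_add' sqi_mult' sqi_diff' sqi_uminus' sqi_divide' sqi_cnj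

lemma sqi_mult_integrable:
 assumes "f \<in> sqi M" "h \<in> sqi M"
 shows "integrable M (\<lambda>x. f x * h x)"
proof (rule int_bound[of M "\<lambda>x. (cmod (f x))\<^sup>2 + (cmod (h x))\<^sup>2"])
 show "integrable M (\<lambda>x. (cmod (f x))\<^sup>2 + (cmod (h x))\<^sup>2)"
  using assms by (intro Bochner_Integration.integrable_add sqiD)
 show "(\<lambda>x. f x * h x) \<in> borel_measurable M" using assms by (intro borel_measurable_times sqiD)
 have "cmod a * cmod b \<le> (cmod a)\<^sup>2 + (cmod b)\<^sup>2" for a b
 proof -
  have "0 \<le> cmod a * cmod b" by simp
  then show ?thesis using sum_squares_bound[of "cmod a" "cmod b"] by linarith
 qed
 then show "AE x in M. norm (f x * h x) \<le> norm ((cmod (f x))\<^sup>2 + (cmod (h x))\<^sup>2)"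
  by (simp add: norm_mult)
qed

lemma inner_eq_Re: "inner a b = Re (a * cnj b)" for a b :: complex by (simp add: inner_complex_def)

lemma rip_integrable: "f \<in> sqi M ==> h \<in> sqi M ==> integrable M (\<lambda>x. inner (f x) (h x))"
 using integrable_Re[OF sqi_mult_integrable[OF _ sqi_cnj]] by (simp add: inner_eq_Re del: times_complex.sel)

lemma rip_eq_Re: "f \<in> sqi M ==> h \<in> sqi M ==> rip M f h = Re (LINT x|M. f x * cnj (h x))"
 unfolding rip_def inner_eq_Re by (rule integral_Re[OF sqi_mult_integrable[OF _ sqi_cnj]])

lemma rip_cong:
 assumes "f \<in> sqi M" "h \<in> sqi M" "f' \<in> sqi M" "h' \<in> sqi M" "AE x in M. f x = f' x" "AE x in M. h x = h' x"
 shows "rip M f h = rip M f' h'" unfolding rip_def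
proof (rule integral_cong_AE)
 show "AE x in M. inner (f x) (h x) = inner (f' x) (h' x)" using assms(5,6) by eventually_elim simp
qed (use assms rip_integrable[of _ M] in \<open>auto intro: borel_measurable_integrable\<close>)

lemma rip_add': "f \<in> sqi M ==> h \<in> sqi M ==> k \<in> sqi M ==> rip M (\<lambda>x. f x + h x) k = rip M f k + rip M h k"
 unfolding rip_def by (simp add: inner_add_left rip_integrable)

lemma rip_sym: "rip M f h = rip M h f" by (simp add: rip_def inner_commute)

lemma rip_add_right': "f \<in> sqi M ==> h \<in> sqi M ==> k \<in> sqi M ==> rip M k (\<lambda>x. f x + h x) = rip M k f + rip M k h"
 unfolding rip_def by (simp add: inner_add_right rip_integrable)

lemma rip_scale': "rip M (\<lambda>x. complex_of_real c * f x) h = c * rip M f h"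
proof -
 have "inner (complex_of_real c * a) b = c * inner a b" for a b by (simp add: inner_complex_def algebra_simps)
 then show ?thesis by (simp add: rip_def)
qed

lemma rip_scale_right': "rip M h (\<lambda>x. complex_of_real c * f x) = c * rip M h f"
 using rip_scale'[of M c f h] by (simp add: rip_sym[of M h])

lemma rip_diff': "f \<in> sqi M ==> h \<in> sqi M ==> k \<in> sqi M ==> rip M (\<lambda>x. f x - h x) k = rip M f k - rip M h k"
 unfolding rip_def by (simp add: inner_diff_left rip_integrable)

lemma rip_uminus': "rip M (\<lambda>x. - f x) k = - rip M f k" unfolding rip_def by simp

lemma rip_diff_right': "f \<in> sqi M ==> h \<in> sqi M ==> k \<in> sqi M ==> rip M k (\<lambda>x. f x - h x) = rip M k f - rip M k h"
 unfolding rip_def by (simp add: inner_diff_right rip_integrable)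

lemma rip_i: "rip M (\<lambda>x. \<i> * f x) (\<lambda>x. \<i> * h x) = rip M f h"
 by (simp add: rip_def inner_complex_def add.commute)

lemma rip_self: "rip M f f = (l2n M f)\<^sup>2" by (simp add: rip_def l2n_def dot_square_norm)

lemma l2n_eq: "l2n M f = sqrt (rip M f f)" by (simp add: rip_def l2n_def dot_square_norm)

lemma l2n_ge0 [simp]: "l2n M f \<ge> 0" by (simp add: l2n_def)

lemma semi_inner_sqi: "semi_inner (sqi M) (rip M)"
proof
 show "rip M (x + y) z = rip M x z + rip M y z" if "x \<in> sqi M" "y \<in> sqi M" "z \<in> sqi M" for x y z
  using rip_add'[OF that] by (simp add: plus_fun_def)
 show "rip M (complex_of_real c *\<^sub>C x) z = c * rip M x z" for x z c
  using rip_scale' by (simp add: scaleC_fun_def scaleC_complex_def)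
qed (auto simp: sqi_add sqi_scaleC rip_sym rip_self)

lemma semi_inner_nrm_sqi: "semi_inner.nrm (rip M) f = l2n M f"
 by (simp add: semi_inner.nrm_def[OF semi_inner_sqi] l2n_eq)

lemma rip_bound: "f \<in> sqi M ==> h \<in> sqi M ==> \<bar>rip M f h\<bar> \<le> l2n M f * l2n M h"
 using semi_inner.r_bound[OF semi_inner_sqi, of f M h] by (simp add: semi_inner_nrm_sqi)

lemma l2n_triangle: "f \<in> sqi M ==> h \<in> sqi M ==> l2n M (\<lambda>x. f x + h x) \<le> l2n M f + l2n M h"
 using semi_inner.nrm_triangle[OF semi_inner_sqi, of f M h] by (simp add: semi_inner_nrm_sqi plus_fun_def)

lemma l2n_cong:
 assumes "f \<in> sqi M" "h \<in> borel_measurable M" "AE x in M. h x = f x"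
 shows "l2n M h = l2n M f"
proof -
 have "rip M h h = rip M f f" using sqi_cong[OF assms] assms by (intro rip_cong) auto
 then show ?thesis by (simp add: l2n_eq)
qed

lemma l2n_uminus: "l2n M (\<lambda>x. - f x) = l2n M f" by (simp add: l2n_def)

lemma l2n_triangle_diff:
 "f \<in> sqi M ==> h \<in> sqi M ==> l2n M (\<lambda>x. f x - h x) \<le> l2n M f + l2n M h"
 using l2n_triangle[OF _ sqi_uminus', of f M h] by (simp add: l2n_uminus)

lemma l2n_zero_AE:
 assumes "f \<in> sqi M" "l2n M f = 0"
 shows "AE x in M. f x = 0"
proof -
 have "(LINT x|M. (cmod (f x))\<^sup>2) = 0" using assms(2) by (simp add: l2n_def)
 then have "AE x in M. (cmod (f x))\<^sup>2 = 0" using assms sqiD by (subst (asm) integral_nonneg_eq_0_iff_AE) auto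
 then show ?thesis by eventually_elim simp
qed

lemma l2n_AE_zero: "AE x in M. f x = 0 ==> l2n M f = 0"
proof -
 assume "AE x in M. f x = 0"
 then have "AE x in M. (cmod (f x))\<^sup>2 = 0" by eventually_elim simp
 then show ?thesis unfolding l2n_def using integral_eq_zero_AE by fastforce
qed

lemma l2n_sq: "(l2n M f)\<^sup>2 = (LINT x|M. (cmod (f x))\<^sup>2)" by (simp add: l2n_def)

lemma l2n_eq_nn: "f \<in> sqi M ==> ennreal ((l2n M f)\<^sup>2) = (\<integral>\<^sup>+x. ennreal ((cmod (f x))\<^sup>2) \<partial>M)"
 by (simp add: l2n_sq nn_integral_eq_integral sqiD)

lemma sqi_nn_bound:
 assumes "h \<in> borel_measurable M" "(\<integral>\<^sup>+x. ennreal ((cmod (h x))\<^sup>2) \<partial>M) \<le> ennreal (C\<^sup>2)" "C \<ge> 0"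
 shows "h \<in> sqi M" "l2n M h \<le> C"
proof -
 have "integrable M (\<lambda>x. (cmod (h x))\<^sup>2)"
 proof (rule integrableI_bounded)
  show "(\<integral>\<^sup>+x. ennreal (norm ((cmod (h x))\<^sup>2)) \<partial>M) < \<infinity>"
   using assms(2) by (simp add: order_le_less_trans)
 qed (use assms in auto)
 then show s: "h \<in> sqi M" using assms(1) by (simp add: sqi_def)
 have "ennreal ((l2n M h)\<^sup>2) \<le> ennreal (C\<^sup>2)" unfolding l2n_eq_nn[OF s] by (rule assms(2))
 then have "(l2n M h)\<^sup>2 \<le> C\<^sup>2" by (rule ennreal_le_iff[THEN iffD1, rotated]) (rule zero_le_power2)
 then show "l2n M h \<le> C" by (rule power2_le_imp_le[OF _ assms(3)])
qed

context finite_measure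
begin

lemma const_sqi [simp]: "(\<lambda>_. c) \<in> sqi M" by (simp add: sqi_def)

lemma l2n_const: "l2n M (\<lambda>_. c) = cmod c * sqrt (measure M (space M))" by (simp add: l2n_def real_sqrt_mult)

lemma sqi_int: "f \<in> sqi M ==> integrable M f" using sqi_mult_integrable[OF _ const_sqi[of 1], of f] by simp

lemma l1_le_l2n:
 assumes f: "f \<in> sqi M"
 shows "(LINT x|M. cmod (f x)) \<le> sqrt (measure M (space M)) * l2n M f"
proof -
 have c: "(\<lambda>x. complex_of_real (cmod (f x))) \<in> sqi M"
  by (rule sqi_bound[OF _ sqiD(2)[OF f]]) (use sqiD(1)[OF f] in auto)
 have "(LINT x|M. cmod (f x)) = rip M (\<lambda>x. complex_of_real (cmod (f x))) (\<lambda>_. 1)"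
  by (simp add: rip_def inner_complex_def)
 also have "\<dots> \<le> l2n M (\<lambda>x. complex_of_real (cmod (f x))) * l2n M (\<lambda>_. 1)"
  using rip_bound[OF c const_sqi[of 1]] by linarith
 also have "\<dots> = sqrt (measure M (space M)) * l2n M f" by (simp add: l2n_const) (simp add: l2n_def)
 finally show ?thesis .
qed

lemma integral_le_l2n:
 assumes f: "f \<in> sqi M"
 shows "cmod (LINT x|M. f x) \<le> sqrt (measure M (space M)) * l2n M f"
 using order_trans[OF integral_norm_bound l1_le_l2n[OF f]] .

text \<open>A subsequence with summable increments converges almost everywhere.\<close>

theorem riesz_fischer:
 assumes f: "!!n. f n \<in> sqi M"
  and cau: "!!e. e > 0 ==> \<exists>K. \<forall>m\<ge>K. \<forall>n\<ge>K. l2n M (\<lambda>x. f m x - f n x) < e"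
 obtains F where "F \<in> sqi M" "(\<lambda>n. l2n M (\<lambda>x. f n x - F x)) \<longlonglongrightarrow> 0"
proof -
 have "\<exists>K. \<forall>m\<ge>K. \<forall>n\<ge>K. l2n M (\<lambda>x. f m x - f n x) < (1/2)^k" for k :: nat
  using cau by simp
 then obtain K where K: "!!k m n. [|m \<ge> K k; n \<ge> K k|] ==> l2n M (\<lambda>x. f m x - f n x) < (1/2)^k" by metis
 define s where "s = (\<lambda>k. \<Sum>i\<le>k. K i)"
 have sK: "s k \<ge> K k" for k by (simp add: s_def member_le_sum)
 have smono: "s k \<le> s (Suc k)" for k by (simp add: s_def)
 have s_mono: "s k \<le> s l" if "k \<le> l" for k l using lift_Suc_mono_le[of s] smono that by blast
 define d where "d = (\<lambda>k x. f (s (Suc k)) x - f (s k) x)"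
 have dS: "d k \<in> sqi M" for k unfolding d_def by (intro sqi_ops f)
 let ?C = "sqrt (measure M (space M))"
 have d1: "(LINT x|M. cmod (d k x)) \<le> ?C * (1/2)^k" for k
 proof -
  have "l2n M (d k) \<le> (1/2)^k" using K[of k "s (Suc k)" "s k"] sK[of k] smono[of k] by (simp add: d_def)
  then show ?thesis using l1_le_l2n[OF dS[of k]] by (meson mult_left_mono order_trans real_sqrt_ge_zero measure_nonneg)
 qed
 have "(\<integral>\<^sup>+x. (\<Sum>k. ennreal (cmod (d k x))) \<partial>M) = (\<Sum>k. \<integral>\<^sup>+x. ennreal (cmod (d k x)) \<partial>M)"
  using sqiD(1)[OF dS] by (intro nn_integral_suminf) auto
 also have "\<dots> = (\<Sum>k. ennreal (LINT x|M. cmod (d k x)))"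
  using sqi_int[OF dS] by (intro suminf_cong nn_integral_eq_integral) auto
 also have "\<dots> \<le> (\<Sum>k. ennreal (?C * (1/2)^k))"
  using d1 by (intro suminf_le) (auto intro: ennreal_leI)
 also have "\<dots> = ennreal (\<Sum>k. ?C * (1/2)^k)"
  by (intro suminf_ennreal2) (auto intro!: summable_mult summable_geometric)
 finally have fin: "(\<integral>\<^sup>+x. (\<Sum>k. ennreal (cmod (d k x))) \<partial>M) \<noteq> \<infinity>"
  by (metis ennreal_neq_top infinity_ennreal_def neq_top_trans)
 have "AE x in M. (\<Sum>k. ennreal (cmod (d k x))) \<noteq> \<infinity>"
  using sqiD(1)[OF dS] by (intro nn_integral_PInf_AE fin) auto
 then have conv: "AE x in M. (\<lambda>k. f (s k) x) \<longlonglongrightarrow> lim (\<lambda>k. f (s k) x)"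
 proof eventually_elim
  case (elim x)
  then have "summable (\<lambda>k. cmod (d k x))" by (intro summable_suminf_not_top) auto
  then have "summable (\<lambda>k. d k x)" by (rule summable_norm_cancel)
  then have "convergent (\<lambda>n. \<Sum>k<n. d k x)" by (simp add: summable_iff_convergent)
  moreover have "(\<Sum>k<n. d k x) = f (s n) x - f (s 0) x" for n
   unfolding d_def by (rule sum_lessThan_telescope)
  ultimately have "convergent (\<lambda>n. f (s n) x - f (s 0) x)" by simp
  then have "convergent (\<lambda>n. (f (s n) x - f (s 0) x) + f (s 0) x)" by (intro convergent_add convergent_const)
  then show ?case by (simp add: convergent_LIMSEQ_iff)
 qed
 define F where "F = (\<lambda>x. lim (\<lambda>k. f (s k) x))"
 have Fm: "F \<in> borel_measurable M"
  unfolding F_def using sqiD(1)[OF f] by (intro borel_measurable_lim_metric) auto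
 \<comment> \<open>Fatou's lemma along the subsequence shows at once that \<open>f n - F\<close> is
   square integrable and that it is small.\<close>
 have bound: "(\<lambda>x. f n x - F x) \<in> sqi M \<and> l2n M (\<lambda>x. f n x - F x) \<le> (1/2)^k" if n: "n \<ge> K k" for n k
 proof -
  have "(\<integral>\<^sup>+x. ennreal ((cmod (f n x - F x))\<^sup>2) \<partial>M) \<le> (\<integral>\<^sup>+x. liminf (\<lambda>l. ennreal ((cmod (f n x - f (s l) x))\<^sup>2)) \<partial>M)"
  proof (rule nn_integral_mono_AE)
   show "AE x in M. ennreal ((cmod (f n x - F x))\<^sup>2) \<le> liminf (\<lambda>l. ennreal ((cmod (f n x - f (s l) x))\<^sup>2))"
    using conv
   proof eventually_elim
    case (elim x)
    then have "(\<lambda>l. ennreal ((cmod (f n x - f (s l) x))\<^sup>2)) \<longlonglongrightarrow> ennreal ((cmod (f n x - F x))\<^sup>2)"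
     unfolding F_def by (intro tendsto_intros tendsto_ennrealI)
    then show ?case using lim_imp_Liminf[OF sequentially_bot] by fastforce
   qed
  qed
  also have "\<dots> \<le> liminf (\<lambda>l. \<integral>\<^sup>+x. ennreal ((cmod (f n x - f (s l) x))\<^sup>2) \<partial>M)"
   using sqiD(1)[OF f] by (intro nn_integral_liminf) auto
  also have "\<dots> \<le> ennreal (((1/2)^k)\<^sup>2)"
  proof -
   have "\<forall>\<^sub>F l in sequentially. (\<integral>\<^sup>+x. ennreal ((cmod (f n x - f (s l) x))\<^sup>2) \<partial>M) \<le> ennreal (((1/2)^k)\<^sup>2)"
    unfolding eventually_sequentially
   proof (intro exI allI impI)
    fix l assume l: "k \<le> l"
    have "l2n M (\<lambda>x. f n x - f (s l) x) \<le> (1/2)^k"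
     using K[of k n "s l"] n sK[of k] s_mono[OF l] by simp
    then have "(l2n M (\<lambda>x. f n x - f (s l) x))\<^sup>2 \<le> ((1/2)^k)\<^sup>2" by (intro power_mono) auto
    then show "(\<integral>\<^sup>+x. ennreal ((cmod (f n x - f (s l) x))\<^sup>2) \<partial>M) \<le> ennreal (((1/2)^k)\<^sup>2)"
     unfolding l2n_eq_nn[OF sqi_diff'[OF f f], symmetric] by (rule ennreal_leI)
   qed
   then show ?thesis by (intro Liminf_le) auto
  qed
  finally show ?thesis using sqi_nn_bound[of "\<lambda>x. f n x - F x" M "(1/2)^k"] Fm sqiD(1)[OF f[of n]] by auto
 qed
 have "F = (\<lambda>x. f (K 0) x - (f (K 0) x - F x))" by simp
 then have FS: "F \<in> sqi M" using sqi_diff'[OF f conjunct1[OF bound[of 0 "K 0"]], of "K 0"] by simp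
 have "(\<lambda>n. l2n M (\<lambda>x. f n x - F x)) \<longlonglongrightarrow> 0"
 proof (rule LIMSEQ_I)
  fix e :: real assume "e > 0"
  then obtain k where k: "(1/2::real)^k < e" using real_arch_pow_inv[of e "1/2"] by auto
  show "\<exists>no. \<forall>n\<ge>no. norm (l2n M (\<lambda>x. f n x - F x) - 0) < e"
  proof (intro exI allI impI)
   fix n assume "K k \<le> n"
   then show "norm (l2n M (\<lambda>x. f n x - F x) - 0) < e" using bound[of k n] k by simp
  qed
 qed
 then show ?thesis using that FS by blast
qed

lemma semi_hilbert_sqi: "semi_hilbert (sqi M) (rip M)"
proof (intro semi_hilbert.intro semi_inner_sqi semi_hilbert_axioms.intro)
 fix f :: "nat => 'a => complex"
 assume f: "!!n. f n \<in> sqi M"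
  and cau: "!!e. e > 0 ==> \<exists>K. \<forall>m\<ge>K. \<forall>n\<ge>K. sqrt (rip M (f m - f n) (f m - f n)) < e"
 have "\<exists>K. \<forall>m\<ge>K. \<forall>n\<ge>K. l2n M (\<lambda>x. f m x - f n x) < e" if "e > 0" for e
  using cau[OF that] by (simp add: l2n_eq fun_diff_def)
 then obtain F where "F \<in> sqi M" "(\<lambda>n. l2n M (\<lambda>x. f n x - F x)) \<longlonglongrightarrow> 0"
  using riesz_fischer[of f, OF f] by blast
 then show "\<exists>l\<in>sqi M. (\<lambda>n. sqrt (rip M (f n - l) (f n - l))) \<longlonglongrightarrow> 0"
  by (auto simp: l2n_eq fun_diff_def)
qed

end

section \<open>Sobolev spaces on an interval\<close>

lemma indefinite_integral_continuous:
 fixes f :: "real => 'b::{banach, second_countable_topology}"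
 assumes f: "integrable lborel f"
 shows "continuous_on UNIV (\<lambda>x. LINT y|lborel. (if y \<le> x then f y else 0))"
proof -
 have "isCont (\<lambda>x. LINT y|lborel. (if y \<le> x then f y else 0)) x" for x
  unfolding continuous_at_sequentially
 proof (intro allI impI)
  fix u :: "nat => real" assume u: "u \<longlonglongrightarrow> x"
  have [measurable]: "f \<in> borel_measurable borel" using borel_measurable_integrable[OF f] by simp
  have "(\<lambda>n. LINT y|lborel. (if y \<le> u n then f y else 0)) \<longlonglongrightarrow> (LINT y|lborel. (if y \<le> x then f y else 0))"
  proof (rule integral_dominated_convergence)
   show "integrable lborel (\<lambda>y. norm (f y))" using f by simp
   show "AE y in lborel. (\<lambda>n. if y \<le> u n then f y else 0) \<longlonglongrightarrow> (if y \<le> x then f y else 0)"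
    using AE_lborel_singleton[of x]
   proof eventually_elim
    case (elim y)
    then consider "y < x" | "x < y" by linarith
    then have "\<forall>\<^sub>F n in sequentially. (if y \<le> u n then f y else 0) = (if y \<le> x then f y else 0)"
    proof cases
     case 1
     show ?thesis using order_tendstoD(1)[OF u 1] by eventually_elim (use 1 in auto)
    next
     case 2
     show ?thesis using order_tendstoD(2)[OF u 2] by eventually_elim (use 2 in auto)
    qed
    then show ?case by (rule tendsto_eventually)
   qed
   show "AE y in lborel. norm (if y \<le> u n then f y else 0) \<le> norm (f y)" for n by simp
  qed measurable
  then show "((\<lambda>x. LINT y|lborel. (if y \<le> x then f y else 0)) \<circ> u) \<longlonglongrightarrow> (LINT y|lborel. (if y \<le> x then f y else 0))"
   by (simp add: o_def)
 qed
 then show ?thesis by (simp add: continuous_at_imp_continuous_on)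
qed

text \<open>The integral vanishes on half-lines, which generate the Borel sets and are stable under
  intersection. The class of sets with zero integral is closed under complements because the total
  integral, a limit over half-lines, is 0 as well.\<close>

lemma indefinite_integral_zero_imp_AE:
 fixes f :: "real => complex"
 assumes f: "integrable lborel f" and 0: "!!x. (LINT y|lborel. (if y \<le> x then f y else 0)) = 0"
 shows "AE y in lborel. f y = 0"
proof (rule sigma_finite_measure.density_zero[OF sigma_finite_lborel f])
 have [measurable]: "f \<in> borel_measurable borel" using borel_measurable_integrable[OF f] by simp
 have si: "set_integrable lborel A f" if "A \<in> sets borel" for A
  using integrable_mult_indicator[OF _ f, of A] that by (simp add: set_integrable_def)
 have total: "(LINT y|lborel. f y) = 0"
 proof -
  have "(\<lambda>n. LINT y|lborel. (if y \<le> real n then f y else 0)) \<longlonglongrightarrow> (LINT y|lborel. f y)"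
  proof (rule integral_dominated_convergence)
   show "integrable lborel (\<lambda>y. norm (f y))" using f by simp
   have "(\<lambda>n. if y \<le> real n then f y else 0) \<longlonglongrightarrow> f y" for y
   proof (rule tendsto_eventually)
    obtain N where "y \<le> real N" using real_arch_simple by blast
    then show "\<forall>\<^sub>F n in sequentially. (if y \<le> real n then f y else 0) = f y"
     unfolding eventually_sequentially by (intro exI[of _ N]) auto
   qed
   then show "AE y in lborel. (\<lambda>n. if y \<le> real n then f y else 0) \<longlonglongrightarrow> f y" by simp
  qed simp_all
  then show ?thesis using 0 LIMSEQ_unique[OF _ tendsto_const] by simp
 qed
 fix A :: "real set" assume "A \<in> sets lborel"
 then have mem: "A \<in> sigma_sets UNIV (range atMost)" by (simp add: borel_eq_atMost)
 have st: "Int_stable (range (atMost :: real => _))" and cl: "range (atMost :: real => _) \<subseteq> Pow UNIV"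
  by (auto simp: Int_stable_def)
 show "set_lebesgue_integral lborel A f = 0" using st cl mem
 proof (induction rule: sigma_sets_induct_disjoint)
  case (basic A)
  then obtain x where "A = {..x}" by blast
  moreover have "indicat_real {..x} y *\<^sub>R f y = (if y \<le> x then f y else 0)" for y by (simp add: indicator_def)
  ultimately show ?case using 0[of x] by (simp add: set_lebesgue_integral_def)
 next
  case empty
  show ?case by (simp add: set_lebesgue_integral_def)
 next
  case (compl A)
  have A: "A \<in> sets borel" using compl(1) by (simp add: borel_eq_atMost)
  have "(LINT y|lborel. f y) = (LINT y:UNIV - A \<union> A|lborel. f y)" by (simp add: set_lebesgue_integral_def)
  also have "\<dots> = (LINT y:UNIV - A|lborel. f y) + (LINT y:A|lborel. f y)"
   using A by (intro set_integral_Un si) auto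
  finally show ?case using total compl by simp
 next
  case (union B)
  have B: "B i \<in> sets borel" for i using union(2)[of ] by (auto simp: borel_eq_atMost sets_measure_of_conv)
  have "(LINT y:(\<Union>i. B i)|lborel. f y) = (\<Sum>i. (LINT y:(B i)|lborel. f y))"
   using B union(1) by (intro lebesgue_integral_countable_add si) (auto simp: disjoint_family_on_def)
  then show ?case using union(3) by simp
 qed
qed

lemma integrable_pair_bound:
 fixes F :: "'x \<times> 'y => 'c::{banach, second_countable_topology}"
 assumes sf: "sigma_finite_measure M1" "sigma_finite_measure M2"
  and a: "integrable M1 (a :: 'x => complex)" and b: "integrable M2 (b :: 'y => complex)"
  and F[measurable]: "F \<in> borel_measurable (M1 \<Otimes>\<^sub>M M2)"
  and bnd: "!!x y. norm (F (x, y)) \<le> cmod (a x) * cmod (b y)"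
 shows "integrable (M1 \<Otimes>\<^sub>M M2) F"
proof -
 interpret pair_sigma_finite M1 M2 using sf by (simp add: pair_sigma_finite_def)
 have b': "integrable M2 (\<lambda>y. cmod (a x) * cmod (b y))" for x using b by simp
 have in2: "integrable M2 (\<lambda>y. F (x, y))" if "x \<in> space M1" for x
  by (rule int_bound[OF b'[of x]]) (use bnd that in \<open>auto simp: abs_mult\<close>)
 show ?thesis
 proof (rule Fubini_integrable[OF F])
  show "AE x in M1. integrable M2 (\<lambda>y. F (x, y))" using in2 by simp
  show "integrable M1 (\<lambda>x. LINT y|M2. norm (F (x, y)))"
  proof (rule int_bound)
   show "integrable M1 (\<lambda>x. cmod (a x) * (LINT y|M2. cmod (b y)))" using a by simp
   show "AE x in M1. norm (LINT y|M2. norm (F (x, y))) \<le> norm (cmod (a x) * (LINT y|M2. cmod (b y)))"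
   proof (rule AE_I2)
    fix x assume x: "x \<in> space M1"
    have "(LINT y|M2. norm (F (x, y))) \<le> (LINT y|M2. cmod (a x) * cmod (b y))"
     using in2[OF x] b' bnd by (intro integral_mono) auto
    then show "norm (LINT y|M2. norm (F (x, y))) \<le> norm (cmod (a x) * (LINT y|M2. cmod (b y)))" by simp
   qed
  qed measurable
 qed
qed

locale interval =
 fixes L :: real
 assumes L_pos: "0 < L"
begin

abbreviation "I \<equiv> intv L"

lemma space_I [simp]: "space I = {0<..<L}" by (simp add: space_restrict_space)

lemma measure_I [simp]: "measure I {0<..<L} = L" using L_pos by (simp add: measure_restrict_space)

sublocale fin: finite_measure I using L_pos by (intro finite_measureI) (simp add: emeasure_restrict_space)

sublocale pr: pair_sigma_finite I I by (simp add: pair_sigma_finite_def fin.sigma_finite_measure_axioms)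

lemma L2_eq: "L2 L = sqi I" by (simp add: L2_def sqi_def)

lemma L2norm_eq: "L2norm L = l2n I" by (simp add: L2norm_def l2n_def fun_eq_iff)

lemma id_meas [measurable]: "(\<lambda>x. x) \<in> borel_measurable I" by (rule measurable_restrict_space1) simp

lemma cont_meas: "continuous_on UNIV f ==> f \<in> borel_measurable I" for f :: "real => 'b::topological_space"
 by (intro measurable_restrict_space1) (simp add: borel_measurable_continuous_onI)

lemma AE_I: "(AE x in I. P x) \<longleftrightarrow> (AE x in lborel. 0 < x \<and> x < L --> P x)"
 by (subst AE_restrict_space_iff) auto

lemma AE_I_neq: "AE x in I. x \<noteq> y" unfolding AE_I using AE_lborel_singleton[of y] by eventually_elim simp

lemma AE_I_conv: "(!!x. 0 < x ==> x < L ==> P x) ==> AE x in I. P x" by (rule AE_I2) simp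

lemma AE_I_ex: "AE x in I. P x ==> 0 \<le> a ==> a < b ==> b \<le> L ==> \<exists>x. a < x \<and> x < b \<and> P x"
proof (rule ccontr)
 assume P: "AE x in I. P x" and ab: "0 \<le> a" "a < b" "b \<le> L" and n: "\<not> (\<exists>x. a < x \<and> x < b \<and> P x)"
 have "AE x in lborel. x \<notin> {a<..<b}" using P unfolding AE_I by eventually_elim (use ab n in force)
 then have "emeasure lborel {a<..<b} = 0" by (subst (asm) AE_iff_null_sets[symmetric]) (auto simp: null_sets_def)
 then show False using ab by simp
qed

lemma integral_I: "(LINT x|I. f x) = (LINT x|lborel. indicator {0<..<L} x *\<^sub>R f x)"
 for f :: "real => complex" by (rule integral_restrict_space) simp

lemma integrable_I: "integrable I f \<longleftrightarrow> integrable lborel (\<lambda>x. indicator {0<..<L} x *\<^sub>R f x)"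
 for f :: "real => complex" by (rule integrable_restrict_space) simp

text \<open>The primitive from 0, constant left of 0 and right of \<open>L\<close>. Sobolev
  functions are handled throughout as a constant plus \<open>prim\<close> of the weak derivative,
  almost everywhere.\<close>

definition prim :: "(real => complex) => real => complex" where
 "prim f x = (LINT y|I. (if y \<le> x then f y else 0))"

lemma prim_lborel: "prim f x = (LINT y|lborel. (if y \<le> x then indicator {0<..<L} y *\<^sub>R f y else 0))"
 unfolding prim_def integral_I by (intro int_cong) auto

lemma prim_cont: "integrable I f ==> continuous_on UNIV (prim f)"
 using indefinite_integral_continuous[of "\<lambda>y. indicator {0<..<L} y *\<^sub>R f y"]
 by (simp add: prim_lborel[abs_def] integrable_I)

lemma prim_meas [measurable]: "integrable I f ==> prim f \<in> borel_measurable I"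
 using prim_cont cont_meas by blast

lemma prim_0: "x \<le> 0 ==> prim f x = 0" unfolding prim_def by (rule integral_eq_zero_AE) (auto intro!: AE_I_conv)

lemma prim_L: "L \<le> x ==> prim f x = (LINT y|I. f y)" unfolding prim_def by (intro int_cong) auto

lemma integrable_if_le: "integrable I f ==> integrable I (\<lambda>y. if y \<le> x then f y else 0)"
 for f :: "real => complex" by (rule int_bound[of I f]) auto

lemma integrable_if_ge: "integrable I f ==> integrable I (\<lambda>y. if x \<le> y then f y else 0)"
 for f :: "real => complex" by (rule int_bound[of I f]) auto

lemma prim_cong: "AE x in I. f x = h x ==> f \<in> borel_measurable I ==> h \<in> borel_measurable I ==> prim f = prim h"
 unfolding prim_def fun_eq_iff by (intro allI integral_cong_AE) auto

lemma prim_bound: "integrable I f ==> cmod (prim f x) \<le> (LINT y|I. cmod (f y))" unfolding prim_def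
 by (rule order_trans[OF integral_norm_bound]) (intro integral_mono integrable_norm integrable_if_le, auto)

lemma prim_bound_l2n: "f \<in> sqi I ==> cmod (prim f x) \<le> sqrt L * l2n I f"
 using order_trans[OF prim_bound[OF fin.sqi_int] fin.l1_le_l2n] by simp

lemma prim_sqi: "f \<in> sqi I ==> prim f \<in> sqi I"
 by (rule sqi_bound[of _ _ "\<lambda>_. (sqrt L * l2n I f)\<^sup>2"])
  (auto intro!: power_mono prim_bound_l2n prim_meas fin.sqi_int)

lemma l2n_const_I: "l2n I (\<lambda>_. c) = cmod c * sqrt L" using fin.l2n_const[of c] by simp

lemma l2n_prim: "f \<in> sqi I ==> l2n I (prim f) \<le> L * l2n I f"
proof -
 assume f: "f \<in> sqi I"
 let ?C = "sqrt L * l2n I f"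
 have "(l2n I (prim f))\<^sup>2 \<le> (LINT x|I. ?C\<^sup>2)"
  unfolding l2n_sq using prim_sqi[OF f] sqiD by (intro integral_mono) (auto intro!: power_mono prim_bound_l2n f)
 also have "\<dots> = (L * l2n I f)\<^sup>2" using L_pos by (simp add: power_mult_distrib power2_eq_square)
 finally show ?thesis using L_pos by (auto intro: power2_le_imp_le)
qed

lemma prim_add: "integrable I f ==> integrable I h ==> prim (\<lambda>x. f x + h x) y = prim f y + prim h y"
 unfolding prim_def by (subst Bochner_Integration.integral_add[symmetric]) (auto intro!: integrable_if_le int_cong)

lemma prim_mult: "prim (\<lambda>x. c * f x) y = c * prim f y"
 unfolding prim_def integral_mult_right_zero[symmetric] by (intro int_cong) auto

lemma prim_diff: "integrable I f ==> integrable I h ==> prim (\<lambda>x. f x - h x) y = prim f y - prim h y"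
 using prim_add[of f "\<lambda>x. (-1) * h x" y] prim_mult[of "-1" h y] by simp

lemma prim_cnj: "prim (\<lambda>x. cnj (f x)) y = cnj (prim f y)"
proof -
 have "(if z \<le> y then cnj (f z) else 0) = cnj (if z \<le> y then f z else 0)" for z by simp
 then show ?thesis unfolding prim_def by (simp only: Bochner_Integration.integral_cnj)
qed

text \<open>Integration by parts as Fubini's theorem on the triangle \<open>y \<le> x\<close>; the
  diagonal point counted twice when the inner integral is split is null.\<close>

lemma prim_adj:
 assumes f: "integrable I f" and k: "integrable I k"
 shows "(LINT x|I. prim f x * k x) = (LINT y|I. f y * ((LINT x|I. k x) - prim k y))"
proof -
 have [measurable]: "f \<in> borel_measurable I" "k \<in> borel_measurable I"
  using f k borel_measurable_integrable by auto
 let ?F = "\<lambda>(y, x). if y \<le> x then f y * k x else (0::complex)"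
 have int: "integrable (I \<Otimes>\<^sub>M I) ?F"
  by (rule integrable_pair_bound[OF fin.sigma_finite_measure_axioms fin.sigma_finite_measure_axioms f k])
   (auto simp: norm_mult)
 have "(LINT x|I. prim f x * k x) = (LINT x|I. LINT y|I. (if y \<le> x then f y * k x else 0))"
  unfolding prim_def integral_mult_left_zero[symmetric] by (intro int_cong) auto
 also have "\<dots> = (LINT y|I. LINT x|I. (if y \<le> x then f y * k x else 0))"
  using pr.Fubini_integral[OF int] .
 also have "\<dots> = (LINT y|I. f y * ((LINT x|I. k x) - prim k y))"
 proof (rule int_cong[OF refl])
  fix y
  have "(LINT x|I. (if y \<le> x then f y * k x else 0)) = f y * (LINT x|I. (if y \<le> x then k x else 0))"
   unfolding integral_mult_right_zero[symmetric] by (intro int_cong) auto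
  moreover have "(LINT x|I. k x) = (LINT x|I. (if y \<le> x then k x else 0) + (if x \<le> y then k x else 0))"
   by (rule integral_cong_AE) (use AE_I_neq[of y] in \<open>auto elim!: eventually_mono\<close>)
  moreover have "\<dots> = (LINT x|I. (if y \<le> x then k x else 0)) + prim k y"
   unfolding prim_def by (intro Bochner_Integration.integral_add integrable_if_le integrable_if_ge k)
  ultimately show "(LINT x|I. (if y \<le> x then f y * k x else 0)) = f y * ((LINT x|I. k x) - prim k y)" by simp
 qed
 finally show ?thesis .
qed

lemma rip_prim:
 assumes f: "f \<in> sqi I" and k: "k \<in> sqi I" and 0: "(LINT x|I. k x) = 0"
 shows "rip I (prim f) k = - rip I f (prim k)"
proof -
 have k': "(\<lambda>x. cnj (k x)) \<in> sqi I" using k by (rule sqi_cnj)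
 have "(LINT x|I. cnj (k x)) = 0" using 0 by simp
 then have "(LINT x|I. prim f x * cnj (k x)) = (LINT y|I. - (f y * cnj (prim k y)))"
  using prim_adj[OF fin.sqi_int[OF f] fin.sqi_int[OF k']] by (simp add: prim_cnj)
 then show ?thesis using f k by (simp add: rip_eq_Re prim_sqi)
qed

lemma cont_constant:
 fixes u :: "real => complex"
 assumes u: "continuous_on UNIV u" and c: "AE x in I. u x = c" and x: "0 \<le> x" "x \<le> L"
 shows "u x = c"
proof -
 have cl: "closed {x. u x = c}" using continuous_closed_preimage_constant[OF u, of c] by simp
 have "x \<in> closure {x. u x = c}" unfolding closure_approachable
 proof (intro allI impI)
  fix e :: real assume e: "e > 0"
  have "\<exists>y. max 0 (x - e) < y \<and> y < min L (x + e) \<and> u y = c"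
   using x e L_pos by (intro AE_I_ex[OF c]) auto
  then show "\<exists>y\<in>{x. u x = c}. dist y x < e" by (auto simp: dist_real_def)
 qed
 then show ?thesis using cl by simp
qed

text \<open>By continuity the constant is the value of the primitive at 0, which is 0; then the
  primitive vanishes on the whole line and so does its density.\<close>

lemma prim_const_imp_zero:
 assumes k: "integrable I k" and c: "AE x in I. prim k x = c"
 shows "AE x in I. k x = 0"
proof -
 have p: "prim k x = c" if "0 \<le> x" "x \<le> L" for x using cont_constant[OF prim_cont[OF k] c that] .
 have "c = 0" using p[of 0] prim_0[of 0 k] L_pos by simp
 then have "prim k x = 0" for x
  using p[of x] prim_0[of x k] prim_L[of x k] prim_L[of L k] p[of L] L_pos by (cases "x \<le> 0"; cases "x \<le> L") auto
 then have "AE y in lborel. indicat_real {0<..<L} y *\<^sub>R k y = 0"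
  using k by (intro indefinite_integral_zero_imp_AE) (auto simp: integrable_I simp flip: prim_lborel)
 then show ?thesis unfolding AE_I by eventually_elim auto
qed

lemma prim_of_cont:
 assumes W: "continuous_on UNIV W" and F: "!!x. (F has_vector_derivative W x) (at x)" and x: "0 \<le> x" "x \<le> L"
 shows "prim W x = F x - F 0"
proof -
 have [measurable]: "W \<in> borel_measurable borel" using W by (rule borel_measurable_continuous_onI)
 have "prim W x = (LINT y|lborel. indicator {0..x} y *\<^sub>R W y)" unfolding prim_lborel
 proof (rule integral_cong_AE)
  show "AE y in lborel. (if y \<le> x then indicat_real {0<..<L} y *\<^sub>R W y else 0) = indicat_real {0..x} y *\<^sub>R W y"
   using AE_lborel_singleton[of 0] AE_lborel_singleton[of L]
   by eventually_elim (use x in \<open>auto simp: indicator_def\<close>)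
 qed auto
 also have "\<dots> = F x - F 0"
  using W F x by (intro integral_FTC_Icc) (auto intro: continuous_on_subset has_vector_derivative_at_within)
 finally show ?thesis .
qed

lemma cont_sqi:
 assumes "continuous_on UNIV f" shows "f \<in> sqi I"
proof -
 have "bounded (f ` {0..L})"
  using continuous_on_subset[OF assms] by (intro compact_imp_bounded compact_continuous_image) auto
 then obtain C where "\<forall>x\<in>{0..L}. cmod (f x) \<le> C" unfolding bounded_iff by blast
 then show ?thesis
  by (intro sqi_bound[of _ _ "\<lambda>_. C\<^sup>2"] cont_meas assms) (auto intro!: power_mono AE_I_conv)
qed

section \<open>Test functions and the lemma of du Bois-Reymond\<close>

abbreviation "dv h \<equiv> \<lambda>x. vector_derivative h (at x)"

lemma test_D:
 assumes "h \<in> test_functions L"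
 shows "continuous_on UNIV (dv h)" "!!x. (h has_vector_derivative dv h x) (at x)" "continuous_on UNIV h"
  "x \<le> 0 ==> h x = 0" "L \<le> x ==> h x = 0" "dv h \<in> sqi I" "h \<in> sqi I"
  "0 \<le> x ==> x \<le> L ==> prim (dv h) x = h x" "(LINT x|I. dv h x) = 0"
proof -
 obtain a b where ab: "0 < a" "b < L" "!!x. x \<notin> {a..b} ==> h x = 0"
  and C: "h C1_differentiable_on UNIV" using assms by (auto simp: test_functions_def)
 show c: "continuous_on UNIV (dv h)" using C by (simp add: C1_differentiable_on_eq)
 show d: "(h has_vector_derivative dv h x) (at x)" for x
  using C by (simp add: C1_differentiable_on_eq vector_derivative_works)
 show hc: "continuous_on UNIV h"
  unfolding continuous_on_eq_continuous_within using has_vector_derivative_continuous[OF d] by blast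
 show h0: "x \<le> 0 ==> h x = 0" for x using ab by auto
 show hL: "L \<le> x ==> h x = 0" for x using ab by auto
 show "dv h \<in> sqi I" "h \<in> sqi I" using c hc cont_sqi by auto
 show p: "0 \<le> x ==> x \<le> L ==> prim (dv h) x = h x" for x using prim_of_cont[OF c d] h0[of 0] by simp
 show "(LINT x|I. dv h x) = 0" using p[of L] hL[of L] L_pos prim_L[of L "dv h"] by simp
qed

text \<open>The primitive vanishes left of the support by construction and right of it because the
  mean is 0.\<close>

lemma test_from_cont:
 assumes w: "continuous_on UNIV w" and ab: "0 < a" "a < b" "b < L" and 0: "!!x. x \<notin> {a..b} ==> w x = 0"
  and int: "(LINT x|I. w x) = 0"
 obtains h where "h \<in> test_functions L" "dv h = w"
proof -
 define h where "h = (\<lambda>x. integral {0..x} w)"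
 have wi: "w integrable_on {c..d}" for c d
  using continuous_on_subset[OF w] by (intro integrable_continuous_real) auto
 have h_left: "h x = 0" if "x < a" for x
  unfolding h_def using 0 that by (intro integral_unique has_integral_is_0) auto
 have d_pos: "(h has_vector_derivative w x) (at x)" if "x > 0" for x
 proof -
  have "(h has_vector_derivative w x) (at x within {0..x+1})"
   unfolding h_def using that continuous_on_subset[OF w] by (intro integral_has_vector_derivative) auto
  then have "(h has_vector_derivative w x) (at x within {0<..<x+1})"
   by (rule has_vector_derivative_within_subset) auto
  moreover have "at x within {0<..<x+1} = at x" by (rule at_within_open) (use that in auto)
  ultimately show ?thesis by simp
 qed
 have d: "(h has_vector_derivative w x) (at x)" for x
 proof (cases "x > 0")
  case False
  have "w x = 0" using 0 False ab by simp
  moreover have "(h has_vector_derivative 0) (at x)"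
   by (rule has_vector_derivative_transform_within_open[of "\<lambda>_. 0" _ _ "{..<a}"])
    (use False ab h_left in auto)
  ultimately show ?thesis by simp
 qed (rule d_pos)
 have h_right: "h x = 0" if "x > b" for x
 proof -
  have "h x = h L"
  proof -
   have "integral {0..max x L} w = integral {0..y} w" if "b < y" "y \<le> max x L" for y
   proof -
    have "integral {0..y} w + integral {y..max x L} w = integral {0..max x L} w"
     using that ab by (intro Henstock_Kurzweil_Integration.integral_combine wi) auto
    moreover have "integral {y..max x L} w = 0" using 0 that by (intro integral_unique has_integral_is_0) auto
    ultimately show ?thesis by simp
   qed
   from this[of x] this[of L] show ?thesis using that ab by (simp add: h_def)
  qed
  also have "h L = prim w L" using prim_of_cont[OF w d, of L] L_pos h_left[of 0] ab by simp
  also have "\<dots> = 0" using int prim_L[of L w] by simp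
  finally show ?thesis .
 qed
 have "h \<in> test_functions L" unfolding test_functions_def C1_differentiable_on_def
 proof (intro CollectI conjI)
  show "\<exists>a b. 0 < a \<and> b < L \<and> (\<forall>x. x \<notin> {a..b} --> h x = 0)"
   using ab h_left h_right by (metis atLeastAtMost_iff not_le)
 qed (use d w in auto)
 moreover have "dv h = w" using d vector_derivative_at by blast
 ultimately show ?thesis using that by blast
qed

end

context interval
begin

lemma test_I:
 assumes "!!x. (h has_vector_derivative w x) (at x)" "continuous_on UNIV w" "0 < a" "b < L"
  "!!x. x \<notin> {a..b} ==> h x = 0"
 shows "h \<in> test_functions L \<and> dv h = w"
proof
 show "dv h = w" using vector_derivative_at[OF assms(1)] by blast
 show "h \<in> test_functions L" unfolding test_functions_def C1_differentiable_on_def using assms by blast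
qed

lemma test_scale:
 assumes h: "h \<in> test_functions L"
 shows "(\<lambda>x. c * h x) \<in> test_functions L \<and> dv (\<lambda>x. c * h x) = (\<lambda>x. c * dv h x)"
proof -
 obtain a b where ab: "0 < a" "b < L" "!!x. x \<notin> {a..b} ==> h x = 0"
  using h by (auto simp: test_functions_def)
 show ?thesis
 proof (rule test_I[OF _ _ ab(1,2)])
  show "((\<lambda>x. c * h x) has_vector_derivative c * dv h x) (at x)" for x
   using test_D(2)[OF h] by (rule has_vector_derivative_mult_right)
  show "continuous_on UNIV (\<lambda>x. c * dv h x)" using test_D(1)[OF h] by (intro continuous_intros)
  show "c * h x = 0" if "x \<notin> {a..b}" for x using ab(3)[OF that] by simp
 qed
qed

lemma test_add:
 assumes h: "h \<in> test_functions L" and k: "k \<in> test_functions L"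
 shows "(\<lambda>x. h x + k x) \<in> test_functions L \<and> dv (\<lambda>x. h x + k x) = (\<lambda>x. dv h x + dv k x)"
proof -
 obtain a b where ab: "0 < a" "b < L" "!!x. x \<notin> {a..b} ==> h x = 0"
  using h by (auto simp: test_functions_def)
 obtain a' b' where ab': "0 < a'" "b' < L" "!!x. x \<notin> {a'..b'} ==> k x = 0"
  using k by (auto simp: test_functions_def)
 show ?thesis
 proof (rule test_I)
  show "((\<lambda>x. h x + k x) has_vector_derivative dv h x + dv k x) (at x)" for x
   using test_D(2)[OF h] test_D(2)[OF k] by (rule has_vector_derivative_add)
  show "continuous_on UNIV (\<lambda>x. dv h x + dv k x)" using test_D(1)[OF h] test_D(1)[OF k] by (intro continuous_intros)
  show "0 < min a a'" "max b b' < L" using ab ab' by auto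
  show "h x + k x = 0" if "x \<notin> {min a a'..max b b'}" for x
  proof -
   have "x \<notin> {a..b}" "x \<notin> {a'..b'}" using that by auto
   then show ?thesis using ab(3) ab'(3) by simp
  qed
 qed
qed

lemma test_zero: "(\<lambda>_. 0) \<in> test_functions L \<and> dv (\<lambda>_. 0) = (\<lambda>_. 0)"
 using test_I[of "\<lambda>_. 0" "\<lambda>_. 0" "L/2" "L/2"] L_pos by simp

lemmas dv_scale = fun_cong[OF conjunct2[OF test_scale]]

text \<open>A trapezoid with slopes \<open>n\<close> at the ends, increasing to the indicator of the
  open interval. Being continuous with compact support, combinations of mean zero are derivatives of
  test functions.\<close>

definition trap :: "real => real => nat => real => complex" where
 "trap a b n x = complex_of_real (min 1 (real n * max 0 (min (x - a) (b - x))))"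

lemma trap_cont: "continuous_on UNIV (trap a b n)" unfolding trap_def by (intro continuous_intros)

lemma trap_zero: "x \<notin> {a..b} ==> trap a b n x = 0" by (auto simp: trap_def)

lemma trap_norm: "cmod (trap a b n x) \<le> 1"
proof -
 have "0 \<le> real n * max 0 (min (x - a) (b - x))" by simp
 then show ?thesis by (simp add: trap_def)
qed

lemma trap_limit:
 assumes g: "integrable I g" and ab: "a < b"
 shows "(\<lambda>n. LINT x|I. g x * trap a b n x) \<longlonglongrightarrow> prim g b - prim g a"
proof -
 have [measurable]: "g \<in> borel_measurable I" using g by auto
 have [measurable]: "trap a b n \<in> borel_measurable I" for n using trap_cont cont_meas by blast
 have "(\<lambda>n. LINT x|I. g x * trap a b n x) \<longlonglongrightarrow> (LINT x|I. (if a < x \<and> x < b then g x else 0))"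
 proof (rule integral_dominated_convergence)
  show "integrable I (\<lambda>x. cmod (g x))" using g by simp
  have "(\<lambda>n. trap a b n x) \<longlonglongrightarrow> (if a < x \<and> x < b then 1 else 0)" for x
  proof (cases "a < x \<and> x < b")
   case True
   define d where "d = min (x - a) (b - x)"
   have d: "d > 0" using True by (simp add: d_def)
   obtain N :: nat where N: "1 / d < real N" using reals_Archimedean2 by blast
   have "trap a b n x = 1" if n: "n \<ge> N" for n
   proof -
    have "1 / d \<le> real n" using N n by simp
    then have "1 \<le> real n * d" using d by (simp add: field_simps)
    then show ?thesis using d by (simp add: trap_def d_def)
   qed
   then show ?thesis using True by (intro tendsto_eventually) (auto simp: eventually_sequentially)
  next
   case False
   then have "trap a b n x = 0" for n by (auto simp: trap_def)
   then show ?thesis unfolding if_not_P[OF False] by simp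
  qed
  then have "(\<lambda>n. g x * trap a b n x) \<longlonglongrightarrow> g x * (if a < x \<and> x < b then 1 else 0)" for x
   by (intro tendsto_mult tendsto_const)
  moreover have "g x * (if a < x \<and> x < b then 1 else 0) = (if a < x \<and> x < b then g x else 0)" for x by simp
  ultimately show "AE x in I. (\<lambda>n. g x * trap a b n x) \<longlonglongrightarrow> (if a < x \<and> x < b then g x else 0)" by simp
  show "AE x in I. norm (g x * trap a b n x) \<le> cmod (g x)" for n
   using mult_left_mono[OF trap_norm, of "cmod (g _)"] by (simp add: norm_mult)
 qed measurable
 also have "(LINT x|I. (if a < x \<and> x < b then g x else 0)) =
   (LINT x|I. (if x \<le> b then g x else 0) - (if x \<le> a then g x else 0))"
 proof (rule integral_cong_AE)
  show "AE x in I. (if a < x \<and> x < b then g x else 0) = (if x \<le> b then g x else 0) - (if x \<le> a then g x else 0)"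
   using AE_I_neq[of b] by eventually_elim (use ab in auto)
 qed measurable
 also have "\<dots> = prim g b - prim g a"
  unfolding prim_def by (intro Bochner_Integration.integral_diff integrable_if_le g)
 finally show ?thesis .
qed

text \<open>Testing against mean-zero combinations of two trapezoids shows that the averages of
  \<open>f\<close> over any two compact subintervals agree. With \<open>c\<close> the common
  average, the primitive of \<open>f - c\<close> is constant.\<close>

theorem du_bois_reymond:
 assumes f: "f \<in> sqi I" and 0: "!!h. h \<in> test_functions L ==> (LINT x|I. f x * dv h x) = 0"
 shows "\<exists>c. AE x in I. f x = c"
proof -
 have fi: "integrable I f" using f by (rule fin.sqi_int)
 have ft: "integrable I (\<lambda>x. f x * trap a b n x)" for a b n
  using sqi_mult_integrable[OF f cont_sqi[OF trap_cont]] .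
 have ti: "integrable I (trap a b n)" for a b n using fin.sqi_int[OF cont_sqi[OF trap_cont]] .
 have eq: "(LINT x|I. trap a' b' k x) * (LINT x|I. f x * trap a b n x) =
   (LINT x|I. trap a b n x) * (LINT x|I. f x * trap a' b' k x)"
  if ab: "0 < a" "a < b" "b < L" "0 < a'" "a' < b'" "b' < L" for a b a' b' n k
 proof -
  \<comment> \<open>Cross-weighting by the two integrals makes the mean of \<open>w\<close>
    zero.\<close>
  define m m' where "m = (LINT x|I. trap a b n x)" and "m' = (LINT x|I. trap a' b' k x)"
  define w where "w = (\<lambda>x. m' * trap a b n x - m * trap a' b' k x)"
  have W: "continuous_on UNIV w" unfolding w_def by (intro continuous_intros trap_cont)
  have W0: "w x = 0" if "x \<notin> {min a a'..max b b'}" for x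
   using that trap_zero[of x a b n] trap_zero[of x a' b' k] by (auto simp: w_def min_def max_def split: if_splits)
  have int0: "(LINT x|I. w x) = 0" unfolding w_def using ti by (simp add: m_def m'_def)
  have aa: "0 < min a a'" "min a a' < max b b'" "max b b' < L" using ab by auto
  obtain h where "h \<in> test_functions L" "dv h = w" using test_from_cont[OF W aa W0 int0] by blast
  then have "(LINT x|I. f x * w x) = 0" using 0 by metis
  moreover have "f x * w x = m' * (f x * trap a b n x) - m * (f x * trap a' b' k x)" for x
   by (simp add: w_def algebra_simps)
  ultimately show ?thesis using ft by (simp add: m_def m'_def)
 qed
 have dcr: "(complex_of_real has_vector_derivative 1) (at x)" for x
  using has_vector_derivative_of_real[OF DERIV_ident, of "at x"] by simp
 have p1: "(\<lambda>n. LINT x|I. trap a b n x) \<longlonglongrightarrow> complex_of_real (b - a)" if "0 < a" "a < b" "b < L" for a b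
 proof -
  have "(\<lambda>n. LINT x|I. 1 * trap a b n x) \<longlonglongrightarrow> prim (\<lambda>_. 1) b - prim (\<lambda>_. 1) a"
   using that by (intro trap_limit) auto
  moreover have "prim (\<lambda>_. 1) x = complex_of_real x" if "0 \<le> x" "x \<le> L" for x
   using that prim_of_cont[of "\<lambda>_. 1" complex_of_real x] dcr by simp
  ultimately show ?thesis using that by simp
 qed
 define a0 b0 where "a0 = L / 4" and "b0 = L / 2"
 have ab0: "0 < a0" "a0 < b0" "b0 < L" using L_pos by (auto simp: a0_def b0_def)
 define c where "c = (prim f b0 - prim f a0) / complex_of_real (b0 - a0)"
 have mean: "prim f b - prim f a = complex_of_real (b - a) * c" if ab: "0 < a" "a < b" "b < L" for a b
 proof -
  have "(\<lambda>n. (LINT x|I. trap a0 b0 n x) * (LINT x|I. f x * trap a b n x)) \<longlonglongrightarrow>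
    complex_of_real (b0 - a0) * (prim f b - prim f a)" using ab ab0 by (intro tendsto_mult p1 trap_limit fi)
  moreover have "(\<lambda>n. (LINT x|I. trap a b n x) * (LINT x|I. f x * trap a0 b0 n x)) \<longlonglongrightarrow>
    complex_of_real (b - a) * (prim f b0 - prim f a0)" using ab ab0 by (intro tendsto_mult p1 trap_limit fi)
  ultimately have "complex_of_real (b0 - a0) * (prim f b - prim f a) = complex_of_real (b - a) * (prim f b0 - prim f a0)"
   using eq[OF ab ab0] LIMSEQ_unique by simp
  then show ?thesis using ab0 by (simp add: c_def field_simps)
 qed
 let ?k = "\<lambda>x. f x - c"
 have ki: "integrable I ?k" using fi by simp
 have pk: "prim ?k b = prim ?k a" if ab: "0 < a" "a < b" "b < L" for a b
 proof -
  have "prim (\<lambda>_. c) x = c * complex_of_real x" if "0 \<le> x" "x \<le> L" for x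
   using that prim_of_cont[of "\<lambda>_. c" "\<lambda>x. c * complex_of_real x" x]
    has_vector_derivative_mult_right[OF dcr, of c] by simp
  then have "prim (\<lambda>_. c) a = c * complex_of_real a" "prim (\<lambda>_. c) b = c * complex_of_real b" using ab by auto
  moreover have "prim ?k a = prim f a - prim (\<lambda>_. c) a" "prim ?k b = prim f b - prim (\<lambda>_. c) b"
   using fi by (auto intro!: prim_diff)
  moreover have "prim f b = prim f a + complex_of_real (b - a) * c" using mean[OF ab] by (simp add: algebra_simps)
  ultimately have "prim ?k b = prim f a + complex_of_real (b - a) * c - c * complex_of_real b"
   and "prim ?k a = prim f a - c * complex_of_real a" by simp_all
  moreover have "prim f a + complex_of_real (b - a) * c - c * complex_of_real b = prim f a - c * complex_of_real a"
   by (simp add: algebra_simps)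
  ultimately show ?thesis by metis
 qed
 have "prim ?k x = prim ?k (L/2)" if "0 < x" "x < L" for x
  using pk[of x "L/2"] pk[of "L/2" x] that L_pos by (cases x "L/2" rule: linorder_cases) auto
 then have "AE x in I. prim ?k x = prim ?k (L/2)" by (intro AE_I_conv)
 then have "AE x in I. ?k x = 0" by (rule prim_const_imp_zero[OF ki])
 then have "AE x in I. f x = c" by eventually_elim simp
 then show ?thesis by blast
qed

section \<open>Sobolev spaces characterized by primitives\<close>

lemma weak_deriv_prim:
 assumes d: "d \<in> sqi I" and f: "f \<in> sqi I" and eq: "AE x in I. f x = c + prim d x"
 shows "has_weak_deriv L f d" unfolding has_weak_deriv_def
proof
 fix h assume h: "h \<in> test_functions L"
 note t = test_D[OF h]
 have "(LINT x|I. f x * dv h x) = (LINT x|I. c * dv h x + prim d x * dv h x)" by (rule integral_cong_AE)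
   (use eq sqiD(1)[OF f] sqiD(1)[OF t(6)] sqiD(1)[OF prim_sqi[OF d]] in \<open>auto elim!: eventually_mono simp: algebra_simps\<close>)
 also have "\<dots> = c * (LINT x|I. dv h x) + (LINT x|I. prim d x * dv h x)"
  using fin.sqi_int[OF t(6)] sqi_mult_integrable[OF prim_sqi[OF d] t(6)] by simp
 also have "\<dots> = (LINT x|I. d x * (0 - prim (dv h) x))"
  using prim_adj[OF fin.sqi_int[OF d] fin.sqi_int[OF t(6)]] t(9) by simp
 also have "\<dots> = (LINT x|I. - (d x * h x))" by (intro int_cong) (auto simp: t(8))
 finally show "(LINT x|I. f x * dv h x) = - (LINT x|I. d x * h x)" by simp
qed

text \<open>The function and the primitive of its weak derivative have the same weak derivative, so
  du Bois-Reymond applies to their difference.\<close>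

lemma weak_deriv_imp_prim:
 assumes d: "d \<in> sqi I" and f: "f \<in> sqi I" and wd: "has_weak_deriv L f d"
 shows "\<exists>c. AE x in I. f x = c + prim d x"
proof -
 let ?k = "\<lambda>x. f x - prim d x"
 have "\<exists>c. AE x in I. ?k x = c"
 proof (rule du_bois_reymond)
  show "?k \<in> sqi I" by (intro sqi_ops f prim_sqi d)
  fix h assume h: "h \<in> test_functions L"
  have "has_weak_deriv L (prim d) d" using weak_deriv_prim[OF d prim_sqi[OF d], of 0] by simp
  then have "(LINT x|I. f x * dv h x) = (LINT x|I. prim d x * dv h x)"
   using wd h by (simp add: has_weak_deriv_def)
  then show "(LINT x|I. ?k x * dv h x) = 0"
   using sqi_mult_integrable[OF f test_D(6)[OF h]] sqi_mult_integrable[OF prim_sqi[OF d] test_D(6)[OF h]]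
   by (simp add: left_diff_distrib)
 qed
 then obtain c where "AE x in I. ?k x = c" by blast
 then have "AE x in I. f x = c + prim d x" by eventually_elim (simp add: algebra_simps)
 then show ?thesis by blast
qed

lemma prim_eq_unique:
 assumes i: "integrable I a" "integrable I b" and eq: "AE x in I. c + prim a x = c' + prim b x"
 shows "AE x in I. a x = b x"
proof -
 have "AE x in I. prim (\<lambda>x. a x - b x) x = c' - c"
  using eq by eventually_elim (simp add: prim_diff[OF i] algebra_simps)
 then have "AE x in I. a x - b x = 0" using i by (intro prim_const_imp_zero) auto
 then show ?thesis by eventually_elim simp
qed

lemma H1_D:
 assumes "f \<in> H1 L"
 shows "f \<in> sqi I" "wderiv L f \<in> sqi I" "\<exists>c. AE x in I. f x = c + prim (wderiv L f) x"
proof -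
 have "\<exists>f'. f' \<in> L2 L \<and> has_weak_deriv L f f'" using assms by (auto simp: H1_def)
 then have w: "wderiv L f \<in> L2 L \<and> has_weak_deriv L f (wderiv L f)" unfolding wderiv_def by (rule someI_ex)
 then show 1: "f \<in> sqi I" "wderiv L f \<in> sqi I" using assms by (auto simp: H1_def L2_eq)
 show "\<exists>c. AE x in I. f x = c + prim (wderiv L f) x" using weak_deriv_imp_prim 1 w by blast
qed

lemma H1_I:
 assumes "f \<in> sqi I" "d \<in> sqi I" "AE x in I. f x = c + prim d x"
 shows "f \<in> H1 L" "AE x in I. wderiv L f x = d x"
proof -
 show H: "f \<in> H1 L" using weak_deriv_prim[OF assms(2,1,3)] assms by (auto simp: H1_def L2_eq)
 obtain c' where "AE x in I. f x = c' + prim (wderiv L f) x" using H1_D[OF H] by blast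
 then have "AE x in I. c' + prim (wderiv L f) x = c + prim d x" using assms(3) by eventually_elim simp
 then show "AE x in I. wderiv L f x = d x" using prim_eq_unique[OF fin.sqi_int fin.sqi_int] H1_D[OF H] assms by blast
qed

text \<open>The residual of the projection of \<open>d\<close> onto the derivatives of test functions is constant by
 du Bois-Reymond, and has mean zero.\<close>

lemma test_deriv_dense:
 assumes d: "d \<in> sqi I" and 0: "(LINT x|I. d x) = 0" and e: "e > 0"
 shows "\<exists>h\<in>test_functions L. l2n I (\<lambda>x. d x - dv h x) < e"
proof -
 interpret S: semi_hilbert "sqi I" "rip I" by (rule fin.semi_hilbert_sqi)
 have nrm: "S.nrm = l2n I" by (simp add: fun_eq_iff semi_inner_nrm_sqi)
 let ?V = "dv ` test_functions L"
 have VS: "?V \<subseteq> sqi I" using test_D(6) by blast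
 obtain p where p: "p \<in> sqi I" "!!z. z \<in> ?V ==> rip I z p = rip I z d"
  "!!e. e > 0 ==> \<exists>v\<in>?V. S.nrm (p - v) < e"
 proof (rule S.riesz[of ?V "\<lambda>z. rip I z d" "l2n I d"])
  have "dv (\<lambda>_. 0) \<in> ?V" using test_zero by blast
  then show "0 \<in> ?V" using test_zero by (simp add: zero_fun_def)
  show "x + y \<in> ?V" if xy: "x \<in> ?V" "y \<in> ?V" for x y
  proof -
   obtain h k where hk: "h \<in> test_functions L" "k \<in> test_functions L" and x: "x = dv h" and y: "y = dv k"
    using xy by blast
   have "x + y = dv (\<lambda>u. h u + k u)" unfolding conjunct2[OF test_add[OF hk]] x y plus_fun_def ..
   then show ?thesis using conjunct1[OF test_add[OF hk]] by (rule image_eqI)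
  qed
  show "complex_of_real c *\<^sub>C x \<in> ?V" if x: "x \<in> ?V" for x c
  proof -
   obtain h where h: "h \<in> test_functions L" and xh: "x = dv h" using x by blast
   have "complex_of_real c *\<^sub>C x = dv (\<lambda>u. complex_of_real c * h u)"
    unfolding conjunct2[OF test_scale[OF h]] xh scaleC_fun_def scaleC_complex_def ..
   then show ?thesis using conjunct1[OF test_scale[OF h]] by (rule image_eqI)
  qed
  show "\<bar>rip I x d\<bar> \<le> l2n I d * S.nrm x" if "x \<in> ?V" for x
   using rip_bound[of x I d] that VS d by (auto simp: semi_inner_nrm_sqi mult.commute)
  show "rip I (x + y) d = rip I x d + rip I y d" if "x \<in> ?V" "y \<in> ?V" for x y
   using S.r_add[of x y d] that VS d by blast
  show "rip I (complex_of_real c *\<^sub>C x) d = c * rip I x d" if "x \<in> ?V" for x c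
   using S.r_scale[of x d c] that VS d by blast
 qed (use VS in blast)+
 note pS = p(1)
 have pV: "rip I (dv h) p = rip I (dv h) d" if "h \<in> test_functions L" for h using p(2) that by blast
 have ZE: "\<exists>h\<in>test_functions L. l2n I (\<lambda>x. p x - dv h x) < e" if "e > 0" for e
  using p(3)[OF that] by (auto simp: nrm fun_diff_def)
 \<comment> \<open>The conjugate turns the real inner product with \<open>d - p\<close> into the
   real part of the bilinear pairing in \<open>du_bois_reymond\<close>.\<close>
 define u where "u = (\<lambda>x. cnj (d x - p x))"
 have uS: "u \<in> sqi I" unfolding u_def by (intro sqi_ops d pS)
 have "\<exists>c. AE x in I. u x = c"
 proof (rule du_bois_reymond[OF uS])
  fix h assume h: "h \<in> test_functions L"
  have re: "Re (LINT x|I. u x * dv k x) = 0" if k: "k \<in> test_functions L" for k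
  proof -
   have "rip I (dv k) (\<lambda>x. d x - p x) = 0"
    using pV[OF k] rip_diff_right'[OF d pS test_D(6)[OF k]] by simp
   then show ?thesis using test_D(6)[OF k] d pS by (simp add: rip_eq_Re sqi_diff' u_def mult.commute)
  qed
  \<comment> \<open>Orthogonality is known for real parts only; the test function
    \<open>\<i> h\<close> supplies the imaginary part.\<close>
  have "Re (\<i> * (LINT x|I. u x * dv h x)) = 0"
   using re[of "\<lambda>x. \<i> * h x"] test_scale[OF h, of "\<i>"] dv_scale[OF h, of "\<i>"]
   by (simp add: mult.left_commute[of _ "\<i>"] del: times_complex.sel)
  then have "Im (LINT x|I. u x * dv h x) = 0" by simp
  then show "(LINT x|I. u x * dv h x) = 0" using re[OF h] by (simp add: complex_eq_iff)
 qed
 then obtain c where c: "AE x in I. u x = c" by blast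
 have p0: "(LINT x|I. p x) = 0"
 proof -
  have "cmod (LINT x|I. p x) \<le> 0 + e" if e: "e > 0" for e
  proof -
   have "e / sqrt L > 0" using e L_pos by simp
   then obtain h where h: "h \<in> test_functions L" "l2n I (\<lambda>x. p x - dv h x) < e / sqrt L"
    using ZE by blast
   have "(LINT x|I. p x) = (LINT x|I. p x - dv h x)"
    using fin.sqi_int[OF pS] fin.sqi_int[OF test_D(6)[OF h(1)]] test_D(9)[OF h(1)] by simp
   also have "cmod \<dots> \<le> sqrt L * l2n I (\<lambda>x. p x - dv h x)"
    using fin.integral_le_l2n[OF sqi_diff'[OF pS test_D(6)[OF h(1)]]] by simp
   also have "\<dots> \<le> sqrt L * (e / sqrt L)" using h L_pos by (intro mult_left_mono) auto
   finally show ?thesis using L_pos by simp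
  qed
  then have "cmod (LINT x|I. p x) \<le> 0" by (rule field_le_epsilon)
  then show ?thesis by simp
 qed
 have "(LINT x|I. u x) = 0" unfolding u_def using fin.sqi_int[OF d] fin.sqi_int[OF pS] 0 p0 by simp
 moreover have "(LINT x|I. u x) = (LINT x|I. c)" using c sqiD(1)[OF uS] by (intro integral_cong_AE) auto
 ultimately have "c = 0" using L_pos by simp
 have dp: "AE x in I. p x = d x" using c unfolding u_def \<open>c = 0\<close> by eventually_elim simp
 obtain h where h: "h \<in> test_functions L" "l2n I (\<lambda>x. p x - dv h x) < e" using ZE[OF e] by blast
 have "l2n I (\<lambda>x. d x - dv h x) = l2n I (\<lambda>x. p x - dv h x)"
  by (rule l2n_cong) (use dp sqi_diff'[OF pS test_D(6)[OF h(1)]] sqi_diff'[OF d test_D(6)[OF h(1)]] sqiD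
    in \<open>auto elim!: eventually_mono\<close>)
 then show ?thesis using h by (intro bexI[of _ h]) simp_all
qed

text \<open>For test functions the derivative has mean zero and the additive constant is 0. Both
  properties are continuous in the norm of \<open>H1\<close> and so pass to the closure.\<close>

lemma H10_D:
 assumes f: "f \<in> H10 L"
 shows "f \<in> H1 L" "f \<in> sqi I" "wderiv L f \<in> sqi I" "(LINT x|I. wderiv L f x) = 0"
  "AE x in I. f x = prim (wderiv L f) x"
proof -
 show H1: "f \<in> H1 L" using f by (simp add: H10_def)
 show fS: "f \<in> sqi I" and dS: "wderiv L f \<in> sqi I" using H1_D[OF H1] by auto
 let ?d = "wderiv L f"
 obtain c where c: "AE x in I. f x = c + prim ?d x" using H1_D[OF H1] by blast
 have appr: "\<exists>h\<in>test_functions L. l2n I (\<lambda>x. f x - h x) < e \<and> l2n I (\<lambda>x. ?d x - dv h x) < e" if e: "e > 0" for e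
 proof -
  obtain h where h: "h \<in> test_functions L" "H1norm L (f - h) < e" using f e by (auto simp: H10_def)
  have i: "integrable I ?d" "integrable I (dv h)" using fin.sqi_int dS test_D(6)[OF h(1)] by auto
  have w: "AE x in I. wderiv L (f - h) x = ?d x - dv h x"
  proof (rule H1_I(2)[of _ _ c])
   show "f - h \<in> sqi I" using sqi_diff[OF fS test_D(7)[OF h(1)]] .
   show "(\<lambda>x. ?d x - dv h x) \<in> sqi I" by (intro sqi_ops dS test_D(6) h)
   have "AE x in I. prim (dv h) x = h x" using test_D(8)[OF h(1)] by (intro AE_I_conv) auto
   then show "AE x in I. (f - h) x = c + prim (\<lambda>x. ?d x - dv h x) x"
    using c by eventually_elim (simp add: prim_diff[OF i])
  qed
  have fh: "f - h \<in> H1 L"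
  proof (rule H1_I(1)[of _ _ c])
   show "f - h \<in> sqi I" using sqi_diff[OF fS test_D(7)[OF h(1)]] .
   show "(\<lambda>x. ?d x - dv h x) \<in> sqi I" by (intro sqi_ops dS test_D(6) h)
   have "AE x in I. prim (dv h) x = h x" using test_D(8)[OF h(1)] by (intro AE_I_conv) auto
   then show "AE x in I. (f - h) x = c + prim (\<lambda>x. ?d x - dv h x) x"
    using c by eventually_elim (simp add: prim_diff[OF i])
  qed
  have "l2n I (wderiv L (f - h)) = l2n I (\<lambda>x. ?d x - dv h x)"
   by (rule l2n_cong[OF sqi_diff'[OF dS test_D(6)[OF h(1)]] sqiD(1)[OF H1_D(2)[OF fh]] w])
  then have n: "sqrt ((l2n I (\<lambda>x. f x - h x))\<^sup>2 + (l2n I (\<lambda>x. ?d x - dv h x))\<^sup>2) < e"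
   using h(2) by (simp add: H1norm_def L2norm_eq fun_diff_def)
  have "l2n I (\<lambda>x. f x - h x) \<le> sqrt ((l2n I (\<lambda>x. f x - h x))\<^sup>2 + (l2n I (\<lambda>x. ?d x - dv h x))\<^sup>2)"
   "l2n I (\<lambda>x. ?d x - dv h x) \<le> sqrt ((l2n I (\<lambda>x. f x - h x))\<^sup>2 + (l2n I (\<lambda>x. ?d x - dv h x))\<^sup>2)"
   by (auto intro!: real_le_rsqrt)
  then show ?thesis using n h(1) by (meson le_less_trans)
 qed
 have "cmod (LINT x|I. ?d x) \<le> 0 + e" if e: "e > 0" for e
 proof -
  have "e / sqrt L > 0" using e L_pos by simp
  then obtain h where h: "h \<in> test_functions L" "l2n I (\<lambda>x. ?d x - dv h x) < e / sqrt L"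
   using appr by blast
  have "(LINT x|I. ?d x) = (LINT x|I. ?d x - dv h x)"
   using fin.sqi_int[OF dS] fin.sqi_int[OF test_D(6)[OF h(1)]] test_D(9)[OF h(1)] by simp
  also have "cmod \<dots> \<le> sqrt L * l2n I (\<lambda>x. ?d x - dv h x)"
   using fin.integral_le_l2n[OF sqi_diff'[OF dS test_D(6)[OF h(1)]]] by simp
  also have "\<dots> \<le> sqrt L * (e / sqrt L)" using h L_pos by (intro mult_left_mono) auto
  finally show ?thesis using L_pos by simp
 qed
 then have "cmod (LINT x|I. ?d x) \<le> 0" by (rule field_le_epsilon)
 then show "(LINT x|I. ?d x) = 0" by simp
 \<comment> \<open>The constant equals \<open>(f - h) - prim (wderiv L f - dv h)\<close> almost
   everywhere, whose norm is below \<open>(1 + L) * (e / (1 + L))\<close>.\<close>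
 have "cmod c * sqrt L \<le> 0 + e" if e: "e > 0" for e
 proof -
  have "e / (1 + L) > 0" using e L_pos by simp
  then obtain h where h: "h \<in> test_functions L" "l2n I (\<lambda>x. f x - h x) < e / (1 + L)"
   "l2n I (\<lambda>x. ?d x - dv h x) < e / (1 + L)" using appr by blast
  have i: "integrable I ?d" "integrable I (dv h)" using fin.sqi_int dS test_D(6)[OF h(1)] by auto
  have dd: "(\<lambda>x. ?d x - dv h x) \<in> sqi I" by (intro sqi_ops dS test_D(6) h)
  have ff: "(\<lambda>x. f x - h x) \<in> sqi I" by (intro sqi_ops fS test_D(7) h)
  have "AE x in I. prim (dv h) x = h x" using test_D(8)[OF h(1)] by (intro AE_I_conv) auto
  then have "AE x in I. c = (f x - h x) - prim (\<lambda>x. ?d x - dv h x) x"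
   using c by eventually_elim (simp add: prim_diff[OF i])
  then have "l2n I (\<lambda>_. c) = l2n I (\<lambda>x. (f x - h x) - prim (\<lambda>x. ?d x - dv h x) x)"
   using sqi_diff'[OF ff prim_sqi[OF dd]] by (intro l2n_cong) auto
  also have "\<dots> \<le> l2n I (\<lambda>x. f x - h x) + l2n I (prim (\<lambda>x. ?d x - dv h x))"
   by (rule l2n_triangle_diff[OF ff prim_sqi[OF dd]])
  also have "\<dots> \<le> e / (1 + L) + L * (e / (1 + L))"
   using h(2,3) l2n_prim[OF dd] L_pos mult_left_mono[of "l2n I (\<lambda>x. ?d x - dv h x)" "e / (1 + L)" L] by linarith
  also have "\<dots> = (1 + L) * (e / (1 + L))" by (simp only: distrib_right mult_1)
  also have "\<dots> = e" using L_pos by simp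
  finally show ?thesis by (simp add: l2n_const_I)
 qed
 then have "cmod c * sqrt L \<le> 0" by (rule field_le_epsilon)
 then have "c = 0" using L_pos by (simp add: mult_le_0_iff)
 then show "AE x in I. f x = prim ?d x" using c by simp
qed

text \<open>Approximating the derivative by derivatives of test functions approximates the function
  too, as taking primitives costs a factor \<open>L\<close>; hence the tolerance
  \<open>e / (2 * (1 + L))\<close>.\<close>

lemma H10_I:
 assumes f: "f \<in> sqi I" and d: "d \<in> sqi I" and 0: "(LINT x|I. d x) = 0" and eq: "AE x in I. f x = prim d x"
 shows "f \<in> H10 L" "AE x in I. wderiv L f x = d x"
proof -
 have H1: "f \<in> H1 L" and w: "AE x in I. wderiv L f x = d x" using H1_I[of f d 0] assms by auto
 show "AE x in I. wderiv L f x = d x" by (rule w)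
 show "f \<in> H10 L" unfolding H10_def
 proof (intro CollectI conjI allI impI H1)
  fix e :: real assume e: "e > 0"
  have "e / (2 * (1 + L)) > 0" using e L_pos by simp
  then obtain h where h: "h \<in> test_functions L" "l2n I (\<lambda>x. d x - dv h x) < e / (2 * (1 + L))"
   using test_deriv_dense[OF d 0] by blast
  let ?D = "\<lambda>x. d x - dv h x"
  have i: "integrable I d" "integrable I (dv h)" using fin.sqi_int d test_D(6)[OF h(1)] by auto
  have dd: "?D \<in> sqi I" by (intro sqi_ops d test_D(6) h)
  have ff: "f - h \<in> sqi I" using sqi_diff[OF f test_D(7)[OF h(1)]] .
  have "AE x in I. prim (dv h) x = h x" using test_D(8)[OF h(1)] by (intro AE_I_conv) auto
  then have fh: "AE x in I. (f - h) x = 0 + prim ?D x" using eq by eventually_elim (simp add: prim_diff[OF i])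
  note W = H1_I[OF ff dd fh]
  have "l2n I (wderiv L (f - h)) = l2n I ?D" by (rule l2n_cong[OF dd sqiD(1)[OF H1_D(2)[OF W(1)]] W(2)])
  moreover have "l2n I (f - h) = l2n I (prim ?D)"
   by (rule l2n_cong[OF prim_sqi[OF dd] sqiD(1)[OF ff]]) (use fh in \<open>auto elim!: eventually_mono\<close>)
  ultimately have "H1norm L (f - h) = sqrt ((l2n I (prim ?D))\<^sup>2 + (l2n I ?D)\<^sup>2)"
   by (simp add: H1norm_def L2norm_eq)
  also have "\<dots> \<le> l2n I (prim ?D) + l2n I ?D" by (rule sqrt_sum_squares_le_sum) auto
  also have "\<dots> \<le> (1 + L) * l2n I ?D" using l2n_prim[OF dd] by (simp add: algebra_simps)
  also have "\<dots> \<le> (1 + L) * (e / (2 * (1 + L)))" using h L_pos by (intro mult_left_mono) auto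
  also have "\<dots> = e / 2" using L_pos by (simp add: divide_simps)
  also have "\<dots> < e" using e by simp
  finally show "\<exists>h\<in>test_functions L. H1norm L (f - h) < e" using h(1) by blast
 qed
qed

text \<open>There are no boundary terms: the mean of \<open>wderiv L k\<close> is zero, which
  removes both the additive constant of \<open>f\<close> and the value at \<open>L\<close>.\<close>

lemma integration_by_parts:
 assumes f: "f \<in> H1 L" and k: "k \<in> H10 L"
 shows "rip I (wderiv L f) k = - rip I f (wderiv L k)"
proof -
 note F = H1_D[OF f] and K = H10_D[OF k]
 obtain c where c: "AE x in I. f x = c + prim (wderiv L f) x" using F by blast
 let ?d = "wderiv L f" and ?e = "wderiv L k"
 have "rip I f ?e = rip I (\<lambda>x. c + prim ?d x) ?e"
  using c F K by (intro rip_cong) (auto intro!: sqi_ops prim_sqi)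
 also have "\<dots> = rip I (\<lambda>_. c) ?e + rip I (prim ?d) ?e"
  using F K by (intro rip_add') (auto intro!: prim_sqi)
 also have "rip I (\<lambda>_. c) ?e = 0" using K by (simp add: rip_eq_Re)
 also have "rip I (prim ?d) ?e = - rip I ?d (prim ?e)" using rip_prim F K by blast
 also have "rip I ?d (prim ?e) = rip I ?d k" using K F by (intro rip_cong) (auto intro!: prim_sqi)
 finally show ?thesis by simp
qed

lemma poincare_H10: "f \<in> H10 L ==> l2n I f \<le> L * l2n I (wderiv L f)"
 using l2n_prim[OF H10_D(3)] l2n_cong[OF prim_sqi[OF H10_D(3)] sqiD(1)[OF H10_D(2)] H10_D(5)] by metis

text \<open>The primitive of mean zero. Elements of \<open>H1star\<close> are recovered from their
  derivative by it, just as those of \<open>H10\<close> are by \<open>prim\<close>.\<close>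

definition mprim :: "(real => complex) => real => complex" where
 "mprim d x = prim d x - (LINT y|I. prim d y) / complex_of_real L"

lemma mprim_sqi: "d \<in> sqi I ==> mprim d \<in> sqi I"
 unfolding mprim_def[abs_def] by (intro sqi_ops prim_sqi) auto

lemma mprim_mean: "d \<in> sqi I ==> (LINT x|I. mprim d x) = 0"
 unfolding mprim_def[abs_def] using fin.sqi_int[OF prim_sqi] L_pos by (simp add: scaleR_conv_of_real)

lemma l2n_mprim:
 assumes d: "d \<in> sqi I"
 shows "l2n I (mprim d) \<le> 2 * L * l2n I d"
proof -
 let ?m = "(LINT y|I. prim d y) / complex_of_real L"
 have "l2n I (mprim d) \<le> l2n I (prim d) + l2n I (\<lambda>_. ?m)"
  unfolding mprim_def[abs_def] using d by (intro l2n_triangle_diff prim_sqi) auto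
 also have "l2n I (\<lambda>_. ?m) = cmod (LINT y|I. prim d y) / L * sqrt L"
  using L_pos by (simp add: l2n_const_I norm_divide)
 also have "\<dots> \<le> sqrt L * l2n I (prim d) / L * sqrt L"
  using fin.integral_le_l2n[OF prim_sqi[OF d]] L_pos by (intro mult_right_mono divide_right_mono) auto
 also have "\<dots> = l2n I (prim d)" using L_pos by (simp add: field_simps)
 finally show ?thesis using l2n_prim[OF d] by simp
qed

lemma H1star_D:
 assumes "f \<in> H1star L"
 shows "f \<in> H1 L" "f \<in> sqi I" "wderiv L f \<in> sqi I" "(LINT x|I. f x) = 0" "AE x in I. f x = mprim (wderiv L f) x"
proof -
 show H1: "f \<in> H1 L" using assms by (simp add: H1star_def)
 show S: "f \<in> sqi I" "wderiv L f \<in> sqi I" using H1_D[OF H1] by auto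
 show 0: "(LINT x|I. f x) = 0" using assms by (simp add: H1star_def L2star_def)
 obtain c where c: "AE x in I. f x = c + prim (wderiv L f) x" using H1_D[OF H1] by blast
 have p: "prim (wderiv L f) \<in> sqi I" using S prim_sqi by blast
 have "(LINT x|I. f x) = (LINT x|I. c + prim (wderiv L f) x)"
  using c sqiD(1)[OF S(1)] sqiD(1)[OF p] by (intro integral_cong_AE) auto
 also have "\<dots> = complex_of_real L * c + (LINT x|I. prim (wderiv L f) x)"
  using fin.sqi_int[OF p] by (simp add: scaleR_conv_of_real)
 finally have "c = - ((LINT x|I. prim (wderiv L f) x) / complex_of_real L)"
  using 0 L_pos by (simp add: field_simps eq_neg_iff_add_eq_0 add.commute)
 then show "AE x in I. f x = mprim (wderiv L f) x" using c by (simp add: mprim_def)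
qed

lemma H1star_I:
 assumes f: "f \<in> sqi I" and d: "d \<in> sqi I" and eq: "AE x in I. f x = mprim d x"
 shows "f \<in> H1star L" "AE x in I. wderiv L f x = d x"
proof -
 have "AE x in I. f x = - ((LINT y|I. prim d y) / complex_of_real L) + prim d x" using eq by (simp add: mprim_def)
 note H = H1_I[OF f d this]
 have "(LINT x|I. f x) = (LINT x|I. mprim d x)"
  using eq sqiD(1)[OF f] sqiD(1)[OF mprim_sqi[OF d]] by (intro integral_cong_AE) auto
 then show "f \<in> H1star L" using H f mprim_mean[OF d] by (simp add: H1star_def L2star_def L2_eq)
 show "AE x in I. wderiv L f x = d x" by (rule H)
qed

lemma poincare_H1star: "f \<in> H1star L ==> l2n I f \<le> 2 * L * l2n I (wderiv L f)"
 using l2n_mprim[OF H1star_D(3)] l2n_cong[OF mprim_sqi[OF H1star_D(3)] sqiD(1)[OF H1star_D(2)] H1star_D(5)] by metis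

end

section \<open>The memory space\<close>

text \<open>The integral defining \<open>Lg2\<close> is over the completed measure, since the slice
  norms of chosen derivatives agree with a Borel function only almost everywhere.\<close>

lemma lebesgue_measurable_AE:
 fixes f h :: "real => real"
 assumes f: "f \<in> borel_measurable lebesgue" and eq: "AE x in lebesgue. f x = h x"
 shows "h \<in> borel_measurable lebesgue"
proof (rule measurableI)
 fix A :: "real set" assume A: "A \<in> sets borel"
 show "h -` A \<inter> space lebesgue \<in> sets lebesgue"
 proof (rule completion.in_sets_AE)
  show "f -` A \<inter> space lebesgue \<in> sets lebesgue" using f A by (rule measurable_sets)
  show "AE x in lebesgue. (x \<in> f -` A \<inter> space lebesgue) \<longleftrightarrow> (x \<in> h -` A \<inter> space lebesgue)"
   using eq by eventually_elim simp
 qed simp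
qed simp

lemma (in pair_sigma_finite) integrable_fst_only:
 assumes "finite_measure M2" "integrable M1 (w :: 'a => real)"
 shows "integrable (M1 \<Otimes>\<^sub>M M2) (\<lambda>p. w (fst p))"
proof -
 interpret f2: finite_measure M2 by (rule assms(1))
 show ?thesis
 proof (rule Fubini_integrable)
  have [measurable]: "w \<in> borel_measurable M1" using assms(2) by simp
  show "(\<lambda>p. w (fst p)) \<in> borel_measurable (M1 \<Otimes>\<^sub>M M2)" by measurable
 qed (use assms in auto)
qed

lemma (in interval) rip_coprim:
 assumes f: "f \<in> sqi I" and k: "k \<in> sqi I"
 shows "rip I (prim f) k = rip I f (\<lambda>x. (LINT y|I. k y) - prim k x)"
proof -
 have k': "(\<lambda>x. cnj (k x)) \<in> sqi I" using k by (rule sqi_cnj)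
 have "(\<lambda>x. (LINT y|I. k y) - prim k x) \<in> sqi I" by (intro sqi_ops prim_sqi k) auto
 then show ?thesis using prim_adj[OF fin.sqi_int[OF f] fin.sqi_int[OF k']] f k
  by (simp add: rip_eq_Re prim_sqi prim_cnj)
qed

text \<open>The differential inequality for the kernel is kept in integrated form, which yields both
  monotonicity and the exponential weight in Hardy's inequality.\<close>

locale memory = interval L for L :: real +
 fixes g :: "real => real" and \<kappa>1 :: real
 assumes kappa1_pos: "\<kappa>1 > 0"
  and g_ge0: "s \<ge> 0 ==> g s \<ge> 0"
  and g_int: "set_integrable lborel {0..} g"
  and g_cont: "continuous_on {0..} g"
  and g_decay: "[|0 \<le> r; r \<le> s|] ==> g s \<le> exp (- \<kappa>1 * (s - r)) * g r"
begin

section \<open>The weighted half line and its product with the interval\<close>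

definition R :: "real measure" where "R = restrict_space lborel {0..}"
text \<open>The weight is absorbed into a finite measure: \<open>AE s in G\<close> speaks about
  almost all \<open>s\<close> with \<open>g s > 0\<close>, and the joint derivative of a history is
  an element of \<open>L2\<close> of the finite measure \<open>P\<close>.\<close>

definition G :: "real measure" where "G = density R (\<lambda>s. ennreal (g s))"

lemma space_R [simp]: "space R = {0..}" by (simp add: R_def space_restrict_space)
lemma space_G [simp]: "space G = {0..}" by (simp add: G_def)
lemma sets_G [measurable_cong]: "sets G = sets R" by (simp add: G_def)
lemma space_in_R [simp]: "{0..} \<in> sets R" using sets.top[of R] by simp

lemma meas_G: "f \<in> borel_measurable G \<longleftrightarrow> f \<in> borel_measurable R"
 unfolding measurable_cong_sets[OF sets_G refl] ..

lemma g_meas [measurable]: "g \<in> borel_measurable R"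
proof -
 have "sets R = sets (restrict_space borel {0..})" unfolding R_def by (rule sets_restrict_space_cong) simp
 then show ?thesis
  using borel_measurable_continuous_on_restrict[OF g_cont] measurable_cong_sets[OF _ refl] by blast
qed

lemma id_meas_R [measurable]: "(\<lambda>x. x) \<in> borel_measurable R"
 unfolding R_def by (rule measurable_restrict_space1) simp

lemma AE_R: "(AE s in R. Q s) \<longleftrightarrow> (AE s in lborel. 0 \<le> s --> Q s)"
 unfolding R_def by (subst AE_restrict_space_iff) auto

lemma AE_G': "(AE s in G. Q s) \<longleftrightarrow> (AE s in R. 0 < g s --> Q s)"
 unfolding G_def by (subst AE_density) auto

lemma AE_G: "(AE s in G. Q s) \<longleftrightarrow> (AE s in lborel. 0 \<le> s \<and> 0 < g s --> Q s)"
 unfolding AE_G' AE_R by (intro arg_cong2[where f = eventually] refl) auto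

lemma integral_R: "(LINT s|R. f s) = (LINT s|lborel. indicator {0..} s *\<^sub>R f s)"
 for f :: "real => 'b::{banach, second_countable_topology}" unfolding R_def by (rule integral_restrict_space) simp

lemma integrable_R: "integrable R f \<longleftrightarrow> integrable lborel (\<lambda>s. indicator {0..} s *\<^sub>R f s)"
 for f :: "real => 'b::{banach, second_countable_topology}"
 unfolding R_def by (rule integrable_restrict_space) simp

lemma g_ge0_R: "AE s in R. 0 \<le> g s" using g_ge0 by (intro AE_I2) simp

lemma integral_G: "f \<in> borel_measurable R ==> (LINT s|G. f s) = (LINT s|R. g s *\<^sub>R f s)"
 for f :: "real => 'b::{banach, second_countable_topology}"
 unfolding G_def by (rule integral_density[OF _ g_meas g_ge0_R])

lemma integrable_G: "f \<in> borel_measurable R ==> integrable G f \<longleftrightarrow> integrable R (\<lambda>s. g s *\<^sub>R f s)"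
 for f :: "real => 'b::{banach, second_countable_topology}"
 unfolding G_def by (rule integrable_density[OF _ g_meas g_ge0_R])

lemma integral_G_lborel:
 assumes f: "f \<in> borel_measurable R"
 shows "(LINT s:{0..}|lborel. complex_of_real (g s) * f s) = (LINT s|G. f s)"
 unfolding integral_G[OF f] integral_R set_lebesgue_integral_def by (simp add: scaleR_conv_of_real)

lemma g_int_R: "integrable R g" using g_int by (simp add: integrable_R set_integrable_def)

sublocale Gf: finite_measure G
proof (rule finite_measureI)
 have "emeasure G (space G) = (\<integral>\<^sup>+s. ennreal (g s) \<partial>R)"
  unfolding G_def by (subst emeasure_density) (auto intro!: nn_integral_cong simp: indicator_def)
 also have "\<dots> = ennreal (LINT s|R. g s)" using g_int_R g_ge0_R by (rule nn_integral_eq_integral)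
 finally show "emeasure G (space G) \<noteq> \<infinity>" by simp
qed

sublocale pg: pair_sigma_finite G I
 by (simp add: pair_sigma_finite_def Gf.sigma_finite_measure_axioms fin.sigma_finite_measure_axioms)

abbreviation "P \<equiv> G \<Otimes>\<^sub>M I"

sublocale Pf: finite_measure P
 by (rule finite_measure_pair_measure[OF fin.finite_measure_axioms Gf.finite_measure_axioms])

lemma sf_R: "sigma_finite_measure R"
 unfolding R_def by (rule sigma_finite_measure_restrict_space[OF sigma_finite_lborel]) simp

sublocale pR: pair_sigma_finite R I by (simp add: pair_sigma_finite_def sf_R fin.sigma_finite_measure_axioms)

lemma sets_P: "sets P = sets (R \<Otimes>\<^sub>M I)" by (intro sets_pair_measure_cong sets_G refl)

lemma meas_P: "f \<in> borel_measurable P \<longleftrightarrow> f \<in> borel_measurable (R \<Otimes>\<^sub>M I)"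
 unfolding measurable_cong_sets[OF sets_P refl] ..

definition sl :: "(real \<times> real => complex) => real => real => complex" where "sl Z s = (\<lambda>x. Z (s, x))"

lemma sl_meas: "Z \<in> borel_measurable P ==> 0 \<le> s ==> sl Z s \<in> borel_measurable I"
 unfolding sl_def using measurable_compose[OF measurable_Pair1'[of s G I]] by simp

lemma sl_sqi:
 assumes Z: "Z \<in> sqi P"
 shows "AE s in G. sl Z s \<in> sqi I" using pg.AE_integrable_fst'[OF sqiD(2)[OF Z]] AE_space
proof eventually_elim
 case (elim s)
 then show ?case using sl_meas[OF sqiD(1)[OF Z]] by (simp add: sqi_def sl_def)
qed

lemma l2n_sl:
 assumes Z: "Z \<in> sqi P"
 shows "integrable G (\<lambda>s. (l2n I (sl Z s))\<^sup>2)" "(LINT s|G. (l2n I (sl Z s))\<^sup>2) = (l2n P Z)\<^sup>2"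
 using pg.integrable_fst'[OF sqiD(2)[OF Z]] pg.integral_fst'[OF sqiD(2)[OF Z]] by (simp_all add: l2n_sq sl_def)

lemma rip_sl:
 assumes Z: "Z \<in> sqi P" and W: "W \<in> sqi P"
 shows "integrable G (\<lambda>s. rip I (sl Z s) (sl W s))" "(LINT s|G. rip I (sl Z s) (sl W s)) = rip P Z W"
 using pg.integrable_fst'[OF rip_integrable[OF Z W]] pg.integral_fst'[OF rip_integrable[OF Z W]]
 by (simp_all add: rip_def sl_def)

lemma AE_P:
 assumes "{p \<in> space P. Q (fst p) (snd p)} \<in> sets P"
 shows "(AE p in P. Q (fst p) (snd p)) \<longleftrightarrow> (AE s in G. AE x in I. Q s x)"
 using pg.AE_pair_iff[OF assms] by simp

lemma AE_P_eq:
 fixes u v :: "real \<times> real => complex"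
 assumes [measurable]: "u \<in> borel_measurable P" "v \<in> borel_measurable P"
 shows "(AE p in P. u p = v p) \<longleftrightarrow> (AE s in G. AE x in I. sl u s x = sl v s x)"
 using AE_P[of "\<lambda>s x. u (s, x) = v (s, x)"] by (simp add: sl_def)

lemma AE_P_eq_snd:
 fixes u v :: "real \<times> real => complex"
 assumes [measurable]: "u \<in> borel_measurable P" "v \<in> borel_measurable P"
 shows "(AE p in P. u p = v p) \<longleftrightarrow> (AE x in I. AE s in G. u (s, x) = v (s, x))"
 using AE_P[of "\<lambda>s x. u (s, x) = v (s, x)"] pg.AE_commute[of "\<lambda>s x. u (s, x) = v (s, x)"] by simp

definition primP :: "(real \<times> real => complex) => real \<times> real => complex" where
 "primP Z = (\<lambda>(s, x). prim (sl Z s) x)"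

lemma sl_primP: "sl (primP Z) s = prim (sl Z s)" by (simp add: primP_def sl_def)

lemma primP_meas [measurable]:
 assumes [measurable]: "Z \<in> borel_measurable P"
 shows "primP Z \<in> borel_measurable P" unfolding primP_def prim_def sl_def by measurable

lemma meanP_meas [measurable]:
 fixes Z :: "real \<times> real => complex"
 assumes [measurable]: "Z \<in> borel_measurable P"
 shows "(\<lambda>p. LINT y|I. Z (fst p, y)) \<in> borel_measurable P"
proof -
 have "(\<lambda>q. (fst (fst q), snd q)) \<in> P \<Otimes>\<^sub>M I \<rightarrow>\<^sub>M P" by measurable
 then have "(\<lambda>q. Z (fst (fst q), snd q)) \<in> borel_measurable (P \<Otimes>\<^sub>M I)" using assms by (rule measurable_compose)
 then show ?thesis
  using fin.borel_measurable_lebesgue_integral[of "\<lambda>p y. Z (fst p, y)" P] by (simp add: case_prod_unfold)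
qed

lemma primP_sqi:
 assumes Z: "Z \<in> sqi P"
 shows "primP Z \<in> sqi P"
proof (rule sqi_bound)
 show "primP Z \<in> borel_measurable P" using sqiD(1)[OF Z] by measurable
 show "integrable P (\<lambda>p. L * (l2n I (sl Z (fst p)))\<^sup>2)"
  using pg.integrable_fst_only[OF fin.finite_measure_axioms l2n_sl(1)[OF Z]] by simp
 have [measurable]: "Z \<in> borel_measurable P" using sqiD(1)[OF Z] .
 have l: "(\<lambda>s. l2n I (sl Z s)) \<in> borel_measurable G" unfolding l2n_def sl_def by measurable
 have "AE s in G. AE x in I. (cmod (prim (sl Z s) x))\<^sup>2 \<le> L * (l2n I (sl Z s))\<^sup>2"
  using sl_sqi[OF Z]
 proof eventually_elim
  case (elim s)
  have "(cmod (prim (sl Z s) x))\<^sup>2 \<le> (sqrt L * l2n I (sl Z s))\<^sup>2" for x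
   by (intro power_mono prim_bound_l2n elim) auto
  then show ?case using L_pos by (simp add: power_mult_distrib)
 qed
 moreover have "{p \<in> space P. (cmod (primP Z (fst p, snd p)))\<^sup>2 \<le> L * (l2n I (sl Z (fst p)))\<^sup>2} \<in> sets P"
  using primP_meas[of Z] l by (simp del: space_pair_measure)
 ultimately have "AE p in P. (cmod (primP Z (fst p, snd p)))\<^sup>2 \<le> L * (l2n I (sl Z (fst p)))\<^sup>2"
  using AE_P[of "\<lambda>s x. (cmod (primP Z (s, x)))\<^sup>2 \<le> L * (l2n I (sl Z s))\<^sup>2"] by (simp add: primP_def)
 then show "AE p in P. (cmod (primP Z p))\<^sup>2 \<le> L * (l2n I (sl Z (fst p)))\<^sup>2" by simp
qed

text \<open>For almost every slice this is the integral of \<open>Z (s, y)\<close> over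
  \<open>y\<close> from \<open>x\<close> to \<open>L\<close>; it is the adjoint of
  \<open>primP\<close>.\<close>

definition coP :: "(real \<times> real => complex) => real \<times> real => complex" where
 "coP Z = (\<lambda>p. (LINT y|I. Z (fst p, y)) - primP Z p)"

lemma sl_coP: "sl (coP Z) s = (\<lambda>x. (LINT y|I. sl Z s y) - prim (sl Z s) x)"
 by (simp add: coP_def sl_def primP_def)

lemma meanP_sqi:
 assumes Z: "Z \<in> sqi P"
 shows "(\<lambda>p. LINT y|I. Z (fst p, y)) \<in> sqi P"
proof (rule sqi_bound)
 have [measurable]: "Z \<in> borel_measurable P" using sqiD(1)[OF Z] .
 show m: "(\<lambda>p. LINT y|I. Z (fst p, y)) \<in> borel_measurable P" by (rule meanP_meas) measurable
 show "integrable P (\<lambda>p. L * (l2n I (sl Z (fst p)))\<^sup>2)"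
  using pg.integrable_fst_only[OF fin.finite_measure_axioms l2n_sl(1)[OF Z]] by simp
 have l: "(\<lambda>s. l2n I (sl Z s)) \<in> borel_measurable G" unfolding l2n_def sl_def by measurable
 have "AE s in G. AE x in I. (cmod (LINT y|I. sl Z s y))\<^sup>2 \<le> L * (l2n I (sl Z s))\<^sup>2"
  using sl_sqi[OF Z]
 proof eventually_elim
  case (elim s)
  have "(cmod (LINT y|I. sl Z s y))\<^sup>2 \<le> (sqrt L * l2n I (sl Z s))\<^sup>2"
   using fin.integral_le_l2n[OF elim] by (intro power_mono) auto
  then show ?case using L_pos by (simp add: power_mult_distrib)
 qed
 moreover have "{p \<in> space P. (cmod (LINT y|I. Z (fst p, y)))\<^sup>2 \<le> L * (l2n I (sl Z (fst p)))\<^sup>2} \<in> sets P"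
  using m l by (simp del: space_pair_measure)
 ultimately show "AE p in P. (cmod (LINT y|I. Z (fst p, y)))\<^sup>2 \<le> L * (l2n I (sl Z (fst p)))\<^sup>2"
  using AE_P[of "\<lambda>s x. (cmod (LINT y|I. Z (s, y)))\<^sup>2 \<le> L * (l2n I (sl Z s))\<^sup>2"] by (simp add: sl_def)
qed

lemma coP_sqi: "Z \<in> sqi P ==> coP Z \<in> sqi P" unfolding coP_def by (intro sqi_ops meanP_sqi primP_sqi)

lemma rip_coP:
 assumes Z: "Z \<in> sqi P" and k: "k \<in> sqi P"
 shows "rip P (primP Z) k = rip P Z (coP k)"
proof -
 have "AE s in G. rip I (sl (primP Z) s) (sl k s) = rip I (sl Z s) (sl (coP k) s)"
  using sl_sqi[OF Z] sl_sqi[OF k] by eventually_elim (simp add: sl_primP sl_coP rip_coprim)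
 then have "(LINT s|G. rip I (sl (primP Z) s) (sl k s)) = (LINT s|G. rip I (sl Z s) (sl (coP k) s))"
  using rip_sl(1)[OF primP_sqi[OF Z] k] rip_sl(1)[OF Z coP_sqi[OF k]] by (intro integral_cong_AE) auto
 then show ?thesis unfolding rip_sl(2)[OF primP_sqi[OF Z] k] rip_sl(2)[OF Z coP_sqi[OF k]] .
qed

text \<open>Slice-wise \<open>wderiv\<close> is chosen separately for every \<open>s\<close> and
  need not be jointly measurable, whereas \<open>Z\<close> is. Mean zero of its slices encodes the
  boundary condition at \<open>L\<close>.\<close>

definition mem_rep :: "(real => real => complex) => (real \<times> real => complex) => bool" where
 "mem_rep \<eta> Z \<longleftrightarrow> Z \<in> sqi P \<and> (\<lambda>(s, x). \<eta> s x) \<in> borel_measurable P \<and>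
   (AE s in G. (LINT x|I. sl Z s x) = 0 \<and> (AE x in I. \<eta> s x = prim (sl Z s) x))"

lemma set_integrable_lebesgue_G:
 assumes w: "integrable G w" and eq: "AE s in G. w s = (f s :: real)"
 shows "set_integrable lebesgue {0..} (\<lambda>s. g s * f s)" "(LINT s:{0..}|lebesgue. g s * f s) = (LINT s|G. w s)"
proof -
 have wm: "w \<in> borel_measurable R" using borel_measurable_integrable[OF w] meas_G by blast
 have wi: "integrable R (\<lambda>s. g s * w s)" using w integrable_G[OF wm] by simp
 let ?u = "\<lambda>s. indicat_real {0..} s *\<^sub>R (g s * w s)" and ?v = "\<lambda>s. indicat_real {0..} s *\<^sub>R (g s * f s)"
 have ui: "integrable lborel ?u" using wi unfolding integrable_R .
 then have ui': "integrable lebesgue ?u" by (subst integrable_completion) auto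
 have "AE s in lborel. ?u s = ?v s" using eq unfolding AE_G
 proof eventually_elim
  case (elim s)
  then show ?case using g_ge0[of s] by (cases "0 \<le> s"; cases "g s = 0") auto
 qed
 then have ae: "AE s in lebesgue. ?u s = ?v s" by (rule AE_completion)
 have vm: "?v \<in> borel_measurable lebesgue"
  by (rule lebesgue_measurable_AE[OF borel_measurable_integrable[OF ui'] ae])
 show "set_integrable lebesgue {0..} (\<lambda>s. g s * f s)"
  unfolding set_integrable_def by (rule integrable_cong_AE_imp[OF ui' vm]) (use ae in \<open>auto elim!: eventually_mono\<close>)
 have "(LINT s:{0..}|lebesgue. g s * f s) = (LINT s|lebesgue. ?u s)"
  unfolding set_lebesgue_integral_def using ae vm borel_measurable_integrable[OF ui']
  by (intro integral_cong_AE) (auto elim!: eventually_mono)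
 also have "\<dots> = (LINT s|lborel. ?u s)" using ui by (intro integral_completion) auto
 also have "\<dots> = (LINT s|G. w s)" using integral_G[OF wm] by (simp add: integral_R)
 finally show "(LINT s:{0..}|lebesgue. g s * f s) = (LINT s|G. w s)" .
qed

text \<open>\<open>u\<close> is Borel while \<open>f\<close> is measurable only for the completion;
  the comparison passes through the completed integral.\<close>

lemma nn_integral_G_lebesgue_bound:
 assumes u: "u \<in> borel_measurable R" and f: "set_integrable lebesgue {0..} (\<lambda>s. g s * f s)" and f0: "!!s. 0 \<le> f s"
  and le: "AE s in G. u s \<le> ennreal (f s)"
 shows "(\<integral>\<^sup>+s. u s \<partial>G) \<le> ennreal (LINT s:{0..}|lebesgue. g s * f s)"
proof -
 have "(\<integral>\<^sup>+s. u s \<partial>G) = (\<integral>\<^sup>+s. ennreal (g s) * u s \<partial>R)"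
  unfolding G_def using u by (intro nn_integral_density) auto
 also have "\<dots> = (\<integral>\<^sup>+s. ennreal (g s) * u s * indicator {0..} s \<partial>lborel)"
  unfolding R_def by (rule nn_integral_restrict_space) simp
 also have "\<dots> \<le> (\<integral>\<^sup>+s. ennreal (indicat_real {0..} s *\<^sub>R (g s * f s)) \<partial>lborel)"
 proof (rule nn_integral_mono_AE)
  show "AE s in lborel. ennreal (g s) * u s * indicator {0..} s \<le> ennreal (indicat_real {0..} s *\<^sub>R (g s * f s))"
   using le unfolding AE_G
  proof eventually_elim
   case (elim s)
   show ?case
   proof (cases "0 \<le> s \<and> 0 < g s")
    case True
    then have "ennreal (g s) * u s \<le> ennreal (g s) * ennreal (f s)" using elim by (intro mult_left_mono) auto
    then show ?thesis using True f0[of s] by (simp add: ennreal_mult)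
   next
    case False
    then have "s < 0 \<or> g s = 0" using g_ge0[of s] by force
    then show ?thesis by auto
   qed
  qed
 qed
 also have "\<dots> = (\<integral>\<^sup>+s. ennreal (indicat_real {0..} s *\<^sub>R (g s * f s)) \<partial>lebesgue)"
  by (rule nn_integral_completion[symmetric])
 also have "\<dots> = ennreal (LINT s:{0..}|lebesgue. g s * f s)"
  unfolding set_lebesgue_integral_def using f g_ge0 f0
  by (intro nn_integral_eq_integral) (auto simp: set_integrable_def indicator_def)
 finally show ?thesis .
qed

lemma mem_rep_Lg2:
 assumes rep: "mem_rep \<eta> Z"
 shows "\<eta> \<in> Lg2 L g" "Lg2norm L g \<eta> = l2n P Z"
  "AE s in G. \<eta> s \<in> H10 L \<and> (AE x in I. wderiv L (\<eta> s) x = sl Z s x)"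
proof -
 have Z: "Z \<in> sqi P" and jm: "(\<lambda>(s, x). \<eta> s x) \<in> borel_measurable P"
  and ae: "AE s in G. (LINT x|I. sl Z s x) = 0 \<and> (AE x in I. \<eta> s x = prim (sl Z s) x)"
  using rep by (auto simp: mem_rep_def)
 show H: "AE s in G. \<eta> s \<in> H10 L \<and> (AE x in I. wderiv L (\<eta> s) x = sl Z s x)"
  using ae sl_sqi[OF Z] AE_space
 proof eventually_elim
  case (elim s)
  have "\<eta> s \<in> borel_measurable I" using sl_meas[OF jm, of s] elim by (simp add: sl_def)
  then have "\<eta> s \<in> sqi I" using sqi_cong[OF prim_sqi[OF elim(2)]] elim by blast
  then show ?case using H10_I[of "\<eta> s" "sl Z s"] elim by blast
 qed
 have eq: "AE s in G. (l2n I (sl Z s))\<^sup>2 = (L2norm L (wderiv L (\<eta> s)))\<^sup>2" using H sl_sqi[OF Z]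
 proof eventually_elim
  case (elim s)
  then have "l2n I (wderiv L (\<eta> s)) = l2n I (sl Z s)"
   using H10_D(3)[of "\<eta> s"] sqiD(1) by (intro l2n_cong) auto
  then show ?case by (simp add: L2norm_eq)
 qed
 note si = set_integrable_lebesgue_G[OF l2n_sl(1)[OF Z] eq]
 show "\<eta> \<in> Lg2 L g" unfolding Lg2_def
 proof (intro CollectI conjI)
  show "(\<lambda>(s, x). \<eta> s x) \<in> borel_measurable (restrict_space lborel {0..} \<Otimes>\<^sub>M I)"
   using jm unfolding meas_P by (simp add: R_def)
  have "AE s in G. \<eta> s \<in> H10 L" using H by eventually_elim simp
  then show "AE s in lborel. 0 \<le> s \<and> 0 < g s --> \<eta> s \<in> H10 L" unfolding AE_G .
 qed (rule si(1))
 show "Lg2norm L g \<eta> = l2n P Z" unfolding Lg2norm_def si(2) l2n_sl(2)[OF Z] by simp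
qed

text \<open>The joint derivative is the Riesz representer, on the closure of the range of \<^term>\<open>coP\<close>, of the
 functional \<open>coP k \<mapsto> rip P \<eta> k\<close>.\<close>

lemma Lg2_mem_rep:
 assumes eta: "\<eta> \<in> Lg2 L g"
 shows "\<exists>Z. mem_rep \<eta> Z"
proof -
 define h where "h = (\<lambda>(s, x). \<eta> s x)"
 have hm: "h \<in> borel_measurable P" using eta unfolding meas_P h_def by (simp add: Lg2_def R_def)
 have H: "AE s in G. \<eta> s \<in> H10 L" using eta unfolding AE_G by (simp add: Lg2_def)
 define N where "N = (\<lambda>s. (l2n I (wderiv L (\<eta> s)))\<^sup>2)"
 have Nint: "set_integrable lebesgue {0..} (\<lambda>s. g s * N s)" using eta by (simp add: Lg2_def N_def L2norm_eq)
 define A where "A = (LINT s:{0..}|lebesgue. g s * N s)"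
 have A0: "A \<ge> 0"
  unfolding A_def set_lebesgue_integral_def using g_ge0 by (intro integral_nonneg_AE AE_I2) (auto simp: indicator_def N_def)
 have slh: "sl h s = \<eta> s" for s by (simp add: sl_def h_def)
 have hS: "h \<in> sqi P"
 proof (rule sqi_nn_bound(1)[OF hm, of "L * sqrt A"])
  have [measurable]: "h \<in> borel_measurable (R \<Otimes>\<^sub>M I)" using hm meas_P by simp
  have "(\<integral>\<^sup>+p. ennreal ((cmod (h p))\<^sup>2) \<partial>P) = (\<integral>\<^sup>+s. \<integral>\<^sup>+x. ennreal ((cmod (h (s, x)))\<^sup>2) \<partial>I \<partial>G)"
   using hm by (subst fin.nn_integral_fst[symmetric]) auto
  also have "\<dots> \<le> ennreal (LINT s:{0..}|lebesgue. g s * (L\<^sup>2 * N s))"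
  proof (rule nn_integral_G_lebesgue_bound)
   show "(\<lambda>s. \<integral>\<^sup>+x. ennreal ((cmod (h (s, x)))\<^sup>2) \<partial>I) \<in> borel_measurable R" by measurable
   show "set_integrable lebesgue {0..} (\<lambda>s. g s * (L\<^sup>2 * N s))"
   proof -
    have "set_integrable lebesgue {0..} (\<lambda>s. L\<^sup>2 * (g s * N s))" by (rule set_integrable_mult_right[OF Nint])
    then show ?thesis by (simp add: mult.left_commute)
   qed
   show "AE s in G. (\<integral>\<^sup>+x. ennreal ((cmod (h (s, x)))\<^sup>2) \<partial>I) \<le> ennreal (L\<^sup>2 * N s)"
    using H
   proof eventually_elim
    case (elim s)
    have "(l2n I (\<eta> s))\<^sup>2 \<le> (L * l2n I (wderiv L (\<eta> s)))\<^sup>2"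
     by (intro power_mono poincare_H10 elim) auto
    then show ?case using l2n_eq_nn[OF H10_D(2)[OF elim]] by (simp add: h_def N_def power_mult_distrib ennreal_leI flip: l2n_eq_nn)
      (metis ennreal_leI)
   qed
  qed (simp add: N_def)
  also have "(LINT s:{0..}|lebesgue. g s * (L\<^sup>2 * N s)) = (L * sqrt A)\<^sup>2"
  proof -
   have "(LINT s:{0..}|lebesgue. g s * (L\<^sup>2 * N s)) = (LINT s:{0..}|lebesgue. L\<^sup>2 * (g s * N s))"
    by (simp add: mult.left_commute)
   also have "\<dots> = L\<^sup>2 * A" unfolding A_def by (rule set_integral_mult_right)
   finally show ?thesis using A0 by (simp add: power_mult_distrib)
  qed
  finally show "(\<integral>\<^sup>+p. ennreal ((cmod (h p))\<^sup>2) \<partial>P) \<le> ennreal ((L * sqrt A)\<^sup>2)" .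
 qed (use L_pos A0 in auto)
 \<comment> \<open>This makes the functional on the range of \<open>coP\<close> both well defined
   and bounded. It is the Cauchy-Schwarz inequality for the pairing of the derivative with
   \<open>coP k\<close>; as no joint derivative is available yet, it is proved slice by
   slice.\<close>
 have bound: "\<bar>rip P h k\<bar> \<le> sqrt A * l2n P (coP k)" if k: "k \<in> sqi P" for k
 proof -
  have [measurable]: "k \<in> borel_measurable P" "h \<in> borel_measurable P" "coP k \<in> borel_measurable P"
   using k hm coP_sqi sqiD(1) by auto
  define n where "n = (\<lambda>s. l2n I (sl (coP k) s))"
  define u where "u = (\<lambda>s. rip I (sl h s) (sl k s))"
  have nm [measurable]: "n \<in> borel_measurable G" unfolding n_def l2n_def sl_def by measurable
  have um [measurable]: "u \<in> borel_measurable G" unfolding u_def rip_def sl_def by measurable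
  \<comment> \<open>The slice norms of \<open>wderiv L (\<eta> s)\<close> may fail to be Borel. The
    quotient \<open>u / n\<close> is Borel and dominated by them, so Cauchy-Schwarz in
    \<open>s\<close> is applied to \<open>v\<close> and \<open>n\<close>.\<close>
  define v where "v = (\<lambda>s. complex_of_real (if n s = 0 then 0 else u s / n s))"
  have vm [measurable]: "v \<in> borel_measurable G" unfolding v_def by measurable
  have ub: "AE s in G. \<bar>u s\<bar> \<le> l2n I (wderiv L (\<eta> s)) * n s"
   using H sl_sqi[OF k] sl_sqi[OF coP_sqi[OF k]]
  proof eventually_elim
   case (elim s)
   note D = H10_D[OF elim(1)]
   have "u s = rip I (prim (wderiv L (\<eta> s))) (sl k s)"
    unfolding u_def slh using D elim by (intro rip_cong) (auto intro!: prim_sqi)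
   also have "\<dots> = rip I (wderiv L (\<eta> s)) (sl (coP k) s)"
    unfolding sl_coP using D elim by (intro rip_coprim) auto
   finally show ?case using rip_bound[OF D(3) elim(3)] by (simp add: n_def)
  qed
  have vS: "v \<in> sqi G" "l2n G v \<le> sqrt A"
  proof -
   have "(\<integral>\<^sup>+s. ennreal ((cmod (v s))\<^sup>2) \<partial>G) \<le> ennreal (LINT s:{0..}|lebesgue. g s * N s)"
   proof (rule nn_integral_G_lebesgue_bound[OF _ Nint])
    have "v \<in> borel_measurable R" using vm meas_G by blast
    then show "(\<lambda>s. ennreal ((cmod (v s))\<^sup>2)) \<in> borel_measurable R" by measurable
    show "AE s in G. ennreal ((cmod (v s))\<^sup>2) \<le> ennreal (N s)" using ub
    proof eventually_elim
     case (elim s)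
     have n0: "n s \<ge> 0" by (simp add: n_def)
     have "cmod (v s) \<le> l2n I (wderiv L (\<eta> s))"
     proof (cases "n s = 0")
      case False
      then have "n s > 0" using n0 by simp
      then show ?thesis using elim by (simp add: v_def divide_le_eq norm_divide)
     qed (simp add: v_def)
     then show ?case unfolding N_def by (intro ennreal_leI power_mono) auto
    qed
   qed (simp add: N_def)
   then have "(\<integral>\<^sup>+s. ennreal ((cmod (v s))\<^sup>2) \<partial>G) \<le> ennreal ((sqrt A)\<^sup>2)" using A0 by (simp add: A_def)
   from sqi_nn_bound[OF vm this] A0 show "v \<in> sqi G" "l2n G v \<le> sqrt A" by auto
  qed
  have nS: "(\<lambda>s. complex_of_real (n s)) \<in> sqi G" and nn: "l2n G (\<lambda>s. complex_of_real (n s)) = l2n P (coP k)"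
   using l2n_sl[OF coP_sqi[OF k]] nm by (auto simp: sqi_def n_def l2n_def[of G])
  have "rip P h k = (LINT s|G. u s)" using rip_sl(2)[OF hS k] by (simp add: u_def)
  also have "\<dots> = rip G v (\<lambda>s. complex_of_real (n s))" unfolding rip_def
  proof (rule integral_cong_AE)
   show "AE s in G. u s = inner (v s) (complex_of_real (n s))"
    using ub by eventually_elim (auto simp: v_def inner_complex_def)
  qed (auto simp: inner_complex_def)
  also have "\<bar>\<dots>\<bar> \<le> l2n G v * l2n P (coP k)" using rip_bound[OF vS(1) nS] by (simp add: nn)
  also have "\<dots> \<le> sqrt A * l2n P (coP k)" using vS by (intro mult_right_mono) auto
  finally show ?thesis .
 qed
 interpret S: semi_hilbert "sqi P" "rip P" by (rule Pf.semi_hilbert_sqi)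
 have nrm: "S.nrm = l2n P" by (simp add: fun_eq_iff semi_inner_nrm_sqi)
 have coP_add: "AE p in P. coP (\<lambda>p. k p + k' p) p = coP k p + coP k' p" if k: "k \<in> sqi P" "k' \<in> sqi P" for k k'
 proof -
  have m: "coP (\<lambda>p. k p + k' p) \<in> borel_measurable P" "(\<lambda>p. coP k p + coP k' p) \<in> borel_measurable P"
   by (auto intro!: sqiD(1) sqi_ops coP_sqi k)
  have "AE s in G. AE x in I. sl (coP (\<lambda>p. k p + k' p)) s x = sl (\<lambda>p. coP k p + coP k' p) s x"
   using sl_sqi[OF k(1)] sl_sqi[OF k(2)]
  proof eventually_elim
   case (elim s)
   have i: "integrable I (sl k s)" "integrable I (sl k' s)" using elim fin.sqi_int by auto
   have "sl (\<lambda>p. k p + k' p) s = (\<lambda>x. sl k s x + sl k' s x)" by (simp add: sl_def)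
   moreover have "sl (\<lambda>p. coP k p + coP k' p) s x = sl (coP k) s x + sl (coP k') s x" for x by (simp add: sl_def)
   ultimately show ?case using i by (simp add: sl_coP prim_add)
  qed
  then show ?thesis using AE_P_eq[OF m] by simp
 qed
 have coP_mult: "coP (\<lambda>p. c * k p) = (\<lambda>p. c * coP k p)" for c k
 proof -
  have "prim (sl (\<lambda>p. c * k p) s) x = c * prim (sl k s) x" for s x by (simp add: sl_def prim_mult)
  then show ?thesis by (auto simp: fun_eq_iff coP_def primP_def right_diff_distrib)
 qed
 have coP_zero: "coP (\<lambda>_. 0) = (\<lambda>_. 0)" using coP_mult[of 0 "\<lambda>_. 0"] by simp
 \<comment> \<open>Closed under equality almost everywhere, because \<open>coP\<close> is additive
   only up to null sets; \<open>pick\<close> chooses a preimage and \<open>l_eq\<close> shows that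
   its choice is immaterial.\<close>
 define V where "V = {\<zeta> \<in> sqi P. \<exists>k\<in>sqi P. AE p in P. \<zeta> p = coP k p}"
 define pick where "pick = (\<lambda>\<zeta>. SOME k. k \<in> sqi P \<and> (AE p in P. \<zeta> p = coP k p))"
 define l where "l = (\<lambda>\<zeta>. rip P h (pick \<zeta>))"
 have pick: "pick \<zeta> \<in> sqi P" "AE p in P. \<zeta> p = coP (pick \<zeta>) p" if "\<zeta> \<in> V" for \<zeta>
 proof -
  have "\<exists>k. k \<in> sqi P \<and> (AE p in P. \<zeta> p = coP k p)" using that by (auto simp: V_def)
  then have "pick \<zeta> \<in> sqi P \<and> (AE p in P. \<zeta> p = coP (pick \<zeta>) p)" unfolding pick_def by (rule someI_ex)
  then show "pick \<zeta> \<in> sqi P" "AE p in P. \<zeta> p = coP (pick \<zeta>) p" by auto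
 qed
 have l_eq: "l \<zeta> = rip P h k" if z: "\<zeta> \<in> V" and k: "k \<in> sqi P" "AE p in P. \<zeta> p = coP k p" for \<zeta> k
 proof -
  let ?d = "\<lambda>p. pick \<zeta> p + (-1) * k p"
  have d: "?d \<in> sqi P" by (intro sqi_ops pick z k)
  have "AE p in P. coP ?d p = coP (pick \<zeta>) p + coP (\<lambda>p. (-1) * k p) p"
   by (rule coP_add) (intro sqi_ops pick z k)+
  then have "AE p in P. coP ?d p = 0" using pick(2)[OF z] k(2) unfolding coP_mult by eventually_elim simp
  then have "l2n P (coP ?d) = 0" by (rule l2n_AE_zero)
  then have "rip P h ?d = 0" using bound[OF d] by simp
  then show ?thesis using rip_diff_right'[OF pick(1)[OF z] k(1) hS] by (simp add: l_def)
 qed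
 have VS: "V \<subseteq> sqi P" by (auto simp: V_def)
 have V_coP: "coP k \<in> V" if "k \<in> sqi P" for k using that coP_sqi by (auto simp: V_def)
 obtain Z where Z: "Z \<in> sqi P" "!!\<zeta>. \<zeta> \<in> V ==> rip P \<zeta> Z = l \<zeta>"
 proof (rule S.riesz[of V l "sqrt A"])
  show "V \<subseteq> sqi P" by (rule VS)
  show "0 \<in> V" using V_coP[of "\<lambda>_. 0"] by (simp add: coP_zero zero_fun_def)
  fix x y assume x: "x \<in> V" and y: "y \<in> V"
  have ks: "(\<lambda>p. pick x p + pick y p) \<in> sqi P" by (intro sqi_ops pick x y)
  have ae: "AE p in P. (x + y) p = coP (\<lambda>p. pick x p + pick y p) p"
   using coP_add[OF pick(1)[OF x] pick(1)[OF y]] pick(2)[OF x] pick(2)[OF y] by eventually_elim simp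
  then show xy: "x + y \<in> V" using ks x y VS sqi_add by (auto simp: V_def)
  show "l (x + y) = l x + l y"
   by (simp only: l_eq[OF xy ks ae]) (simp only: rip_add_right'[OF pick(1)[OF x] pick(1)[OF y] hS] l_def)
 next
  fix x and c :: real assume x: "x \<in> V"
  have ks: "(\<lambda>p. complex_of_real c * pick x p) \<in> sqi P" by (intro sqi_ops pick x)
  have ae: "AE p in P. (complex_of_real c *\<^sub>C x) p = coP (\<lambda>p. complex_of_real c * pick x p) p"
   using pick(2)[OF x] by eventually_elim (simp add: coP_mult scaleC_fun_def scaleC_complex_def)
  then show cx: "complex_of_real c *\<^sub>C x \<in> V" using ks x VS sqi_scaleC by (auto simp: V_def)
  show "l (complex_of_real c *\<^sub>C x) = c * l x"
   by (simp only: l_eq[OF cx ks ae]) (simp only: rip_scale_right' l_def)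
 next
  fix x assume x: "x \<in> V"
  have "l2n P x = l2n P (coP (pick x))"
   using pick[OF x] coP_sqi[OF pick(1)[OF x]] x VS sqiD(1) by (intro l2n_cong) auto
  then show "\<bar>l x\<bar> \<le> sqrt A * S.nrm x" using bound[OF pick(1)[OF x]] by (simp add: l_def nrm)
 qed blast
 have eqk: "rip P (primP Z) k = rip P h k" if k: "k \<in> sqi P" for k
  using rip_coP[OF Z(1) k] Z(2)[OF V_coP[OF k]] l_eq[OF V_coP[OF k] k] by (simp add: rip_sym)
 let ?k = "\<lambda>p. primP Z p - h p"
 have kS: "?k \<in> sqi P" by (intro sqi_ops primP_sqi Z hS)
 have "rip P ?k ?k = 0" using rip_diff'[OF primP_sqi[OF Z(1)] hS kS] eqk[OF kS] by simp
 then have "l2n P ?k = 0" by (simp add: rip_self)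
 then have "AE p in P. primP Z p - h p = 0" using l2n_zero_AE[OF kS] by simp
 then have "AE p in P. h p = primP Z p" by eventually_elim simp
 then have hZ: "AE s in G. AE x in I. \<eta> s x = prim (sl Z s) x"
  using AE_P_eq[OF hm sqiD(1)[OF primP_sqi[OF Z(1)]]] by (simp add: slh sl_primP)
 have "AE s in G. (LINT x|I. sl Z s x) = 0 \<and> (AE x in I. \<eta> s x = prim (sl Z s) x)"
  using hZ H sl_sqi[OF Z(1)]
 proof eventually_elim
  case (elim s)
  note D = H10_D[OF elim(2)]
  have "AE x in I. 0 + prim (sl Z s) x = 0 + prim (wderiv L (\<eta> s)) x"
   using elim(1) D(5) by eventually_elim simp
  then have "AE x in I. sl Z s x = wderiv L (\<eta> s) x"
   by (rule prim_eq_unique[OF fin.sqi_int[OF elim(3)] fin.sqi_int[OF D(3)]])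
  then have "(LINT x|I. sl Z s x) = (LINT x|I. wderiv L (\<eta> s) x)"
   using sqiD(1)[OF elim(3)] sqiD(1)[OF D(3)] by (intro integral_cong_AE) auto
  then show ?case using D(4) elim by simp
 qed
 then show ?thesis using Z(1) hm by (auto simp: mem_rep_def h_def)
qed

end

text \<open>Integrability is not assumed: the integral of a non-integrable function is 0 by
  convention.\<close>

lemma norm_integral_le_nn: "ennreal (norm (LINT x|M. f x)) \<le> (\<integral>\<^sup>+x. ennreal (norm (f x)) \<partial>M)"
 for f :: "'a => 'b::{banach, second_countable_topology}"
 using integral_norm_bound_ennreal[of M f] not_integrable_integral_eq[of M f] by (cases "integrable M f") auto

section \<open>Integration in the history variable\<close>

context memory
begin

lemma g_mono: "0 \<le> r ==> r \<le> s ==> g s \<le> g r"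
proof -
 assume rs: "0 \<le> r" "r \<le> s"
 have "exp (- \<kappa>1 * (s - r)) \<le> 1" using rs kappa1_pos by simp
 then have "exp (- \<kappa>1 * (s - r)) * g r \<le> 1 * g r" using g_ge0[OF rs(1)] by (intro mult_right_mono)
 then show ?thesis using g_decay[OF rs] by simp
qed

lemma AE_G_pos: "AE s in G. 0 \<le> s \<and> 0 < g s" unfolding AE_G by simp

text \<open>Where \<open>g > t\<close>, the function is dominated by \<open>g f / t\<close>.\<close>

lemma integrable_upto:
 fixes f :: "real => 'b::{banach, second_countable_topology}"
 assumes f: "integrable G f" and t: "t > 0"
 shows "integrable R (\<lambda>r. if t < g r then f r else 0)"
proof (rule int_bound)
 have m[measurable]: "f \<in> borel_measurable R" using borel_measurable_integrable[OF f] unfolding meas_G .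
 have "integrable R (\<lambda>r. g r *\<^sub>R f r)" using f unfolding integrable_G[OF m] .
 then show "integrable R (\<lambda>r. (1 / t) *\<^sub>R (g r *\<^sub>R f r))" by (rule integrable_scaleR_right)
 show "(\<lambda>r. if t < g r then f r else 0) \<in> borel_measurable R" by measurable
 show "AE r in R. norm (if t < g r then f r else 0) \<le> norm ((1 / t) *\<^sub>R (g r *\<^sub>R f r))"
 proof (rule AE_I2)
  fix r show "norm (if t < g r then f r else 0) \<le> norm ((1 / t) *\<^sub>R (g r *\<^sub>R f r))"
  proof (cases "t < g r")
   case True
   then have "1 * norm (f r) \<le> (g r / t) * norm (f r)" using t by (intro mult_right_mono) auto
   then show ?thesis using True t by simp
  qed simp
 qed
qed

lemma integrable_P_density:
 fixes f :: "real \<times> real => complex"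
 assumes f: "integrable P f"
 shows "integrable (R \<Otimes>\<^sub>M I) (\<lambda>p. g (fst p) *\<^sub>R f p)"
proof (rule pR.Fubini_integrable)
 have m[measurable]: "f \<in> borel_measurable (R \<Otimes>\<^sub>M I)" using borel_measurable_integrable[OF f] meas_P by blast
 show "(\<lambda>p. g (fst p) *\<^sub>R f p) \<in> borel_measurable (R \<Otimes>\<^sub>M I)" by measurable
 have "AE s in G. integrable I (\<lambda>y. f (s, y))" by (rule pg.AE_integrable_fst'[OF f])
 then show "AE s in R. integrable I (\<lambda>y. g (fst (s, y)) *\<^sub>R f (s, y))" unfolding AE_G' using g_ge0_R
 proof eventually_elim
  case (elim s)
  then show ?case by (cases "g s = 0") auto
 qed
 have n: "integrable G (\<lambda>s. LINT y|I. norm (f (s, y)))" using pg.integrable_fst'[OF integrable_norm[OF f]] by simp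
 have nm: "(\<lambda>s. LINT y|I. norm (f (s, y))) \<in> borel_measurable R" using borel_measurable_integrable[OF n] meas_G by blast
 have "integrable R (\<lambda>s. g s *\<^sub>R (LINT y|I. norm (f (s, y))))" using n integrable_G[OF nm] by blast
 then show "integrable R (\<lambda>s. LINT y|I. norm (g (fst (s, y)) *\<^sub>R f (s, y)))"
 proof (rule integrable_cong_AE_imp)
  show "AE s in R. g s *\<^sub>R (LINT y|I. norm (f (s, y))) = (LINT y|I. norm (g (fst (s, y)) *\<^sub>R f (s, y)))"
   using g_ge0_R by eventually_elim simp
  show "(\<lambda>s. LINT y|I. norm (g (fst (s, y)) *\<^sub>R f (s, y))) \<in> borel_measurable R"
   by (rule fin.borel_measurable_lebesgue_integral) measurable
 qed
qed

text \<open>Left of \<open>s\<close> the kernel is at least \<open>g s > 0\<close>, so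
  \<open>f\<close> is dominated by \<open>g f / g s\<close>.\<close>

lemma integrable_P_upto:
 fixes f :: "real \<times> real => complex"
 assumes f: "integrable P f" and s: "0 \<le> s" "0 < g s"
 shows "integrable (R \<Otimes>\<^sub>M I) (\<lambda>p. if fst p \<le> s then f p else 0)"
proof (rule int_bound)
 show "integrable (R \<Otimes>\<^sub>M I) (\<lambda>p. (1 / g s) *\<^sub>R (g (fst p) *\<^sub>R f p))"
  using integrable_P_density[OF f] by (rule integrable_scaleR_right)
 have m[measurable]: "f \<in> borel_measurable (R \<Otimes>\<^sub>M I)" using borel_measurable_integrable[OF f] meas_P by blast
 show "(\<lambda>p. if fst p \<le> s then f p else 0) \<in> borel_measurable (R \<Otimes>\<^sub>M I)" by measurable
 show "AE p in R \<Otimes>\<^sub>M I. norm (if fst p \<le> s then f p else 0) \<le> norm ((1 / g s) *\<^sub>R (g (fst p) *\<^sub>R f p))"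
 proof (rule AE_I2)
  fix p assume "p \<in> space (R \<Otimes>\<^sub>M I)"
  then have p: "0 \<le> fst p" by (auto simp: space_pair_measure)
  show "norm (if fst p \<le> s then f p else 0) \<le> norm ((1 / g s) *\<^sub>R (g (fst p) *\<^sub>R f p))"
  proof (cases "fst p \<le> s")
   case True
   then have "1 * norm (f p) \<le> (g (fst p) / g s) * norm (f p)" using s g_mono[OF p True] by (intro mult_right_mono) auto
   then show ?thesis using True s g_ge0[OF p] by simp
  qed simp
 qed
qed

text \<open>Integration in \<open>s\<close> from 0, the inverse of the derivative in
  \<open>s\<close> with zero initial value.\<close>

definition J :: "(real \<times> real => complex) => real \<times> real => complex" where
 "J Z = (\<lambda>(s, x). LINT r|R. (if r \<le> s then Z (r, x) else 0))"

lemma sl_J: "sl (J Z) s x = (LINT r|R. (if r \<le> s then Z (r, x) else 0))" by (simp add: sl_def J_def)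

lemma J_meas:
 assumes "Z \<in> borel_measurable P"
 shows "J Z \<in> borel_measurable P"
proof -
 have Z: "Z \<in> borel_measurable (R \<Otimes>\<^sub>M I)" using assms meas_P by blast
 have "(\<lambda>q. (snd q, snd (fst q))) \<in> (R \<Otimes>\<^sub>M I) \<Otimes>\<^sub>M R \<rightarrow>\<^sub>M R \<Otimes>\<^sub>M I" by measurable
 then have [measurable]: "(\<lambda>q. Z (snd q, snd (fst q))) \<in> borel_measurable ((R \<Otimes>\<^sub>M I) \<Otimes>\<^sub>M R)"
  using Z by (rule measurable_compose)
 have "(\<lambda>q. if snd q \<le> fst (fst q) then Z (snd q, snd (fst q)) else 0) \<in> borel_measurable ((R \<Otimes>\<^sub>M I) \<Otimes>\<^sub>M R)"
  by measurable
 then have "J Z \<in> borel_measurable (R \<Otimes>\<^sub>M I)"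
  using pR.M1.borel_measurable_lebesgue_integral[of "\<lambda>p r. if r \<le> fst p then Z (r, snd p) else 0" "R \<Otimes>\<^sub>M I"]
  by (simp add: J_def case_prod_unfold)
 then show ?thesis using meas_P by blast
qed

text \<open>Fubini's theorem: integration in \<open>s\<close> commutes with taking primitives in
  \<open>x\<close>. It is used to pass from histories to their joint derivatives.\<close>

lemma J_prim:
 assumes Z: "Z \<in> sqi P" and s: "0 \<le> s" "0 < g s"
 shows "integrable I (sl (J Z) s)"
  "(LINT r|R. (if r \<le> s then prim (sl Z r) x else 0)) = prim (sl (J Z) s) x"
proof -
 have Zi: "integrable P Z" by (rule Pf.sqi_int[OF Z])
 have i1: "integrable (R \<Otimes>\<^sub>M I) (\<lambda>(r, y). if r \<le> s then Z (r, y) else 0)"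
  using integrable_P_upto[OF Zi s] by (simp add: case_prod_unfold cong: if_cong)
 show "integrable I (sl (J Z) s)" using pR.integrable_snd[OF i1] by (simp add: sl_J[abs_def])
 let ?F = "\<lambda>r y. if y \<le> x then (if r \<le> s then Z (r, y) else 0) else 0"
 have i2: "integrable (R \<Otimes>\<^sub>M I) (case_prod ?F)"
 proof (rule int_bound[OF i1])
  have [measurable]: "(\<lambda>(r, y). if r \<le> s then Z (r, y) else 0) \<in> borel_measurable (R \<Otimes>\<^sub>M I)" using i1 by auto
  have "(\<lambda>p. if snd p \<le> x then (case p of (r, y) => if r \<le> s then Z (r, y) else 0) else 0) \<in> borel_measurable (R \<Otimes>\<^sub>M I)"
   by measurable
  then show "case_prod ?F \<in> borel_measurable (R \<Otimes>\<^sub>M I)" by (simp add: case_prod_unfold cong: if_cong)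
 qed auto
 have "(LINT r|R. (if r \<le> s then prim (sl Z r) x else 0)) = (LINT r|R. LINT y|I. ?F r y)"
 proof (rule int_cong[OF refl])
  fix r show "(if r \<le> s then prim (sl Z r) x else 0) = (LINT y|I. ?F r y)"
   by (cases "r \<le> s") (simp_all add: prim_def sl_def cong: if_cong)
 qed
 also have "\<dots> = (LINT y|I. LINT r|R. ?F r y)" by (rule pR.Fubini_integral[OF i2, symmetric])
 also have "\<dots> = prim (sl (J Z) s) x" unfolding prim_def
 proof (rule int_cong[OF refl])
  fix y show "(LINT r|R. ?F r y) = (if y \<le> x then sl (J Z) s y else 0)"
   by (cases "y \<le> x") (simp_all add: sl_J)
 qed
 finally show "(LINT r|R. (if r \<le> s then prim (sl Z r) x else 0)) = prim (sl (J Z) s) x" .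
qed

lemma sec_meas_R: "u \<in> borel_measurable P ==> 0 < x ==> x < L ==> (\<lambda>s. u (s, x)) \<in> borel_measurable R"
 using measurable_compose[OF measurable_Pair2'[of x I R], of u borel] meas_P[of u] by simp

lemma mem_repD:
 assumes "mem_rep \<eta> Z"
 shows "Z \<in> sqi P" "(\<lambda>(s, x). \<eta> s x) \<in> borel_measurable P"
  "AE s in G. (LINT x|I. sl Z s x) = 0" "AE s in G. AE x in I. \<eta> s x = prim (sl Z s) x"
 using assms by (auto simp: mem_rep_def)

text \<open>The null sets are exchanged, from almost every \<open>s\<close> to almost every
  \<open>x\<close>, by joint measurability of both sides; integrals in \<open>s\<close> at fixed
  \<open>x\<close> need the second form.\<close>

lemma mem_rep_swap:
 assumes "mem_rep \<eta> Z"
 shows "AE x in I. AE s in G. \<eta> s x = prim (sl Z s) x"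
proof -
 note r = mem_repD[OF assms]
 have m: "primP Z \<in> borel_measurable P" using sqiD(1)[OF primP_sqi[OF r(1)]] .
 have "AE s in G. AE x in I. sl (\<lambda>(s, x). \<eta> s x) s x = sl (primP Z) s x"
  using r(4) unfolding sl_primP by (simp add: sl_def)
 then have "AE x in I. AE s in G. (\<lambda>(s, x). \<eta> s x) (s, x) = primP Z (s, x)"
  unfolding AE_P_eq[OF r(2) m, symmetric] AE_P_eq_snd[OF r(2) m] .
 then show ?thesis by (simp add: primP_def)
qed

lemma integral_upto_lborel:
 fixes u :: "real => complex"
 shows "(LINT r:{0..s}|lborel. u r) = (LINT r|R. (if r \<le> s then u r else 0))"
 unfolding integral_R set_lebesgue_integral_def by (intro int_cong refl) (auto simp: indicator_def)

lemma s_integral_prim: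
 assumes rep: "mem_rep \<zeta> Z" and s: "0 \<le> s" "0 < g s"
 shows "AE x in I. (LINT r:{0..s}|lborel. \<zeta> r x) = prim (sl (J Z) s) x" using mem_rep_swap[OF rep] AE_space
proof eventually_elim
 case (elim x)
 note r = mem_repD[OF rep]
 have x: "0 < x" "x < L" using elim by auto
 have [measurable]: "(\<lambda>r. \<zeta> r x) \<in> borel_measurable R" "(\<lambda>r. prim (sl Z r) x) \<in> borel_measurable R"
  using sec_meas_R[OF r(2) x] sec_meas_R[OF sqiD(1)[OF primP_sqi[OF r(1)]] x] by (simp_all add: primP_def)
 have "(LINT r:{0..s}|lborel. \<zeta> r x) = (LINT r|R. (if r \<le> s then prim (sl Z r) x else 0))"
  unfolding integral_upto_lborel
 proof (rule integral_cong_AE)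
  show "AE r in R. (if r \<le> s then \<zeta> r x else 0) = (if r \<le> s then prim (sl Z r) x else 0)"
   using elim(1) AE_space unfolding AE_G'
  proof eventually_elim
   case (elim r)
   then show ?case using g_mono[of r s] s by auto
  qed
 qed measurable
 then show ?case using J_prim(2)[OF r(1) s] by simp
qed

text \<open>Taking primitives in \<open>x\<close> commutes with integration in \<open>s\<close> and
  is injective modulo null functions, so the relation between histories is equivalent to the one
  between joint derivatives.\<close>

theorem has_s_deriv_iff:
 assumes eta: "mem_rep \<eta> W" and zeta: "mem_rep \<zeta> Z" and e: "e \<in> sqi I" "AE x in I. \<eta>0 x = prim e x"
 shows "has_s_deriv L g \<eta> \<zeta> \<eta>0 \<longleftrightarrow> (AE s in G. AE x in I. sl W s x = e x + sl (J Z) s x)"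
proof -
 note W = mem_repD[OF eta] and Z = mem_repD[OF zeta]
 have "has_s_deriv L g \<eta> \<zeta> \<eta>0 \<longleftrightarrow>
   (AE s in G. AE x in I. \<eta> s x = \<eta>0 x + (LINT r:{0..s}|lborel. \<zeta> r x))"
  unfolding has_s_deriv_def AE_G ..
 also have "\<dots> \<longleftrightarrow> (AE s in G. AE x in I. sl W s x = e x + sl (J Z) s x)"
 proof
  assume "AE s in G. AE x in I. \<eta> s x = \<eta>0 x + (LINT r:{0..s}|lborel. \<zeta> r x)"
  then show "AE s in G. AE x in I. sl W s x = e x + sl (J Z) s x" using W(4) sl_sqi[OF W(1)] AE_G_pos
  proof eventually_elim
   case (elim s)
   have s: "0 \<le> s" "0 < g s" using elim by auto
   have i: "integrable I (sl W s)" "integrable I e" "integrable I (sl (J Z) s)"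
    using fin.sqi_int elim e J_prim(1)[OF Z(1) s] by auto
   have "AE x in I. 0 + prim (sl W s) x = 0 + prim (\<lambda>x. e x + sl (J Z) s x) x"
    using elim(1,2) e(2) s_integral_prim[OF zeta s]
   proof eventually_elim
    case (elim x)
    show ?case unfolding prim_add[OF i(2,3)] elim(3,4)[symmetric] elim(2)[symmetric] elim(1) ..
   qed
   then show ?case by (rule prim_eq_unique[OF i(1) Bochner_Integration.integrable_add[OF i(2,3)]])
  qed
 next
  assume "AE s in G. AE x in I. sl W s x = e x + sl (J Z) s x"
  then show "AE s in G. AE x in I. \<eta> s x = \<eta>0 x + (LINT r:{0..s}|lborel. \<zeta> r x)"
   using W(4) sl_sqi[OF W(1)] AE_G_pos
  proof eventually_elim
   case (elim s)
   have s: "0 \<le> s" "0 < g s" using elim by auto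
   have i: "integrable I (sl W s)" "integrable I e" "integrable I (sl (J Z) s)"
    using fin.sqi_int elim e J_prim(1)[OF Z(1) s] by auto
   have p: "prim (sl W s) = prim (\<lambda>x. e x + sl (J Z) s x)" using elim(1) i by (intro prim_cong) auto
   show ?case using elim(2) e(2) s_integral_prim[OF zeta s] by eventually_elim (simp add: p prim_add[OF i(2,3)])
  qed
 qed
 finally show ?thesis .
qed

text \<open>This and the next lemma are the row and column bounds of the Schur test.\<close>

lemma exp_integral_left:
 assumes "0 \<le> s"
 shows "(\<integral>\<^sup>+r. ennreal (if r \<le> s then exp (- \<kappa>1 * (s - r) / 2) else 0) \<partial>R) \<le> ennreal (2 / \<kappa>1)"
proof -
 have "(\<integral>\<^sup>+r. ennreal (if r \<le> s then exp (- \<kappa>1 * (s - r) / 2) else 0) \<partial>R) =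
   (\<integral>\<^sup>+r. ennreal (exp (- \<kappa>1 * (s - r) / 2)) * indicator {0..s} r \<partial>lborel)"
  unfolding R_def by (subst nn_integral_restrict_space) (auto intro!: nn_integral_cong simp: indicator_def)
 also have "\<dots> = ennreal ((2 / \<kappa>1) * exp (- \<kappa>1 * (s - s) / 2) - (2 / \<kappa>1) * exp (- \<kappa>1 * (s - 0) / 2))"
  using assms kappa1_pos by (intro nn_integral_FTC_Icc) (auto intro!: derivative_eq_intros)
 also have "\<dots> \<le> ennreal (2 / \<kappa>1)" using kappa1_pos by (intro ennreal_leI) simp
 finally show ?thesis .
qed

lemma exp_integral_right:
 assumes "0 \<le> r"
 shows "(\<integral>\<^sup>+s. ennreal (if r \<le> s then exp (- \<kappa>1 * (s - r) / 2) else 0) \<partial>R) \<le> ennreal (2 / \<kappa>1)"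
proof -
 have "(\<integral>\<^sup>+s. ennreal (if r \<le> s then exp (- \<kappa>1 * (s - r) / 2) else 0) \<partial>R) =
   (\<integral>\<^sup>+s. ennreal (exp (- \<kappa>1 * (s - r) / 2)) * indicator {r..} s \<partial>lborel)"
  unfolding R_def using assms by (subst nn_integral_restrict_space) (auto intro!: nn_integral_cong simp: indicator_def)
 also have "\<dots> = ennreal (0 - (- (2 / \<kappa>1) * exp (- \<kappa>1 * (r - r) / 2)))"
 proof (rule nn_integral_FTC_atLeast[where F = "\<lambda>s. - (2 / \<kappa>1) * exp (- \<kappa>1 * (s - r) / 2)" and T = 0])
  show "((\<lambda>s. - (2 / \<kappa>1) * exp (- \<kappa>1 * (s - r) / 2)) \<longlongrightarrow> 0) at_top"
   using kappa1_pos by real_asymp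
 qed (use kappa1_pos in \<open>auto intro!: derivative_eq_intros\<close>)
 also have "\<dots> = ennreal (2 / \<kappa>1)" by simp
 finally show ?thesis by simp
qed

text \<open>Hardy's inequality for the weight \<open>g\<close>, by the Schur test with the kernel \<open>exp (-\<kappa>1 (s - r) / 2)\<close>.\<close>

lemma hardy:
 fixes z :: "real => complex"
 assumes z[measurable]: "z \<in> borel_measurable R"
 shows "(\<integral>\<^sup>+s. ennreal ((cmod (LINT r|R. (if r \<le> s then z r else 0)))\<^sup>2) \<partial>G) \<le>
  ennreal ((2 / \<kappa>1)\<^sup>2) * (\<integral>\<^sup>+s. ennreal ((cmod (z s))\<^sup>2) \<partial>G)"
proof -
 interpret RR: pair_sigma_finite R R by (simp add: pair_sigma_finite_def sf_R)
 let ?w = "\<lambda>s. LINT r|R. (if r \<le> s then z r else 0)"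
 define K where "K = (\<lambda>s r :: real. if r \<le> s then exp (- \<kappa>1 * (s - r) / 2) else 0)"
 define a where "a = (\<lambda>r. g r * (cmod (z r))\<^sup>2)"
 have [measurable]: "(\<lambda>p. K (fst p) (snd p)) \<in> borel_measurable (R \<Otimes>\<^sub>M R)" unfolding K_def by measurable
 have [measurable]: "K s \<in> borel_measurable R" "(\<lambda>s. K s r) \<in> borel_measurable R" for s r unfolding K_def by measurable
 have [measurable]: "a \<in> borel_measurable R" unfolding a_def by measurable
 have "(\<lambda>q. if snd q \<le> fst q then z (snd q) else 0) \<in> borel_measurable (R \<Otimes>\<^sub>M R)" by measurable
 then have wm [measurable]: "?w \<in> borel_measurable R"
  using sigma_finite_measure.borel_measurable_lebesgue_integral[OF sf_R, of "\<lambda>s r. if r \<le> s then z r else 0" R] by (simp add: case_prod_unfold)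
 have K0: "0 \<le> K s r" for s r by (simp add: K_def)
 have pt: "ennreal (g s) * ennreal ((cmod (?w s))\<^sup>2) \<le> ennreal (2 / \<kappa>1) * (\<integral>\<^sup>+r. ennreal (K s r * a r) \<partial>R)"
  if s: "0 \<le> s" for s
 proof -
  \<comment> \<open>The factor 1 is split into exponentials with rate \<open>\<kappa>1 / 4\<close>.
    Squaring doubles the rate, and the decay of \<open>g\<close> at rate \<open>\<kappa>1\<close>
    pays for the growing factor, leaving \<open>exp (- \<kappa>1 * (s - r) / 2)\<close>.\<close>
  let ?f1 = "\<lambda>r. ennreal (if r \<le> s then exp (- \<kappa>1 * (s - r) / 4) else 0)"
  let ?f2 = "\<lambda>r. ennreal (if r \<le> s then exp (\<kappa>1 * (s - r) / 4) * cmod (z r) else 0)"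
  have "ennreal (cmod (?w s)) \<le> (\<integral>\<^sup>+r. ennreal (cmod (if r \<le> s then z r else 0)) \<partial>R)"
   by (rule norm_integral_le_nn)
  also have "\<dots> = (\<integral>\<^sup>+r. ?f1 r * ?f2 r \<partial>R)"
  proof (rule nn_integral_cong)
   fix r
   have "exp (- \<kappa>1 * (s - r) / 4) * exp (\<kappa>1 * (s - r) / 4) = 1" by (simp flip: exp_add)
   then show "ennreal (cmod (if r \<le> s then z r else 0)) = ?f1 r * ?f2 r"
    by (simp add: mult.assoc[symmetric] flip: ennreal_mult)
  qed
  finally have "ennreal (cmod (?w s))^2 \<le> (\<integral>\<^sup>+r. ?f1 r * ?f2 r \<partial>R)^2" by (intro power_mono) auto
  also have "\<dots> \<le> (\<integral>\<^sup>+r. (?f1 r)^2 \<partial>R) * (\<integral>\<^sup>+r. (?f2 r)^2 \<partial>R)"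
   by (intro Cauchy_Schwarz_nn_integral) measurable
  finally have cs: "ennreal ((cmod (?w s))\<^sup>2) \<le> (\<integral>\<^sup>+r. (?f1 r)^2 \<partial>R) * (\<integral>\<^sup>+r. (?f2 r)^2 \<partial>R)"
   by (simp add: ennreal_power)
  have f1: "(\<integral>\<^sup>+r. (?f1 r)^2 \<partial>R) \<le> ennreal (2 / \<kappa>1)"
  proof -
   have "(?f1 r)^2 = ennreal (if r \<le> s then exp (- \<kappa>1 * (s - r) / 2) else 0)" for r
   proof -
    have "exp (- \<kappa>1 * (s - r) / 4) * exp (- \<kappa>1 * (s - r) / 4) = exp (- \<kappa>1 * (s - r) / 2)"
     unfolding exp_add[symmetric] by (simp add: field_simps)
    then show ?thesis by (simp add: power2_eq_square flip: ennreal_mult)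
   qed
   then show ?thesis using exp_integral_left[OF s] by simp
  qed
  have f2: "ennreal (g s) * (\<integral>\<^sup>+r. (?f2 r)^2 \<partial>R) \<le> (\<integral>\<^sup>+r. ennreal (K s r * a r) \<partial>R)"
  proof -
   have "ennreal (g s) * (\<integral>\<^sup>+r. (?f2 r)^2 \<partial>R) = (\<integral>\<^sup>+r. ennreal (g s) * (?f2 r)^2 \<partial>R)"
    by (intro nn_integral_cmult[symmetric]) measurable
   also have "\<dots> \<le> (\<integral>\<^sup>+r. ennreal (K s r * a r) \<partial>R)"
   proof (rule nn_integral_mono)
    fix r assume "r \<in> space R"
    then have r: "0 \<le> r" by simp
    show "ennreal (g s) * (?f2 r)^2 \<le> ennreal (K s r * a r)"
    proof (cases "r \<le> s")
     case True
     have e2: "(exp (\<kappa>1 * (s - r) / 4))\<^sup>2 = exp (\<kappa>1 * (s - r) / 2)"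
      by (simp add: power2_eq_square flip: exp_add)
     have "g s * (exp (\<kappa>1 * (s - r) / 4) * cmod (z r))\<^sup>2 \<le>
       (exp (- \<kappa>1 * (s - r)) * g r) * (exp (\<kappa>1 * (s - r) / 4) * cmod (z r))\<^sup>2"
      using g_decay[OF r True] by (intro mult_right_mono) auto
     also have "\<dots> = (exp (- \<kappa>1 * (s - r)) * exp (\<kappa>1 * (s - r) / 2)) * (g r * (cmod (z r))\<^sup>2)"
      by (simp add: power_mult_distrib e2)
     also have "exp (- \<kappa>1 * (s - r)) * exp (\<kappa>1 * (s - r) / 2) = exp (- \<kappa>1 * (s - r) / 2)"
      by (simp flip: exp_add)
     finally show ?thesis
      using True g_ge0[OF s] by (simp add: K_def a_def ennreal_power ennreal_leI flip: ennreal_mult)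
    qed simp
   qed
   finally show ?thesis .
  qed
  have "ennreal (g s) * ennreal ((cmod (?w s))\<^sup>2) \<le> ennreal (g s) * ((\<integral>\<^sup>+r. (?f1 r)^2 \<partial>R) * (\<integral>\<^sup>+r. (?f2 r)^2 \<partial>R))"
   using cs by (rule mult_left_mono) simp
  also have "\<dots> = (\<integral>\<^sup>+r. (?f1 r)^2 \<partial>R) * (ennreal (g s) * (\<integral>\<^sup>+r. (?f2 r)^2 \<partial>R))"
   by (rule mult.left_commute)
  also have "\<dots> \<le> ennreal (2 / \<kappa>1) * (\<integral>\<^sup>+r. ennreal (K s r * a r) \<partial>R)"
   using f1 f2 by (intro mult_mono) auto
  finally show ?thesis .
 qed
 have "(\<integral>\<^sup>+s. ennreal ((cmod (?w s))\<^sup>2) \<partial>G) = (\<integral>\<^sup>+s. ennreal (g s) * ennreal ((cmod (?w s))\<^sup>2) \<partial>R)"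
  unfolding G_def by (intro nn_integral_density) measurable
 also have "\<dots> \<le> (\<integral>\<^sup>+s. ennreal (2 / \<kappa>1) * (\<integral>\<^sup>+r. ennreal (K s r * a r) \<partial>R) \<partial>R)"
  by (intro nn_integral_mono pt) simp
 also have "\<dots> = ennreal (2 / \<kappa>1) * (\<integral>\<^sup>+s. (\<integral>\<^sup>+r. ennreal (K s r * a r) \<partial>R) \<partial>R)"
  by (intro nn_integral_cmult sigma_finite_measure.borel_measurable_nn_integral[OF sf_R]) (auto simp: case_prod_unfold)
 finally have A: "(\<integral>\<^sup>+s. ennreal ((cmod (?w s))\<^sup>2) \<partial>G) \<le>
   ennreal (2 / \<kappa>1) * (\<integral>\<^sup>+s. (\<integral>\<^sup>+r. ennreal (K s r * a r) \<partial>R) \<partial>R)" .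
 have "(\<integral>\<^sup>+s. (\<integral>\<^sup>+r. ennreal (K s r * a r) \<partial>R) \<partial>R) = (\<integral>\<^sup>+r. (\<integral>\<^sup>+s. ennreal (K s r * a r) \<partial>R) \<partial>R)"
 proof (rule RR.Fubini')
  have "(\<lambda>p. K (snd p) (fst p)) \<in> borel_measurable (R \<Otimes>\<^sub>M R)" unfolding K_def by measurable
  then show "(\<lambda>(r, s). ennreal (K s r * a r)) \<in> borel_measurable (R \<Otimes>\<^sub>M R)"
   by (simp add: case_prod_unfold)
 qed
 also have "\<dots> \<le> (\<integral>\<^sup>+r. ennreal (2 / \<kappa>1) * ennreal (a r) \<partial>R)"
 proof (rule nn_integral_mono)
  fix r assume "r \<in> space R"
  then have r: "0 \<le> r" by simp
  have a0: "0 \<le> a r" using g_ge0[OF r] by (simp add: a_def)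
  have "(\<integral>\<^sup>+s. ennreal (K s r * a r) \<partial>R) = (\<integral>\<^sup>+s. ennreal (K s r) * ennreal (a r) \<partial>R)"
   using K0 a0 by (simp add: ennreal_mult)
  also have "\<dots> = (\<integral>\<^sup>+s. ennreal (K s r) \<partial>R) * ennreal (a r)" by (intro nn_integral_multc) measurable
  also have "\<dots> \<le> ennreal (2 / \<kappa>1) * ennreal (a r)"
   using exp_integral_right[OF r] unfolding K_def by (rule mult_right_mono) simp
  finally show "(\<integral>\<^sup>+s. ennreal (K s r * a r) \<partial>R) \<le> ennreal (2 / \<kappa>1) * ennreal (a r)" .
 qed
 also have "\<dots> = ennreal (2 / \<kappa>1) * (\<integral>\<^sup>+r. ennreal (a r) \<partial>R)" by (intro nn_integral_cmult) measurable
 also have "(\<integral>\<^sup>+r. ennreal (a r) \<partial>R) = (\<integral>\<^sup>+s. ennreal ((cmod (z s))\<^sup>2) \<partial>G)"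
 proof -
  have "(\<integral>\<^sup>+s. ennreal ((cmod (z s))\<^sup>2) \<partial>G) = (\<integral>\<^sup>+s. ennreal (g s) * ennreal ((cmod (z s))\<^sup>2) \<partial>R)"
   unfolding G_def by (intro nn_integral_density) measurable
  also have "\<dots> = (\<integral>\<^sup>+r. ennreal (a r) \<partial>R)"
   by (intro nn_integral_cong) (simp add: a_def g_ge0 ennreal_mult)
  finally show ?thesis ..
 qed
 finally have "(\<integral>\<^sup>+s. (\<integral>\<^sup>+r. ennreal (K s r * a r) \<partial>R) \<partial>R) \<le>
   ennreal (2 / \<kappa>1) * (\<integral>\<^sup>+s. ennreal ((cmod (z s))\<^sup>2) \<partial>G)" .
 then have B: "ennreal (2 / \<kappa>1) * (\<integral>\<^sup>+s. (\<integral>\<^sup>+r. ennreal (K s r * a r) \<partial>R) \<partial>R) \<le>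
   ennreal (2 / \<kappa>1) * (ennreal (2 / \<kappa>1) * (\<integral>\<^sup>+s. ennreal ((cmod (z s))\<^sup>2) \<partial>G))"
  by (rule mult_left_mono) simp
 have C: "ennreal ((2 / \<kappa>1)\<^sup>2) = ennreal (2 / \<kappa>1) * ennreal (2 / \<kappa>1)"
  unfolding power2_eq_square using kappa1_pos by (intro ennreal_mult) auto
 show ?thesis unfolding C mult.assoc using A B by (rule order_trans)
qed

lemma J_sqi:
 assumes Z: "Z \<in> sqi P"
 shows "J Z \<in> sqi P"
proof (rule sqi_nn_bound(1))
 have Zm[measurable]: "Z \<in> borel_measurable P" and Jm[measurable]: "J Z \<in> borel_measurable P"
  using sqiD(1)[OF Z] J_meas by auto
 show "J Z \<in> borel_measurable P" by (rule Jm)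
 have "(\<integral>\<^sup>+p. ennreal ((cmod (J Z p))\<^sup>2) \<partial>P) = (\<integral>\<^sup>+x. (\<integral>\<^sup>+s. ennreal ((cmod (J Z (s, x)))\<^sup>2) \<partial>G) \<partial>I)"
  using pg.nn_integral_snd[of "\<lambda>p. ennreal ((cmod (J Z p))\<^sup>2)"] by simp
 also have "\<dots> \<le> (\<integral>\<^sup>+x. ennreal ((2 / \<kappa>1)\<^sup>2) * (\<integral>\<^sup>+s. ennreal ((cmod (Z (s, x)))\<^sup>2) \<partial>G) \<partial>I)"
 proof (rule nn_integral_mono)
  fix x assume "x \<in> space I"
  then have "(\<lambda>s. Z (s, x)) \<in> borel_measurable R" using sec_meas_R[OF Zm] by auto
  from hardy[OF this] show "(\<integral>\<^sup>+s. ennreal ((cmod (J Z (s, x)))\<^sup>2) \<partial>G) \<le>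
    ennreal ((2 / \<kappa>1)\<^sup>2) * (\<integral>\<^sup>+s. ennreal ((cmod (Z (s, x)))\<^sup>2) \<partial>G)" by (simp add: J_def)
 qed
 also have "\<dots> = ennreal ((2 / \<kappa>1)\<^sup>2) * (\<integral>\<^sup>+x. (\<integral>\<^sup>+s. ennreal ((cmod (Z (s, x)))\<^sup>2) \<partial>G) \<partial>I)"
  by (intro nn_integral_cmult Gf.borel_measurable_nn_integral) (simp add: case_prod_unfold, measurable)
 also have "(\<integral>\<^sup>+x. (\<integral>\<^sup>+s. ennreal ((cmod (Z (s, x)))\<^sup>2) \<partial>G) \<partial>I) = ennreal ((l2n P Z)\<^sup>2)"
  using pg.nn_integral_snd[of "\<lambda>p. ennreal ((cmod (Z p))\<^sup>2)"] l2n_eq_nn[OF Z] by simp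
 also have "ennreal ((2 / \<kappa>1)\<^sup>2) * ennreal ((l2n P Z)\<^sup>2) = ennreal ((2 / \<kappa>1 * l2n P Z)\<^sup>2)"
  unfolding power_mult_distrib by (rule ennreal_mult[symmetric]) simp_all
 finally show "(\<integral>\<^sup>+p. ennreal ((cmod (J Z p))\<^sup>2) \<partial>P) \<le> ennreal ((2 / \<kappa>1 * l2n P Z)\<^sup>2)" .
 show "0 \<le> 2 / \<kappa>1 * l2n P Z" using kappa1_pos by simp
qed

text \<open>Exchanging \<open>r\<close> and \<open>s\<close> shows that the integral over
  \<open>r \<le> s\<close> is half of the integral over the whole quadrant, which is the squared
  norm of the integral of \<open>y\<close>.\<close>

lemma inner_indefinite_nonneg:
 fixes y :: "real => complex"
 assumes y: "integrable R y"
 shows "0 \<le> (LINT s|R. inner (y s) (LINT r|R. (if r \<le> s then y r else 0)))"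
proof -
 interpret RR: pair_sigma_finite R R by (simp add: pair_sigma_finite_def sf_R)
 have [measurable]: "y \<in> borel_measurable R" using y by auto
 let ?F = "\<lambda>(s, r). if r \<le> s then inner (y s) (y r) else 0"
 have iF: "integrable (R \<Otimes>\<^sub>M R) ?F"
  by (rule integrable_pair_bound[OF sf_R sf_R y y]) (auto intro: Cauchy_Schwarz_ineq2)
 let ?H = "\<lambda>(s, r). if s \<le> r then inner (y s) (y r) else 0"
 have iH: "integrable (R \<Otimes>\<^sub>M R) ?H"
  by (rule integrable_pair_bound[OF sf_R sf_R y y]) (auto intro: Cauchy_Schwarz_ineq2)
 have yr: "integrable R (\<lambda>r. if r \<le> s then y r else 0)" for s by (rule int_bound[OF y]) auto
 have A: "(LINT s|R. inner (y s) (LINT r|R. (if r \<le> s then y r else 0))) = (LINT s|R. LINT r|R. ?F (s, r))"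
 proof (rule int_cong[OF refl])
  fix s
  have "inner (y s) (LINT r|R. (if r \<le> s then y r else 0)) = (LINT r|R. inner (y s) (if r \<le> s then y r else 0))"
   using yr by (intro integral_inner_right[symmetric]) auto
  also have "\<dots> = (LINT r|R. ?F (s, r))" by (intro int_cong) auto
  finally show "inner (y s) (LINT r|R. (if r \<le> s then y r else 0)) = (LINT r|R. ?F (s, r))" .
 qed
 have B: "(LINT s|R. LINT r|R. ?F (s, r)) = (LINT s|R. LINT r|R. ?H (s, r))"
 proof -
  have "(LINT s|R. LINT r|R. ?F (s, r)) = (LINT r|R. LINT s|R. ?F (s, r))"
   using RR.Fubini_integral[of "\<lambda>s r. ?F (s, r)"] iF by (simp add: case_prod_unfold cong: if_cong)
  also have "\<dots> = (LINT s|R. LINT r|R. ?H (s, r))" by (intro int_cong refl) (simp add: inner_commute)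
  finally show ?thesis .
 qed
 have "(LINT s|R. LINT r|R. ?F (s, r)) + (LINT s|R. LINT r|R. ?H (s, r)) = (LINT p|(R \<Otimes>\<^sub>M R). ?F p) + (LINT p|(R \<Otimes>\<^sub>M R). ?H p)"
  using RR.integral_fst'[OF iF] RR.integral_fst'[OF iH] by simp
 also have "\<dots> = (LINT p|(R \<Otimes>\<^sub>M R). (?F p + ?H p))" using iF iH by simp
 also have "\<dots> = (LINT s|R. LINT r|R. (?F (s, r) + ?H (s, r)))"
  using RR.integral_fst'[of "\<lambda>p. ?F p + ?H p"] iF iH by simp
 also have "\<dots> = (LINT s|R. LINT r|R. inner (y s) (y r))"
 proof (rule int_cong[OF refl])
  fix s assume s: "s \<in> space R"
  have [measurable]: "(\<lambda>r. ?F (s, r)) \<in> borel_measurable R" "(\<lambda>r. ?H (s, r)) \<in> borel_measurable R"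
   using measurable_compose[OF measurable_Pair1'[OF s] borel_measurable_integrable[OF iF]]
    measurable_compose[OF measurable_Pair1'[OF s] borel_measurable_integrable[OF iH]] by auto
  have "AE r in R. r \<noteq> s" unfolding AE_R using AE_lborel_singleton[of s] by eventually_elim simp
  then show "(LINT r|R. (?F (s, r) + ?H (s, r))) = (LINT r|R. inner (y s) (y r))"
  proof (intro integral_cong_AE)
   assume "AE r in R. r \<noteq> s"
   then show "AE r in R. ?F (s, r) + ?H (s, r) = inner (y s) (y r)" by eventually_elim auto
  qed (rule borel_measurable_add, measurable)
 qed
 also have "\<dots> = inner (LINT s|R. y s) (LINT r|R. y r)" using y by simp
 also have "\<dots> \<ge> 0" by simp
 finally show ?thesis using A B by simp
qed

text \<open>Layer cake: \<open>g s\<close> is the integral over \<open>t > 0\<close> of the indicator of \<open>t < g s\<close>, and since \<open>g\<close> is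
 decreasing the set where \<open>t < g\<close> is an initial segment, on which \<open>inner z (\<integral>\<^sub>0\<^sup>s z)\<close> integrates to a
 square.\<close>

lemma weighted_inner_nonneg:
 fixes z :: "real => complex"
 assumes z: "integrable G z" and H: "integrable G (\<lambda>s. inner (z s) (LINT r|R. (if r \<le> s then z r else 0)))"
 shows "0 \<le> (LINT s|G. inner (z s) (LINT r|R. (if r \<le> s then z r else 0)))"
proof -
 interpret Rl: pair_sigma_finite R "lborel :: real measure"
  by (simp add: pair_sigma_finite_def sf_R sigma_finite_lborel)
 define h where "h = (\<lambda>s. inner (z s) (LINT r|R. (if r \<le> s then z r else 0)))"
 have hG: "integrable G h" using H by (simp add: h_def)
 have hm[measurable]: "h \<in> borel_measurable R" using borel_measurable_integrable[OF hG] meas_G by blast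
 have hR: "integrable R (\<lambda>s. g s * h s)" using hG integrable_G[OF hm] by simp
 let ?F = "\<lambda>s t. if 0 < t \<and> t < g s then h s else 0"
 have inner_int: "(LINT t|lborel. ?F s t) = g s * h s" "(LINT t|lborel. norm (?F s t)) = g s * \<bar>h s\<bar>"
  "integrable lborel (?F s)" if "0 \<le> g s" for s
 proof -
  have eq: "?F s t = indicat_real {0<..<g s} t * h s" "norm (?F s t) = indicat_real {0<..<g s} t * \<bar>h s\<bar>" for t
   by (auto simp: indicator_def)
  show "(LINT t|lborel. ?F s t) = g s * h s" "integrable lborel (?F s)" unfolding eq(1) using that by simp_all
  have "(LINT t|lborel. norm (?F s t)) = (LINT t|lborel. indicat_real {0<..<g s} t * \<bar>h s\<bar>)"
   by (rule int_cong[OF refl eq(2)])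
  then show "(LINT t|lborel. norm (?F s t)) = g s * \<bar>h s\<bar>" using that by simp
 qed
 have "(\<lambda>p. if 0 < snd p \<and> snd p < g (fst p) then h (fst p) else 0) \<in> borel_measurable (R \<Otimes>\<^sub>M lborel)"
  by measurable
 then have Fm: "case_prod ?F \<in> borel_measurable (R \<Otimes>\<^sub>M lborel)" by (simp add: case_prod_unfold)
 have iF: "integrable (R \<Otimes>\<^sub>M lborel) (case_prod ?F)"
 proof (rule Rl.Fubini_integrable[OF Fm])
  show "AE s in R. integrable lborel (\<lambda>t. case (s, t) of (s, t) => ?F s t)"
   using g_ge0_R by eventually_elim (use inner_int(3) in simp)
  have "integrable R (\<lambda>s. \<bar>g s * h s\<bar>)" using hR by simp
  then show "integrable R (\<lambda>s. LINT t|lborel. norm (case (s, t) of (s, t) => ?F s t))"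
  proof (rule integrable_cong_AE_imp)
   show "(\<lambda>s. LINT t|lborel. norm (case (s, t) of (s, t) => ?F s t)) \<in> borel_measurable R"
    using Fm by (intro lborel.borel_measurable_lebesgue_integral) (simp add: case_prod_unfold)
   show "AE s in R. \<bar>g s * h s\<bar> = (LINT t|lborel. norm (case (s, t) of (s, t) => ?F s t))"
    using g_ge0_R
   proof eventually_elim
    case (elim s)
    then show ?case using inner_int(2)[of s] by (simp add: abs_mult)
   qed
  qed
 qed
 have "(LINT s|G. h s) = (LINT s|R. g s * h s)" using integral_G[OF hm] by simp
 also have "\<dots> = (LINT s|R. LINT t|lborel. ?F s t)" using inner_int(1) g_ge0 by (intro int_cong) auto
 also have "\<dots> = (LINT t|lborel. LINT s|R. ?F s t)" by (rule Rl.Fubini_integral[OF iF, symmetric])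
 also have "\<dots> \<ge> 0"
 proof (rule integral_nonneg_AE, rule AE_I2)
  fix t :: real
  show "0 \<le> (LINT s|R. ?F s t)"
  proof (cases "0 < t")
   case True
   let ?y = "\<lambda>s. if t < g s then z s else 0"
   have "(LINT s|R. ?F s t) = (LINT s|R. inner (?y s) (LINT r|R. (if r \<le> s then ?y r else 0)))"
   proof (rule int_cong[OF refl])
    fix s assume "s \<in> space R"
    show "?F s t = inner (?y s) (LINT r|R. (if r \<le> s then ?y r else 0))"
    proof (cases "t < g s")
     case tg: True
     have "(LINT r|R. (if r \<le> s then ?y r else 0)) = (LINT r|R. (if r \<le> s then z r else 0))"
     proof (rule int_cong[OF refl])
      fix r assume "r \<in> space R"
      then show "(if r \<le> s then ?y r else 0) = (if r \<le> s then z r else 0)" using g_mono[of r s] tg by auto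
     qed
     then show ?thesis using tg True by (simp add: h_def)
    qed simp
   qed
   then show ?thesis using inner_indefinite_nonneg[OF integrable_upto[OF z True]] by simp
  qed simp
 qed
 finally show ?thesis by (simp add: h_def)
qed

text \<open>The dissipation due to memory. Formally it is minus half the integral of
  \<open>g'\<close> times the square of \<open>J Z\<close>; the layer-cake argument avoids
  differentiating under the integral and any boundary term at infinity.\<close>

lemma rip_J_nonneg:
 assumes Z: "Z \<in> sqi P"
 shows "0 \<le> rip P Z (J Z)"
proof -
 have i: "integrable P (\<lambda>(s, x). inner (Z (s, x)) (J Z (s, x)))"
  using rip_integrable[OF Z J_sqi[OF Z]] by (simp add: case_prod_unfold)
 have iZ: "integrable P (\<lambda>(s, x). Z (s, x))" using Pf.sqi_int[OF Z] by (simp add: case_prod_unfold)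
 have "rip P Z (J Z) = (LINT x|I. LINT s|G. inner (Z (s, x)) (J Z (s, x)))"
  using pg.integral_snd[OF i] by (simp add: rip_def case_prod_unfold)
 also have "\<dots> \<ge> 0"
 proof (rule integral_nonneg_AE)
  show "AE x in I. 0 \<le> (LINT s|G. inner (Z (s, x)) (J Z (s, x)))"
   using pg.AE_integrable_snd[OF i] pg.AE_integrable_snd[OF iZ]
  proof eventually_elim
   case (elim x)
   then show ?case using weighted_inner_nonneg[of "\<lambda>s. Z (s, x)"] by (simp add: J_def)
  qed
 qed
 finally show ?thesis .
qed

text \<open>On an interval \<open>(0, q)\<close> with \<open>g q > 0\<close> both functions are
  integrable and the primitive of their difference is constant, so they agree there.\<close>

lemma indefinite_unique:
 fixes z1 z2 :: "real => complex"
 assumes z: "integrable G z1" "integrable G z2"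
  and eq: "AE s in G. (LINT r|R. (if r \<le> s then z1 r else 0)) = c + (LINT r|R. (if r \<le> s then z2 r else 0))"
 shows "AE s in G. z1 s = z2 s"
proof -
 have [measurable]: "z1 \<in> borel_measurable R" "z2 \<in> borel_measurable R" using z[THEN borel_measurable_integrable] unfolding meas_G .
 have loc: "AE r in lborel. 0 < r \<and> r < q --> z1 r = z2 r" if q: "0 < q" "0 < g q" for q
 proof -
  interpret Q: interval q by standard (rule q(1))
  let ?k = "\<lambda>r. z1 r - z2 r"
  have iz: "integrable R (\<lambda>r. if r \<le> s then u r else 0)" if u: "integrable G u" and s: "s \<le> q" for u :: "real => complex" and s
  proof (rule int_bound)
   show "integrable R (\<lambda>r. if g q / 2 < g r then u r else 0)" by (rule integrable_upto[OF u]) (use q in simp)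
   have "u \<in> borel_measurable R" using borel_measurable_integrable[OF u] unfolding meas_G .
   then show "(\<lambda>r. if r \<le> s then u r else 0) \<in> borel_measurable R" by measurable
   show "AE r in R. norm (if r \<le> s then u r else 0) \<le> norm (if g q / 2 < g r then u r else 0)"
   proof (rule AE_I2)
    fix r assume "r \<in> space R"
    then show "norm (if r \<le> s then u r else 0) \<le> norm (if g q / 2 < g r then u r else 0)"
     using g_mono[of r q] s q by auto
   qed
  qed
  have conv: "(LINT r|R. (if r \<le> s then u r else 0)) = Q.prim u s"
   if s: "s < q" and [measurable]: "u \<in> borel_measurable R" for u :: "real => complex" and s
  proof -
   have [measurable]: "(\<lambda>r. indicat_real {0..} r *\<^sub>R u r) \<in> borel_measurable lborel"
    using that(2) unfolding R_def by (subst (asm) borel_measurable_restrict_space_iff) auto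
   have e: "(if r \<le> s then indicat_real {0<..<q} r *\<^sub>R u r else 0) =
     (if r \<le> s then indicat_real {0<..<q} r *\<^sub>R (indicat_real {0..} r *\<^sub>R u r) else 0)"
    "indicat_real {0..} r *\<^sub>R (if r \<le> s then u r else 0) = (if r \<le> s then indicat_real {0..} r *\<^sub>R u r else 0)" for r
    by (auto simp: indicator_def)
   show ?thesis unfolding integral_R Q.prim_lborel e
   proof (rule integral_cong_AE)
    show "AE r in lborel. (if r \<le> s then indicat_real {0..} r *\<^sub>R u r else 0) =
     (if r \<le> s then indicat_real {0<..<q} r *\<^sub>R (indicat_real {0..} r *\<^sub>R u r) else 0)"
     using AE_lborel_singleton[of 0] by eventually_elim (use s in \<open>auto simp: indicator_def\<close>)
   qed measurable
  qed
  have iI: "integrable Q.I u" if u: "integrable G u" for u :: "real => complex"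
  proof -
   have "integrable lborel (\<lambda>r. indicat_real {0<..<q} r *\<^sub>R (indicat_real {0..} r *\<^sub>R (if r \<le> q then u r else 0)))"
    by (intro integrable_mult_indicator iz[OF u order_refl, unfolded integrable_R]) auto
   moreover have "indicat_real {0<..<q} r *\<^sub>R (indicat_real {0..} r *\<^sub>R (if r \<le> q then u r else 0)) = indicat_real {0<..<q} r *\<^sub>R u r" for r
    by (auto simp: indicator_def)
   ultimately show ?thesis unfolding Q.integrable_I by simp
  qed
  have "AE r in Q.I. Q.prim ?k r = c" unfolding Q.AE_I using eq unfolding AE_G
  proof eventually_elim
   case (elim s)
   show ?case
   proof
    assume s: "0 < s \<and> s < q"
    then have "0 < g s" using g_mono[of s q] q by auto
    then have "Q.prim z1 s = c + Q.prim z2 s" using elim s by (simp add: conv)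
    then show "Q.prim ?k s = c" using Q.prim_diff[OF iI[OF z(1)] iI[OF z(2)]] by simp
   qed
  qed
  then have "AE r in Q.I. ?k r = 0" using iI[OF z(1)] iI[OF z(2)] by (intro Q.prim_const_imp_zero) auto
  then show ?thesis unfolding Q.AE_I by eventually_elim simp
 qed
 \<comment> \<open>Rational \<open>q\<close> keep the exceptional set null; by continuity of
   \<open>g\<close> each point where \<open>g > 0\<close> has such a \<open>q\<close> to its
   right.\<close>
 have "AE r in lborel. \<forall>q\<in>\<rat>. 0 < q \<and> 0 < g q --> 0 < r \<and> r < q --> z1 r = z2 r"
  by (subst AE_ball_countable[OF countable_rat]) (auto intro: loc)
 then show ?thesis unfolding AE_G using AE_lborel_singleton[of 0]
 proof eventually_elim
  case (elim r)
  show ?case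
  proof
   assume r: "0 \<le> r \<and> 0 < g r"
   have "\<exists>d>0. \<forall>r'\<in>{0..}. dist r' r < d --> dist (g r') (g r) < g r"
    using g_cont r unfolding continuous_on_iff by (metis atLeast_iff)
   then obtain d where d: "d > 0" "!!r'. 0 \<le> r' ==> dist r' r < d ==> dist (g r') (g r) < g r" by auto
   obtain q where q: "q \<in> \<rat>" "r < q" "q < r + d" using Rats_dense_in_real[of r "r + d"] d(1) by auto
   have "dist (g q) (g r) < g r" using d(2)[of q] q r by (simp add: dist_real_def)
   then have "0 < g q" by (simp add: dist_real_def)
   then show "z1 r = z2 r" using elim q r by auto
  qed
 qed
qed

text \<open>\<open>e\<close> is the difference of the unknown initial values. At fixed
  \<open>x\<close> it is a constant in \<open>s\<close>, which \<open>indefinite_unique\<close>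
  tolerates.\<close>

theorem s_deriv_unique:
 assumes Z: "Z1 \<in> sqi P" "Z2 \<in> sqi P" and e: "e \<in> borel_measurable I"
  and eq: "AE s in G. AE x in I. sl (J Z1) s x = e x + sl (J Z2) s x"
 shows "AE p in P. Z1 p = Z2 p"
proof -
 have m: "J Z1 \<in> borel_measurable P" "(\<lambda>p. e (snd p) + J Z2 p) \<in> borel_measurable P"
  using J_meas sqiD(1) Z e by measurable
 have "AE s in G. AE x in I. sl (J Z1) s x = sl (\<lambda>p. e (snd p) + J Z2 p) s x"
  using eq by (simp add: sl_def)
 then have A: "AE x in I. AE s in G. J Z1 (s, x) = e x + J Z2 (s, x)" using AE_P_eq[OF m] AE_P_eq_snd[OF m] by simp
 have i: "AE x in I. integrable G (\<lambda>s. Z (s, x))" if "Z \<in> sqi P" for Z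
  using pg.AE_integrable_snd[of "\<lambda>s x. Z (s, x)"] Pf.sqi_int[OF that] by (simp add: case_prod_unfold)
 have "AE x in I. AE s in G. Z1 (s, x) = Z2 (s, x)" using A i[OF Z(1)] i[OF Z(2)]
 proof eventually_elim
  case (elim x)
  show ?case
   by (rule indefinite_unique[of "\<lambda>s. Z1 (s, x)" "\<lambda>s. Z2 (s, x)" "e x"]) (use elim in \<open>simp_all add: J_def\<close>)
 qed
 then show ?thesis unfolding AE_P_eq_snd[OF sqiD(1)[OF Z(1)] sqiD(1)[OF Z(2)]] .
qed

end

lemma (in finite_measure) integral_sq_le:
 assumes f: "f \<in> sqi M"
 shows "(cmod (LINT x|M. f x))\<^sup>2 \<le> measure M (space M) * (l2n M f)\<^sup>2"
proof -
 have "(cmod (LINT x|M. f x))\<^sup>2 \<le> (sqrt (measure M (space M)) * l2n M f)\<^sup>2"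
  by (intro power_mono integral_le_l2n f) simp
 then show ?thesis by (simp add: power_mult_distrib)
qed

section \<open>Linearity of joint derivatives and the memory flux\<close>

context memory
begin

lemma sqi_snd:
 assumes k: "k \<in> sqi I"
 shows "(\<lambda>p. k (snd p)) \<in> sqi P"
proof -
 have m[measurable]: "k \<in> borel_measurable I" by (rule sqiD(1)[OF k])
 have "integrable P (\<lambda>(s, x). (cmod (k x))\<^sup>2)"
 proof (rule pg.Fubini_integrable)
  show "(\<lambda>(s, x). (cmod (k x))\<^sup>2) \<in> borel_measurable P" by measurable
 qed (use sqiD(2)[OF k] in simp_all)
 then show ?thesis by (simp add: sqi_def case_prod_unfold)
qed

lemma sl_snd: "sl (\<lambda>p. k (snd p)) s = k" by (simp add: sl_def)

lemma section_sqi: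
 assumes Z: "Z \<in> sqi P"
 shows "AE x in I. (\<lambda>s. Z (s, x)) \<in> sqi G"
proof -
 have "integrable P (\<lambda>(s, x). (cmod (Z (s, x)))\<^sup>2)" using sqiD(2)[OF Z] by (simp add: case_prod_unfold)
 from pg.AE_integrable_snd[OF this] AE_space show ?thesis
 proof eventually_elim
  case (elim x)
  have "(\<lambda>s. Z (s, x)) \<in> borel_measurable G"
   using measurable_compose[OF measurable_Pair2'[OF elim(2)] sqiD(1)[OF Z]] .
  then show ?case using elim by (simp add: sqi_def)
 qed
qed

lemma mem_rep_add:
 assumes "mem_rep \<eta> Z" "mem_rep \<eta>' Z'"
 shows "mem_rep (\<lambda>s x. \<eta> s x + \<eta>' s x) (\<lambda>p. Z p + Z' p)"
proof -
 note a = mem_repD[OF assms(1)] and b = mem_repD[OF assms(2)]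
 have m: "(\<lambda>(s, x). \<eta> s x + \<eta>' s x) \<in> borel_measurable P"
  using borel_measurable_add[OF a(2) b(2)] by (simp add: case_prod_unfold)
 have "AE s in G. (LINT x|I. sl (\<lambda>p. Z p + Z' p) s x) = 0 \<and>
   (AE x in I. \<eta> s x + \<eta>' s x = prim (sl (\<lambda>p. Z p + Z' p) s) x)"
  using a(3,4) b(3,4) sl_sqi[OF a(1)] sl_sqi[OF b(1)]
 proof eventually_elim
  case (elim s)
  have i: "integrable I (sl Z s)" "integrable I (sl Z' s)" using elim fin.sqi_int by auto
  have e: "sl (\<lambda>p. Z p + Z' p) s = (\<lambda>x. sl Z s x + sl Z' s x)" by (simp add: sl_def)
  have "AE x in I. \<eta> s x + \<eta>' s x = prim (\<lambda>x. sl Z s x + sl Z' s x) x"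
   using elim(2,4) by eventually_elim (simp add: prim_add[OF i])
  then show ?case using elim i unfolding e by simp
 qed
 then show ?thesis unfolding mem_rep_def using sqi_add'[OF a(1) b(1)] m by blast
qed

lemma mem_rep_mult:
 assumes "mem_rep \<eta> Z"
 shows "mem_rep (\<lambda>s x. c * \<eta> s x) (\<lambda>p. c * Z p)"
proof -
 note a = mem_repD[OF assms]
 have m: "(\<lambda>(s, x). c * \<eta> s x) \<in> borel_measurable P"
  using borel_measurable_times[OF borel_measurable_const a(2), of c] by (simp add: case_prod_unfold)
 have "AE s in G. (LINT x|I. sl (\<lambda>p. c * Z p) s x) = 0 \<and>
   (AE x in I. c * \<eta> s x = prim (sl (\<lambda>p. c * Z p) s) x)" using a(3,4)
 proof eventually_elim
  case (elim s)
  have e: "sl (\<lambda>p. c * Z p) s = (\<lambda>x. c * sl Z s x)" by (simp add: sl_def)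
  have "AE x in I. c * \<eta> s x = prim (\<lambda>x. c * sl Z s x) x"
   using elim(2) by eventually_elim (simp add: prim_mult)
  then show ?case using elim unfolding e by simp
 qed
 then show ?thesis unfolding mem_rep_def using sqi_mult'[OF a(1)] m by blast
qed

lemma mem_rep_unique:
 assumes "mem_rep \<eta> Z" "mem_rep \<eta>' Z'" "AE s in G. AE x in I. \<eta> s x = \<eta>' s x"
 shows "AE p in P. Z p = Z' p"
proof -
 note a = mem_repD[OF assms(1)] and b = mem_repD[OF assms(2)]
 have "AE s in G. AE x in I. sl Z s x = sl Z' s x" using a(4) b(4) sl_sqi[OF a(1)] sl_sqi[OF b(1)] assms(3)
 proof eventually_elim
  case (elim s)
  have "AE x in I. 0 + prim (sl Z s) x = 0 + prim (sl Z' s) x" using elim(1,2,5) by eventually_elim simp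
  then show ?case by (rule prim_eq_unique[OF fin.sqi_int[OF elim(3)] fin.sqi_int[OF elim(4)]])
 qed
 then show ?thesis unfolding AE_P_eq[OF sqiD(1)[OF a(1)] sqiD(1)[OF b(1)]] .
qed

lemma mem_rep_primP:
 assumes "Z \<in> sqi P" "AE s in G. (LINT x|I. sl Z s x) = 0"
 shows "mem_rep (\<lambda>s x. primP Z (s, x)) Z" unfolding mem_rep_def
 using assms sqiD(1)[OF primP_sqi[OF assms(1)]] by (simp add: primP_def case_prod_unfold)

lemma mem_rep_const:
 assumes "\<Psi> \<in> H10 L"
 shows "mem_rep (\<lambda>s. \<Psi>) (\<lambda>p. wderiv L \<Psi> (snd p))"
proof -
 note D = H10_D[OF assms]
 have [measurable]: "\<Psi> \<in> borel_measurable I" by (rule sqiD(1)[OF D(2)])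
 show ?thesis unfolding mem_rep_def sl_snd using D sqi_snd[OF D(3)] by simp
qed

definition memd :: "(real => real => complex) => real \<times> real => complex" where
 "memd \<eta> = (SOME Z. mem_rep \<eta> Z)"

lemma mem_rep_memd: "\<eta> \<in> Lg2 L g ==> mem_rep \<eta> (memd \<eta>)"
 unfolding memd_def by (rule someI_ex[OF Lg2_mem_rep])

lemma memd_eq: "mem_rep \<eta> Z ==> AE p in P. memd \<eta> p = Z p"
 by (rule mem_rep_unique[OF mem_rep_memd[OF mem_rep_Lg2(1)]]) auto

lemma J_prim_L:
 assumes Z: "Z \<in> sqi P" and 0: "AE s in G. (LINT x|I. sl Z s x) = 0"
 shows "AE s in G. (LINT x|I. sl (J Z) s x) = 0" using AE_G_pos
proof eventually_elim
 case (elim s)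
 have [measurable]: "(\<lambda>r. prim (sl Z r) L) \<in> borel_measurable R"
 proof -
  have "(\<lambda>(r, y). Z (r, y)) \<in> borel_measurable (R \<Otimes>\<^sub>M I)" using sqiD(1)[OF Z] meas_P by (simp add: case_prod_unfold)
  then have "(\<lambda>r. LINT y|I. Z (r, y)) \<in> borel_measurable R" by (rule fin.borel_measurable_lebesgue_integral)
  then show ?thesis by (simp add: prim_L sl_def)
 qed
 have "(LINT x|I. sl (J Z) s x) = (LINT r|R. (if r \<le> s then prim (sl Z r) L else 0))"
  using J_prim(2)[OF Z, of s L] elim by (simp add: prim_L)
 also have "\<dots> = (LINT r|R. 0)"
 proof (rule integral_cong_AE)
  show "AE r in R. (if r \<le> s then prim (sl Z r) L else 0) = 0" using 0 AE_space unfolding AE_G'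
  proof eventually_elim
   case (elim r)
   then show ?case using g_mono[of r s] \<open>0 \<le> s \<and> 0 < g s\<close> by (auto simp: prim_L)
  qed
 qed measurable
 finally show ?case by simp
qed

lemma J_AE_section:
 assumes "Z \<in> sqi P"
 shows "AE x in I. AE s in G. integrable R (\<lambda>r. if r \<le> s then Z (r, x) else 0)"
 using section_sqi[OF assms]
proof eventually_elim
 case (elim x)
 have i: "integrable G (\<lambda>s. Z (s, x))" by (rule Gf.sqi_int[OF elim])
 have [measurable]: "(\<lambda>s. Z (s, x)) \<in> borel_measurable R" using borel_measurable_integrable[OF i] unfolding meas_G .
 show ?case using AE_G_pos
 proof eventually_elim
  case (elim s)
  show ?case
  proof (rule int_bound)
   show "integrable R (\<lambda>r. if g s / 2 < g r then Z (r, x) else 0)"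
    by (rule integrable_upto[OF i]) (use elim in simp)
   show "AE r in R. norm (if r \<le> s then Z (r, x) else 0) \<le> norm (if g s / 2 < g r then Z (r, x) else 0)"
   proof (rule AE_I2)
    fix r assume "r \<in> space R"
    then show "norm (if r \<le> s then Z (r, x) else 0) \<le> norm (if g s / 2 < g r then Z (r, x) else 0)"
     using g_mono[of r s] elim by auto
   qed
  qed measurable
 qed
qed

text \<open>Additivity holds almost everywhere only: on exceptional sections an integral may be
  undefined and default to 0.\<close>

lemma J_add:
 assumes Z: "Z \<in> sqi P" "Z' \<in> sqi P"
 shows "AE p in P. J (\<lambda>p. Z p + Z' p) p = J Z p + J Z' p"
proof -
 have m: "J (\<lambda>p. Z p + Z' p) \<in> borel_measurable P" "(\<lambda>p. J Z p + J Z' p) \<in> borel_measurable P"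
  by (auto intro!: J_meas borel_measurable_add sqiD(1)[OF Z(1)] sqiD(1)[OF Z(2)])
 have "AE x in I. AE s in G. J (\<lambda>p. Z p + Z' p) (s, x) = J Z (s, x) + J Z' (s, x)"
  using J_AE_section[OF Z(1)] J_AE_section[OF Z(2)]
 proof eventually_elim
  case (elim x)
  then show ?case
  proof eventually_elim
   case (elim s)
   have "(LINT r|R. (if r \<le> s then Z (r, x) + Z' (r, x) else 0)) =
     (LINT r|R. (if r \<le> s then Z (r, x) else 0) + (if r \<le> s then Z' (r, x) else 0))"
    by (intro int_cong) auto
   then show ?case using elim by (simp add: J_def)
  qed
 qed
 then show ?thesis unfolding AE_P_eq_snd[OF m] .
qed

lemma J_mult: "J (\<lambda>p. c * Z p) = (\<lambda>p. c * J Z p)"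
proof -
 have "(LINT r|R. (if r \<le> s then c * Z (r, x) else 0)) = c * (LINT r|R. (if r \<le> s then Z (r, x) else 0))" for s x
  unfolding integral_mult_right_zero[symmetric] by (intro int_cong) auto
 then show ?thesis by (simp add: J_def fun_eq_iff)
qed

lemma J_cong:
 assumes Z: "Z \<in> sqi P" "Z' \<in> sqi P" and eq: "AE p in P. Z p = Z' p"
 shows "AE p in P. J Z p = J Z' p"
proof -
 note m = sqiD(1)[OF Z(1)] sqiD(1)[OF Z(2)]
 have "AE x in I. AE s in G. J Z (s, x) = J Z' (s, x)" using eq[unfolded AE_P_eq_snd[OF m]] AE_space
 proof eventually_elim
  case (elim x)
  have [measurable]: "(\<lambda>s. Z (s, x)) \<in> borel_measurable R" "(\<lambda>s. Z' (s, x)) \<in> borel_measurable R"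
   using sec_meas_R[OF m(1)] sec_meas_R[OF m(2)] elim by auto
  show ?case using AE_G_pos
  proof eventually_elim
   case s: (elim s)
   have "(LINT r|R. (if r \<le> s then Z (r, x) else 0)) = (LINT r|R. (if r \<le> s then Z' (r, x) else 0))"
   proof (rule integral_cong_AE)
    show "AE r in R. (if r \<le> s then Z (r, x) else 0) = (if r \<le> s then Z' (r, x) else 0)"
     using elim(1) AE_space unfolding AE_G'
    proof eventually_elim
     case (elim r)
     then show ?case using g_mono[of r s] s by auto
    qed
   qed measurable
   then show ?case by (simp add: J_def)
  qed
 qed
 then show ?thesis unfolding AE_P_eq_snd[OF J_meas[OF m(1)] J_meas[OF m(2)]] .
qed

text \<open>With \<open>W\<close> the joint derivative of a history, this is the
  \<open>x\<close>-derivative of its memory integral.\<close>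

definition meanG :: "(real \<times> real => complex) => real => complex" where
 "meanG W = (\<lambda>y. LINT s|G. W (s, y))"

lemma meanG_meas:
 assumes "W \<in> borel_measurable P"
 shows "meanG W \<in> borel_measurable I"
proof -
 have "(\<lambda>q. (snd q, fst q)) \<in> I \<Otimes>\<^sub>M G \<rightarrow>\<^sub>M P" by measurable
 from measurable_compose[OF this assms]
 have "(\<lambda>(y, s). W (s, y)) \<in> borel_measurable (I \<Otimes>\<^sub>M G)" by (simp add: case_prod_unfold)
 then show ?thesis unfolding meanG_def by (rule Gf.borel_measurable_lebesgue_integral)
qed

lemma meanG_sqi:
 assumes W: "W \<in> sqi P"
 shows "meanG W \<in> sqi I"
proof (rule sqi_bound[OF meanG_meas[OF sqiD(1)[OF W]]])
 have i: "integrable P (\<lambda>(s, x). (cmod (W (s, x)))\<^sup>2)" using sqiD(2)[OF W] by (simp add: case_prod_unfold)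
 show "integrable I (\<lambda>x. measure G (space G) * (LINT s|G. (cmod (W (s, x)))\<^sup>2))"
  using pg.integrable_snd[OF i] by simp
 show "AE x in I. (cmod (meanG W x))\<^sup>2 \<le> measure G (space G) * (LINT s|G. (cmod (W (s, x)))\<^sup>2)"
  using section_sqi[OF W]
 proof eventually_elim
  case (elim x)
  then show ?case using Gf.integral_sq_le[OF elim] by (simp add: meanG_def l2n_sq)
 qed
qed

lemma meanG_add:
 assumes W: "W \<in> sqi P" "W' \<in> sqi P"
 shows "AE x in I. meanG (\<lambda>p. W p + W' p) x = meanG W x + meanG W' x"
 using section_sqi[OF W(1)] section_sqi[OF W(2)] by eventually_elim (simp add: meanG_def Gf.sqi_int)

lemma meanG_mult: "meanG (\<lambda>p. c * W p) = (\<lambda>x. c * meanG W x)" by (simp add: meanG_def)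

lemma meanG_cong:
 assumes W: "W \<in> sqi P" "W' \<in> sqi P" and eq: "AE p in P. W p = W' p"
 shows "AE x in I. meanG W x = meanG W' x"
 using eq[unfolded AE_P_eq_snd[OF sqiD(1)[OF W(1)] sqiD(1)[OF W(2)]]] section_sqi[OF W(1)] section_sqi[OF W(2)]
proof eventually_elim
 case (elim x)
 then show ?case unfolding meanG_def by (intro integral_cong_AE sqiD(1))
qed

text \<open>In the energy identity it turns the pairing of the history with \<open>\<Psi>\<close>
  into the term that the memory flux cancels.\<close>

lemma rip_meanG:
 assumes W: "W \<in> sqi P" and k: "k \<in> sqi I"
 shows "rip P W (\<lambda>p. k (snd p)) = rip I (meanG W) k"
proof -
 have i: "integrable P (\<lambda>(s, x). inner (W (s, x)) (k x))"
  using rip_integrable[OF W sqi_snd[OF k]] by (simp add: case_prod_unfold)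
 have "rip P W (\<lambda>p. k (snd p)) = (LINT x|I. LINT s|G. inner (W (s, x)) (k x))"
  using pg.integral_snd[OF i] by (simp add: rip_def case_prod_unfold)
 also have "\<dots> = rip I (meanG W) k" unfolding rip_def
 proof (rule integral_cong_AE)
  show "AE x in I. (LINT s|G. inner (W (s, x)) (k x)) = inner (meanG W x) (k x)"
   using section_sqi[OF W] by eventually_elim (simp add: meanG_def Gf.sqi_int)
  show "(\<lambda>x. LINT s|G. inner (W (s, x)) (k x)) \<in> borel_measurable I" using pg.integrable_snd[OF i] by simp
  show "(\<lambda>x. inner (meanG W x) (k x)) \<in> borel_measurable I"
   using sqiD(1)[OF meanG_sqi[OF W]] sqiD(1)[OF k] by measurable
 qed
 finally show ?thesis .
qed

text \<open>Fubini's theorem exchanges the primitive in \<open>x\<close> with the weighted integral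
  in \<open>s\<close>. The derivative of the flux is thereby expressed through the joint derivative
  of the history.\<close>

lemma memory_flux_prim:
 assumes rep: "mem_rep \<eta> W"
 shows "AE x in I. memory_flux b g \<psi> \<eta> x = complex_of_real (b_tilde b g) * \<psi> x + prim (meanG W) x"
 using mem_rep_swap[OF rep] AE_space
proof eventually_elim
 case (elim x)
 note W = mem_repD[OF rep]
 have x: "0 < x" "x < L" using elim by auto
 have m: "(\<lambda>s. \<eta> s x) \<in> borel_measurable R" using sec_meas_R[OF W(2) x] by simp
 have mp: "(\<lambda>s. prim (sl W s) x) \<in> borel_measurable R"
  using sec_meas_R[OF sqiD(1)[OF primP_sqi[OF W(1)]] x] by (simp add: primP_def)
 have i: "integrable P (\<lambda>(s, y). if y \<le> x then W (s, y) else 0)"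
 proof (rule int_bound[OF Pf.sqi_int[OF W(1)]])
  have [measurable]: "W \<in> borel_measurable P" by (rule sqiD(1)[OF W(1)])
  have "(\<lambda>p. if snd p \<le> x then W p else 0) \<in> borel_measurable P" by measurable
  then show "(\<lambda>(s, y). if y \<le> x then W (s, y) else 0) \<in> borel_measurable P"
   by (simp add: case_prod_unfold cong: if_cong)
 qed auto
 have "(LINT s|G. \<eta> s x) = (LINT s|G. prim (sl W s) x)"
  using elim(1) m mp unfolding meas_G[symmetric] by (intro integral_cong_AE)
 also have "\<dots> = (LINT y|I. LINT s|G. (if y \<le> x then W (s, y) else 0))"
  using pg.Fubini_integral[OF i] by (simp add: prim_def sl_def)
 also have "\<dots> = prim (meanG W) x" unfolding prim_def meanG_def by (intro int_cong) auto
 finally show ?case unfolding memory_flux_def integral_G_lborel[OF m] by simp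
qed

lemma zero_H10: "0 \<in> H10 L" using H10_I(1)[of 0 0] by (simp add: prim_def zero_fun_def sqi_zero)

text \<open>The choice in \<open>s_deriv\<close> ranges over all initial values, whereas the domain
  provides a derivative with initial value 0. Uniqueness forces the chosen derivative to agree with
  that one up to a null function.\<close>

lemma s_deriv_rep:
 assumes eta: "mem_rep \<eta> W" and zeta: "\<zeta> \<in> Lg2 L g" "has_s_deriv L g \<eta> \<zeta> 0"
 shows "s_deriv L g \<eta> \<in> Lg2 L g" "AE p in P. W p = J (memd (s_deriv L g \<eta>)) p"
proof -
 note W = mem_repD[OF eta]
 have z: "AE x in I. (0 :: real => complex) x = prim (\<lambda>_. 0) x" by (simp add: prim_def)
 have "\<exists>\<zeta>. \<zeta> \<in> Lg2 L g \<and> (\<exists>\<eta>0\<in>H10 L. has_s_deriv L g \<eta> \<zeta> \<eta>0)" using zeta zero_H10 by blast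
 then have S: "s_deriv L g \<eta> \<in> Lg2 L g \<and> (\<exists>\<eta>0\<in>H10 L. has_s_deriv L g \<eta> (s_deriv L g \<eta>) \<eta>0)"
  unfolding s_deriv_def by (rule someI_ex)
 then show s: "s_deriv L g \<eta> \<in> Lg2 L g" by simp
 obtain \<eta>0 where h: "\<eta>0 \<in> H10 L" "has_s_deriv L g \<eta> (s_deriv L g \<eta>) \<eta>0" using S by blast
 note r1 = mem_rep_memd[OF zeta(1)] and r2 = mem_rep_memd[OF s]
 note Z1 = mem_repD(1)[OF r1] and Z2 = mem_repD(1)[OF r2]
 note D = H10_D[OF h(1)]
 have e1: "AE s in G. AE x in I. sl W s x = sl (J (memd \<zeta>)) s x"
  using zeta(2) unfolding has_s_deriv_iff[OF eta r1 sqi_zero(1) z] by simp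
 have e2: "AE s in G. AE x in I. sl W s x = wderiv L \<eta>0 x + sl (J (memd (s_deriv L g \<eta>))) s x"
  using h(2) unfolding has_s_deriv_iff[OF eta r2 D(3) D(5)] .
 have "AE s in G. AE x in I. sl (J (memd \<zeta>)) s x = wderiv L \<eta>0 x + sl (J (memd (s_deriv L g \<eta>))) s x"
  using e1 e2
 proof eventually_elim
  case (elim s)
  then show ?case by eventually_elim simp
 qed
 from s_deriv_unique[OF Z1 Z2 sqiD(1)[OF D(3)] this]
 have "AE p in P. J (memd \<zeta>) p = J (memd (s_deriv L g \<eta>)) p" by (rule J_cong[OF Z1 Z2])
 moreover have "AE p in P. W p = J (memd \<zeta>) p"
  using e1 unfolding AE_P_eq[OF sqiD(1)[OF W(1)] J_meas[OF sqiD(1)[OF Z1]]] .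
 ultimately show "AE p in P. W p = J (memd (s_deriv L g \<eta>)) p" by eventually_elim simp
qed

lemma has_s_deriv_zero_iff:
 assumes eta: "mem_rep \<eta> W" and zeta: "mem_rep \<zeta> Z"
 shows "has_s_deriv L g \<eta> \<zeta> 0 \<longleftrightarrow> (AE p in P. W p = J Z p)"
proof -
 have z: "AE x in I. (0 :: real => complex) x = prim (\<lambda>_. 0) x" by (simp add: prim_def)
 note m = sqiD(1)[OF mem_repD(1)[OF eta]] J_meas[OF sqiD(1)[OF mem_repD(1)[OF zeta]]]
 show ?thesis unfolding has_s_deriv_iff[OF eta zeta sqi_zero(1) z] AE_P_eq[OF m] by simp
qed

text \<open>Testing with \<open>k (s, x) = \<integral> Z (s, y) dy\<close>, the inner product with which is \<open>\<integral> |\<integral> Z (s, y) dy|\<^sup>2 dG\<close>.\<close>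

lemma mean_zero_closed:
 assumes F: "!!n :: nat. F n \<in> sqi P" "!!n. AE s in G. (LINT x|I. sl (F n) s x) = 0"
  and Z: "Z \<in> sqi P" and lim: "(\<lambda>n. l2n P (\<lambda>p. F n p - Z p)) \<longlonglongrightarrow> 0"
 shows "AE s in G. (LINT x|I. sl Z s x) = 0"
proof -
 define k where "k = (\<lambda>p :: real \<times> real. LINT y|I. Z (fst p, y))"
 have k: "k \<in> sqi P" unfolding k_def by (rule meanP_sqi[OF Z])
 have rk: "rip P V k = (LINT s|G. inner (LINT x|I. sl V s x) (LINT x|I. sl Z s x))" if V: "V \<in> sqi P" for V
 proof -
  have "rip P V k = (LINT s|G. rip I (sl V s) (sl k s))" by (rule rip_sl(2)[OF V k, symmetric])
  also have "\<dots> = (LINT s|G. inner (LINT x|I. sl V s x) (LINT x|I. sl Z s x))"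
  proof (rule integral_cong_AE)
   show "AE s in G. rip I (sl V s) (sl k s) = inner (LINT x|I. sl V s x) (LINT x|I. sl Z s x)"
    using sl_sqi[OF V] by eventually_elim (simp add: rip_def k_def sl_def fin.sqi_int)
   show "(\<lambda>s. rip I (sl V s) (sl k s)) \<in> borel_measurable G" using rip_sl(1)[OF V k] by simp
   have [measurable]: "(\<lambda>(s, x). V (s, x)) \<in> borel_measurable P" "(\<lambda>(s, x). Z (s, x)) \<in> borel_measurable P"
    using sqiD(1)[OF V] sqiD(1)[OF Z] by (simp_all add: case_prod_unfold)
   show "(\<lambda>s. inner (LINT x|I. sl V s x) (LINT x|I. sl Z s x)) \<in> borel_measurable G"
    unfolding sl_def by measurable
  qed
  finally show ?thesis .
 qed
 have 0: "rip P (F n) k = 0" for n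
 proof -
  have "rip P (F n) k = (LINT s|G. 0)" unfolding rk[OF F(1)]
  proof (rule integral_cong_AE)
   show "AE s in G. inner (LINT x|I. sl (F n) s x) (LINT x|I. sl Z s x) = 0"
    using F(2)[of n] by eventually_elim simp
   have [measurable]: "(\<lambda>(s, x). F n (s, x)) \<in> borel_measurable P" "(\<lambda>(s, x). Z (s, x)) \<in> borel_measurable P"
    using sqiD(1)[OF F(1)] sqiD(1)[OF Z] by (simp_all add: case_prod_unfold)
   show "(\<lambda>s. inner (LINT x|I. sl (F n) s x) (LINT x|I. sl Z s x)) \<in> borel_measurable G"
    unfolding sl_def by measurable
  qed simp
  then show ?thesis by simp
 qed
 have "\<bar>rip P Z k\<bar> \<le> l2n P (\<lambda>p. F n p - Z p) * l2n P k" for n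
  using rip_bound[OF sqi_diff'[OF F(1) Z] k] 0 by (simp add: rip_diff'[OF F(1) Z k])
 then have "\<bar>rip P Z k\<bar> \<le> 0"
  using tendsto_mult_right[OF lim, of "l2n P k"] by (intro LIMSEQ_le_const[of _ 0]) auto
 then have "rip P Z k = 0" by simp
 then have z: "(LINT s|G. (cmod (LINT x|I. sl Z s x))\<^sup>2) = 0" unfolding rk[OF Z] power2_norm_eq_inner .
 have i: "integrable G (\<lambda>s. (cmod (LINT x|I. sl Z s x))\<^sup>2)"
 proof (rule int_bound)
  show "integrable G (\<lambda>s. L * (l2n I (sl Z s))\<^sup>2)" using l2n_sl(1)[OF Z] by simp
  have [measurable]: "(\<lambda>(s, x). Z (s, x)) \<in> borel_measurable P" using sqiD(1)[OF Z] by (simp_all add: case_prod_unfold)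
  show "(\<lambda>s. (cmod (LINT x|I. sl Z s x))\<^sup>2) \<in> borel_measurable G" unfolding sl_def by measurable
  show "AE s in G. norm ((cmod (LINT x|I. sl Z s x))\<^sup>2) \<le> norm (L * (l2n I (sl Z s))\<^sup>2)"
   using sl_sqi[OF Z] by eventually_elim (use fin.integral_sq_le L_pos in simp)
 qed
 have "AE s in G. (cmod (LINT x|I. sl Z s x))\<^sup>2 = 0" using z integral_nonneg_eq_0_iff_AE[OF i] by simp
 then show ?thesis by eventually_elim simp
qed

end

section \<open>The phase space\<close>

context interval
begin

lemma H1_add:
 assumes "f \<in> H1 L" "h \<in> H1 L"
 shows "(\<lambda>x. f x + h x) \<in> H1 L" "AE x in I. wderiv L (\<lambda>x. f x + h x) x = wderiv L f x + wderiv L h x"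
proof -
 note f = H1_D[OF assms(1)] and h = H1_D[OF assms(2)]
 note i = fin.sqi_int[OF f(2)] fin.sqi_int[OF h(2)]
 obtain c c' where c: "AE x in I. f x = c + prim (wderiv L f) x" "AE x in I. h x = c' + prim (wderiv L h) x"
  using f(3) h(3) by blast
 then have e: "AE x in I. f x + h x = (c + c') + prim (\<lambda>x. wderiv L f x + wderiv L h x) x"
  by eventually_elim (simp add: prim_add[OF i])
 from H1_I[OF sqi_add'[OF f(1) h(1)] sqi_add'[OF f(2) h(2)] e]
 show "(\<lambda>x. f x + h x) \<in> H1 L" "AE x in I. wderiv L (\<lambda>x. f x + h x) x = wderiv L f x + wderiv L h x" by auto
qed

lemma H1_mult:
 assumes "f \<in> H1 L"
 shows "(\<lambda>x. c * f x) \<in> H1 L" "AE x in I. wderiv L (\<lambda>x. c * f x) x = c * wderiv L f x"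
proof -
 note f = H1_D[OF assms]
 obtain d where "AE x in I. f x = d + prim (wderiv L f) x" using f(3) by blast
 then have e: "AE x in I. c * f x = c * d + prim (\<lambda>x. c * wderiv L f x) x"
  by eventually_elim (simp add: prim_mult distrib_left)
 from H1_I[OF sqi_mult'[OF f(1)] sqi_mult'[OF f(2)] e]
 show "(\<lambda>x. c * f x) \<in> H1 L" "AE x in I. wderiv L (\<lambda>x. c * f x) x = c * wderiv L f x" by auto
qed

lemma H10_add:
 assumes "f \<in> H10 L" "h \<in> H10 L"
 shows "(\<lambda>x. f x + h x) \<in> H10 L"
proof -
 note f = H10_D[OF assms(1)] and h = H10_D[OF assms(2)]
 note i = fin.sqi_int[OF f(3)] fin.sqi_int[OF h(3)]
 have "AE x in I. f x + h x = prim (\<lambda>x. wderiv L f x + wderiv L h x) x"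
  using f(5) h(5) by eventually_elim (simp add: prim_add[OF i])
 from H10_I(1)[OF sqi_add'[OF f(2) h(2)] sqi_add'[OF f(3) h(3)] _ this] show ?thesis using f(4) h(4) i by simp
qed

lemma H10_mult:
 assumes "f \<in> H10 L"
 shows "(\<lambda>x. c * f x) \<in> H10 L"
proof -
 note f = H10_D[OF assms]
 have "AE x in I. c * f x = prim (\<lambda>x. c * wderiv L f x) x"
  using f(5) by eventually_elim (simp add: prim_mult)
 from H10_I(1)[OF sqi_mult'[OF f(2)] sqi_mult'[OF f(3)] _ this] show ?thesis using f(4) by simp
qed

lemma L2star_iff: "f \<in> L2star L \<longleftrightarrow> f \<in> sqi I \<and> (LINT x|I. f x) = 0"
 by (simp add: L2star_def L2_eq)

lemma H1star_iff: "f \<in> H1star L \<longleftrightarrow> f \<in> H1 L \<and> (LINT x|I. f x) = 0"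
 using H1_D(1) by (auto simp: H1star_def L2star_iff)

lemma L2star_add: "f \<in> L2star L ==> h \<in> L2star L ==> (\<lambda>x. f x + h x) \<in> L2star L"
 by (simp add: L2star_iff sqi_add' fin.sqi_int)

lemma L2star_mult: "f \<in> L2star L ==> (\<lambda>x. c * f x) \<in> L2star L" by (simp add: L2star_iff sqi_mult')

lemma H1star_add: "f \<in> H1star L ==> h \<in> H1star L ==> (\<lambda>x. f x + h x) \<in> H1star L"
 using H1_D(1) by (auto simp: H1star_iff H1_add fin.sqi_int)

lemma H1star_mult: "f \<in> H1star L ==> (\<lambda>x. c * f x) \<in> H1star L" by (simp add: H1star_iff H1_mult)

lemma mprim_add: "d \<in> sqi I ==> e \<in> sqi I ==> mprim (\<lambda>x. d x + e x) x = mprim d x + mprim e x"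
proof -
 assume d: "d \<in> sqi I" "e \<in> sqi I"
 have "prim (\<lambda>x. d x + e x) = (\<lambda>x. prim d x + prim e x)"
  using prim_add[OF fin.sqi_int[OF d(1)] fin.sqi_int[OF d(2)]] by (simp add: fun_eq_iff)
 then show ?thesis using fin.sqi_int[OF prim_sqi[OF d(1)]] fin.sqi_int[OF prim_sqi[OF d(2)]]
  by (simp add: mprim_def add_divide_distrib)
qed

lemma H1star_mprim: "d \<in> sqi I ==> mprim d \<in> H1star L" "d \<in> sqi I ==> AE x in I. wderiv L (mprim d) x = d x"
 using H1star_I[of "mprim d" d] mprim_sqi by auto

lemma H10_prim:
 assumes "d \<in> sqi I" "(LINT x|I. d x) = 0"
 shows "prim d \<in> H10 L" "AE x in I. wderiv L (prim d) x = d x"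
 using H10_I[of "prim d" d] assms prim_sqi by auto

lemma wderiv_null:
 assumes f: "f \<in> sqi I" and 0: "AE x in I. f x = 0"
 shows "AE x in I. wderiv L f x = 0" using H1_I(2)[OF f sqi_zero(1), of 0] 0 by (simp add: prim_def)

end

text \<open>Coordinate maps into some \<open>L\<^sup>2(M)\<close>, linear up to null functions, and the symmetric forms that
 are sums of weighted inner products of coordinates.\<close>

definition coord :: "'x measure => 'a::complex_vector set => ('a => 'x => complex) => bool" where
 "coord M X c \<longleftrightarrow> (\<forall>x\<in>X. c x \<in> sqi M) \<and>
   (\<forall>x\<in>X. \<forall>y\<in>X. AE p in M. c (x + y) p = c x p + c y p) \<and>
   (\<forall>x\<in>X. \<forall>k. AE p in M. c (k *\<^sub>C x) p = k * c x p)"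

definition form :: "'a::complex_vector set => ('a => 'a => real) => bool" where
 "form X r \<longleftrightarrow>
   (\<forall>x\<in>X. \<forall>y\<in>X. \<forall>z\<in>X. r (x + y) z = r x z + r y z) \<and>
   (\<forall>x\<in>X. \<forall>z\<in>X. \<forall>c. r (complex_of_real c *\<^sub>C x) z = c * r x z) \<and>
   (\<forall>x\<in>X. \<forall>z\<in>X. r x z = r z x) \<and> (\<forall>x\<in>X. 0 \<le> r x x) \<and>
   (\<forall>x\<in>X. \<forall>y\<in>X. r (\<i> *\<^sub>C x) (\<i> *\<^sub>C y) = r x y)"

lemma form_plus: "form X r ==> form X r' ==> form X (\<lambda>x y. r x y + r' x y)"
 unfolding form_def by (auto simp: distrib_left)

lemma form_mult: "0 \<le> k ==> form X r ==> form X (\<lambda>x y. k * r x y)"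
 unfolding form_def by (auto simp: distrib_left)

lemma coordD:
 assumes "coord M X c"
 shows "x \<in> X ==> c x \<in> sqi M" "x \<in> X ==> y \<in> X ==> AE p in M. c (x + y) p = c x p + c y p"
  "x \<in> X ==> AE p in M. c (k *\<^sub>C x) p = k * c x p" using assms by (auto simp: coord_def)

lemma coord_add:
 assumes c: "coord M X c" and d: "coord M X d"
 shows "coord M X (\<lambda>y p. c y p + d y p)" unfolding coord_def
proof (intro conjI ballI allI)
 note C = coordD[OF c] and D = coordD[OF d]
 show "(\<lambda>p. c x p + d x p) \<in> sqi M" if "x \<in> X" for x by (rule sqi_add'[OF C(1)[OF that] D(1)[OF that]])
 show "AE p in M. c (x + y) p + d (x + y) p = c x p + d x p + (c y p + d y p)" if "x \<in> X" "y \<in> X" for x y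
  using C(2)[OF that] D(2)[OF that] by eventually_elim simp
 show "AE p in M. c (k *\<^sub>C x) p + d (k *\<^sub>C x) p = k * (c x p + d x p)" if "x \<in> X" for x k
  using C(3)[OF that, of k] D(3)[OF that, of k] by eventually_elim (simp add: distrib_left)
qed

lemma coord_mult:
 assumes c: "coord M X c"
 shows "coord M X (\<lambda>y p. a * c y p)" unfolding coord_def
proof (intro conjI ballI allI)
 note C = coordD[OF c]
 show "(\<lambda>p. a * c x p) \<in> sqi M" if "x \<in> X" for x by (rule sqi_mult'[OF C(1)[OF that]])
 show "AE p in M. a * c (x + y) p = a * c x p + a * c y p" if "x \<in> X" "y \<in> X" for x y
  using C(2)[OF that] by eventually_elim (simp add: distrib_left)
 show "AE p in M. a * c (k *\<^sub>C x) p = k * (a * c x p)" if "x \<in> X" for x k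
  using C(3)[OF that, of k] by eventually_elim simp
qed

lemma coord_sub: "coord M X c ==> coord M X d ==> coord M X (\<lambda>y p. c y p - d y p)"
 using coord_add[OF _ coord_mult[of M X d "-1"]] by simp

lemma coord_sel:
 assumes "!!x y. f (x + y) = f x + f y" "!!x k. f (k *\<^sub>C x) = k *\<^sub>C f x" "coord M S h" "!!x. x \<in> X ==> f x \<in> S"
 shows "coord M X (\<lambda>x. h (f x))" using assms unfolding coord_def by simp

lemma coord_form:
 assumes X: "!!x y. x \<in> X ==> y \<in> X ==> x + y \<in> X" "!!x k. x \<in> X ==> k *\<^sub>C x \<in> X" and c: "coord M X c"
 shows "form X (\<lambda>x y. rip M (c x) (c y))" unfolding form_def
proof (intro conjI ballI allI)
 note C = coordD[OF c]
 show "rip M (c (x + y)) (c z) = rip M (c x) (c z) + rip M (c y) (c z)" if "x \<in> X" "y \<in> X" "z \<in> X" for x y z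
 proof -
  have "rip M (c (x + y)) (c z) = rip M (\<lambda>p. c x p + c y p) (c z)"
   by (rule rip_cong[OF C(1)[OF X(1)[OF that(1,2)]] C(1)[OF that(3)] sqi_add'[OF C(1)[OF that(1)] C(1)[OF that(2)]]
      C(1)[OF that(3)] C(2)[OF that(1,2)]]) simp
  then show ?thesis by (simp add: rip_add'[OF C(1)[OF that(1)] C(1)[OF that(2)] C(1)[OF that(3)]])
 qed
 show "rip M (c (complex_of_real k *\<^sub>C x)) (c z) = k * rip M (c x) (c z)" if "x \<in> X" "z \<in> X" for x z k
  unfolding rip_scale'[symmetric]
  by (rule rip_cong[OF C(1)[OF X(2)[OF that(1)]] C(1)[OF that(2)] sqi_mult'[OF C(1)[OF that(1)]] C(1)[OF that(2)]
     C(3)[OF that(1)]]) simp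
 show "rip M (c (\<i> *\<^sub>C x)) (c (\<i> *\<^sub>C y)) = rip M (c x) (c y)" if "x \<in> X" "y \<in> X" for x y
  unfolding rip_i[symmetric, of M "c x" "c y"]
  by (rule rip_cong[OF C(1)[OF X(2)[OF that(1)]] C(1)[OF X(2)[OF that(2)]] sqi_mult'[OF C(1)[OF that(1)]]
     sqi_mult'[OF C(1)[OF that(2)]] C(3)[OF that(1)] C(3)[OF that(2)]])
qed (auto simp: rip_sym rip_self)

lemma coord_diff:
 assumes X: "!!x k. x \<in> X ==> k *\<^sub>C x \<in> X" and c: "coord M X c" and xy: "x \<in> X" "y \<in> X"
 shows "AE p in M. c (x - y) p = c x p - c y p"
proof -
 have e: "x + (-1) *\<^sub>C y = x - y" by (simp add: scaleC_minus1)
 show ?thesis using coordD(2)[OF c xy(1) X[OF xy(2), of "-1"]] coordD(3)[OF c xy(2), of "-1"] unfolding e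
  by eventually_elim simp
qed

text \<open>A coordinate dominated by the form inherits the Cauchy property, so completeness of the
  phase space reduces to that of \<open>L2\<close> spaces.\<close>

lemma (in finite_measure) coord_limit:
 assumes X: "!!x k. x \<in> X ==> k *\<^sub>C x \<in> X" "!!x y. x \<in> X ==> y \<in> X ==> x - y \<in> X"
  and c: "coord M X c" and w: "0 < w" "!!x. x \<in> X ==> w * (l2n M (c x))\<^sup>2 \<le> r x x"
  and f: "!!n :: nat. f n \<in> X" "!!e :: real. e > 0 ==> \<exists>K. \<forall>m\<ge>K. \<forall>n\<ge>K. sqrt (r (f m - f n) (f m - f n)) < e"
 obtains F where "F \<in> sqi M" "(\<lambda>n. l2n M (\<lambda>p. c (f n) p - F p)) \<longlonglongrightarrow> 0"
proof (rule riesz_fischer[of "\<lambda>n. c (f n)"])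
 show "c (f n) \<in> sqi M" for n by (rule coordD(1)[OF c f(1)])
 fix e :: real assume e: "e > 0"
 then have "sqrt w * e > 0" using w by simp
 from f(2)[OF this] obtain K where K: "!!m n. m \<ge> K ==> n \<ge> K ==> sqrt (r (f m - f n) (f m - f n)) < sqrt w * e" by blast
 have "l2n M (\<lambda>p. c (f m) p - c (f n) p) < e" if mn: "m \<ge> K" "n \<ge> K" for m n
 proof -
  have d: "f m - f n \<in> X" by (rule X(2)[OF f(1) f(1)])
  have "l2n M (\<lambda>p. c (f m) p - c (f n) p) = l2n M (c (f m - f n))"
   by (rule l2n_cong[OF coordD(1)[OF c d] sqiD(1)[OF sqi_diff'[OF coordD(1)[OF c f(1)] coordD(1)[OF c f(1)]]]])
    (use coord_diff[OF X(1) c f(1) f(1), of m n] in \<open>auto elim!: eventually_mono\<close>)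
  moreover have "sqrt (w * (l2n M (c (f m - f n)))\<^sup>2) < sqrt w * e"
   using real_sqrt_le_mono[OF w(2)[OF d]] K[OF mn] by linarith
  ultimately show ?thesis using w(1) by (simp add: real_sqrt_mult)
 qed
 then show "\<exists>K. \<forall>m\<ge>K. \<forall>n\<ge>K. l2n M (\<lambda>p. c (f m) p - c (f n) p) < e" by blast
qed (use that in blast)

lemma coord_tendsto:
 assumes X: "!!x k. x \<in> X ==> k *\<^sub>C x \<in> X" "!!x y. x \<in> X ==> y \<in> X ==> x - y \<in> X" and c: "coord M X c"
  and f: "!!n :: nat. f n \<in> X" and l: "l \<in> X" and F: "F \<in> sqi M" "AE p in M. c l p = F p"
  and lim: "(\<lambda>n. l2n M (\<lambda>p. c (f n) p - F p)) \<longlonglongrightarrow> 0"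
 shows "(\<lambda>n. l2n M (c (f n - l))) \<longlonglongrightarrow> 0"
proof -
 have "l2n M (c (f n - l)) = l2n M (\<lambda>p. c (f n) p - F p)" for n
  by (rule l2n_cong[OF sqi_diff'[OF coordD(1)[OF c f] F(1)] sqiD(1)[OF coordD(1)[OF c X(2)[OF f l]]]])
   (use coord_diff[OF X(1) c f l, of n] F(2) in \<open>auto elim: eventually_elim2\<close>)
 then show ?thesis using lim by simp
qed

locale porous = memory L g \<kappa>1 for L :: real and g :: "real => real" and \<kappa>1 :: real +
 fixes \<rho> \<rho>1 \<rho>2 \<rho>3 \<alpha> \<kappa> b \<tau> \<sigma> \<beta> \<gamma> m :: real
 assumes cpos: "\<rho> > 0" "\<rho>1 > 0" "\<rho>2 > 0" "\<rho>3 > 0" "\<alpha> > 0" "\<kappa> > 0" "\<tau> > 0" "\<sigma> > 0" "\<beta> > 0" "\<gamma> > 0"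
  and bt_pos: "b_tilde b g > 0"
begin

section \<open>The energy space\<close>

abbreviation "bt \<equiv> b_tilde b g" abbreviation "X \<equiv> phase_space L g" abbreviation "wd \<equiv> wderiv L"

text \<open>Names beginning with \<open>p\<close> are components that enter the energy only through
  derived quantities; names beginning with \<open>c\<close> are the coordinates whose weighted
  squares make up the energy.\<close>

definition pu :: "state => fld" where "pu = (\<lambda>(u, v, \<phi>, \<Phi>, \<psi>, \<Psi>, \<theta>, q, \<eta>). u)"
definition cv :: "state => fld" where "cv = (\<lambda>(u, v, \<phi>, \<Phi>, \<psi>, \<Psi>, \<theta>, q, \<eta>). v)"
definition pf :: "state => fld" where "pf = (\<lambda>(u, v, \<phi>, \<Phi>, \<psi>, \<Psi>, \<theta>, q, \<eta>). \<phi>)"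
definition cPhi :: "state => fld" where "cPhi = (\<lambda>(u, v, \<phi>, \<Phi>, \<psi>, \<Psi>, \<theta>, q, \<eta>). \<Phi>)"
definition pp :: "state => fld" where "pp = (\<lambda>(u, v, \<phi>, \<Phi>, \<psi>, \<Psi>, \<theta>, q, \<eta>). \<psi>)"
definition cPsi :: "state => fld" where "cPsi = (\<lambda>(u, v, \<phi>, \<Phi>, \<psi>, \<Psi>, \<theta>, q, \<eta>). \<Psi>)"
definition ct :: "state => fld" where "ct = (\<lambda>(u, v, \<phi>, \<Phi>, \<psi>, \<Psi>, \<theta>, q, \<eta>). \<theta>)"
definition cq :: "state => fld" where "cq = (\<lambda>(u, v, \<phi>, \<Phi>, \<psi>, \<Psi>, \<theta>, q, \<eta>). q)"
definition pe :: "state => real => fld" where "pe = (\<lambda>(u, v, \<phi>, \<Phi>, \<psi>, \<Psi>, \<theta>, q, \<eta>). \<eta>)"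
definition cu :: "state => fld" where "cu U = wd (pu U)"
definition cp :: "state => fld" where "cp U = wd (pp U)"
definition cb :: "state => fld" where "cb U = (\<lambda>x. pf U x - pu U x)"
definition ck :: "state => fld" where "ck U = (\<lambda>x. wd (pf U) x + pp U x)"
definition ce :: "state => real \<times> real => complex" where "ce U = memd (pe U)"

lemmas p_defs = pu_def cv_def pf_def cPhi_def pp_def cPsi_def ct_def cq_def pe_def
lemmas c_defs = cu_def cp_def cb_def ck_def ce_def p_defs

lemma sel_add:
 "pu (U + V) = pu U + pu V" "cv (U + V) = cv U + cv V" "pf (U + V) = pf U + pf V" "cPhi (U + V) = cPhi U + cPhi V"
 "pp (U + V) = pp U + pp V" "cPsi (U + V) = cPsi U + cPsi V" "ct (U + V) = ct U + ct V" "cq (U + V) = cq U + cq V"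
 "pe (U + V) = pe U + pe V" by (simp_all add: p_defs case_prod_unfold del: plus_fun_apply)

lemma sel_scale:
 "pu (k *\<^sub>C U) = k *\<^sub>C pu U" "cv (k *\<^sub>C U) = k *\<^sub>C cv U" "pf (k *\<^sub>C U) = k *\<^sub>C pf U" "cPhi (k *\<^sub>C U) = k *\<^sub>C cPhi U"
 "pp (k *\<^sub>C U) = k *\<^sub>C pp U" "cPsi (k *\<^sub>C U) = k *\<^sub>C cPsi U" "ct (k *\<^sub>C U) = k *\<^sub>C ct U" "cq (k *\<^sub>C U) = k *\<^sub>C cq U"
 "pe (k *\<^sub>C U) = k *\<^sub>C pe U" by (simp_all add: p_defs case_prod_unfold scaleC_prod_def)

definition rS :: "state => state => real" where
 "rS U V = \<rho> * rip I (cv U) (cv V) + \<alpha> * rip I (cu U) (cu V) + \<rho>1 * rip I (cPhi U) (cPhi V)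
   + \<rho>2 * rip I (cPsi U) (cPsi V) + bt * rip I (cp U) (cp V) + \<beta> * rip I (cb U) (cb V)
   + \<kappa> * rip I (ck U) (ck V) + \<rho>3 * rip I (ct U) (ct V) + \<tau> * rip I (cq U) (cq V) + rip P (ce U) (ce V)"

lemma phase_iff: "(u, v, \<phi>, \<Phi>, \<psi>, \<Psi>, \<theta>, q, \<eta>) \<in> X \<longleftrightarrow>
  u \<in> H1star L \<and> v \<in> L2star L \<and> \<phi> \<in> H1star L \<and> \<Phi> \<in> L2star L \<and> \<psi> \<in> H10 L \<and> \<Psi> \<in> sqi I \<and> \<theta> \<in> sqi I \<and> q \<in> sqi I \<and> \<eta> \<in> Lg2 L g"
 by (simp add: phase_space_def L2_eq)

lemma Lg2_add: "\<eta> \<in> Lg2 L g ==> \<eta>' \<in> Lg2 L g ==> (\<lambda>s x. \<eta> s x + \<eta>' s x) \<in> Lg2 L g"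
 by (rule mem_rep_Lg2(1)[OF mem_rep_add[OF mem_rep_memd mem_rep_memd]])

lemma Lg2_mult: "\<eta> \<in> Lg2 L g ==> (\<lambda>s x. c * \<eta> s x) \<in> Lg2 L g"
 by (rule mem_rep_Lg2(1)[OF mem_rep_mult[OF mem_rep_memd]])

lemma state_plus: "(u, v, \<phi>, \<Phi>, \<psi>, \<Psi>, \<theta>, q, \<eta>) + (u', v', \<phi>', \<Phi>', \<psi>', \<Psi>', \<theta>', q', \<eta>') =
  ((\<lambda>x. u x + u' x), (\<lambda>x. v x + v' x), (\<lambda>x. \<phi> x + \<phi>' x), (\<lambda>x. \<Phi> x + \<Phi>' x), (\<lambda>x. \<psi> x + \<psi>' x),
  (\<lambda>x. \<Psi> x + \<Psi>' x), (\<lambda>x. \<theta> x + \<theta>' x), (\<lambda>x. q x + q' x), (\<lambda>s x. \<eta> s x + \<eta>' s x))"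
 for \<eta> \<eta>' :: "real => fld" by (simp add: fun_eq_iff)

lemma state_scale: "c *\<^sub>C (u, v, \<phi>, \<Phi>, \<psi>, \<Psi>, \<theta>, q, \<eta>) =
  ((\<lambda>x. c * u x), (\<lambda>x. c * v x), (\<lambda>x. c * \<phi> x), (\<lambda>x. c * \<Phi> x), (\<lambda>x. c * \<psi> x),
  (\<lambda>x. c * \<Psi> x), (\<lambda>x. c * \<theta> x), (\<lambda>x. c * q x), (\<lambda>s x. c * \<eta> s x))"
 for u v \<phi> \<Phi> \<psi> \<Psi> \<theta> q :: fld and \<eta> :: "real => fld"
 by (simp add: scaleC_prod_def scaleC_fun_def scaleC_complex_def)

lemma state_cases:
 fixes U :: state
 obtains u v \<phi> \<Phi> \<psi> \<Psi> \<theta> q \<eta> where "U = (u, v, \<phi>, \<Phi>, \<psi>, \<Psi>, \<theta>, q, \<eta>)"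
 using that by (metis surj_pair)

lemma X_add: "U \<in> X ==> V \<in> X ==> U + V \<in> X" by (rule state_cases[of U], rule state_cases[of V])
  (simp only: state_plus phase_iff H1star_add L2star_add H10_add sqi_add' Lg2_add simp_thms)

lemma X_scale: "U \<in> X ==> c *\<^sub>C U \<in> X" by (rule state_cases[of U])
  (simp only: state_scale phase_iff H1star_mult L2star_mult H10_mult sqi_mult' Lg2_mult simp_thms)

lemma X_diff: "U \<in> X ==> V \<in> X ==> U - V \<in> X"
 using X_add[of U "(-1) *\<^sub>C V"] X_scale[of V "-1"] by (simp add: scaleC_minus1)

lemma X_zero: "0 \<in> X"
proof -
 have Z: "(\<lambda>_. 0) \<in> H1star L" "(\<lambda>_. 0) \<in> L2star L" "(\<lambda>_. 0) \<in> H10 L"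
  using H1star_mprim(1)[OF sqi_zero(1)] zero_H10
  by (simp_all add: mprim_def[abs_def] prim_def[abs_def] L2star_iff zero_fun_def)
 have "mem_rep (\<lambda>s x. primP (\<lambda>_. 0) (s, x)) (\<lambda>_. 0)" by (intro mem_rep_primP) (simp_all add: sl_def)
 then have "(\<lambda>s x. 0) \<in> Lg2 L g" using mem_rep_Lg2(1) by (simp add: primP_def prim_def sl_def)
 then have "((\<lambda>_. 0), (\<lambda>_. 0), (\<lambda>_. 0), (\<lambda>_. 0), (\<lambda>_. 0), (\<lambda>_. 0), (\<lambda>_. 0), (\<lambda>_. 0), (\<lambda>_ _. 0)) \<in> X"
  using Z unfolding phase_iff by simp
 then show ?thesis by (simp add: zero_prod_def zero_fun_def)
qed

lemma sqi_of:
 assumes "(u, v, \<phi>, \<Phi>, \<psi>, \<Psi>, \<theta>, q, \<eta>) \<in> X"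
 shows "u \<in> H1 L" "u \<in> sqi I" "wd u \<in> sqi I" "\<phi> \<in> H1 L" "\<phi> \<in> sqi I" "wd \<phi> \<in> sqi I" "\<psi> \<in> H1 L" "\<psi> \<in> sqi I" "wd \<psi> \<in> sqi I"
  "v \<in> sqi I" "\<Phi> \<in> sqi I" "\<Psi> \<in> sqi I" "\<theta> \<in> sqi I" "q \<in> sqi I" "memd \<eta> \<in> sqi P"
  "(LINT x|I. u x) = 0" "(LINT x|I. v x) = 0" "(LINT x|I. \<phi> x) = 0" "(LINT x|I. \<Phi> x) = 0"
  "AE s in G. (LINT x|I. sl (memd \<eta>) s x) = 0"
 using assms H1star_D H10_D mem_repD[OF mem_rep_memd] unfolding phase_iff by (auto simp: L2star_iff)

lemma coord_wd: "coord I (H1 L) wd" unfolding coord_def plus_fun_def scaleC_fun_def scaleC_complex_def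
 by (simp add: H1_D H1_add H1_mult)

lemma coord_memd: "coord P (Lg2 L g) memd" unfolding coord_def plus_fun_def scaleC_fun_def scaleC_complex_def
 using memd_eq[OF mem_rep_add[OF mem_rep_memd mem_rep_memd]] memd_eq[OF mem_rep_mult[OF mem_rep_memd]]
  mem_repD(1)[OF mem_rep_memd] by blast

lemma coord_id: "coord I (sqi I) (\<lambda>f. f)" by (simp add: coord_def scaleC_fun_def scaleC_complex_def)

lemma sel_sqi:
 assumes "U \<in> X"
 shows "pu U \<in> H1 L" "pf U \<in> H1 L" "pp U \<in> H1 L" "pe U \<in> Lg2 L g" "pu U \<in> sqi I" "pf U \<in> sqi I" "pp U \<in> sqi I"
  "cv U \<in> sqi I" "cPhi U \<in> sqi I" "cPsi U \<in> sqi I" "ct U \<in> sqi I" "cq U \<in> sqi I"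
proof -
 obtain u v \<phi> \<Phi> \<psi> \<Psi> \<theta> q \<eta> where Ueq: "U = (u, v, \<phi>, \<Phi>, \<psi>, \<Psi>, \<theta>, q, \<eta>)" by (rule state_cases)
 have "\<eta> \<in> Lg2 L g" using assms unfolding Ueq phase_iff by simp
 with sqi_of[OF assms[unfolded Ueq]]
 show "pu U \<in> H1 L" "pf U \<in> H1 L" "pp U \<in> H1 L" "pe U \<in> Lg2 L g" "pu U \<in> sqi I" "pf U \<in> sqi I" "pp U \<in> sqi I"
  "cv U \<in> sqi I" "cPhi U \<in> sqi I" "cPsi U \<in> sqi I" "ct U \<in> sqi I" "cq U \<in> sqi I"
  by (simp_all add: Ueq p_defs)
qed

lemma coord_c:
 "coord I X cv" "coord I X cu" "coord I X cPhi" "coord I X cPsi" "coord I X cp" "coord I X cb" "coord I X ck"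
 "coord I X ct" "coord I X cq" "coord P X ce" "coord I X pu" "coord I X pf" "coord I X pp" "coord I X (\<lambda>U. wd (pf U))"
proof -
 show p: "coord I X pu" "coord I X pf" "coord I X pp" "coord I X cv" "coord I X cPhi" "coord I X cPsi" "coord I X ct" "coord I X cq"
  by (rule coord_sel[OF sel_add(1) sel_scale(1) coord_id sel_sqi(5)] coord_sel[OF sel_add(3) sel_scale(3) coord_id sel_sqi(6)]
    coord_sel[OF sel_add(5) sel_scale(5) coord_id sel_sqi(7)] coord_sel[OF sel_add(2) sel_scale(2) coord_id sel_sqi(8)]
    coord_sel[OF sel_add(4) sel_scale(4) coord_id sel_sqi(9)] coord_sel[OF sel_add(6) sel_scale(6) coord_id sel_sqi(10)]
    coord_sel[OF sel_add(7) sel_scale(7) coord_id sel_sqi(11)] coord_sel[OF sel_add(8) sel_scale(8) coord_id sel_sqi(12)];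
    assumption)+
 note w = coord_sel[OF sel_add(1) sel_scale(1) coord_wd sel_sqi(1)] coord_sel[OF sel_add(3) sel_scale(3) coord_wd sel_sqi(2)]
   coord_sel[OF sel_add(5) sel_scale(5) coord_wd sel_sqi(3)]
 show "coord I X cu" "coord I X cp" "coord I X cb" "coord I X ck" "coord P X ce" "coord I X (\<lambda>U. wd (pf U))"
  unfolding cu_def[abs_def] cp_def[abs_def] cb_def[abs_def] ck_def[abs_def] ce_def[abs_def]
  by (intro coord_add coord_sub w p coord_sel[OF sel_add(9) sel_scale(9) coord_memd sel_sqi(4)]; assumption)+
qed

lemma form_rS: "form X rS"
proof -
 note f = coord_form[OF X_add X_scale]
 have "form X (\<lambda>U V. rS U V)" unfolding rS_def using cpos bt_pos
  by (intro form_plus form_mult f coord_c) auto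
 then show ?thesis .
qed

lemma rS_self: "rS U U = \<rho> * (l2n I (cv U))\<^sup>2 + \<alpha> * (l2n I (cu U))\<^sup>2 + \<rho>1 * (l2n I (cPhi U))\<^sup>2
   + \<rho>2 * (l2n I (cPsi U))\<^sup>2 + bt * (l2n I (cp U))\<^sup>2 + \<beta> * (l2n I (cb U))\<^sup>2
   + \<kappa> * (l2n I (ck U))\<^sup>2 + \<rho>3 * (l2n I (ct U))\<^sup>2 + \<tau> * (l2n I (cq U))\<^sup>2 + (l2n P (ce U))\<^sup>2"
 by (simp add: rS_def rip_self)

lemma rS_terms:
 "\<rho> * (l2n I (cv U))\<^sup>2 \<le> rS U U" "\<alpha> * (l2n I (cu U))\<^sup>2 \<le> rS U U" "\<rho>1 * (l2n I (cPhi U))\<^sup>2 \<le> rS U U"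
 "\<rho>2 * (l2n I (cPsi U))\<^sup>2 \<le> rS U U" "bt * (l2n I (cp U))\<^sup>2 \<le> rS U U" "\<beta> * (l2n I (cb U))\<^sup>2 \<le> rS U U"
 "\<kappa> * (l2n I (ck U))\<^sup>2 \<le> rS U U" "\<rho>3 * (l2n I (ct U))\<^sup>2 \<le> rS U U" "\<tau> * (l2n I (cq U))\<^sup>2 \<le> rS U U"
 "1 * (l2n P (ce U))\<^sup>2 \<le> rS U U"
 unfolding rS_self using cpos bt_pos by (simp_all add: add_nonneg_nonneg add_increasing add_increasing2)

text \<open>\<open>u\<close> and \<open>\<phi>\<close> have mean zero and \<open>\<psi>\<close>
  vanishes at the ends, so \<open>\<phi> - u\<close> is recovered from the three derivative
  coordinates; its limit therefore comes for free in the completeness proof.\<close>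

lemma cb_eq:
 assumes U: "U \<in> X"
 shows "AE x in I. cb U x = mprim (ck U) x - mprim (prim (cp U)) x - mprim (cu U) x"
proof -
 obtain u v \<phi> \<Phi> \<psi> \<Psi> \<theta> q \<eta> where Ueq: "U = (u, v, \<phi>, \<Phi>, \<psi>, \<Psi>, \<theta>, q, \<eta>)" by (rule state_cases)
 note X = U[unfolded Ueq]
 note S = sqi_of[OF X]
 have H: "u \<in> H1star L" "\<phi> \<in> H1star L" "\<psi> \<in> H10 L" using X unfolding phase_iff by auto
 have p: "prim \<psi> = prim (prim (wd \<psi>))"
  by (rule prim_cong[OF H10_D(5)[OF H(3)] sqiD(1)[OF S(8)] sqiD(1)[OF prim_sqi[OF S(9)]]])
 have mp: "mprim \<psi> = mprim (prim (wd \<psi>))" by (simp add: mprim_def[abs_def] p)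
 have "mprim (\<lambda>x. wd \<phi> x + \<psi> x) x = mprim (wd \<phi>) x + mprim (prim (wd \<psi>)) x" for x
  using mprim_add[OF S(6,8)] mp by simp
 then show ?thesis
  using H1star_D(5)[OF H(1)] H1star_D(5)[OF H(2)] by (auto simp: Ueq c_defs elim: eventually_elim2)
qed

lemma l2n_cb:
 assumes U: "U \<in> X"
 shows "l2n I (cb U) \<le> 2 * L * l2n I (ck U) + 2 * L * (L * l2n I (cp U)) + 2 * L * l2n I (cu U)"
proof -
 have S: "ck U \<in> sqi I" "cp U \<in> sqi I" "cu U \<in> sqi I" "cb U \<in> sqi I"
  using coordD(1)[OF coord_c(7) U] coordD(1)[OF coord_c(5) U] coordD(1)[OF coord_c(2) U] coordD(1)[OF coord_c(6) U] by auto
 note q = mprim_sqi[OF S(1)] mprim_sqi[OF prim_sqi[OF S(2)]] mprim_sqi[OF S(3)]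
 have "l2n I (cb U) = l2n I (\<lambda>x. mprim (ck U) x - mprim (prim (cp U)) x - mprim (cu U) x)"
  by (rule l2n_cong[OF sqi_diff'[OF sqi_diff'[OF q(1,2)] q(3)] sqiD(1)[OF S(4)] cb_eq[OF U]])
 also have "\<dots> \<le> l2n I (mprim (ck U)) + l2n I (mprim (prim (cp U))) + l2n I (mprim (cu U))"
  using l2n_triangle_diff[OF sqi_diff'[OF q(1,2)] q(3)] l2n_triangle_diff[OF q(1,2)] by linarith
 also have "\<dots> \<le> 2 * L * l2n I (ck U) + 2 * L * l2n I (prim (cp U)) + 2 * L * l2n I (cu U)"
  using l2n_mprim[OF S(1)] l2n_mprim[OF prim_sqi[OF S(2)]] l2n_mprim[OF S(3)] by linarith
 also have "\<dots> \<le> 2 * L * l2n I (ck U) + 2 * L * (L * l2n I (cp U)) + 2 * L * l2n I (cu U)"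
  using l2n_prim[OF S(2)] L_pos by simp
 finally show ?thesis .
qed

lemma mean_limit:
 assumes f: "!!n :: nat. f n \<in> sqi I" "!!n. (LINT x|I. f n x) = 0" and F: "F \<in> sqi I"
  and lim: "(\<lambda>n. l2n I (\<lambda>p. f n p - F p)) \<longlonglongrightarrow> 0"
 shows "(LINT x|I. F x) = 0"
proof -
 have "cmod (LINT x|I. F x) \<le> sqrt L * l2n I (\<lambda>x. f n x - F x)" for n
  using fin.integral_le_l2n[OF sqi_diff'[OF f(1) F], of n] f(2)[of n] fin.sqi_int[OF f(1)] fin.sqi_int[OF F]
  by simp
 moreover have "(\<lambda>n. sqrt L * l2n I (\<lambda>x. f n x - F x)) \<longlonglongrightarrow> 0" using tendsto_mult_right_zero[OF lim] .
 ultimately have "cmod (LINT x|I. F x) \<le> 0" by (intro LIMSEQ_le_const) auto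
 then show ?thesis by simp
qed

theorem semi_hilbert_phase: "semi_hilbert X rS"
proof
 note f = form_rS[unfolded form_def]
 show "0 \<in> X" by (rule X_zero)
 show "x + y \<in> X" if "x \<in> X" "y \<in> X" for x y using that by (rule X_add)
 show "c *\<^sub>C x \<in> X" if "x \<in> X" for x c using that by (rule X_scale)
 show "rS (x + y) z = rS x z + rS y z" if "x \<in> X" "y \<in> X" "z \<in> X" for x y z using f that by blast
 show "rS (complex_of_real c *\<^sub>C x) z = c * rS x z" if "x \<in> X" "z \<in> X" for x z c using f that by blast
 show "rS x z = rS z x" if "x \<in> X" "z \<in> X" for x z using f that by blast
 show "0 \<le> rS x x" if "x \<in> X" for x using f that by blast
 fix f :: "nat => state"
 assume fX: "!!n. f n \<in> X"
  and cau: "!!e. e > 0 ==> \<exists>M. \<forall>m\<ge>M. \<forall>n\<ge>M. sqrt (rS (f m - f n) (f m - f n)) < e"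
 have lim: thesis if "coord I X c" "0 < w" "!!x. w * (l2n I (c x))\<^sup>2 \<le> rS x x"
   "!!F. F \<in> sqi I ==> (\<lambda>n. l2n I (\<lambda>p. c (f n) p - F p)) \<longlonglongrightarrow> 0 ==> thesis" for c w thesis
  by (rule fin.coord_limit[of X c w rS f thesis]) (use X_scale X_diff fX cau that in auto)
 obtain V where V: "V \<in> sqi I" "(\<lambda>n. l2n I (\<lambda>p. cv (f n) p - V p)) \<longlonglongrightarrow> 0"
  using lim[OF coord_c(1) cpos(1) rS_terms(1)] .
 obtain A where A: "A \<in> sqi I" "(\<lambda>n. l2n I (\<lambda>p. cu (f n) p - A p)) \<longlonglongrightarrow> 0"
  using lim[OF coord_c(2) cpos(5) rS_terms(2)] .
 obtain Ph where Ph: "Ph \<in> sqi I" "(\<lambda>n. l2n I (\<lambda>p. cPhi (f n) p - Ph p)) \<longlonglongrightarrow> 0"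
  using lim[OF coord_c(3) cpos(2) rS_terms(3)] .
 obtain Ps where Ps: "Ps \<in> sqi I" "(\<lambda>n. l2n I (\<lambda>p. cPsi (f n) p - Ps p)) \<longlonglongrightarrow> 0"
  using lim[OF coord_c(4) cpos(3) rS_terms(4)] .
 obtain C where C: "C \<in> sqi I" "(\<lambda>n. l2n I (\<lambda>p. cp (f n) p - C p)) \<longlonglongrightarrow> 0"
  using lim[OF coord_c(5) bt_pos rS_terms(5)] .
 obtain K where K: "K \<in> sqi I" "(\<lambda>n. l2n I (\<lambda>p. ck (f n) p - K p)) \<longlonglongrightarrow> 0"
  using lim[OF coord_c(7) cpos(6) rS_terms(7)] .
 obtain Th where Th: "Th \<in> sqi I" "(\<lambda>n. l2n I (\<lambda>p. ct (f n) p - Th p)) \<longlonglongrightarrow> 0"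
  using lim[OF coord_c(8) cpos(4) rS_terms(8)] .
 obtain Q where Q: "Q \<in> sqi I" "(\<lambda>n. l2n I (\<lambda>p. cq (f n) p - Q p)) \<longlonglongrightarrow> 0"
  using lim[OF coord_c(9) cpos(7) rS_terms(9)] .
 obtain Z where Z: "Z \<in> sqi P" "(\<lambda>n. l2n P (\<lambda>p. ce (f n) p - Z p)) \<longlonglongrightarrow> 0"
  by (rule Pf.coord_limit[of X ce 1 rS f]) (use X_scale X_diff coord_c(10) rS_terms(10) fX cau in auto)
 have comp: "(LINT x|I. cv U x) = 0" "(LINT x|I. cPhi U x) = 0" "(LINT x|I. cp U x) = 0"
  "AE s in G. (LINT x|I. sl (ce U) s x) = 0" if "U \<in> X" for U
 proof -
  obtain u v \<phi> \<Phi> \<psi> \<Psi> \<theta> q \<eta> where Ueq: "U = (u, v, \<phi>, \<Phi>, \<psi>, \<Psi>, \<theta>, q, \<eta>)" by (rule state_cases)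
  have "\<psi> \<in> H10 L" using that unfolding Ueq phase_iff by simp
  then show "(LINT x|I. cv U x) = 0" "(LINT x|I. cPhi U x) = 0" "(LINT x|I. cp U x) = 0"
   "AE s in G. (LINT x|I. sl (ce U) s x) = 0"
   using sqi_of[OF that[unfolded Ueq]] H10_D(4) by (auto simp: Ueq c_defs)
 qed
 note S = coordD(1)[OF coord_c(1) fX] coordD(1)[OF coord_c(3) fX] coordD(1)[OF coord_c(5) fX] coordD(1)[OF coord_c(10) fX]
 have V0: "(LINT x|I. V x) = 0" by (rule mean_limit[OF S(1) comp(1)[OF fX] V])
 have Ph0: "(LINT x|I. Ph x) = 0" by (rule mean_limit[OF S(2) comp(2)[OF fX] Ph])
 have C0: "(LINT x|I. C x) = 0" by (rule mean_limit[OF S(3) comp(3)[OF fX] C])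
 have Z0: "AE s in G. (LINT x|I. sl Z s x) = 0" by (rule mean_zero_closed[OF S(4) comp(4)[OF fX] Z])
 \<comment> \<open>The limit is rebuilt from limits of derivatives. \<open>K\<close> is the limit of
   \<open>\<phi>\<close>'s derivative plus \<open>\<psi>\<close>, and \<open>prim C\<close> is that
   of \<open>\<psi>\<close>, which explains the third component.\<close>
 define l :: state where "l = (mprim A, V, mprim (\<lambda>x. K x - prim C x), Ph, prim C, Ps, Th, Q, (\<lambda>s x. primP Z (s, x)))"
 have KC: "(\<lambda>x. K x - prim C x) \<in> sqi I" by (rule sqi_diff'[OF K(1) prim_sqi[OF C(1)]])
 note rep = mem_rep_primP[OF Z(1) Z0]
 have lX: "l \<in> X"
  unfolding l_def phase_iff using H1star_mprim(1)[OF A(1)] H1star_mprim(1)[OF KC] V V0 Ph Ph0 H10_prim(1)[OF C(1) C0]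
   Ps Th Q mem_rep_Lg2(1)[OF rep] by (simp add: L2star_iff)
 have tend: "(\<lambda>n. l2n M (c (f n - l))) \<longlonglongrightarrow> 0"
  if "coord M X c" "F \<in> sqi M" "AE p in M. c l p = F p" "(\<lambda>n. l2n M (\<lambda>p. c (f n) p - F p)) \<longlonglongrightarrow> 0"
  for M :: "'z measure" and c F
  by (rule coord_tendsto[where X = X and c = c and f = f and l = l and F = F]) (use X_scale X_diff fX lX that in auto)
 have k: "AE x in I. ck l x = K x" using H1star_mprim(2)[OF KC] by eventually_elim (simp add: l_def c_defs)
 have T: "(\<lambda>n. l2n I (cv (f n - l))) \<longlonglongrightarrow> 0" "(\<lambda>n. l2n I (cu (f n - l))) \<longlonglongrightarrow> 0"
  "(\<lambda>n. l2n I (cPhi (f n - l))) \<longlonglongrightarrow> 0" "(\<lambda>n. l2n I (cPsi (f n - l))) \<longlonglongrightarrow> 0"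
  "(\<lambda>n. l2n I (cp (f n - l))) \<longlonglongrightarrow> 0" "(\<lambda>n. l2n I (ck (f n - l))) \<longlonglongrightarrow> 0"
  "(\<lambda>n. l2n I (ct (f n - l))) \<longlonglongrightarrow> 0" "(\<lambda>n. l2n I (cq (f n - l))) \<longlonglongrightarrow> 0"
  "(\<lambda>n. l2n P (ce (f n - l))) \<longlonglongrightarrow> 0"
  by (rule tend[OF coord_c(1) V(1) _ V(2)] tend[OF coord_c(2) A(1) _ A(2)] tend[OF coord_c(3) Ph(1) _ Ph(2)]
    tend[OF coord_c(4) Ps(1) _ Ps(2)] tend[OF coord_c(5) C(1) _ C(2)] tend[OF coord_c(7) K(1) k K(2)]
    tend[OF coord_c(8) Th(1) _ Th(2)] tend[OF coord_c(9) Q(1) _ Q(2)] tend[OF coord_c(10) Z(1) _ Z(2)];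
   use H1star_mprim(2)[OF A(1)] H10_prim(2)[OF C(1) C0] memd_eq[OF rep] in \<open>simp add: l_def c_defs\<close>)+
 have Tb: "(\<lambda>n. l2n I (cb (f n - l))) \<longlonglongrightarrow> 0"
 proof (rule tendsto_sandwich[OF _ _ tendsto_const])
  show "\<forall>\<^sub>F n in sequentially. l2n I (cb (f n - l)) \<le>
    2 * L * l2n I (ck (f n - l)) + 2 * L * (L * l2n I (cp (f n - l))) + 2 * L * l2n I (cu (f n - l))"
   using l2n_cb[OF X_diff[OF fX lX]] by simp
  show "(\<lambda>n. 2 * L * l2n I (ck (f n - l)) + 2 * L * (L * l2n I (cp (f n - l))) + 2 * L * l2n I (cu (f n - l))) \<longlonglongrightarrow> 0"
   by (intro tendsto_add_zero tendsto_mult_right_zero T)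
 qed simp
 have "(\<lambda>n. rS (f n - l) (f n - l)) \<longlonglongrightarrow> 0"
  unfolding rS_self by (intro tendsto_add_zero tendsto_mult_right_zero tendsto_null_power T Tb) auto
 then have "(\<lambda>n. sqrt (rS (f n - l) (f n - l))) \<longlonglongrightarrow> sqrt 0" by (rule tendsto_real_sqrt)
 then show "\<exists>l\<in>X. (\<lambda>n. sqrt (rS (f n - l) (f n - l))) \<longlonglongrightarrow> 0" using lX by auto
qed

abbreviation "N \<equiv> phase_norm L \<rho> \<rho>1 \<rho>2 \<rho>3 \<alpha> \<kappa> b \<tau> \<beta> g"

lemma N_eq:
 assumes U: "U \<in> X"
 shows "N U = sqrt (rS U U)"
proof -
 obtain u v \<phi> \<Phi> \<psi> \<Psi> \<theta> q \<eta> where Ueq: "U = (u, v, \<phi>, \<Phi>, \<psi>, \<Psi>, \<theta>, q, \<eta>)" by (rule state_cases)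
 have "\<eta> \<in> Lg2 L g" using U unfolding Ueq phase_iff by simp
 from mem_rep_Lg2(2)[OF mem_rep_memd[OF this]] have e: "Lg2norm L g \<eta> = l2n P (memd \<eta>)" .
 have d: "\<phi> - u = (\<lambda>x. \<phi> x - u x)" "wd \<phi> + \<psi> = (\<lambda>x. wd \<phi> x + \<psi> x)" by (simp_all add: fun_eq_iff)
 show ?thesis unfolding Ueq phase_norm_def rS_self L2norm_eq prod.case e d by (simp add: c_defs)
qed

lemma N_zero:
 assumes U: "(u, v, \<phi>, \<Phi>, \<psi>, \<Psi>, \<theta>, q, \<eta>) \<in> X"
  and 0: "AE x in I. u x = 0" "AE x in I. v x = 0" "AE x in I. \<phi> x = 0" "AE x in I. \<Phi> x = 0" "AE x in I. \<psi> x = 0"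
  "AE x in I. \<Psi> x = 0" "AE x in I. \<theta> x = 0" "AE x in I. q x = 0" "AE p in P. memd \<eta> p = 0"
 shows "N (u, v, \<phi>, \<Phi>, \<psi>, \<Psi>, \<theta>, q, \<eta>) = 0"
proof -
 note S = sqi_of[OF U]
 note w = wderiv_null[OF S(2) 0(1)] wderiv_null[OF S(5) 0(3)] wderiv_null[OF S(8) 0(5)]
 have "AE x in I. \<phi> x - u x = 0" using 0(1,3) by eventually_elim simp
 moreover have "AE x in I. wd \<phi> x + \<psi> x = 0" using w(2) 0(5) by eventually_elim simp
 ultimately show ?thesis unfolding N_eq[OF U] rS_self by (simp add: c_defs l2n_AE_zero 0 w)
qed

text \<open>Definiteness: \<open>u\<close> and \<open>\<psi>\<close> vanish because their
  derivatives do, and \<open>\<phi>\<close> then vanishes through \<open>\<phi> - u\<close>.\<close>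

lemma N_zero_D:
 assumes U: "(u, v, \<phi>, \<Phi>, \<psi>, \<Psi>, \<theta>, q, \<eta>) \<in> X" and N: "N (u, v, \<phi>, \<Phi>, \<psi>, \<Psi>, \<theta>, q, \<eta>) = 0"
 shows "AE x in I. u x = 0" "AE x in I. v x = 0" "AE x in I. \<phi> x = 0" "AE x in I. \<Phi> x = 0" "AE x in I. \<psi> x = 0"
  "AE x in I. \<Psi> x = 0" "AE x in I. \<theta> x = 0" "AE x in I. q x = 0" "AE p in P. memd \<eta> p = 0"
proof -
 note S = sqi_of[OF U]
 let ?U = "(u, v, \<phi>, \<Phi>, \<psi>, \<Psi>, \<theta>, q, \<eta>)"
 have "rS ?U ?U = 0" using N unfolding N_eq[OF U] by simp
 note t = rS_terms[of ?U, unfolded this]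
 have z: "l2n M f = 0" if "w * (l2n M f)\<^sup>2 \<le> 0" "w > 0" for w :: real and M :: "'z measure" and f
  using that by (simp add: mult_le_0_iff)
 have H: "u \<in> H1star L" "\<phi> \<in> H1star L" "\<psi> \<in> H10 L" using U unfolding phase_iff by auto
 show "AE x in I. v x = 0" "AE x in I. \<Phi> x = 0" "AE x in I. \<Psi> x = 0" "AE x in I. \<theta> x = 0" "AE x in I. q x = 0" "AE p in P. memd \<eta> p = 0"
  using z[OF t(1) cpos(1)] z[OF t(3) cpos(2)] z[OF t(4) cpos(3)] z[OF t(8) cpos(4)] z[OF t(9) cpos(7)] z[OF t(10) zero_less_one]
  by (auto intro: l2n_zero_AE S simp: c_defs)
 have u0: "AE x in I. wd u x = 0" using z[OF t(2) cpos(5)] by (auto intro: l2n_zero_AE S simp: c_defs)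
 have "prim (wd u) = (\<lambda>_. 0)" using prim_cong[OF u0 sqiD(1)[OF S(3)]] by (simp add: prim_def[abs_def])
 then have "mprim (wd u) = (\<lambda>_. 0)" by (simp add: mprim_def[abs_def])
 then show u: "AE x in I. u x = 0" using H1star_D(5)[OF H(1)] by simp
 have "AE x in I. wd \<psi> x = 0" using z[OF t(5) bt_pos] by (auto intro: l2n_zero_AE S simp: c_defs)
 then have "prim (wd \<psi>) = (\<lambda>_. 0)"
  using prim_cong[OF _ sqiD(1)[OF S(9)], of "\<lambda>_. 0"] by (simp add: prim_def[abs_def])
 then show "AE x in I. \<psi> x = 0" using H10_D(5)[OF H(3)] by simp
 have "AE x in I. \<phi> x - u x = 0"
  using z[OF t(6) cpos(9)] l2n_zero_AE[OF sqi_diff'[OF S(5,2)]] by (simp add: c_defs)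
 then show "AE x in I. \<phi> x = 0" using u by eventually_elim simp
qed

end

section \<open>The operator\<close>

text \<open>A coordinate map that also vanishes on null elements, hence lives on the quotient. The
  class is closed under every operation that occurs in the integrated equation.\<close>

definition lcoord :: "'x measure => 'a::complex_vector set => ('a => bool) => ('a => 'x => complex) => bool" where
 "lcoord M Y nul c \<longleftrightarrow> coord M Y c \<and> (\<forall>y\<in>Y. nul y --> (AE p in M. c y p = 0))"

lemma lcoordD:
 assumes "lcoord M Y nul c"
 shows "x \<in> Y ==> c x \<in> sqi M" "x \<in> Y ==> y \<in> Y ==> AE p in M. c (x + y) p = c x p + c y p"
  "x \<in> Y ==> AE p in M. c (k *\<^sub>C x) p = k * c x p" "x \<in> Y ==> nul x ==> AE p in M. c x p = 0"
 using assms by (auto simp: lcoord_def coord_def)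

lemma lcoordI:
 assumes "!!x. x \<in> Y ==> c x \<in> sqi M" "!!x y. x \<in> Y ==> y \<in> Y ==> AE p in M. c (x + y) p = c x p + c y p"
  "!!x k. x \<in> Y ==> AE p in M. c (k *\<^sub>C x) p = k * c x p" "!!x. x \<in> Y ==> nul x ==> AE p in M. c x p = 0"
 shows "lcoord M Y nul c" using assms by (auto simp: lcoord_def coord_def)

lemma lcoord_add:
 assumes "lcoord M Y nul c" "lcoord M Y nul d"
 shows "lcoord M Y nul (\<lambda>y p. c y p + d y p)" unfolding lcoord_def
proof (intro conjI ballI impI coord_add)
 show "AE p in M. c y p + d y p = 0" if "y \<in> Y" "nul y" for y
  using lcoordD(4)[OF assms(1) that] lcoordD(4)[OF assms(2) that] by eventually_elim simp
qed (use assms in \<open>auto simp: lcoord_def\<close>)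

lemma lcoord_mult: "lcoord M Y nul c ==> lcoord M Y nul (\<lambda>y p. a * c y p)"
 using coord_mult unfolding lcoord_def by (auto elim!: eventually_mono)

lemma lcoord_diff:
 assumes "lcoord M Y nul c" "lcoord M Y nul d"
 shows "lcoord M Y nul (\<lambda>y p. c y p - d y p)"
 using lcoord_add[OF assms(1) lcoord_mult[OF assms(2), of "-1"]] by simp

lemma (in interval) lcoord_prim:
 assumes c: "lcoord I Y nul c" and Y: "!!x y. x \<in> Y ==> y \<in> Y ==> x + y \<in> Y" "!!x k. x \<in> Y ==> k *\<^sub>C x \<in> Y"
 shows "lcoord I Y nul (\<lambda>y. prim (c y))"
proof (rule lcoordI)
 note C = lcoordD[OF c]
 note m = sqiD(1)[OF C(1)] and i = fin.sqi_int[OF C(1)]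
 show "AE p in I. prim (c (x + y)) p = prim (c x) p + prim (c y) p" if "x \<in> Y" "y \<in> Y" for x y
 proof -
  have "prim (c (x + y)) = prim (\<lambda>p. c x p + c y p)"
   by (rule prim_cong[OF C(2)[OF that] m[OF Y(1)[OF that]] borel_measurable_add[OF m[OF that(1)] m[OF that(2)]]])
  then show ?thesis by (simp add: prim_add[OF i[OF that(1)] i[OF that(2)]])
 qed
 show "AE p in I. prim (c (k *\<^sub>C x)) p = k * prim (c x) p" if "x \<in> Y" for x k
 proof -
  have "prim (c (k *\<^sub>C x)) = prim (\<lambda>p. k * c x p)"
   by (rule prim_cong[OF C(3)[OF that] m[OF Y(2)[OF that]] sqiD(1)[OF sqi_mult'[OF C(1)[OF that]]]])
  then show ?thesis by (simp add: prim_mult)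
 qed
 show "AE p in I. prim (c x) p = 0" if "x \<in> Y" "nul x" for x
  using prim_cong[OF C(4)[OF that] m[OF that(1)]] by (simp add: prim_def)
qed (use lcoordD[OF c] prim_sqi in blast)

context memory
begin

lemma lcoord_meanG:
 assumes c: "lcoord P Y nul c" and Y: "!!x y. x \<in> Y ==> y \<in> Y ==> x + y \<in> Y" "!!x k. x \<in> Y ==> k *\<^sub>C x \<in> Y"
 shows "lcoord I Y nul (\<lambda>y. meanG (c y))"
proof (rule lcoordI)
 note C = lcoordD[OF c]
 show "AE p in I. meanG (c (x + y)) p = meanG (c x) p + meanG (c y) p" if "x \<in> Y" "y \<in> Y" for x y
  using meanG_cong[OF C(1)[OF Y(1)[OF that]] sqi_add'[OF C(1)[OF that(1)] C(1)[OF that(2)]] C(2)[OF that]]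
   meanG_add[OF C(1)[OF that(1)] C(1)[OF that(2)]] by eventually_elim simp
 show "AE p in I. meanG (c (k *\<^sub>C x)) p = k * meanG (c x) p" if "x \<in> Y" for x k
  using meanG_cong[OF C(1)[OF Y(2)[OF that]] sqi_mult'[OF C(1)[OF that]] C(3)[OF that]] by (simp add: meanG_mult)
 show "AE p in I. meanG (c x) p = 0" if "x \<in> Y" "nul x" for x
  using meanG_cong[OF C(1)[OF that(1)] sqi_zero(1) C(4)[OF that]] by (simp add: meanG_def)
qed (use lcoordD[OF c] meanG_sqi in blast)

lemma lcoord_J:
 assumes c: "lcoord P Y nul c" and Y: "!!x y. x \<in> Y ==> y \<in> Y ==> x + y \<in> Y" "!!x k. x \<in> Y ==> k *\<^sub>C x \<in> Y"
 shows "lcoord P Y nul (\<lambda>y. J (c y))"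
proof (rule lcoordI)
 note C = lcoordD[OF c]
 show "AE p in P. J (c (x + y)) p = J (c x) p + J (c y) p" if "x \<in> Y" "y \<in> Y" for x y
  using J_cong[OF C(1)[OF Y(1)[OF that]] sqi_add'[OF C(1)[OF that(1)] C(1)[OF that(2)]] C(2)[OF that]]
   J_add[OF C(1)[OF that(1)] C(1)[OF that(2)]] by eventually_elim simp
 show "AE p in P. J (c (k *\<^sub>C x)) p = k * J (c x) p" if "x \<in> Y" for x k
  using J_cong[OF C(1)[OF Y(2)[OF that]] sqi_mult'[OF C(1)[OF that]] C(3)[OF that]] by (simp add: J_mult)
 show "AE p in P. J (c x) p = 0" if "x \<in> Y" "nul x" for x
  using J_cong[OF C(1)[OF that(1)] sqi_zero(1) C(4)[OF that]] by (simp add: J_def case_prod_unfold)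
qed (use lcoordD[OF c] J_sqi in blast)

lemma AE_snd:
 assumes "AE x in I. Q x" shows "AE p in P. Q (snd p)"
proof -
 obtain N where N: "{x \<in> space I. \<not> Q x} \<subseteq> N" "N \<in> sets I" "emeasure I N = 0" using AE_E[OF assms] by metis
 have "AE p in P. snd p \<notin> N"
  using AE_P[of "\<lambda>s x. x \<notin> N"] N AE_not_in[of N I] by (simp add: null_sets_def)
 then show ?thesis using AE_space
 proof eventually_elim
  case (elim p)
  then show ?case using N(1) by (auto simp: space_pair_measure)
 qed
qed

lemma lcoord_snd:
 assumes c: "lcoord I Y nul c"
 shows "lcoord P Y nul (\<lambda>y p. c y (snd p))"
proof (rule lcoordI)
 note C = lcoordD[OF c]
 show "AE p in P. c (x + y) (snd p) = c x (snd p) + c y (snd p)" if "x \<in> Y" "y \<in> Y" for x y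
  using AE_snd[OF C(2)[OF that]] .
 show "AE p in P. c (k *\<^sub>C x) (snd p) = k * c x (snd p)" if "x \<in> Y" for x k
  using AE_snd[OF C(3)[OF that]] .
 show "AE p in P. c x (snd p) = 0" if "x \<in> Y" "nul x" for x using AE_snd[OF C(4)[OF that]] .
qed (use lcoordD[OF c] sqi_snd in blast)

lemma memory_flux_sqi:
 assumes rep: "mem_rep \<eta> W" and psi: "\<psi> \<in> sqi I"
 shows "memory_flux b g \<psi> \<eta> \<in> sqi I"
proof (rule sqi_cong[OF _ _ memory_flux_prim[OF rep]])
 note W = mem_repD[OF rep]
 show "(\<lambda>x. complex_of_real (b_tilde b g) * \<psi> x + prim (meanG W) x) \<in> sqi I"
  by (intro sqi_add' sqi_mult' psi prim_sqi meanG_sqi W(1))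
 have e: "memory_flux b g \<psi> \<eta> x = complex_of_real (b_tilde b g) * \<psi> x + meanG (\<lambda>(s, x). \<eta> s x) x"
  if "x \<in> space I" for x
 proof -
  have "(\<lambda>s. \<eta> s x) \<in> borel_measurable R" using sec_meas_R[OF W(2)] that by simp
  then show ?thesis unfolding memory_flux_def meanG_def by (simp add: integral_G_lborel)
 qed
 have "(\<lambda>x. complex_of_real (b_tilde b g) * \<psi> x + meanG (\<lambda>(s, x). \<eta> s x) x) \<in> borel_measurable I"
  using sqiD(1)[OF psi] meanG_meas[OF W(2)] by measurable
 then show "memory_flux b g \<psi> \<eta> \<in> borel_measurable I"
  by (subst measurable_cong[of I "memory_flux b g \<psi> \<eta>"]) (auto simp: e)
qed

end

context interval
begin

lemma H1_cong:
 assumes "h \<in> H1 L" "f \<in> sqi I" "AE x in I. f x = h x"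
 shows "f \<in> H1 L" "AE x in I. wderiv L f x = wderiv L h x"
proof -
 note h = H1_D[OF assms(1)]
 obtain c where "AE x in I. h x = c + prim (wderiv L h) x" using h(3) by blast
 then have "AE x in I. f x = c + prim (wderiv L h) x" using assms(3) by eventually_elim simp
 from H1_I[OF assms(2) h(2) this] show "f \<in> H1 L" "AE x in I. wderiv L f x = wderiv L h x" by auto
qed

lemma H10_cong:
 assumes "h \<in> H10 L" "f \<in> sqi I" "AE x in I. f x = h x"
 shows "f \<in> H10 L"
proof -
 note h = H10_D[OF assms(1)]
 have "AE x in I. f x = prim (wderiv L h) x" using h(5) assms(3) by eventually_elim simp
 then show "f \<in> H10 L" by (rule H10_I(1)[OF assms(2) h(3,4)])
qed

lemma H1star_cong:
 assumes "h \<in> H1star L" "f \<in> sqi I" "AE x in I. f x = h x"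
 shows "f \<in> H1star L"
proof -
 note h = H1star_D[OF assms(1)]
 have "(LINT x|I. f x) = (LINT x|I. h x)"
  by (rule integral_cong_AE[OF sqiD(1)[OF assms(2)] sqiD(1)[OF h(2)] assms(3)])
 then show ?thesis using H1_cong(1)[OF h(1) assms(2,3)] h(4) by (simp add: H1star_iff)
qed

end

section \<open>The stationary equation as a linear relation\<close>

context porous
begin

definition nul :: "state \<times> state => bool" where "nul W \<longleftrightarrow> N (fst W) = 0 \<and> N (snd W) = 0"

lemma lcoord_N:
 "lcoord I X (\<lambda>U. N U = 0) cv" "lcoord I X (\<lambda>U. N U = 0) cu" "lcoord I X (\<lambda>U. N U = 0) cPhi"
 "lcoord I X (\<lambda>U. N U = 0) cPsi" "lcoord I X (\<lambda>U. N U = 0) cp" "lcoord I X (\<lambda>U. N U = 0) cb"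
 "lcoord I X (\<lambda>U. N U = 0) ck" "lcoord I X (\<lambda>U. N U = 0) ct" "lcoord I X (\<lambda>U. N U = 0) cq"
 "lcoord P X (\<lambda>U. N U = 0) ce" "lcoord I X (\<lambda>U. N U = 0) pu" "lcoord I X (\<lambda>U. N U = 0) pf"
 "lcoord I X (\<lambda>U. N U = 0) pp"
proof -
 have z: "(AE x in I. pu U x = 0) \<and> (AE x in I. cv U x = 0) \<and> (AE x in I. pf U x = 0) \<and> (AE x in I. cPhi U x = 0) \<and>
   (AE x in I. pp U x = 0) \<and> (AE x in I. cPsi U x = 0) \<and> (AE x in I. ct U x = 0) \<and> (AE x in I. cq U x = 0) \<and>
   (AE p in P. ce U p = 0)" if "U \<in> X" "N U = 0" for U
  using that by (cases U rule: state_cases) (simp add: c_defs N_zero_D)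
 then show "lcoord I X (\<lambda>U. N U = 0) cv" "lcoord I X (\<lambda>U. N U = 0) cPhi" "lcoord I X (\<lambda>U. N U = 0) cPsi"
  "lcoord I X (\<lambda>U. N U = 0) ct" "lcoord I X (\<lambda>U. N U = 0) cq" "lcoord P X (\<lambda>U. N U = 0) ce"
  and p: "lcoord I X (\<lambda>U. N U = 0) pu" "lcoord I X (\<lambda>U. N U = 0) pf" "lcoord I X (\<lambda>U. N U = 0) pp"
  unfolding lcoord_def using coord_c by simp_all
 have w: "lcoord I X (\<lambda>U. N U = 0) (\<lambda>U. wd (f U))"
  if "coord I X (\<lambda>U. wd (f U))" "coord I X f" "!!U. U \<in> X ==> N U = 0 ==> AE x in I. f U x = 0" for f
  unfolding lcoord_def using that(1) wderiv_null[OF coordD(1)[OF that(2)] that(3)] by simp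
 show "lcoord I X (\<lambda>U. N U = 0) cu" "lcoord I X (\<lambda>U. N U = 0) cp" "lcoord I X (\<lambda>U. N U = 0) cb" "lcoord I X (\<lambda>U. N U = 0) ck"
  unfolding cu_def[abs_def] cp_def[abs_def] cb_def[abs_def] ck_def[abs_def]
  by (intro p lcoord_diff lcoord_add w coord_c coord_c(2)[unfolded cu_def[abs_def]] coord_c(5)[unfolded cp_def[abs_def]];
    simp add: z)+
qed

lemma lcoord_fst: "lcoord M X (\<lambda>U. N U = 0) c ==> lcoord M (X \<times> X) nul (\<lambda>W. c (fst W))"
 unfolding lcoord_def coord_def nul_def by (auto simp: scaleC_prod_def)

lemma lcoord_sn: "lcoord M X (\<lambda>U. N U = 0) c ==> lcoord M (X \<times> X) nul (\<lambda>W. c (snd W))"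
 unfolding lcoord_def coord_def nul_def by (auto simp: scaleC_prod_def)

lemma XX_add: "x \<in> X \<times> X ==> y \<in> X \<times> X ==> x + y \<in> X \<times> X"
 unfolding mem_Times_iff fst_add snd_add by (blast intro: X_add)

lemma XX_scale: "x \<in> X \<times> X ==> k *\<^sub>C x \<in> X \<times> X"
 unfolding mem_Times_iff scaleC_prod_def[of k x] fst_conv snd_conv by (blast intro: X_scale)

lemma lcoord_XX:
 "lcoord I (X \<times> X) nul c ==> lcoord I (X \<times> X) nul (\<lambda>W. prim (c W))"
 "lcoord P (X \<times> X) nul d ==> lcoord I (X \<times> X) nul (\<lambda>W. meanG (d W))"
 "lcoord P (X \<times> X) nul d ==> lcoord P (X \<times> X) nul (\<lambda>W. J (d W))"
 by (rule lcoord_prim lcoord_meanG lcoord_J, assumption, rule XX_add, assumption+, rule XX_scale, assumption)+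

text \<open>The equation \<open>A U = F\<close>, integrated in \<open>x\<close> and \<open>s\<close> so that no derivative of \<open>U\<close> beyond those in the
 phase space occurs; \<open>e7\<close> and \<open>e8\<close> are only determined up to a constant.\<close>

definition e1 where "e1 W x = cv (fst W) x - pu (snd W) x"
definition e2 where "e2 W x = cPhi (fst W) x - pf (snd W) x"
definition e3 where "e3 W x = cPsi (fst W) x - pp (snd W) x"
definition e4 where "e4 W x = \<alpha> * cu (fst W) x - prim (\<lambda>y. \<rho> * cv (snd W) y + \<gamma> * cv (fst W) y - \<beta> * cb (fst W) y) x"
definition e5 where "e5 W x = \<kappa> * ck (fst W) x - m * ct (fst W) x - prim (\<lambda>y. \<rho>1 * cPhi (snd W) y + \<beta> * cb (fst W) y) x"
definition e0 where "e0 W x = \<sigma> * cq (fst W) x + \<tau> * cq (snd W) x"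
definition e6 where "e6 W x = ct (fst W) x + prim (e0 W) x"
definition e7 where "e7 W x = cq (fst W) x + m * cPhi (fst W) x + prim (\<lambda>y. \<rho>3 * ct (snd W) y + m * cPsi (fst W) y) x"
definition e8 where "e8 W x = bt * cp (fst W) x + meanG (ce (fst W)) x -
  prim (\<lambda>y. \<rho>2 * cPsi (snd W) y + \<kappa> * ck (fst W) y - m * ct (fst W) y) x"
definition e9 where "e9 W p = ce (fst W) p - J (\<lambda>p. cp (snd W) (snd p) - ce (snd W) p) p"

lemmas e_defs = e0_def e1_def e2_def e3_def e4_def e5_def e6_def e7_def e8_def e9_def

lemma lcoord_e:
 "lcoord I (X \<times> X) nul e1" "lcoord I (X \<times> X) nul e2" "lcoord I (X \<times> X) nul e3" "lcoord I (X \<times> X) nul e4"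
 "lcoord I (X \<times> X) nul e5" "lcoord I (X \<times> X) nul e6" "lcoord I (X \<times> X) nul e7" "lcoord I (X \<times> X) nul e8"
 "lcoord P (X \<times> X) nul e9" "lcoord I (X \<times> X) nul e0" unfolding e_defs[abs_def]
 by (intro lcoord_add lcoord_diff lcoord_mult lcoord_XX lcoord_snd lcoord_N[THEN lcoord_fst] lcoord_N[THEN lcoord_sn])+

text \<open>The condition on \<open>e0\<close> is the boundary value \<open>\<theta> = 0\<close> at
  \<open>L\<close>, since \<open>e6\<close> makes \<open>\<theta>\<close> minus its primitive. For
  \<open>e4\<close> and \<open>e5\<close> the values at \<open>L\<close> come out right because the
  integrands have mean zero. \<open>q\<close> and the flux carry no boundary condition, hence the
  free constants.\<close>

definition Rel :: "state \<times> state => bool" where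
 "Rel W \<longleftrightarrow> (AE x in I. e1 W x = 0) \<and> (AE x in I. e2 W x = 0) \<and> (AE x in I. e3 W x = 0) \<and> (AE x in I. e4 W x = 0) \<and>
   (AE x in I. e5 W x = 0) \<and> (AE x in I. e6 W x = 0) \<and> (\<exists>c. AE x in I. e7 W x = c) \<and> (\<exists>c. AE x in I. e8 W x = c) \<and>
   (AE p in P. e9 W p = 0) \<and> (LINT x|I. e0 W x) = 0"

lemma lcoord_zero_add:
 assumes "lcoord M Y n c" "x \<in> Y" "y \<in> Y" "AE p in M. c x p = a" "AE p in M. c y p = a'"
 shows "AE p in M. c (x + y) p = a + a'" using lcoordD(2)[OF assms(1-3)] assms(4,5) by eventually_elim simp

lemma lcoord_zero_scale:
 assumes "lcoord M Y n c" "x \<in> Y" "AE p in M. c x p = a"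
 shows "AE p in M. c (k *\<^sub>C x) p = k * a"
 using lcoordD(3)[OF assms(1,2), of k] assms(3) by eventually_elim simp

text \<open>With \<open>Rel_scale\<close> and \<open>Rel_null\<close> this makes the relation a
  linear subspace that contains all null pairs; linearity of the operator modulo null elements is
  deduced from it.\<close>

lemma Rel_add:
 assumes W: "W \<in> X \<times> X" "W' \<in> X \<times> X" and R: "Rel W" "Rel W'"
 shows "Rel (W + W')"
proof -
 note a = lcoord_zero_add[OF _ W]
 have z: "AE x in M. c (W + W') x = 0"
  if "lcoord M (X \<times> X) nul c" "AE x in M. c W x = 0" "AE x in M. c W' x = 0" for M :: "'z measure" and c
  using a[OF that] by simp
 have "(LINT x|I. e0 (W + W') x) = (LINT x|I. e0 W x + e0 W' x)"
  by (rule integral_cong_AE[OF sqiD(1)[OF lcoordD(1)[OF lcoord_e(10) XX_add[OF W]]]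
     sqiD(1)[OF sqi_add'[OF lcoordD(1)[OF lcoord_e(10) W(1)] lcoordD(1)[OF lcoord_e(10) W(2)]]]
     lcoordD(2)[OF lcoord_e(10) W]])
 also have "\<dots> = 0"
  using R fin.sqi_int[OF lcoordD(1)[OF lcoord_e(10) W(1)]] fin.sqi_int[OF lcoordD(1)[OF lcoord_e(10) W(2)]]
  by (simp add: Rel_def)
 finally show ?thesis
  using R z[OF lcoord_e(1)] z[OF lcoord_e(2)] z[OF lcoord_e(3)] z[OF lcoord_e(4)] z[OF lcoord_e(5)] z[OF lcoord_e(6)]
   a[OF lcoord_e(7)] a[OF lcoord_e(8)] z[OF lcoord_e(9)] unfolding Rel_def by blast
qed

lemma Rel_scale:
 assumes W: "W \<in> X \<times> X" and R: "Rel W"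
 shows "Rel (k *\<^sub>C W)"
proof -
 note a = lcoord_zero_scale[OF _ W]
 have z: "AE x in M. c (k *\<^sub>C W) x = 0"
  if "lcoord M (X \<times> X) nul c" "AE x in M. c W x = 0" for M :: "'z measure" and c
  using a[OF that, of k] by simp
 have "(LINT x|I. e0 (k *\<^sub>C W) x) = (LINT x|I. k * e0 W x)"
  by (rule integral_cong_AE[OF sqiD(1)[OF lcoordD(1)[OF lcoord_e(10) XX_scale[OF W]]]
     sqiD(1)[OF sqi_mult'[OF lcoordD(1)[OF lcoord_e(10) W]]] lcoordD(3)[OF lcoord_e(10) W]])
 also have "\<dots> = 0" using R by (simp add: Rel_def)
 finally show ?thesis
  using R z[OF lcoord_e(1)] z[OF lcoord_e(2)] z[OF lcoord_e(3)] z[OF lcoord_e(4)] z[OF lcoord_e(5)] z[OF lcoord_e(6)]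
   a[OF lcoord_e(7)] a[OF lcoord_e(8)] z[OF lcoord_e(9)] unfolding Rel_def by blast
qed

lemma Rel_null:
 assumes W: "W \<in> X \<times> X" and n: "nul W"
 shows "Rel W"
proof -
 have z: "AE p in M. c W p = 0" if "lcoord M (X \<times> X) nul c" for M :: "'z measure" and c
  by (rule lcoordD(4)[OF that W n])
 have "(LINT x|I. e0 W x) = (LINT x|I. 0)"
  by (rule integral_cong_AE[OF sqiD(1)[OF lcoordD(1)[OF lcoord_e(10) W]] _ z[OF lcoord_e(10)]]) simp
 then show ?thesis
  unfolding Rel_def using z[OF lcoord_e(1)] z[OF lcoord_e(2)] z[OF lcoord_e(3)] z[OF lcoord_e(4)] z[OF lcoord_e(5)]
   z[OF lcoord_e(6)] z[OF lcoord_e(7)] z[OF lcoord_e(8)] z[OF lcoord_e(9)] by auto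
qed

end

section \<open>Domain and energy identity of the operator\<close>

context porous
begin

abbreviation "D \<equiv> domA L b g"
abbreviation "A \<equiv> opA L \<rho> \<rho>1 \<rho>2 \<rho>3 \<alpha> \<kappa> b \<tau> \<sigma> \<beta> \<gamma> m g"

lemma nz: "complex_of_real \<rho> \<noteq> 0" "complex_of_real \<rho>1 \<noteq> 0" "complex_of_real \<rho>2 \<noteq> 0" "complex_of_real \<rho>3 \<noteq> 0"
 "complex_of_real \<alpha> \<noteq> 0" "complex_of_real \<kappa> \<noteq> 0" "complex_of_real \<tau> \<noteq> 0" "complex_of_real \<sigma> \<noteq> 0"
 using cpos by auto

lemma dom_iff: "(u, v, \<phi>, \<Phi>, \<psi>, \<Psi>, \<theta>, q, \<eta>) \<in> D \<longleftrightarrow> (u, v, \<phi>, \<Phi>, \<psi>, \<Psi>, \<theta>, q, \<eta>) \<in> X \<and>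
   v \<in> H1star L \<and> \<Phi> \<in> H1star L \<and> wd u \<in> H10 L \<and> wd \<phi> \<in> H10 L \<and> \<theta> \<in> H10 L \<and> \<Psi> \<in> H10 L \<and>
   memory_flux b g \<psi> \<eta> \<in> H2 L \<and> q \<in> H1 L \<and> (\<exists>\<zeta>\<in>Lg2 L g. has_s_deriv L g \<eta> \<zeta> 0)"
 by (simp add: domA_def)

lemma opA_eq: "A (u, v, \<phi>, \<Phi>, \<psi>, \<Psi>, \<theta>, q, \<eta>) = (v,
   (\<lambda>x. (\<alpha> * wd (wd u) x + \<beta> * (\<phi> x - u x) - \<gamma> * v x) / \<rho>), \<Phi>,
   (\<lambda>x. (\<kappa> * wd (\<lambda>x. wd \<phi> x + \<psi> x) x - \<beta> * (\<phi> x - u x) - m * wd \<theta> x) / \<rho>1),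
   \<Psi>,
   (\<lambda>x. (wd (wd (memory_flux b g \<psi> \<eta>)) x - \<kappa> * (wd \<phi> x + \<psi> x) + m * \<theta> x) / \<rho>2),
   (\<lambda>x. (- wd q x - m * (wd \<Phi> x + \<Psi> x)) / \<rho>3),
   (\<lambda>x. (- complex_of_real \<sigma> * q x - wd \<theta> x) / \<tau>),
   (\<lambda>s x. \<Psi> x - s_deriv L g \<eta> s x))"
 for u v \<phi> \<Phi> \<psi> \<Psi> \<theta> q :: fld and \<eta> :: "real => fld"
proof -
 have "wd \<phi> + \<psi> = (\<lambda>x. wd \<phi> x + \<psi> x)" by (simp add: fun_eq_iff)
 then show ?thesis by (simp only: opA_def prod.case)
qed

lemma mem_rep_diff:
 assumes "mem_rep \<eta> Z" "mem_rep \<eta>' Z'"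
 shows "mem_rep (\<lambda>s x. \<eta> s x - \<eta>' s x) (\<lambda>p. Z p - Z' p)"
 using mem_rep_add[OF assms(1) mem_rep_mult[OF assms(2), of "-1"]] by simp

lemma memory_flux_wd:
 assumes "\<psi> \<in> H10 L" "\<eta> \<in> Lg2 L g"
 shows "memory_flux b g \<psi> \<eta> \<in> H1 L" "AE x in I. wd (memory_flux b g \<psi> \<eta>) x = bt * wd \<psi> x + meanG (memd \<eta>) x"
proof -
 note r = mem_rep_memd[OF assms(2)] and H = H10_D[OF assms(1)]
 note W = mem_repD[OF r] note M = meanG_sqi[OF W(1)]
 have s: "(\<lambda>x. bt * wd \<psi> x + meanG (memd \<eta>) x) \<in> sqi I" by (intro sqi_add' sqi_mult' H M)
 have "AE x in I. memory_flux b g \<psi> \<eta> x = 0 + prim (\<lambda>x. bt * wd \<psi> x + meanG (memd \<eta>) x) x"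
  using memory_flux_prim[OF r, of b \<psi>] H(5)
  by eventually_elim (simp add: prim_add[OF fin.sqi_int[OF sqi_mult'[OF H(3)]] fin.sqi_int[OF M]] prim_mult)
 from H1_I[OF memory_flux_sqi[OF r H(2)] s this]
 show "memory_flux b g \<psi> \<eta> \<in> H1 L" "AE x in I. wd (memory_flux b g \<psi> \<eta>) x = bt * wd \<psi> x + meanG (memd \<eta>) x" by auto
qed

lemma dom_facts:
 assumes U: "(u, v, \<phi>, \<Phi>, \<psi>, \<Psi>, \<theta>, q, \<eta>) \<in> D"
 shows "(u, v, \<phi>, \<Phi>, \<psi>, \<Psi>, \<theta>, q, \<eta>) \<in> X" "v \<in> H1star L" "\<Phi> \<in> H1star L" "wd u \<in> H10 L" "\<theta> \<in> H10 L" "\<Psi> \<in> H10 L"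
  "q \<in> H1 L" "\<psi> \<in> H10 L" "\<eta> \<in> Lg2 L g" "(\<lambda>x. wd \<phi> x + \<psi> x) \<in> H10 L" "wd (memory_flux b g \<psi> \<eta>) \<in> H1 L"
  "AE x in I. wd (memory_flux b g \<psi> \<eta>) x = bt * wd \<psi> x + meanG (memd \<eta>) x"
  "s_deriv L g \<eta> \<in> Lg2 L g" "AE p in P. memd \<eta> p = J (memd (s_deriv L g \<eta>)) p"
proof -
 note d = U[unfolded dom_iff]
 show X: "(u, v, \<phi>, \<Phi>, \<psi>, \<Psi>, \<theta>, q, \<eta>) \<in> X" using d by blast
 then show p: "\<psi> \<in> H10 L" and e: "\<eta> \<in> Lg2 L g" unfolding phase_iff by auto
 show "v \<in> H1star L" "\<Phi> \<in> H1star L" "wd u \<in> H10 L" "\<theta> \<in> H10 L" "\<Psi> \<in> H10 L" "q \<in> H1 L"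
  using d by auto
 show "(\<lambda>x. wd \<phi> x + \<psi> x) \<in> H10 L" using d p by (intro H10_add) auto
 show "wd (memory_flux b g \<psi> \<eta>) \<in> H1 L" using d by (simp add: H2_def)
 show "AE x in I. wd (memory_flux b g \<psi> \<eta>) x = bt * wd \<psi> x + meanG (memd \<eta>) x" by (rule memory_flux_wd[OF p e])
 obtain \<zeta> where "\<zeta> \<in> Lg2 L g" "has_s_deriv L g \<eta> \<zeta> 0" using d by blast
 from s_deriv_rep[OF mem_rep_memd[OF e] this]
 show "s_deriv L g \<eta> \<in> Lg2 L g" "AE p in P. memd \<eta> p = J (memd (s_deriv L g \<eta>)) p" by auto
qed

lemma f9_rep:
 assumes "\<Psi> \<in> H10 L" "\<zeta> \<in> Lg2 L g"
 shows "mem_rep (\<lambda>s x. \<Psi> x - \<zeta> s x) (\<lambda>p. wd \<Psi> (snd p) - memd \<zeta> p)"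
 by (rule mem_rep_diff[OF mem_rep_const[OF assms(1)] mem_rep_memd[OF assms(2)]])

text \<open>The second and fourth components have mean zero because their leading terms are
  derivatives of functions in \<open>H10\<close>, and \<open>u\<close>, \<open>v\<close>,
  \<open>\<phi>\<close> have mean zero.\<close>

lemma opA_X:
 assumes U: "U \<in> D"
 shows "A U \<in> X"
proof -
 obtain u v \<phi> \<Phi> \<psi> \<Psi> \<theta> q \<eta> where Ueq: "U = (u, v, \<phi>, \<Phi>, \<psi>, \<Psi>, \<theta>, q, \<eta>)" by (rule state_cases)
 note d = dom_facts[OF U[unfolded Ueq]] and S = sqi_of[OF dom_facts(1)[OF U[unfolded Ueq]]]
 note h = H10_D(3)[OF d(4)] H10_D(3)[OF d(10)] H10_D(3)[OF d(5)] H1_D(2)[OF d(11)] H1_D(2)[OF d(7)] H1star_D(3)[OF d(3)]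
 note i = h[THEN fin.sqi_int] S(2,5,10,11)[THEN fin.sqi_int]
 note z = H10_D(4)[OF d(4)] H10_D(4)[OF d(10)] H10_D(4)[OF d(5)]
 show ?thesis unfolding Ueq opA_eq phase_iff L2star_iff
 proof (intro conjI d)
  show "(\<lambda>x. (\<alpha> * wd (wd u) x + \<beta> * (\<phi> x - u x) - \<gamma> * v x) / \<rho>) \<in> sqi I"
   "(\<lambda>x. (\<kappa> * wd (\<lambda>x. wd \<phi> x + \<psi> x) x - \<beta> * (\<phi> x - u x) - m * wd \<theta> x) / \<rho>1) \<in> sqi I"
   "(\<lambda>x. (wd (wd (memory_flux b g \<psi> \<eta>)) x - \<kappa> * (wd \<phi> x + \<psi> x) + m * \<theta> x) / \<rho>2) \<in> sqi I"
   "(\<lambda>x. (- wd q x - m * (wd \<Phi> x + \<Psi> x)) / \<rho>3) \<in> sqi I"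
   "(\<lambda>x. (- complex_of_real \<sigma> * q x - wd \<theta> x) / \<tau>) \<in> sqi I"
   by (intro sqi_divide' sqi_add' sqi_diff' sqi_mult' sqi_uminus' h S)+
  show "(LINT x|I. (\<alpha> * wd (wd u) x + \<beta> * (\<phi> x - u x) - \<gamma> * v x) / \<rho>) = 0"
   using i z S(16-19) by simp
  show "(LINT x|I. (\<kappa> * wd (\<lambda>x. wd \<phi> x + \<psi> x) x - \<beta> * (\<phi> x - u x) - m * wd \<theta> x) / \<rho>1) = 0"
   using i z S(16-19) by simp
  show "(\<lambda>s x. \<Psi> x - s_deriv L g \<eta> s x) \<in> Lg2 L g" by (rule mem_rep_Lg2(1)[OF f9_rep[OF d(6,13)]])
 qed
qed

lemma Rel_opA:
 assumes U: "U \<in> D"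
 shows "Rel (U, A U)"
proof -
 obtain u v \<phi> \<Phi> \<psi> \<Psi> \<theta> q \<eta> where Ueq: "U = (u, v, \<phi>, \<Phi>, \<psi>, \<Psi>, \<theta>, q, \<eta>)" by (rule state_cases)
 note d = dom_facts[OF U[unfolded Ueq]] and S = sqi_of[OF dom_facts(1)[OF U[unfolded Ueq]]]
 note h = H10_D(3)[OF d(4)] H10_D(3)[OF d(10)] H10_D(3)[OF d(5)] H1_D(2)[OF d(11)] H1_D(2)[OF d(7)] H1star_D(3)[OF d(3)]
 have f: "(\<lambda>y. \<rho> * ((\<alpha> * wd (wd u) y + \<beta> * (\<phi> y - u y) - \<gamma> * v y) / \<rho>) + \<gamma> * v y - \<beta> * (\<phi> y - u y)) = (\<lambda>y. \<alpha> * wd (wd u) y)"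
  "(\<lambda>y. \<rho>1 * ((\<kappa> * wd (\<lambda>x. wd \<phi> x + \<psi> x) y - \<beta> * (\<phi> y - u y) - m * wd \<theta> y) / \<rho>1) + \<beta> * (\<phi> y - u y)) =
   (\<lambda>y. \<kappa> * wd (\<lambda>x. wd \<phi> x + \<psi> x) y - m * wd \<theta> y)"
  "(\<lambda>x. \<sigma> * q x + \<tau> * ((- complex_of_real \<sigma> * q x - wd \<theta> x) / \<tau>)) = (\<lambda>x. (-1) * wd \<theta> x)"
  "(\<lambda>y. \<rho>3 * ((- wd q y - m * (wd \<Phi> y + \<Psi> y)) / \<rho>3) + m * \<Psi> y) = (\<lambda>y. (-1) * wd q y + (- m) * wd \<Phi> y)"
  "(\<lambda>y. \<rho>2 * ((wd (wd (memory_flux b g \<psi> \<eta>)) y - \<kappa> * (wd \<phi> y + \<psi> y) + m * \<theta> y) / \<rho>2) + \<kappa> * (wd \<phi> y + \<psi> y) - m * \<theta> y) =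
   wd (wd (memory_flux b g \<psi> \<eta>))"
  unfolding times_divide_eq_right nonzero_mult_div_cancel_left[OF nz(1)] nonzero_mult_div_cancel_left[OF nz(2)]
   nonzero_mult_div_cancel_left[OF nz(3)] nonzero_mult_div_cancel_left[OF nz(4)] nonzero_mult_div_cancel_left[OF nz(7)]
  by (simp_all add: algebra_simps)
 obtain c1 where c1: "AE x in I. q x = c1 + prim (wd q) x" using H1_D(3)[OF d(7)] by blast
 obtain c2 where c2: "AE x in I. \<Phi> x = c2 + prim (wd \<Phi>) x" using H1_D(3)[OF H1star_D(1)[OF d(3)]] by blast
 obtain c3 where c3: "AE x in I. wd (memory_flux b g \<psi> \<eta>) x = c3 + prim (wd (wd (memory_flux b g \<psi> \<eta>))) x"
  using H1_D(3)[OF d(11)] by blast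
 show ?thesis unfolding Ueq opA_eq Rel_def e_defs c_defs fst_conv snd_conv prod.case f
 proof (intro conjI)
  show "AE x in I. \<alpha> * wd u x - prim (\<lambda>y. \<alpha> * wd (wd u) y) x = 0"
   using H10_D(5)[OF d(4)] by eventually_elim (simp add: prim_mult)
  show "AE x in I. \<kappa> * (wd \<phi> x + \<psi> x) - m * \<theta> x - prim (\<lambda>y. \<kappa> * wd (\<lambda>x. wd \<phi> x + \<psi> x) y - m * wd \<theta> y) x = 0"
   using H10_D(5)[OF d(10)] H10_D(5)[OF d(5)]
  proof eventually_elim
   case (elim x)
   have "prim (\<lambda>y. \<kappa> * wd (\<lambda>x. wd \<phi> x + \<psi> x) y - m * wd \<theta> y) x = \<kappa> * prim (wd (\<lambda>x. wd \<phi> x + \<psi> x)) x - m * prim (wd \<theta>) x"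
    using prim_diff[OF fin.sqi_int[OF sqi_mult'[OF h(2)]] fin.sqi_int[OF sqi_mult'[OF h(3)]]]
    by (simp add: prim_mult)
   then show ?case unfolding elim(1)[symmetric] elim(2)[symmetric] by simp
  qed
  show "AE x in I. \<theta> x + prim (\<lambda>x. (-1) * wd \<theta> x) x = 0"
   using H10_D(5)[OF d(5)] unfolding prim_mult by eventually_elim simp
  show "\<exists>c. AE x in I. q x + m * \<Phi> x + prim (\<lambda>y. (-1) * wd q y + (- m) * wd \<Phi> y) x = c"
  proof
   show "AE x in I. q x + m * \<Phi> x + prim (\<lambda>y. (-1) * wd q y + (- m) * wd \<Phi> y) x = c1 + m * c2"
    using c1 c2
   proof eventually_elim
    case (elim x)
    have p: "prim (\<lambda>y. (-1) * wd q y + (- m) * wd \<Phi> y) x = (-1) * prim (wd q) x + (- m) * prim (wd \<Phi>) x"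
     using prim_add[OF fin.sqi_int[OF sqi_mult'[OF h(5)]] fin.sqi_int[OF sqi_mult'[OF h(6)]]]
     by (simp only: prim_mult)
    show ?case unfolding p by (subst (1) elim(1), subst (1) elim(2)) (simp add: algebra_simps)
   qed
  qed
  show "\<exists>c. AE x in I. bt * wd \<psi> x + meanG (memd \<eta>) x - prim (wd (wd (memory_flux b g \<psi> \<eta>))) x = c"
  proof
   show "AE x in I. bt * wd \<psi> x + meanG (memd \<eta>) x - prim (wd (wd (memory_flux b g \<psi> \<eta>))) x = c3"
    using c3 d(12) by eventually_elim (simp add: algebra_simps)
  qed
  have Z: "memd (s_deriv L g \<eta>) \<in> sqi P" by (rule mem_repD(1)[OF mem_rep_memd[OF d(13)]])
  have F: "memd (\<lambda>s x. \<Psi> x - s_deriv L g \<eta> s x) \<in> sqi P"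
   by (rule mem_repD(1)[OF mem_rep_memd[OF mem_rep_Lg2(1)[OF f9_rep[OF d(6,13)]]]])
  have "AE p in P. wd \<Psi> (snd p) - memd (\<lambda>s x. \<Psi> x - s_deriv L g \<eta> s x) p = memd (s_deriv L g \<eta>) p"
   using memd_eq[OF f9_rep[OF d(6,13)]] by eventually_elim simp
  from J_cong[OF sqi_diff'[OF sqi_snd[OF H10_D(3)[OF d(6)]] F] Z this]
  show "AE p in P. memd \<eta> p - J (\<lambda>p. wd \<Psi> (snd p) - memd (\<lambda>s x. \<Psi> x - s_deriv L g \<eta> s x) p) p = 0"
   using d(14) by eventually_elim simp
  show "(LINT x|I. (-1) * wd \<theta> x) = 0" using H10_D(4)[OF d(5)] by simp
 qed simp_all
qed

text \<open>The energy identity: after integration by parts all coupling terms cancel in pairs, and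
  there remain minus \<open>\<gamma>\<close> times the square of \<open>v\<close>, minus
  \<open>\<sigma>\<close> times the square of \<open>q\<close>, and minus the memory term.\<close>

lemma rS_opA:
 assumes U: "U \<in> D"
 shows "rS (A U) U \<le> 0"
proof -
 obtain u v \<phi> \<Phi> \<psi> \<Psi> \<theta> q \<eta> where Ueq: "U = (u, v, \<phi>, \<Phi>, \<psi>, \<Psi>, \<theta>, q, \<eta>)" by (rule state_cases)
 note d = dom_facts[OF U[unfolded Ueq]] and S = sqi_of[OF dom_facts(1)[OF U[unfolded Ueq]]]
 define a where "a = wd (wd u)"
 define s where "s = (\<lambda>x. wd \<phi> x + \<psi> x)"
 define bb where "bb = (\<lambda>x. \<phi> x - u x)"
 define ch where "ch = wd (memory_flux b g \<psi> \<eta>)"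
 define W where "W = memd \<eta>"
 define Z where "Z = memd (s_deriv L g \<eta>)"
 have h: "a \<in> sqi I" "wd s \<in> sqi I" "wd \<theta> \<in> sqi I" "wd ch \<in> sqi I" "wd q \<in> sqi I" "wd \<Phi> \<in> sqi I" "wd v \<in> sqi I" "wd \<Psi> \<in> sqi I"
  "bb \<in> sqi I" "s \<in> sqi I" "ch \<in> sqi I"
  using H10_D(3)[OF d(4)] H10_D(3)[OF d(10)] H10_D(3)[OF d(5)] H1_D(2)[OF d(11)] H1_D(2)[OF d(7)] H1star_D(3)[OF d(3)]
   H1star_D(3)[OF d(2)] H10_D(3)[OF d(6)] sqi_diff'[OF S(5,2)] H10_D(2)[OF d(10)] H1_D(1)[OF d(11)]
  by (simp_all add: a_def s_def ch_def bb_def)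
 have W: "W \<in> sqi P" using S(15) by (simp add: W_def)
 have Z: "Z \<in> sqi P" unfolding Z_def by (rule mem_repD(1)[OF mem_rep_memd[OF d(13)]])
 note M = meanG_sqi[OF W]
 define f2 where "f2 = (\<lambda>x. (\<alpha> * a x + \<beta> * bb x - \<gamma> * v x) / \<rho>)"
 define f4 where "f4 = (\<lambda>x. (\<kappa> * wd s x - \<beta> * bb x - m * wd \<theta> x) / \<rho>1)"
 define f6 where "f6 = (\<lambda>x. (wd ch x - \<kappa> * s x + m * \<theta> x) / \<rho>2)"
 define f7 where "f7 = (\<lambda>x. (- wd q x - m * (wd \<Phi> x + \<Psi> x)) / \<rho>3)"
 define f8 where "f8 = (\<lambda>x. (- complex_of_real \<sigma> * q x - wd \<theta> x) / \<tau>)"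
 define f9 where "f9 = memd (\<lambda>s x. \<Psi> x - s_deriv L g \<eta> s x)"
 have main: "rS (A U) U = \<rho> * rip I f2 v + \<alpha> * rip I (wd v) (wd u) + \<rho>1 * rip I f4 \<Phi> + \<rho>2 * rip I f6 \<Psi>
   + bt * rip I (wd \<Psi>) (wd \<psi>) + \<beta> * rip I (\<lambda>x. \<Phi> x - v x) bb + \<kappa> * rip I (\<lambda>x. wd \<Phi> x + \<Psi> x) s
   + \<rho>3 * rip I f7 \<theta> + \<tau> * rip I f8 q + rip P f9 W"
  unfolding Ueq opA_eq rS_def c_defs prod.case f2_def f4_def f6_def f7_def f8_def f9_def W_def a_def s_def bb_def ch_def ..
 have E1: "\<rho> * rip I f2 v = \<alpha> * rip I a v + \<beta> * rip I bb v - \<gamma> * rip I v v"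
 proof -
  have "(\<lambda>x. \<rho> * f2 x) = (\<lambda>x. \<alpha> * a x + \<beta> * bb x - \<gamma> * v x)" using nz by (simp add: f2_def)
  then show ?thesis unfolding rip_scale'[symmetric]
   by (simp only: rip_diff'[OF sqi_add'[OF sqi_mult' sqi_mult'] sqi_mult' S(10)] rip_add'[OF sqi_mult' sqi_mult' S(10)] h S)
 qed
 have E2: "\<rho>1 * rip I f4 \<Phi> = \<kappa> * rip I (wd s) \<Phi> - \<beta> * rip I bb \<Phi> - m * rip I (wd \<theta>) \<Phi>"
 proof -
  have "(\<lambda>x. \<rho>1 * f4 x) = (\<lambda>x. \<kappa> * wd s x - \<beta> * bb x - m * wd \<theta> x)" using nz by (simp add: f4_def)
  then show ?thesis unfolding rip_scale'[symmetric]
   by (simp only: rip_diff'[OF sqi_diff'[OF sqi_mult' sqi_mult'] sqi_mult' S(11)] rip_diff'[OF sqi_mult' sqi_mult' S(11)] h S)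
 qed
 have E3: "\<rho>2 * rip I f6 \<Psi> = rip I (wd ch) \<Psi> - \<kappa> * rip I s \<Psi> + m * rip I \<theta> \<Psi>"
 proof -
  have "(\<lambda>x. \<rho>2 * f6 x) = (\<lambda>x. wd ch x - \<kappa> * s x + m * \<theta> x)" using nz by (simp add: f6_def)
  then show ?thesis unfolding rip_scale'[symmetric]
   by (simp only: rip_add'[OF sqi_diff'[OF _ sqi_mult'] sqi_mult' S(12)] rip_diff'[OF _ sqi_mult' S(12)] h S)
 qed
 have E4: "\<rho>3 * rip I f7 \<theta> = - rip I (wd q) \<theta> - m * rip I (wd \<Phi>) \<theta> - m * rip I \<Psi> \<theta>"
 proof -
  have "(\<lambda>x. \<rho>3 * f7 x) = (\<lambda>x. (- wd q x - m * wd \<Phi> x) - m * \<Psi> x)" using nz by (simp add: f7_def) (simp add: algebra_simps)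
  then show ?thesis unfolding rip_scale'[symmetric]
   by (simp only: rip_diff'[OF sqi_diff'[OF sqi_uminus' sqi_mult'] sqi_mult' S(13)] rip_diff'[OF sqi_uminus' sqi_mult' S(13)]
     rip_uminus' h S)
 qed
 have E5: "\<tau> * rip I f8 q = - \<sigma> * rip I q q - rip I (wd \<theta>) q"
 proof -
  have "(\<lambda>x. \<tau> * f8 x) = (\<lambda>x. complex_of_real (- \<sigma>) * q x - wd \<theta> x)" using nz by (simp add: f8_def)
  then show ?thesis unfolding rip_scale'[symmetric] by (simp only: rip_diff'[OF sqi_mult' _ S(14)] h S)
 qed
 have E6: "rip I (\<lambda>x. \<Phi> x - v x) bb = rip I \<Phi> bb - rip I v bb" by (rule rip_diff'[OF S(11,10) h(9)])
 have E7: "rip I (\<lambda>x. wd \<Phi> x + \<Psi> x) s = rip I (wd \<Phi>) s + rip I \<Psi> s" by (rule rip_add'[OF h(6) S(12) h(10)])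
 have E8: "rip P f9 W = rip I (meanG W) (wd \<Psi>) - rip P Z W"
 proof -
  note k = sqi_snd[OF h(8)]
  have "rip P f9 W = rip P (\<lambda>p. wd \<Psi> (snd p) - Z p) W" unfolding f9_def Z_def
   by (rule rip_cong[OF mem_repD(1)[OF mem_rep_memd[OF mem_rep_Lg2(1)[OF f9_rep[OF d(6,13)]]]] W
      sqi_diff'[OF k Z[unfolded Z_def]] W memd_eq[OF f9_rep[OF d(6,13)]]]) simp
  also have "\<dots> = rip P W (\<lambda>p. wd \<Psi> (snd p)) - rip P Z W" using rip_diff'[OF k Z W] by (simp add: rip_sym)
  finally show ?thesis unfolding rip_meanG[OF W h(8)] .
 qed
 have B1: "rip I (wd v) (wd u) = - rip I a v"
  using integration_by_parts[OF H1star_D(1)[OF d(2)] d(4)] by (simp add: a_def rip_sym)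
 have B2: "rip I (wd \<Phi>) s = - rip I (wd s) \<Phi>"
  using integration_by_parts[OF H1star_D(1)[OF d(3)] d(10)] by (simp add: s_def rip_sym)
 have B3: "rip I (wd ch) \<Psi> = - (bt * rip I (wd \<Psi>) (wd \<psi>)) - rip I (meanG W) (wd \<Psi>)"
 proof -
  have "rip I ch (wd \<Psi>) = rip I (\<lambda>x. bt * wd \<psi> x + meanG W x) (wd \<Psi>)"
   by (rule rip_cong[OF h(11,8) sqi_add'[OF sqi_mult'[OF S(9)] M] h(8)]) (use d(12) in \<open>simp_all add: ch_def W_def\<close>)
  also have "\<dots> = bt * rip I (wd \<Psi>) (wd \<psi>) + rip I (meanG W) (wd \<Psi>)"
   using rip_add'[OF sqi_mult'[OF S(9)] M h(8)] by (simp add: rip_scale' rip_sym[of I "wd \<Psi>"])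
  finally show ?thesis using integration_by_parts[OF d(11,6)] by (simp add: ch_def)
 qed
 have B4: "rip I (wd q) \<theta> = - rip I (wd \<theta>) q"
  using integration_by_parts[OF d(7,5)] by (simp add: rip_sym)
 have B5: "rip I (wd \<Phi>) \<theta> = - rip I (wd \<theta>) \<Phi>"
  using integration_by_parts[OF H1star_D(1)[OF d(3)] d(5)] by (simp add: rip_sym)
 \<comment> \<open>Zero initial value of the history makes its joint derivative the integral of that
   of \<open>s_deriv\<close>, so \<open>rip_J_nonneg\<close> applies.\<close>
 have "rip P Z W = rip P Z (J Z)"
  by (rule rip_cong[OF Z W Z J_sqi[OF Z]]) (use d(14) in \<open>simp_all add: W_def Z_def\<close>)
 then have Q: "0 \<le> rip P Z W" using rip_J_nonneg[OF Z] by simp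
 have sy: "rip I \<Phi> bb = rip I bb \<Phi>" "rip I v bb = rip I bb v" "rip I \<Psi> s = rip I s \<Psi>" "rip I \<Psi> \<theta> = rip I \<theta> \<Psi>"
  by (rule rip_sym)+
 have "rS (A U) U = - (\<gamma> * rip I v v) - \<sigma> * rip I q q - rip P Z W"
  unfolding main E1 E2 E3 E4 E5 E6 E7 E8 B1 B2 B3 B4 B5 sy by (simp add: algebra_simps)
 also have "\<dots> \<le> 0"
 proof -
  have "0 \<le> \<gamma> * rip I v v" "0 \<le> \<sigma> * rip I q q" using cpos by (simp_all add: rip_self)
  then show ?thesis using Q by linarith
 qed
 finally show ?thesis .
qed

end

section \<open>Solving the stationary equation\<close>

context porous
begin

lemma state_minus: "(u, v, \<phi>, \<Phi>, \<psi>, \<Psi>, \<theta>, q, \<eta>) - (u', v', \<phi>', \<Phi>', \<psi>', \<Psi>', \<theta>', q', \<eta>') =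
  ((\<lambda>x. u x - u' x), (\<lambda>x. v x - v' x), (\<lambda>x. \<phi> x - \<phi>' x), (\<lambda>x. \<Phi> x - \<Phi>' x), (\<lambda>x. \<psi> x - \<psi>' x),
  (\<lambda>x. \<Psi> x - \<Psi>' x), (\<lambda>x. \<theta> x - \<theta>' x), (\<lambda>x. q x - q' x), (\<lambda>s x. \<eta> s x - \<eta>' s x))"
 for u v \<phi> \<Phi> \<psi> \<Psi> \<theta> q :: fld and \<eta> \<eta>' :: "real => fld"
 by (simp add: fun_eq_iff)

text \<open>The converse of \<open>Rel_opA\<close>. Each integrated equation presents a component,
  or a combination of components, as a primitive; regularity, boundary values and the derivative
  occurring in the operator are read off together.\<close>

lemma Rel_imp_graph:
 assumes UX: "U \<in> X" and FX: "F \<in> X" and R: "Rel (U, F)"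
 shows "U \<in> D \<and> N (A U - F) = 0"
proof -
 obtain u v \<phi> \<Phi> \<psi> \<Psi> \<theta> q \<eta> where Ueq: "U = (u, v, \<phi>, \<Phi>, \<psi>, \<Psi>, \<theta>, q, \<eta>)" by (rule state_cases)
 obtain f1 f2 f3 f4 f5 f6 f7 f8 f9 where Feq: "F = (f1, f2, f3, f4, f5, f6, f7, f8, f9)" by (rule state_cases)
 note UX' = UX[unfolded Ueq] and FX' = FX[unfolded Feq]
 note S = sqi_of[OF UX'] and T = sqi_of[OF FX']
 have H: "u \<in> H1star L" "\<phi> \<in> H1star L" "\<psi> \<in> H10 L" "\<eta> \<in> Lg2 L g" "f1 \<in> H1star L" "f3 \<in> H1star L" "f5 \<in> H10 L" "f9 \<in> Lg2 L g"
  using UX' FX' unfolding phase_iff by auto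
 note R' = R[unfolded Rel_def e_defs c_defs Ueq Feq fst_conv snd_conv prod.case]
 have r1: "AE x in I. v x = f1 x" and r2: "AE x in I. \<Phi> x = f3 x" and r3: "AE x in I. \<Psi> x = f5 x"
  and r4: "AE x in I. \<alpha> * wd u x - prim (\<lambda>y. \<rho> * f2 y + \<gamma> * v y - \<beta> * (\<phi> y - u y)) x = 0"
  and r5: "AE x in I. \<kappa> * (wd \<phi> x + \<psi> x) - m * \<theta> x - prim (\<lambda>y. \<rho>1 * f4 y + \<beta> * (\<phi> y - u y)) x = 0"
  and r6: "AE x in I. \<theta> x + prim (\<lambda>x. \<sigma> * q x + \<tau> * f8 x) x = 0"
  and r7: "\<exists>c. AE x in I. q x + m * \<Phi> x + prim (\<lambda>y. \<rho>3 * f7 y + m * \<Psi> y) x = c"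
  and r8: "\<exists>c. AE x in I. bt * wd \<psi> x + meanG (memd \<eta>) x - prim (\<lambda>y. \<rho>2 * f6 y + \<kappa> * (wd \<phi> y + \<psi> y) - m * \<theta> y) x = c"
  and r9: "AE p in P. memd \<eta> p - J (\<lambda>p. wd f5 (snd p) - memd f9 p) p = 0"
  and r0: "(LINT x|I. \<sigma> * q x + \<tau> * f8 x) = 0" using R' by simp_all
 have v: "v \<in> H1star L" by (rule H1star_cong[OF H(5) S(10) r1])
 have \<Phi>: "\<Phi> \<in> H1star L" by (rule H1star_cong[OF H(6) S(11) r2])
 have \<Psi>: "\<Psi> \<in> H10 L" by (rule H10_cong[OF H(7) S(12) r3])
 have w5: "AE x in I. wd \<Psi> x = wd f5 x" by (rule H1_cong(2)[OF H10_D(1)[OF H(7)] S(12) r3])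
 define a where "a = (\<lambda>y. complex_of_real (1 / \<alpha>) * (\<rho> * f2 y + \<gamma> * v y - \<beta> * (\<phi> y - u y)))"
 have a: "a \<in> sqi I" "(LINT x|I. a x) = 0" unfolding a_def
  by (intro sqi_ops S T) (use S T S(2,5,10)[THEN fin.sqi_int] fin.sqi_int[OF T(10)] in simp)
 have "AE x in I. wd u x = prim a x" using r4
 proof eventually_elim
  case (elim x)
  have "prim a x = complex_of_real (1 / \<alpha>) * (\<alpha> * wd u x)" unfolding a_def prim_mult using elim by simp
  then show ?case using nz by simp
 qed
 from H10_I[OF S(3) a this] have u: "wd u \<in> H10 L" and wwu: "AE x in I. wd (wd u) x = a x" by auto
 define t where "t = (\<lambda>x. (-1) * (\<sigma> * q x + \<tau> * f8 x))"
 have t: "t \<in> sqi I" "(LINT x|I. t x) = 0"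
  unfolding t_def integral_mult_right_zero r0 by (intro sqi_ops S T) simp
 have "AE x in I. \<theta> x = prim t x"
  using r6 unfolding t_def prim_mult by eventually_elim (simp add: add_eq_0_iff)
 from H10_I[OF S(13) t this] have \<theta>: "\<theta> \<in> H10 L" and w\<theta>: "AE x in I. wd \<theta> x = t x" by auto
 define s where "s = (\<lambda>x. wd \<phi> x + \<psi> x)"
 define d where "d = (\<lambda>y. complex_of_real (1 / \<kappa>) * ((\<rho>1 * f4 y + \<beta> * (\<phi> y - u y)) + m * wd \<theta> y))"
 have s: "s \<in> sqi I" unfolding s_def by (intro sqi_ops S)
 note wt = H10_D(3,4,5)[OF \<theta>]
 have d: "d \<in> sqi I" "(LINT x|I. d x) = 0" unfolding d_def
  by (intro sqi_ops S T wt) (use S T wt(2) S(2,5)[THEN fin.sqi_int] fin.sqi_int[OF wt(1)] fin.sqi_int[OF T(11)] in simp)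
 have "AE x in I. s x = prim d x" using r5 wt(3)
 proof eventually_elim
  case (elim x)
  have k: "(\<lambda>y. \<rho>1 * f4 y + \<beta> * (\<phi> y - u y)) \<in> sqi I" by (intro sqi_ops S T)
  have "prim d x = complex_of_real (1 / \<kappa>) * (prim (\<lambda>y. \<rho>1 * f4 y + \<beta> * (\<phi> y - u y)) x + m * prim (wd \<theta>) x)"
   unfolding d_def prim_mult prim_add[OF fin.sqi_int[OF k] fin.sqi_int[OF sqi_mult'[OF wt(1)]]] ..
  also have "\<dots> = complex_of_real (1 / \<kappa>) * (\<kappa> * s x)" using elim by (simp add: s_def algebra_simps)
  finally show ?case using nz by simp
 qed
 from H10_I[OF s d this] have sH: "s \<in> H10 L" and ws: "AE x in I. wd s x = d x" by auto
 \<comment> \<open>The equation controls only the sum \<open>s\<close>; membership of the derivative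
   of \<open>\<phi>\<close> follows because \<open>\<psi>\<close> itself is in
   \<open>H10\<close>.\<close>
 have \<phi>: "wd \<phi> \<in> H10 L" using H10_add[OF sH H10_mult[OF H(3), of "-1"]] by (simp add: s_def)
 define k where "k = (\<lambda>y. \<rho>3 * f7 y + m * \<Psi> y)"
 have k: "k \<in> sqi I" unfolding k_def by (intro sqi_ops S T)
 obtain c where c: "AE x in I. q x + m * \<Phi> x + prim k x = c" using r7 unfolding k_def by blast
 obtain c' where c': "AE x in I. \<Phi> x = c' + prim (wd \<Phi>) x" using H1_D(3)[OF H1star_D(1)[OF \<Phi>]] by blast
 have w\<Phi>: "wd \<Phi> \<in> sqi I" by (rule H1star_D(3)[OF \<Phi>])
 have "AE x in I. q x = (c - m * c') + prim (\<lambda>x. (- m) * wd \<Phi> x + (-1) * k x) x" using c c'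
 proof eventually_elim
  case (elim x)
  have "prim (\<lambda>x. (- m) * wd \<Phi> x + (-1) * k x) x = (- m) * prim (wd \<Phi>) x + (-1) * prim k x"
   using prim_add[OF fin.sqi_int[OF sqi_mult'[OF w\<Phi>]] fin.sqi_int[OF sqi_mult'[OF k]]] by (simp only: prim_mult)
  moreover have "prim k x = c - q x - m * (c' + prim (wd \<Phi>) x)" using elim by (simp add: algebra_simps)
  ultimately show ?case by (simp add: algebra_simps)
 qed
 from H1_I[OF S(14) sqi_add'[OF sqi_mult'[OF w\<Phi>] sqi_mult'[OF k]] this]
 have q: "q \<in> H1 L" and wq: "AE x in I. wd q x = (- m) * wd \<Phi> x + (-1) * k x" by auto
 define l where "l = (\<lambda>y. \<rho>2 * f6 y + \<kappa> * (wd \<phi> y + \<psi> y) - m * \<theta> y)"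
 have l: "l \<in> sqi I" unfolding l_def by (intro sqi_ops S T)
 note fl = memory_flux_wd[OF H(3,4)]
 obtain c3 where c3: "AE x in I. bt * wd \<psi> x + meanG (memd \<eta>) x - prim l x = c3" using r8 unfolding l_def by blast
 have "AE x in I. wd (memory_flux b g \<psi> \<eta>) x = c3 + prim l x"
  using fl(2) c3 by eventually_elim (simp add: algebra_simps)
 from H1_I[OF H1_D(2)[OF fl(1)] l this]
 have ch: "memory_flux b g \<psi> \<eta> \<in> H2 L" and wch: "AE x in I. wd (wd (memory_flux b g \<psi> \<eta>)) x = l x"
  using fl(1) by (auto simp: H2_def)
 have w5s: "wd \<Psi> \<in> sqi I" by (rule H10_D(3)[OF \<Psi>])
 have M9: "memd f9 \<in> sqi P" by (rule mem_repD(1)[OF mem_rep_memd[OF H(8)]])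
 define Z where "Z = (\<lambda>p. wd \<Psi> (snd p) - memd f9 p)"
 have Z: "Z \<in> sqi P" unfolding Z_def by (rule sqi_diff'[OF sqi_snd[OF w5s] M9])
 have JZ: "AE p in P. memd \<eta> p = J Z p"
 proof -
  have "AE p in P. J (\<lambda>p. wd f5 (snd p) - memd f9 p) p = J Z p"
  proof (rule J_cong[OF sqi_diff'[OF sqi_snd[OF H10_D(3)[OF H(7)]] M9] Z])
   show "AE p in P. wd f5 (snd p) - memd f9 p = Z p" using AE_snd[OF w5] by eventually_elim (simp add: Z_def)
  qed
  then show ?thesis using r9 by eventually_elim simp
 qed
 note repZ = f9_rep[OF \<Psi> H(8), folded Z_def]
 have sd: "has_s_deriv L g \<eta> (\<lambda>s x. \<Psi> x - f9 s x) 0"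
  unfolding has_s_deriv_zero_iff[OF mem_rep_memd[OF H(4)] repZ] by (rule JZ)
 note zl = mem_rep_Lg2(1)[OF repZ]
 have dom: "(u, v, \<phi>, \<Phi>, \<psi>, \<Psi>, \<theta>, q, \<eta>) \<in> D"
  unfolding dom_iff using UX' v \<Phi> u \<phi> \<theta> \<Psi> ch q sd zl by blast
 note facts = dom_facts[OF dom]
 define Y where "Y = memd (s_deriv L g \<eta>)"
 have Y: "Y \<in> sqi P" unfolding Y_def by (rule mem_repD(1)[OF mem_rep_memd[OF facts(13)]])
 \<comment> \<open>The derivative selected by \<open>s_deriv\<close> agrees with the constructed
   one, since both integrate to the joint derivative of the history.\<close>
 have YZ: "AE p in P. Y p = Z p"
 proof (rule s_deriv_unique[OF Y Z, of "\<lambda>_. 0"])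
  have "AE p in P. J Y p = J Z p" using JZ facts(14) unfolding Y_def by eventually_elim simp
  then show "AE s in G. AE x in I. sl (J Y) s x = 0 + sl (J Z) s x"
   unfolding AE_P_eq[OF J_meas[OF sqiD(1)[OF Y]] J_meas[OF sqiD(1)[OF Z]]] by simp
 qed simp
 have "A U - F \<in> X" by (rule X_diff[OF opA_X[OF dom[folded Ueq]] FX])
 note AF = this[unfolded Ueq Feq opA_eq state_minus]
 have "N (A U - F) = 0" unfolding Ueq Feq opA_eq state_minus
 proof (rule N_zero[OF AF])
  show "AE x in I. v x - f1 x = 0" using r1 by eventually_elim simp
  show "AE x in I. \<Phi> x - f3 x = 0" using r2 by eventually_elim simp
  show "AE x in I. \<Psi> x - f5 x = 0" using r3 by eventually_elim simp
  show "AE x in I. (\<alpha> * wd (wd u) x + \<beta> * (\<phi> x - u x) - \<gamma> * v x) / \<rho> - f2 x = 0"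
   using wwu
  proof eventually_elim
   case (elim x)
   have "\<alpha> * wd (wd u) x = \<rho> * f2 x + \<gamma> * v x - \<beta> * (\<phi> x - u x)" using nz unfolding elim a_def by simp
   then show ?case using nz by simp
  qed
  show "AE x in I. (\<kappa> * wd (\<lambda>x. wd \<phi> x + \<psi> x) x - \<beta> * (\<phi> x - u x) - m * wd \<theta> x) / \<rho>1 - f4 x = 0"
   using ws unfolding s_def
  proof eventually_elim
   case (elim x)
   have "\<kappa> * wd (\<lambda>x. wd \<phi> x + \<psi> x) x = \<rho>1 * f4 x + \<beta> * (\<phi> x - u x) + m * wd \<theta> x"
    using nz unfolding elim d_def by simp
   then show ?case using nz by simp
  qed
  show "AE x in I. (wd (wd (memory_flux b g \<psi> \<eta>)) x - \<kappa> * (wd \<phi> x + \<psi> x) + m * \<theta> x) / \<rho>2 - f6 x = 0"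
   using wch
  proof eventually_elim
   case (elim x)
   show ?case using nz unfolding elim l_def by simp
  qed
  show "AE x in I. (- wd q x - m * (wd \<Phi> x + \<Psi> x)) / \<rho>3 - f7 x = 0" using wq
  proof eventually_elim
   case (elim x)
   have "- wd q x - m * (wd \<Phi> x + \<Psi> x) = \<rho>3 * f7 x" unfolding elim k_def by (simp add: algebra_simps)
   then show ?case using nz by simp
  qed
  show "AE x in I. (- complex_of_real \<sigma> * q x - wd \<theta> x) / \<tau> - f8 x = 0" using w\<theta>
  proof eventually_elim
   case (elim x)
   show ?case using nz unfolding elim t_def by simp
  qed
  show "AE p in P. memd (\<lambda>s x. \<Psi> x - s_deriv L g \<eta> s x - f9 s x) p = 0"
   using memd_eq[OF mem_rep_diff[OF f9_rep[OF \<Psi> facts(13)] mem_rep_memd[OF H(8)]]] YZ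
   by eventually_elim (simp add: Y_def Z_def)
 qed
 then show ?thesis using dom by (simp add: Ueq)
qed

lemma rip_null: "AE x in M. f x = 0 ==> rip M f h = 0"
 unfolding rip_def by (intro integral_eq_zero_AE) (auto elim: eventually_mono)

lemma rip_const:
 assumes d: "d \<in> sqi I"
 shows "rip I d (\<lambda>_. c) = inner (LINT x|I. d x) c" unfolding rip_def using fin.sqi_int[OF d] by simp

lemma rip_mprim:
 assumes d: "d \<in> sqi I" and k: "k \<in> sqi I" "(LINT x|I. k x) = 0"
 shows "rip I (mprim d) k = - rip I d (prim k)"
proof -
 let ?c = "(LINT y|I. prim d y) / complex_of_real L"
 have "rip I (mprim d) k = rip I (prim d) k - rip I (\<lambda>_. ?c) k"
  unfolding mprim_def[abs_def] by (rule rip_diff'[OF prim_sqi[OF d] _ k(1)]) simp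
 moreover have "rip I (\<lambda>_. ?c) k = 0" using rip_const[OF k(1)] k(2) by (simp add: rip_sym[of I "\<lambda>_. ?c"])
 ultimately show ?thesis using rip_prim[OF d k] by simp
qed

lemma rip_all_zero:
 assumes "h \<in> sqi M" "rip M h h = 0"
 shows "AE x in M. h x = 0" using assms by (intro l2n_zero_AE) (auto simp: rip_self)

text \<open>The residual \<open>C - prim K\<close> is itself an admissible derivative, that of its
  \<open>mprim\<close>; testing with it shows that its norm is 0.\<close>

lemma prim_weak:
 assumes C: "C \<in> sqi I" and K: "K \<in> sqi I" "(LINT x|I. K x) = 0"
  and w: "!!d. d \<in> sqi I ==> rip I (wd (mprim d)) C = - rip I (mprim d) K"
 shows "AE x in I. C x - prim K x = 0"
proof -
 let ?h = "\<lambda>x. C x - prim K x"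
 have h: "?h \<in> sqi I" by (intro sqi_diff' C prim_sqi K)
 note mp = H1star_mprim[OF h]
 have "rip I ?h C = rip I (wd (mprim ?h)) C"
  by (rule rip_cong[OF h C H1star_D(3)[OF mp(1)] C]) (use mp(2) in \<open>auto elim: eventually_mono\<close>)
 then have "rip I ?h ?h = 0" using rip_diff_right'[OF C prim_sqi[OF K(1)] h] w[OF h] rip_mprim[OF h K] by simp
 from rip_all_zero[OF h this] show ?thesis .
qed

text \<open>Here test functions vanish at both ends and their derivatives have mean zero, so only
  the residual minus its mean can be tested; a constant remains.\<close>

lemma prim_weak_const:
 assumes C: "C \<in> sqi I" and K: "K \<in> sqi I"
  and w: "!!d. d \<in> sqi I ==> (LINT x|I. d x) = 0 ==> rip I (wd (prim d)) C = - rip I (prim d) K"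
 shows "\<exists>c. AE x in I. C x - prim K x = c"
proof -
 let ?h = "\<lambda>x. C x - prim K x"
 have h: "?h \<in> sqi I" by (intro sqi_diff' C prim_sqi K)
 define c where "c = (LINT x|I. ?h x) / complex_of_real L"
 let ?d = "\<lambda>x. ?h x - c"
 have d: "?d \<in> sqi I" by (rule sqi_diff'[OF h]) simp
 have d0: "(LINT x|I. ?d x) = 0"
 proof -
  have "(LINT x|I. ?d x) = (LINT x|I. ?h x) - (LINT x|I. c)"
   by (rule Bochner_Integration.integral_diff[OF fin.sqi_int[OF h]]) simp
  then show ?thesis using L_pos by (simp add: c_def scaleR_conv_of_real)
 qed
 note mp = H10_prim[OF d d0]
 have "rip I ?d C = rip I (wd (prim ?d)) C"
  by (rule rip_cong[OF d C H10_D(3)[OF mp(1)] C]) (use mp(2) in \<open>auto elim: eventually_mono\<close>)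
 then have "rip I ?d ?h = 0"
  using rip_diff_right'[OF C prim_sqi[OF K] d] w[OF d d0] rip_prim[OF K d d0] by (simp add: rip_sym)
 then have "rip I ?d ?d = 0" using rip_diff_right'[OF h fin.const_sqi d, of c] rip_const[OF d, of c] d0 by simp
 from rip_all_zero[OF d this] have "AE x in I. ?h x = c" by eventually_elim simp
 then show ?thesis ..
qed

definition blf :: "(state => real) => bool" where
 "blf l \<longleftrightarrow> (\<forall>x\<in>X. \<forall>y\<in>X. l (x + y) = l x + l y) \<and> (\<forall>x\<in>X. \<forall>c. l (complex_of_real c *\<^sub>C x) = c * l x) \<and>
   (\<exists>C. \<forall>x\<in>X. \<bar>l x\<bar> \<le> C * sqrt (rS x x))"

lemma blf_add:
 assumes "blf l" "blf l'"
 shows "blf (\<lambda>x. l x + l' x)"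
proof -
 obtain C C' where "\<forall>x\<in>X. \<bar>l x\<bar> \<le> C * sqrt (rS x x)" "\<forall>x\<in>X. \<bar>l' x\<bar> \<le> C' * sqrt (rS x x)"
  using assms unfolding blf_def by blast
 note C = bspec[OF this(1)] bspec[OF this(2)]
 have "\<bar>l x + l' x\<bar> \<le> (C + C') * sqrt (rS x x)" if "x \<in> X" for x
  using C(1)[OF that] C(2)[OF that] unfolding distrib_right by linarith
 then have "\<exists>C. \<forall>x\<in>X. \<bar>l x + l' x\<bar> \<le> C * sqrt (rS x x)" by blast
 then show ?thesis using assms unfolding blf_def by (simp add: distrib_left)
qed

lemma blf_mult:
 assumes "blf l"
 shows "blf (\<lambda>x. k * l x)"
proof -
 obtain C where "\<forall>x\<in>X. \<bar>l x\<bar> \<le> C * sqrt (rS x x)" using assms unfolding blf_def by blast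
 note C = bspec[OF this]
 have "\<bar>k * l x\<bar> \<le> (\<bar>k\<bar> * C) * sqrt (rS x x)" if "x \<in> X" for x
  using mult_left_mono[OF C[OF that], of "\<bar>k\<bar>"] by (simp add: abs_mult mult.assoc)
 then have "\<exists>C. \<forall>x\<in>X. \<bar>k * l x\<bar> \<le> C * sqrt (rS x x)" by blast
 then show ?thesis using assms unfolding blf_def by (simp add: distrib_left)
qed

lemma blf_rip:
 assumes c: "coord I X c" and k: "k \<in> sqi I" and b: "!!x. x \<in> X ==> l2n I (c x) \<le> C * sqrt (rS x x)"
 shows "blf (\<lambda>x. rip I k (c x))" unfolding blf_def
proof (intro conjI ballI allI exI)
 note C = coordD[OF c]
 show "rip I k (c (x + y)) = rip I k (c x) + rip I k (c y)" if "x \<in> X" "y \<in> X" for x y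
  unfolding rip_add_right'[OF C(1)[OF that(1)] C(1)[OF that(2)] k, symmetric]
  by (rule rip_cong[OF k C(1)[OF X_add[OF that]] k sqi_add'[OF C(1)[OF that(1)] C(1)[OF that(2)]] _ C(2)[OF that]]) simp
 show "rip I k (c (complex_of_real a *\<^sub>C x)) = a * rip I k (c x)" if "x \<in> X" for x a
  unfolding rip_scale_right'[symmetric]
  by (rule rip_cong[OF k C(1)[OF X_scale[OF that]] k sqi_mult'[OF C(1)[OF that]] _ C(3)[OF that]]) simp
 show "\<bar>rip I k (c x)\<bar> \<le> (l2n I k * C) * sqrt (rS x x)" if "x \<in> X" for x
  using rip_bound[OF k C(1)[OF that]] mult_left_mono[OF b[OF that] l2n_ge0[of I k]] by (simp add: mult.assoc)
qed

lemma coord_bound: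
 assumes "w > 0" "w * (l2n I f)\<^sup>2 \<le> r"
 shows "l2n I f \<le> (1 / sqrt w) * sqrt r"
proof -
 have "sqrt w * l2n I f \<le> sqrt r" using real_sqrt_le_mono[OF assms(2)] by (simp add: real_sqrt_mult)
 then show ?thesis using assms(1) by (simp add: field_simps)
qed

lemma p_bounds:
 assumes U: "U \<in> X"
 shows "l2n I (pu U) \<le> (2 * L / sqrt \<alpha>) * sqrt (rS U U)" "l2n I (pp U) \<le> (L / sqrt bt) * sqrt (rS U U)"
  "l2n I (pf U) \<le> (1 / sqrt \<beta> + 2 * L / sqrt \<alpha>) * sqrt (rS U U)"
proof -
 obtain u v \<phi> \<Phi> \<psi> \<Psi> \<theta> q \<eta> where Ueq: "U = (u, v, \<phi>, \<Phi>, \<psi>, \<Psi>, \<theta>, q, \<eta>)" by (rule state_cases)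
 have H: "u \<in> H1star L" "\<psi> \<in> H10 L" using U unfolding Ueq phase_iff by auto
 have "l2n I (pu U) \<le> 2 * L * l2n I (cu U)" using poincare_H1star[OF H(1)] by (simp add: Ueq c_defs)
 also have "\<dots> \<le> 2 * L * ((1 / sqrt \<alpha>) * sqrt (rS U U))"
  using coord_bound[OF cpos(5) rS_terms(2)] L_pos by (intro mult_left_mono) auto
 finally show u: "l2n I (pu U) \<le> (2 * L / sqrt \<alpha>) * sqrt (rS U U)" by simp
 have "l2n I (pp U) \<le> L * l2n I (cp U)" using poincare_H10[OF H(2)] by (simp add: Ueq c_defs)
 also have "\<dots> \<le> L * ((1 / sqrt bt) * sqrt (rS U U))"
  using coord_bound[OF bt_pos rS_terms(5)] L_pos by (intro mult_left_mono) auto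
 finally show "l2n I (pp U) \<le> (L / sqrt bt) * sqrt (rS U U)" by simp
 have "pf U = (\<lambda>x. cb U x + pu U x)" by (simp add: Ueq c_defs)
 then have "l2n I (pf U) \<le> l2n I (cb U) + l2n I (pu U)"
  using l2n_triangle[OF coordD(1)[OF coord_c(6) U] coordD(1)[OF coord_c(11) U]] by simp
 then show "l2n I (pf U) \<le> (1 / sqrt \<beta> + 2 * L / sqrt \<alpha>) * sqrt (rS U U)"
  using coord_bound[OF cpos(9) rS_terms(6)[of U]] u unfolding distrib_right by linarith
qed

text \<open>The elliptic problem for \<open>(u, \<phi>, \<psi>)\<close> left over from \<open>A U = F\<close>, solved in weak form by the Riesz
 representation of its right-hand side.\<close>

lemma elliptic:
 assumes A1: "A1 \<in> sqi I" "(LINT x|I. A1 x) = 0" and A2: "A2 \<in> sqi I" "(LINT x|I. A2 x) = 0"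
  and A3: "A3 \<in> sqi I" and B: "B \<in> sqi I" and M: "M \<in> sqi I"
 obtains w where "w \<in> X" "AE x in I. \<alpha> * cu w x - prim (\<lambda>y. A1 y - \<beta> * cb w y) x = 0"
  "AE x in I. \<kappa> * ck w x - B x - prim (\<lambda>y. A2 y + \<beta> * cb w y) x = 0"
  "\<exists>c. AE x in I. bt * cp w x + M x - prim (\<lambda>y. A3 y + \<kappa> * ck w y) x = c"
proof -
 interpret H: semi_hilbert X rS by (rule semi_hilbert_phase)
 \<comment> \<open>The two terms in \<open>B\<close> together pair \<open>B\<close> with the
   derivative of \<open>\<phi>\<close>. They are written separately because \<open>ck\<close> and
   \<open>pp\<close> are bounded directly by the energy.\<close>
 define l where "l x = (-1) * rip I A1 (pu x) + (-1) * rip I A2 (pf x) + rip I B (ck x) + (-1) * rip I B (pp x)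
  + (-1) * rip I A3 (pp x) + (-1) * rip I M (cp x)" for x
 have l: "blf l" unfolding l_def[abs_def]
  by (intro blf_add blf_mult blf_rip[OF coord_c(11) A1(1) p_bounds(1)] blf_rip[OF coord_c(12) A2(1) p_bounds(3)]
    blf_rip[OF coord_c(7) B coord_bound[OF cpos(6) rS_terms(7)]] blf_rip[OF coord_c(13) B p_bounds(2)]
    blf_rip[OF coord_c(13) A3 p_bounds(2)] blf_rip[OF coord_c(5) M coord_bound[OF bt_pos rS_terms(5)]])
 then obtain C where "\<forall>x\<in>X. \<bar>l x\<bar> \<le> C * sqrt (rS x x)" unfolding blf_def by blast
 note C = bspec[OF this]
 obtain w where w: "w \<in> X" "!!x. x \<in> X ==> rS x w = l x"
 proof (rule H.riesz[of X l C])
  show "l (x + y) = l x + l y" if "x \<in> X" "y \<in> X" for x y using l that unfolding blf_def by blast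
  show "l (complex_of_real c *\<^sub>C x) = c * l x" if "x \<in> X" for x c using l that unfolding blf_def by blast
  show "\<bar>l x\<bar> \<le> C * H.nrm x" if "x \<in> X" for x using C[OF that] by (simp add: H.nrm_def)
 qed (use X_zero X_add X_scale in auto)
 note S = coordD(1)[OF coord_c(2) w(1)] coordD(1)[OF coord_c(5) w(1)] coordD(1)[OF coord_c(6) w(1)] coordD(1)[OF coord_c(7) w(1)]
 have cb0: "(LINT x|I. cb w x) = 0"
 proof -
  obtain u v \<phi> \<Phi> \<psi> \<Psi> \<theta> q \<eta> where weq: "w = (u, v, \<phi>, \<Phi>, \<psi>, \<Psi>, \<theta>, q, \<eta>)" by (rule state_cases)
  note T = sqi_of[OF w(1)[unfolded weq]]
  show ?thesis using T(16,18) T(2,5)[THEN fin.sqi_int] by (simp add: weq c_defs)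
 qed
 let ?z = "\<lambda>_. 0 :: complex"
 \<comment> \<open>Test states live in the three displacement components, where \<open>rS\<close>
   reduces to the bilinear form of the elliptic problem.\<close>
 have test: "(u, ?z, \<phi>, ?z, \<psi>, ?z, ?z, ?z, (\<lambda>_ _. 0)) \<in> X"
  "rS (u, ?z, \<phi>, ?z, \<psi>, ?z, ?z, ?z, (\<lambda>_ _. 0)) w = \<alpha> * rip I (wd u) (cu w) + bt * rip I (wd \<psi>) (cp w)
   + \<beta> * rip I (\<lambda>x. \<phi> x - u x) (cb w) + \<kappa> * rip I (\<lambda>x. wd \<phi> x + \<psi> x) (ck w)"
  if "u \<in> H1star L" "\<phi> \<in> H1star L" "\<psi> \<in> H10 L" for u \<phi> \<psi>
 proof -
  have r: "mem_rep (\<lambda>s x. primP (\<lambda>_. 0) (s, x)) (\<lambda>_. 0)" by (intro mem_rep_primP) (simp_all add: sl_def)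
  then have r: "mem_rep (\<lambda>_ _. 0) (\<lambda>_. 0)" by (simp add: primP_def prim_def sl_def)
  show "(u, ?z, \<phi>, ?z, \<psi>, ?z, ?z, ?z, (\<lambda>_ _. 0)) \<in> X"
   unfolding phase_iff using that mem_rep_Lg2(1)[OF r] by (simp add: L2star_iff)
  have "rip I ?z h = 0" for h by (rule rip_null) simp
  then show "rS (u, ?z, \<phi>, ?z, \<psi>, ?z, ?z, ?z, (\<lambda>_ _. 0)) w = \<alpha> * rip I (wd u) (cu w) + bt * rip I (wd \<psi>) (cp w)
   + \<beta> * rip I (\<lambda>x. \<phi> x - u x) (cb w) + \<kappa> * rip I (\<lambda>x. wd \<phi> x + \<psi> x) (ck w)"
   using rip_null[OF memd_eq[OF r], of "ce w"] by (simp add: rS_def c_defs)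
 qed
 have z: "?z \<in> H1star L" "?z \<in> H10 L" using H1star_mprim(1)[OF sqi_zero(1)] zero_H10
  by (simp_all add: mprim_def[abs_def] prim_def[abs_def] zero_fun_def)
 have wz: "AE x in I. wd ?z x = 0" by (rule wderiv_null[OF sqi_zero(1)]) simp
 have wzr: "rip I k (wd ?z) = 0" "rip I (wd ?z) k = 0" for k using rip_null[OF wz] rip_sym by metis+
 have zz: "rip I ?z h = 0" "rip I h ?z = 0" for h using rip_null[of ?z I h] rip_sym[of I h ?z] by auto
 show ?thesis
 proof (rule that[OF w(1)])
  have k0: "(LINT y|I. A1 y - \<beta> * cb w y) = 0" "(LINT y|I. A2 y + \<beta> * cb w y) = 0"
   using A1 A2 cb0 fin.sqi_int[OF A1(1)] fin.sqi_int[OF A2(1)] fin.sqi_int[OF S(3)] by simp_all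
  show "AE x in I. \<alpha> * cu w x - prim (\<lambda>y. A1 y - \<beta> * cb w y) x = 0"
  proof (rule prim_weak[OF sqi_mult'[OF S(1)] sqi_diff'[OF A1(1) sqi_mult'[OF S(3)]] k0(1)])
   fix d assume "d \<in> sqi I"
   note mp = H1star_mprim(1)[OF this]
   show "rip I (wd (mprim d)) (\<lambda>x. \<alpha> * cu w x) = - rip I (mprim d) (\<lambda>y. A1 y - \<beta> * cb w y)"
    using w(2)[OF test(1)[OF mp z]] rip_diff_right'[OF A1(1) sqi_mult'[OF S(3)] H1star_D(2)[OF mp]]
    by (simp add: test(2)[OF mp z] l_def c_defs wzr zz rip_uminus' rip_scale_right' rip_sym)
  qed
  show "AE x in I. \<kappa> * ck w x - B x - prim (\<lambda>y. A2 y + \<beta> * cb w y) x = 0"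
  proof (rule prim_weak[OF sqi_diff'[OF sqi_mult'[OF S(4)] B] sqi_add'[OF A2(1) sqi_mult'[OF S(3)]] k0(2)])
   fix d assume "d \<in> sqi I"
   note mp = H1star_mprim(1)[OF this]
   show "rip I (wd (mprim d)) (\<lambda>x. \<kappa> * ck w x - B x) = - rip I (mprim d) (\<lambda>y. A2 y + \<beta> * cb w y)"
    using w(2)[OF test(1)[OF z(1) mp z(2)]] rip_add_right'[OF A2(1) sqi_mult'[OF S(3)] H1star_D(2)[OF mp]]
     rip_diff_right'[OF sqi_mult'[OF S(4)] B H1star_D(3)[OF mp]]
    by (simp add: test(2)[OF z(1) mp z(2)] l_def c_defs wzr zz rip_scale_right' rip_sym)
  qed
  have "\<exists>c. AE x in I. (bt * cp w x + M x) - prim (\<lambda>y. A3 y + \<kappa> * ck w y) x = c"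
  proof (rule prim_weak_const[OF sqi_add'[OF sqi_mult'[OF S(2)] M] sqi_add'[OF A3 sqi_mult'[OF S(4)]]])
   fix d assume d: "d \<in> sqi I" "(LINT x|I. d x) = 0"
   note mp = H10_prim(1)[OF d] note sm = H10_D(2,3)[OF mp]
   have n: "rip I k (\<lambda>x. wd ?z x + prim d x) = rip I k (prim d)" "rip I (\<lambda>x. wd ?z x + prim d x) k = rip I (prim d) k"
    if k: "k \<in> sqi I" for k
   proof -
    show "rip I k (\<lambda>x. wd ?z x + prim d x) = rip I k (prim d)"
     by (rule rip_cong[OF k sqi_add'[OF H10_D(3)[OF z(2)] sm(1)] k sm(1)]) (use wz in \<open>auto elim: eventually_mono\<close>)
    then show "rip I (\<lambda>x. wd ?z x + prim d x) k = rip I (prim d) k" by (simp add: rip_sym)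
   qed
   let ?x = "(?z, ?z, ?z, ?z, prim d, ?z, ?z, ?z, (\<lambda>_ _. 0)) :: state"
   have "l ?x = - rip I A3 (prim d) - rip I M (wd (prim d))" by (simp add: l_def c_defs wzr zz n[OF B])
   then have "bt * rip I (wd (prim d)) (cp w) + \<kappa> * rip I (prim d) (ck w) = - rip I A3 (prim d) - rip I M (wd (prim d))"
    using w(2)[OF test(1)[OF z(1) z(1) mp]] by (simp add: test(2)[OF z(1) z(1) mp] wzr zz n[OF S(4)])
   then show "rip I (wd (prim d)) (\<lambda>x. bt * cp w x + M x) = - rip I (prim d) (\<lambda>y. A3 y + \<kappa> * ck w y)"
    using rip_add_right'[OF A3 sqi_mult'[OF S(4)] sm(1)] rip_add_right'[OF sqi_mult'[OF S(2)] M sm(2)]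
    by (simp add: rip_scale_right' rip_sym)
  qed
  then show "\<exists>c. AE x in I. bt * cp w x + M x - prim (\<lambda>y. A3 y + \<kappa> * ck w y) x = c" .
 qed
qed

lemma opA_onto:
 assumes F: "F \<in> X"
 shows "\<exists>U\<in>D. N (A U - F) = 0"
proof -
 obtain f1 f2 f3 f4 f5 f6 f7 f8 f9 where Feq: "F = (f1, f2, f3, f4, f5, f6, f7, f8, f9)" by (rule state_cases)
 note T = sqi_of[OF F[unfolded Feq]]
 have H: "f1 \<in> H1star L" "f3 \<in> H1star L" "f5 \<in> H10 L" "f9 \<in> Lg2 L g" using F unfolding Feq phase_iff by auto
 define q0 where "q0 = (\<lambda>x. (-1) * prim (\<lambda>y. \<rho>3 * f7 y + m * f5 y) x - m * f3 x)"
 \<comment> \<open>The free constant of the flux is fixed so that \<open>t\<close> has mean zero,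
   which is the boundary value of \<open>\<theta>\<close> at \<open>L\<close>.\<close>
 define c where "c = - (LINT x|I. \<sigma> * q0 x + \<tau> * f8 x) / (\<sigma> * complex_of_real L)"
 define q where "q = (\<lambda>x. q0 x + c)"
 have q0: "q0 \<in> sqi I" unfolding q0_def by (intro sqi_diff' sqi_mult' prim_sqi sqi_add' T)
 have q: "q \<in> sqi I" unfolding q_def by (rule sqi_add'[OF q0]) simp
 define t where "t = (\<lambda>x. \<sigma> * q x + \<tau> * f8 x)"
 have t: "t \<in> sqi I" unfolding t_def by (intro sqi_add' sqi_mult' q T)
 have t0: "(LINT x|I. t x) = 0"
 proof -
  have e: "t = (\<lambda>x. (\<sigma> * q0 x + \<tau> * f8 x) + \<sigma> * c)" by (simp add: t_def q_def algebra_simps)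
  have i: "integrable I (\<lambda>x. \<sigma> * q0 x + \<tau> * f8 x)"
   by (intro fin.sqi_int sqi_add' sqi_mult' q0 T)
  have "(LINT x|I. t x) = (LINT x|I. \<sigma> * q0 x + \<tau> * f8 x) + (LINT x|I. \<sigma> * c)"
   unfolding e by (rule Bochner_Integration.integral_add[OF i]) simp
  then show ?thesis using L_pos nz by (simp add: c_def scaleR_conv_of_real)
 qed
 define \<theta> where "\<theta> = (\<lambda>x. (-1) * prim t x)"
 have \<theta>: "\<theta> \<in> sqi I" unfolding \<theta>_def by (intro sqi_mult' prim_sqi t)
 define Z where "Z = (\<lambda>p. wd f5 (snd p) - memd f9 p)"
 note rZ = mem_repD[OF f9_rep[OF H(3,4)], folded Z_def]
 have JZ: "J Z \<in> sqi P" by (rule J_sqi[OF rZ(1)])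
 define \<eta> where "\<eta> = (\<lambda>s x. primP (J Z) (s, x))"
 have rep: "mem_rep \<eta> (J Z)" unfolding \<eta>_def by (rule mem_rep_primP[OF JZ J_prim_L[OF rZ(1,3)]])
 have M: "meanG (J Z) \<in> sqi I" by (rule meanG_sqi[OF JZ])
 have A: "(\<lambda>y. \<rho> * f2 y + \<gamma> * f1 y) \<in> sqi I" "(LINT y|I. \<rho> * f2 y + \<gamma> * f1 y) = 0"
  "(\<lambda>y. \<rho>1 * f4 y) \<in> sqi I" "(LINT y|I. \<rho>1 * f4 y) = 0"
  "(\<lambda>y. \<rho>2 * f6 y - m * \<theta> y) \<in> sqi I" "(\<lambda>y. m * \<theta> y) \<in> sqi I"
  using T(16-19) T(2,10)[THEN fin.sqi_int] by (simp_all add: sqi_ops T \<theta>)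
 obtain w where w: "w \<in> X"
  "AE x in I. \<alpha> * cu w x - prim (\<lambda>y. \<rho> * f2 y + \<gamma> * f1 y - \<beta> * cb w y) x = 0"
  "AE x in I. \<kappa> * ck w x - m * \<theta> x - prim (\<lambda>y. \<rho>1 * f4 y + \<beta> * cb w y) x = 0"
  "\<exists>c. AE x in I. bt * cp w x + meanG (J Z) x - prim (\<lambda>y. \<rho>2 * f6 y - m * \<theta> y + \<kappa> * ck w y) x = c"
  using elliptic[OF A M] by blast
 obtain u v' \<phi> \<Phi>' \<psi> \<Psi>' \<theta>' q' \<eta>' where weq: "w = (u, v', \<phi>, \<Phi>', \<psi>, \<Psi>', \<theta>', q', \<eta>')" by (rule state_cases)
 note wf = w(2-4)[unfolded weq c_defs prod.case]
 \<comment> \<open>Only \<open>u\<close>, \<open>\<phi>\<close> and \<open>\<psi>\<close> are taken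
   from \<open>w\<close>; the other components are the explicit ones.\<close>
 define U :: state where "U = (u, f1, \<phi>, f3, \<psi>, f5, \<theta>, q, \<eta>)"
 have UX: "U \<in> X" using w(1) F H \<theta> q T H1star_D(2)[OF H(1)] H1star_D(2)[OF H(2)] mem_rep_Lg2(1)[OF rep]
  unfolding U_def weq phase_iff Feq by (simp add: L2star_iff)
 have mW: "AE x in I. meanG (memd \<eta>) x = meanG (J Z) x"
  by (rule meanG_cong[OF mem_repD(1)[OF mem_rep_memd[OF mem_rep_Lg2(1)[OF rep]]] JZ memd_eq[OF rep]])
 have "Rel (U, F)" unfolding Rel_def U_def Feq e_defs c_defs fst_conv snd_conv prod.case
 proof (intro conjI)
  show "AE x in I. \<alpha> * wd u x - prim (\<lambda>y. \<rho> * f2 y + \<gamma> * f1 y - \<beta> * (\<phi> y - u y)) x = 0" by (rule wf(1))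
  show "AE x in I. \<kappa> * (wd \<phi> x + \<psi> x) - m * \<theta> x - prim (\<lambda>y. \<rho>1 * f4 y + \<beta> * (\<phi> y - u y)) x = 0" by (rule wf(2))
  show "AE x in I. \<theta> x + prim (\<lambda>x. \<sigma> * q x + \<tau> * f8 x) x = 0" by (simp add: \<theta>_def t_def)
  have "AE x in I. q x + m * f3 x + prim (\<lambda>y. \<rho>3 * f7 y + m * f5 y) x = c" by (simp add: q_def q0_def)
  then show "\<exists>c. AE x in I. q x + m * f3 x + prim (\<lambda>y. \<rho>3 * f7 y + m * f5 y) x = c" ..
  obtain c8 where c8: "AE x in I. bt * wd \<psi> x + meanG (J Z) x - prim (\<lambda>y. \<rho>2 * f6 y - m * \<theta> y + \<kappa> * (wd \<phi> y + \<psi> y)) x = c8"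
   using wf(3) by blast
  have e: "(\<lambda>y. \<rho>2 * f6 y - m * \<theta> y + \<kappa> * (wd \<phi> y + \<psi> y)) = (\<lambda>y. \<rho>2 * f6 y + \<kappa> * (wd \<phi> y + \<psi> y) - m * \<theta> y)"
   by (simp add: algebra_simps)
  have "AE x in I. bt * wd \<psi> x + meanG (memd \<eta>) x - prim (\<lambda>y. \<rho>2 * f6 y + \<kappa> * (wd \<phi> y + \<psi> y) - m * \<theta> y) x = c8"
   using c8 mW unfolding e by eventually_elim simp
  then show "\<exists>c. AE x in I. bt * wd \<psi> x + meanG (memd \<eta>) x - prim (\<lambda>y. \<rho>2 * f6 y + \<kappa> * (wd \<phi> y + \<psi> y) - m * \<theta> y) x = c" ..
  show "AE p in P. memd \<eta> p - J (\<lambda>p. wd f5 (snd p) - memd f9 p) p = 0"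
   using memd_eq[OF rep] unfolding Z_def by eventually_elim simp
  show "(LINT x|I. \<sigma> * q x + \<tau> * f8 x) = 0" using t0 by (simp add: t_def)
 qed simp_all
 then show ?thesis using Rel_imp_graph[OF UX F] by blast
qed

lemma dom_X: "U \<in> D ==> U \<in> X" by (auto simp: domA_def)

lemma N_zero_0: "N 0 = 0"
 using form_rS X_zero N_eq[OF X_zero] unfolding form_def by (metis add_cancel_right_right real_sqrt_zero)

text \<open>Each algebraic axiom is obtained by passing to \<open>Rel\<close>, using its linearity,
  and returning through \<open>Rel_imp_graph\<close>, which yields domain membership and the
  equation together.\<close>

theorem generating: "generating X rS D A N"
proof -
 interpret H: semi_hilbert X rS by (rule semi_hilbert_phase)
 have g: "(U, A U) \<in> X \<times> X" if "U \<in> D" for U using dom_X[OF that] opA_X[OF that] by simp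
 show ?thesis
 proof
  show "N x = sqrt (rS x x)" if "x \<in> X" for x using that by (rule N_eq)
  show "rS (\<i> *\<^sub>C x) (\<i> *\<^sub>C y) = rS x y" if "x \<in> X" "y \<in> X" for x y using form_rS that unfolding form_def by blast
  show "D \<subseteq> X" using dom_X by blast
  have "Rel (0, 0)" by (rule Rel_null) (use X_zero N_zero_0 in \<open>simp_all only: nul_def fst_conv snd_conv mem_Times_iff simp_thms\<close>)
  then show "0 \<in> D" using Rel_imp_graph[OF X_zero X_zero] by blast
  show "A x \<in> X" if "x \<in> D" for x using that by (rule opA_X)
  have add: "x + y \<in> D \<and> N (A (x + y) - (A x + A y)) = 0" if "x \<in> D" "y \<in> D" for x y
   using Rel_add[OF g[OF that(1)] g[OF that(2)] Rel_opA[OF that(1)] Rel_opA[OF that(2)]] unfolding add_Pair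
   by (rule Rel_imp_graph[OF X_add[OF dom_X[OF that(1)] dom_X[OF that(2)]] X_add[OF opA_X[OF that(1)] opA_X[OF that(2)]]])
  then show "x + y \<in> D" "N (A (x + y) - (A x + A y)) = 0" if "x \<in> D" "y \<in> D" for x y using that by auto
  have scale: "c *\<^sub>C x \<in> D \<and> N (A (c *\<^sub>C x) - c *\<^sub>C A x) = 0" if "x \<in> D" for x c
   using Rel_scale[OF g[OF that] Rel_opA[OF that], of c] unfolding scaleC_prod_def[of c "(x, A x)"] fst_conv snd_conv
   by (rule Rel_imp_graph[OF X_scale[OF dom_X[OF that]] X_scale[OF opA_X[OF that]]])
  then show "c *\<^sub>C x \<in> D" "N (A (c *\<^sub>C x) - c *\<^sub>C A x) = 0" if "x \<in> D" for x c using that by auto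
  show "rS (A x) x \<le> 0" if "x \<in> D" for x using that by (rule rS_opA)
  show "\<exists>x\<in>D. N (A x - y) = 0" if "y \<in> X" for y using that by (rule opA_onto)
  show "x \<in> D \<and> N (A x - A y) = 0" if "x \<in> X" "y \<in> D" "N (x - y) = 0" for x y
  proof -
   \<comment> \<open>The null difference paired with 0 satisfies the relation, and
     \<open>(x, A y)\<close> is its sum with \<open>(y, A y)\<close>.\<close>
   have "Rel (x - y, 0)" by (rule Rel_null) (use X_diff[OF that(1) dom_X[OF that(2)]] X_zero N_zero_0 that(3) in
      \<open>simp_all only: nul_def fst_conv snd_conv mem_Times_iff simp_thms\<close>)
   from Rel_add[OF g[OF that(2)] _ Rel_opA[OF that(2)] this]
   have "Rel (x, A y)"
    using X_diff[OF that(1) dom_X[OF that(2)]] X_zero by (simp only: add_Pair mem_Times_iff fst_conv snd_conv simp_thms add_0_right add.commute[of y] diff_add_cancel)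
   then show ?thesis by (rule Rel_imp_graph[OF that(1) opA_X[OF that(2)]])
  qed
 qed
qed

end

text \<open>The differential inequality says that \<open>exp (k * t) * g t\<close> is
  nonincreasing.\<close>

lemma exponential_decay:
 fixes g g' :: "real => real"
 assumes d: "!!s. s \<ge> 0 ==> (g has_real_derivative g' s) (at s within {0..})"
  and le: "!!s. s \<ge> 0 ==> g' s \<le> - k * g s" and rs: "0 \<le> r" "r \<le> s"
 shows "g s \<le> exp (- k * (s - r)) * g r"
proof -
 let ?h = "\<lambda>t. exp (k * t) * g t"
 have c: "continuous_on {0..} g" unfolding continuous_on_eq_continuous_within using d DERIV_continuous by fastforce
 have "?h s \<le> ?h r"
 proof (rule DERIV_nonpos_imp_decreasing_open[OF rs(2)])
  show "continuous_on {r..s} ?h" using rs by (intro continuous_intros continuous_on_subset[OF c]) auto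
  fix t assume t: "r < t" "t < s"
  then have "0 < t" using rs by simp
  then have "(g has_real_derivative g' t) (at t)" using d[of t] at_within_interior[of t "{0..}"] by simp
  then have "(?h has_real_derivative exp (k * t) * (k * g t + g' t)) (at t)"
   by (auto intro!: derivative_eq_intros simp: algebra_simps)
  moreover have "exp (k * t) * (k * g t + g' t) \<le> 0"
   using le[of t] \<open>0 < t\<close> by (intro mult_nonneg_nonpos) auto
  ultimately show "\<exists>y. (?h has_real_derivative y) (at t) \<and> y \<le> 0" by blast
 qed
 then have "exp (- k * s) * ?h s \<le> exp (- k * s) * ?h r" by (rule mult_left_mono) simp
 then show ?thesis by (simp add: algebra_simps flip: exp_add mult.assoc)
qed

theorem theorem3p2:
  fixes L \<rho> \<rho>1 \<rho>2 \<rho>3 \<alpha> \<kappa> b \<tau> \<sigma> \<beta> \<gamma> m \<kappa>1 :: real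
    and g g' :: "real \<Rightarrow> real"
  assumes "L > 0" "\<rho> > 0" "\<rho>1 > 0" "\<rho>2 > 0" "\<rho>3 > 0" "\<alpha> > 0" "\<kappa> > 0" "b > 0"
    and "\<tau> > 0" "\<sigma> > 0" "\<beta> > 0" "\<gamma> > 0" "m \<noteq> 0" "\<kappa>1 > 0"
    and "\<And>s. s \<ge> 0 \<Longrightarrow> g s \<ge> 0"
    and "set_integrable lborel {0..} g"
    and "\<And>s. s \<ge> 0 \<Longrightarrow> (g has_real_derivative g' s) (at s within {0..})"
    and "continuous_on {0..} g'"
    and "\<And>s. s \<ge> 0 \<Longrightarrow> g' s \<le> - \<kappa>1 * g s"
    and "b_tilde b g > 0"
  shows "let X = phase_space L g;
             N = phase_norm L \<rho> \<rho>1 \<rho>2 \<rho>3 \<alpha> \<kappa> b \<tau> \<beta> g;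
             D = domA L b g;
             A = opA L \<rho> \<rho>1 \<rho>2 \<rho>3 \<alpha> \<kappa> b \<tau> \<sigma> \<beta> \<gamma> m g
         in \<exists>T. contraction_semigroup X N T \<and> is_generator X N T D A \<and>
              (\<forall>U0\<in>X.
                 mild_solution X N D A U0 (\<lambda>t. T t U0) \<and>
                 (\<forall>V. mild_solution X N D A U0 V \<longrightarrow> (\<forall>t\<ge>0. N (V t - T t U0) = 0)) \<and>
                 cont_on_in N {0..} (\<lambda>t. T t U0)) \<and>
              (\<forall>U0\<in>D.
                 classical_solution X N D A U0 (\<lambda>t. T t U0) \<and>
                 (\<forall>V. classical_solution X N D A U0 V \<longrightarrow> (\<forall>t\<ge>0. N (V t - T t U0) = 0)) \<and>
                 (\<forall>t\<ge>0. T t U0 \<in> D) \<and>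
                 cont_on_in (graph_norm N A) {0..} (\<lambda>t. T t U0) \<and>
                 C1_on_in X N {0..} (\<lambda>t. T t U0))"
proof -
  have "continuous_on {0..} g"
    unfolding continuous_on_eq_continuous_within using assms(17) DERIV_continuous by fastforce
  then interpret P: porous L g \<kappa>1 \<rho> \<rho>1 \<rho>2 \<rho>3 \<alpha> \<kappa> b \<tau> \<sigma> \<beta> \<gamma> m
    by unfold_locales (use assms exponential_decay[OF assms(17,19)] in auto)
  interpret S: generating P.X P.rS P.D P.A P.N by (rule P.generating)
  show ?thesis unfolding Let_def by (rule S.generation)
qed

end
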